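(* The classes of groups $\mathcal P$ and $\mathcal G'$ coincide (groups being considered up to isomorphism). Here $\mathcal P$ is the class of all homeotopy groups $\pi_0H^{+}(F)$, where $F$ is the canonical foliation of some striped surface $\Sigma\in\mathfrak F$, and $\mathcal G'$ is the class of all groups admitting a representation of finite height in the class $\mathcal G$; all these notions are defined in the context.
   Context: **Model strips.** A model strip is a subset $S\subset\mathbb R^2$ such that $\mathbb R\times(-1,1)\subseteq S\subset\mathbb R\times[-1,1]$ and $S\cap(\mathbb R\times\{-1,1\})$ is a union of mutually disjoint open finite intervals. Put $\partial_\pm S=S\cap(\mathbb R\times\{\pm1\})$ and $\partial S=\partial_-S\cup\partial_+S$. $S$ is foliated by the lines $\mathbb R\times\{t\}$, $t\in(-1,1)$, and the connected components of $\partial S$; leaves are oriented by increasing first coordinate. $S$ is admissible if the closures of the intervals of $\partial_-S$ and $\partial_+S$ are mutually disjoint and form a locally finite family in $\mathbb R^2$. **Striped surfaces.** Let $\{S_\lambda\}_{\lambda\in\Lambda}$ be a family of model strips, $\{X_\alpha\}_{\alpha\in A}$ the family of all components of the sets $\partial_-S_\lambda$, and $\{Y_\beta\}_{\beta\in B}$ the family of all components of the sets $\partial_+S_\lambda$. Let $p:C\to A$, $q:C\to B$ be injective maps from a set $C$, and let $\varphi_\gamma:X_{p(\gamma)}\to Y_{q(\gamma)}$ be the orientation preserving affine homeomorphism. The quotient $\Sigma=\bigsqcup_\lambda S_\lambda/\{X_{p(\gamma)}\overset{\varphi_\gamma}{\sim}Y_{q(\gamma)}\}_{\gamma\in C}$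 is a striped surface. Its canonical foliation $F$ is the one induced by the foliations of the strips; its leaves are oriented. **Special leaves, reduced surfaces.** The saturation $Sat(U)$ of $U\subset\Sigma$ is the union of all leaves meeting $U$. A leaf $\omega$ is special if $\omega\ne\bigcap_{N(\omega)}\overline{Sat(N(\omega))}$, where $N(\omega)$ runs over all open neighborhoods of $\omega$. $\Sigma$ is reduced if a leaf $\omega$ is special if and only if either (1) $\omega$ is the image of glued leaves $X_{p(\gamma)}\sim Y_{q(\gamma)}$ for some $\gamma\in C$, or (2) $\omega\subsetneq\partial_-S_\lambda$ or $\omega\subsetneq\partial_+S_\lambda$ for some $\lambda$. **Graph.** For a reduced striped surface $\Sigma$, $\Gamma(\Sigma)$ is the oriented graph whose vertices are the strips $S_\lambda$ and whose edges are the special leaves $\omega=X_{p(\gamma)}\sim Y_{q(\gamma)}$, $\gamma\in C$; if $X_{p(\gamma)}\subset\partial_-S_{\lambda_0}$ and $Y_{q(\gamma)}\subset\partial_+S_{\lambda_1}$, the edge goes from $S_{\lambda_1}$ to $S_{\lambda_0}$. It has finite diameter if for some integer $d\ge0$ any two vertices are joined by a path with at most $d$ edges. **Class $\mathfrak F$.** Let $J_i=(i,i+0.5)$ for $i\in\mathbb Z$; $[0]=\varnothing$, $[n]=\{1,\dots,n\}$, $-\mathbb N=\{-1,-2,\dots\}$. $\mathfrak F$ is the class of (reduced) striped surfaces $\Sigma$ such that: 1) each $S_\lambda$ is admissible, $\partial_-S_\lambda=J_1\times\{-1\}$ and $\partial_+S_\lambda=\bigcup_{i\in\Delta_\lambda}J_i\times\{1\}$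 with $\Delta_\lambda\in\{[0],[1],[2],\dots,\mathbb N,-\mathbb N,\mathbb Z\}$; 2) $\Gamma(\Sigma)$ is connected, has finite diameter and no cycles. **Homeotopy group.** $H^{+}(F)$ is the group of homeomorphisms $h:\Sigma\to\Sigma$ which map each leaf of $F$ onto a leaf of $F$ preserving the orientation of leaves, with the compact open topology. $H_0^{+}(F)$ is its identity path component, and $\pi_0H^{+}(F)=H^{+}(F)/H_0^{+}(F)$ is the homeotopy group of $F$. **Wreath product.** For groups $A$ and $H$, $A\wr H=Map(H,A)\rtimes H$, where $Map(H,A)$ is the group of all maps $H\to A$ with pointwise multiplication, and $(\varphi_1,h_1)(\varphi_2,h_2)=((\varphi_1\circ h_2)\cdot\varphi_2,\,h_1h_2)$, where in $\varphi_1\circ h_2$ the element $h_2$ acts on $H$ by translation. For $H=\mathbb Z$: $(\varphi_1,n)(\varphi_2,m)=(\varphi_1(\cdot+m)\varphi_2(\cdot),\,n+m)$. **Classes $\mathcal G$ and $\mathcal G'$.** $\mathcal G$ is the minimal class of groups such that: 1) $\{1\}\in\mathcal G$; 2) if $A_i\in\mathcal G$ for $i\in\mathbb N$, then $\prod_{i\in\mathbb N}A_i\in\mathcal G$; 3) if $A\in\mathcal G$, then $A\wr\mathbb Z\in\mathcal G$. A representation $\xi(G)$ of a group $G$ in the class $\mathcal G$ is an expression of $G$ (up to isomorphism) as obtained from unit groups $\{1\}$ by the operations of (finite or infinite) countable direct product and of wreath product with $\mathbb Z$. Its height is defined inductively by $h(\{1\})=0$, $h(\xi(G)\wr\mathbb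 Z)=1+h(\xi(G))$, $h\bigl(\prod_{i\in\Lambda}\xi(A_i)\bigr)=1+\max_i h(\xi(A_i))$; the height is finite when all these maxima are finite. $\mathcal G'\subset\mathcal G$ consists of the groups admitting a representation of finite height.
   Formalization: The class 𝔉 is taken without the surface consisting of one unglued strip with Δ=[1]: the reflection (x,t)↦(x,−t) gives it homeotopy group Z/2, which is not in 𝒢′ since groups in 𝒢 are torsion free, so the claim fails for it. *)

theory Defs
  imports
    "HOL-Analysis.Analysis"
    "HOL-Algebra.Bij"
    "HOL-Algebra.Elementary_Groups"
    "HOL-Algebra.Product_Groups"
    "HOL-Algebra.Weak_Morphisms"
    "Graph_Theory.Digraph_Component"
begin

hide_const (open) Digraph_Component.connected

section \<open>Model strips\<close>

definition model_strip :: "(real \<times> real) set \<Rightarrow> bool" where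
  "model_strip S \<longleftrightarrow>
     UNIV \<times> {-1<..<1} \<subseteq> S \<and> S \<subseteq> UNIV \<times> {-1..1} \<and>
     (\<exists>\<I>. disjoint \<I> \<and>
          (\<forall>I\<in>\<I>. \<exists>a b e. a < b \<and> e \<in> {-1, 1} \<and> I = {a<..<b} \<times> {e}) \<and>
          S \<inter> (UNIV \<times> {-1, 1}) = \<Union>\<I>)"

definition lower_boundary :: "(real \<times> real) set \<Rightarrow> (real \<times> real) set" where
  "lower_boundary S = S \<inter> (UNIV \<times> {-1})"

definition upper_boundary :: "(real \<times> real) set \<Rightarrow> (real \<times> real) set" where
  "upper_boundary S = S \<inter> (UNIV \<times> {1})"

definition strip_boundary :: "(real \<times> real) set \<Rightarrow> (real \<times> real) set" where
  "strip_boundary S = lower_boundary S \<union> upper_boundary S"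

definition strip_leaves :: "(real \<times> real) set \<Rightarrow> (real \<times> real) set set" where
  "strip_leaves S = {UNIV \<times> {t} |t. -1 < t \<and> t < 1} \<union> components (strip_boundary S)"

definition admissible_strip :: "(real \<times> real) set \<Rightarrow> bool" where
  "admissible_strip S \<longleftrightarrow>
     disjoint_family_on closure (components (strip_boundary S)) \<and>
     locally_finite_in euclidean (closure ` components (strip_boundary S))"


section \<open>Striped surfaces\<close>

text \<open>
  The gluing datum of a striped surface.  A component of some \<open>lower_boundary (strip D l)\<close> is
  recorded together with the index \<open>l\<close>, so that the components of all the lower boundaries
  form a family indexed without repetition, and similarly for the upper boundaries.
  The field \<open>seams\<close> is the set \<open>C\<close> of the gluings, \<open>lower_side\<close> and \<open>upper_side\<close> are the
  maps \<open>p\<close> and \<open>q\<close>.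
\<close>

record ('l, 'c) striped_data =
  strips :: "'l set"
  strip :: "'l \<Rightarrow> (real \<times> real) set"
  seams :: "'c set"
  lower_side :: "'c \<Rightarrow> 'l \<times> (real \<times> real) set"
  upper_side :: "'c \<Rightarrow> 'l \<times> (real \<times> real) set"

definition striped_datum :: "('l, 'c) striped_data \<Rightarrow> bool" where
  "striped_datum D \<longleftrightarrow>
     (\<forall>l\<in>strips D. model_strip (strip D l)) \<and>
     lower_side D ` seams D \<subseteq> (SIGMA l:strips D. components (lower_boundary (strip D l))) \<and>
     upper_side D ` seams D \<subseteq> (SIGMA l:strips D. components (upper_boundary (strip D l))) \<and>
     inj_on (lower_side D) (seams D) \<and> inj_on (upper_side D) (seams D)"

text \<open>
  Both intervals lie on horizontal lines, so an orientation preserving affine homeomorphism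
  is given by an increasing affine function of the first coordinate.  Between two bounded
  nonempty open intervals there is exactly one such map (on \<open>X\<close>).
\<close>

definition oriented_affine_homeo ::
    "(real \<times> real) set \<Rightarrow> (real \<times> real) set \<Rightarrow> (real \<times> real \<Rightarrow> real \<times> real) \<Rightarrow> bool" where
  "oriented_affine_homeo X Y f \<longleftrightarrow>
     f ` X = Y \<and> (\<exists>k>0. \<exists>c. \<forall>z\<in>X. fst (f z) = k * fst z + c)"

definition strip_points :: "('l, 'c) striped_data \<Rightarrow> ('l \<times> real \<times> real) set" where
  "strip_points D = (SIGMA l:strips D. strip D l)"

definition glued :: "('l, 'c) striped_data \<Rightarrow> 'l \<times> real \<times> real \<Rightarrow> 'l \<times> real \<times> real \<Rightarrow> bool" where
  "glued D x y \<longleftrightarrow>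
     (\<exists>\<gamma>\<in>seams D. \<exists>X Y f. lower_side D \<gamma> = (fst x, X) \<and> upper_side D \<gamma> = (fst y, Y) \<and>
        oriented_affine_homeo X Y f \<and> snd x \<in> X \<and> snd y = f (snd x))"

definition glue_rel :: "('l, 'c) striped_data \<Rightarrow> (('l \<times> real \<times> real) \<times> ('l \<times> real \<times> real)) set" where
  "glue_rel D = {(x, y). x \<in> strip_points D \<and> y \<in> strip_points D \<and> equivclp (glued D) x y}"

text \<open>Points of the surface are equivalence classes of points of the strips.\<close>

type_synonym 'l surface_point = "('l \<times> real \<times> real) set"

definition strip_proj :: "('l, 'c) striped_data \<Rightarrow> 'l \<times> real \<times> real \<Rightarrow> 'l surface_point" where
  "strip_proj D x = glue_rel D `` {x}"

definition quotient_topology :: "'a topology \<Rightarrow> ('a \<Rightarrow> 'b) \<Rightarrow> 'b topology" where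
  "quotient_topology X f =
     topology (\<lambda>U. U \<subseteq> f ` topspace X \<and> openin X {x \<in> topspace X. f x \<in> U})"

lemma openin_quotient_topology:
  "openin (quotient_topology X f) U \<longleftrightarrow>
     U \<subseteq> f ` topspace X \<and> openin X {x \<in> topspace X. f x \<in> U}"
proof -
  have "istopology (\<lambda>U. U \<subseteq> f ` topspace X \<and> openin X {x \<in> topspace X. f x \<in> U})"
    unfolding istopology_def
  proof (intro conjI allI impI)
    fix S T
    assume S: "S \<subseteq> f ` topspace X \<and> openin X {x \<in> topspace X. f x \<in> S}"
      and T: "T \<subseteq> f ` topspace X \<and> openin X {x \<in> topspace X. f x \<in> T}"
    have "{x \<in> topspace X. f x \<in> S \<inter> T} =
        {x \<in> topspace X. f x \<in> S} \<inter> {x \<in> topspace X. f x \<in> T}" by auto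
    moreover have "openin X ({x \<in> topspace X. f x \<in> S} \<inter> {x \<in> topspace X. f x \<in> T})"
      using S T by (intro openin_Int) (rule conjunct2, assumption)+
    ultimately show "openin X {x \<in> topspace X. f x \<in> S \<inter> T}"
      by (simp only:)
    from S show "S \<inter> T \<subseteq> f ` topspace X" by blast
  next
    fix K
    assume K: "\<forall>S\<in>K. S \<subseteq> f ` topspace X \<and> openin X {x \<in> topspace X. f x \<in> S}"
    have "{x \<in> topspace X. f x \<in> \<Union>K} = (\<Union>S\<in>K. {x \<in> topspace X. f x \<in> S})" by auto
    moreover have "openin X (\<Union>S\<in>K. {x \<in> topspace X. f x \<in> S})"
      using K by (intro openin_Union) blast
    ultimately show "openin X {x \<in> topspace X. f x \<in> \<Union>K}"
      by (simp only:)
    from K show "\<Union>K \<subseteq> f ` topspace X" by blast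
  qed
  then show ?thesis
    by (simp add: quotient_topology_def topology_inverse')
qed

lemma topspace_quotient_topology [simp]: "topspace (quotient_topology X f) = f ` topspace X"
proof
  show "topspace (quotient_topology X f) \<subseteq> f ` topspace X"
    using openin_topspace [of "quotient_topology X f"] unfolding openin_quotient_topology
    by (rule conjunct1)
  have "{x \<in> topspace X. f x \<in> f ` topspace X} = topspace X" by auto
  then have "openin (quotient_topology X f) (f ` topspace X)"
    by (simp add: openin_quotient_topology)
  then show "f ` topspace X \<subseteq> topspace (quotient_topology X f)"
    by (rule openin_subset)
qed

lemma quotient_map_quotient_topology: "quotient_map X (quotient_topology X f) f"
  unfolding quotient_map_def by (simp add: openin_quotient_topology)

definition surface :: "('l, 'c) striped_data \<Rightarrow> 'l surface_point topology" where
  "surface D =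
     quotient_topology (sum_topology (\<lambda>l. top_of_set (strip D l)) (strips D)) (strip_proj D)"

definition leaf :: "('l, 'c) striped_data \<Rightarrow> 'l \<Rightarrow> (real \<times> real) set \<Rightarrow> 'l surface_point set" where
  "leaf D l \<omega> = strip_proj D ` ({l} \<times> \<omega>)"

definition leaves :: "('l, 'c) striped_data \<Rightarrow> 'l surface_point set set" where
  "leaves D = {leaf D l \<omega> |l \<omega>. l \<in> strips D \<and> \<omega> \<in> strip_leaves (strip D l)}"

text \<open>The orientation of the leaves, as the strict order it induces on each of them.\<close>

definition leaf_less :: "('l, 'c) striped_data \<Rightarrow> 'l surface_point \<Rightarrow> 'l surface_point \<Rightarrow> bool" where
  "leaf_less D u v \<longleftrightarrow>
     (\<exists>l\<in>strips D. \<exists>\<omega>\<in>strip_leaves (strip D l). \<exists>x\<in>\<omega>. \<exists>y\<in>\<omega>.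
        fst x < fst y \<and> u = strip_proj D (l, x) \<and> v = strip_proj D (l, y))"


section \<open>Special leaves and reduced surfaces\<close>

definition saturation :: "('l, 'c) striped_data \<Rightarrow> 'l surface_point set \<Rightarrow> 'l surface_point set" where
  "saturation D U = \<Union>{\<omega> \<in> leaves D. \<omega> \<inter> U \<noteq> {}}"

definition special_leaf :: "('l, 'c) striped_data \<Rightarrow> 'l surface_point set \<Rightarrow> bool" where
  "special_leaf D \<omega> \<longleftrightarrow>
     \<omega> \<in> leaves D \<and>
     \<omega> \<noteq> \<Inter>{surface D closure_of saturation D N |N. openin (surface D) N \<and> \<omega> \<subseteq> N}"

text \<open>The leaf obtained from the glued leaves with the index \<open>\<gamma>\<close>.\<close>

definition seam_leaf :: "('l, 'c) striped_data \<Rightarrow> 'c \<Rightarrow> 'l surface_point set" where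
  "seam_leaf D \<gamma> = leaf D (fst (lower_side D \<gamma>)) (snd (lower_side D \<gamma>))"

definition reduced :: "('l, 'c) striped_data \<Rightarrow> bool" where
  "reduced D \<longleftrightarrow>
     (\<forall>\<omega>\<in>leaves D. special_leaf D \<omega> \<longleftrightarrow>
        (\<exists>\<gamma>\<in>seams D. \<omega> = seam_leaf D \<gamma>) \<or>
        (\<exists>l\<in>strips D. \<omega> \<subset> leaf D l (lower_boundary (strip D l)) \<or>
                      \<omega> \<subset> leaf D l (upper_boundary (strip D l))))"


section \<open>The graph of a striped surface\<close>

text \<open>
  On a reduced surface each glued leaf is special, and distinct elements of \<open>seams D\<close>
  give distinct leaves, so the elements of \<open>seams D\<close> serve as names of the edges.
\<close>

definition strip_graph :: "('l, 'c) striped_data \<Rightarrow> ('l, 'c) pre_digraph" where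
  "strip_graph D =
     \<lparr>verts = strips D, arcs = seams D,
      tail = (\<lambda>\<gamma>. fst (upper_side D \<gamma>)), head = (\<lambda>\<gamma>. fst (lower_side D \<gamma>))\<rparr>"

text \<open>
  Connectedness, diameter and cycles refer to the underlying undirected multigraph:
  paths may traverse edges against their orientation.
  A loop is a cycle of length 1, a pair of parallel edges a cycle of length 2.
\<close>

definition finite_diameter :: "('v, 'e) pre_digraph \<Rightarrow> bool" where
  "finite_diameter G \<longleftrightarrow>
     (\<exists>d. \<forall>u\<in>verts G. \<forall>v\<in>verts G.
        \<exists>p. pre_digraph.apath (with_proj (mk_symmetric G)) u p v \<and> length p \<le> d)"

definition undirected_cycle :: "('v, 'e) pre_digraph \<Rightarrow> 'v list \<Rightarrow> 'e list \<Rightarrow> bool" where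
  "undirected_cycle G vs es \<longleftrightarrow>
     es \<noteq> [] \<and> length vs = length es \<and> distinct vs \<and> distinct es \<and> set es \<subseteq> arcs G \<and>
     (\<forall>i<length es. {tail G (es ! i), head G (es ! i)} = {vs ! i, vs ! (Suc i mod length es)})"


section \<open>The class \<open>\<FF>\<close>\<close>

definition J :: "int \<Rightarrow> real set" where
  "J i = {of_int i <..< of_int i + 1/2}"

definition index_sets :: "int set set" where
  "index_sets = {{1..int n} |n. True} \<union> {{1..}, {..-1}, UNIV}"

definition class_F :: "('l, 'c) striped_data set" where
  "class_F = {D.
     striped_datum D \<and> reduced D \<and>
     (\<forall>l\<in>strips D. admissible_strip (strip D l) \<and>
        lower_boundary (strip D l) = J 1 \<times> {-1} \<and>
        (\<exists>\<Delta>\<in>index_sets. upper_boundary (strip D l) = (\<Union>i\<in>\<Delta>. J i \<times> {1}))) \<and>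
     Digraph_Component.connected (strip_graph D) \<and>
     finite_diameter (strip_graph D) \<and>
     (\<nexists>vs es. undirected_cycle (strip_graph D) vs es)}"

text \<open>
  The surfaces consisting of one strip with \<open>\<Delta> = {1}\<close>.  Such a strip has the symmetry
  \<open>(x, t) \<mapsto> (x, -t)\<close>, which preserves the leaves together with their orientations and
  interchanges the two boundary components, so its homeotopy group has two elements.
  No other surface in \<open>class_F\<close> admits a homeomorphism which preserves the oriented leaves
  and reverses the transverse direction.
\<close>

definition symmetric_strips :: "('l, 'c) striped_data set" where
  "symmetric_strips = {D \<in> class_F. \<exists>l. strips D = {l} \<and> upper_boundary (strip D l) = J 1 \<times> {1}}"


section \<open>Homeotopy groups\<close>

definition compact_open_topology :: "'a topology \<Rightarrow> 'b topology \<Rightarrow> ('a \<Rightarrow> 'b) topology" where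
  "compact_open_topology X Y = topology_generated_by
     {{f \<in> extensional (topspace X). continuous_map X Y f \<and> f ` K \<subseteq> U} |K U.
        compactin X K \<and> openin Y U}"

definition foliated_homeos ::
    "('l, 'c) striped_data \<Rightarrow> ('l surface_point \<Rightarrow> 'l surface_point) monoid" where
  "foliated_homeos D = BijGroup (topspace (surface D))
     \<lparr>carrier := {h \<in> Bij (topspace (surface D)).
        homeomorphic_map (surface D) (surface D) h \<and>
        (\<forall>\<omega>\<in>leaves D. h ` \<omega> \<in> leaves D) \<and>
        (\<forall>u v. leaf_less D u v \<longrightarrow> leaf_less D (h u) (h v))}\<rparr>"

definition identity_path_component ::
    "('l, 'c) striped_data \<Rightarrow> ('l surface_point \<Rightarrow> 'l surface_point) set" where
  "identity_path_component D =
     path_component_of_set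
       (subtopology (compact_open_topology (surface D) (surface D)) (carrier (foliated_homeos D)))
       \<one>\<^bsub>foliated_homeos D\<^esub>"

definition homeotopy_group ::
    "('l, 'c) striped_data \<Rightarrow> ('l surface_point \<Rightarrow> 'l surface_point) set monoid" where
  "homeotopy_group D = foliated_homeos D Mod identity_path_component D"

text \<open>The groups isomorphic to the homeotopy group of a surface belonging to \<open>K\<close>.\<close>

definition homeotopy_groups :: "('l, 'c) striped_data set \<Rightarrow> 'g monoid set" where
  "homeotopy_groups K = {G. group G \<and> (\<exists>D\<in>K. G \<cong> homeotopy_group D)}"


section \<open>Wreath products and the class \<open>\<G>'\<close>\<close>

definition wreath_product ::
    "('a, 'm) monoid_scheme \<Rightarrow> ('h, 'n) monoid_scheme \<Rightarrow> (('h \<Rightarrow> 'a) \<times> 'h) monoid" where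
  "wreath_product A H =
     \<lparr>carrier = (carrier H \<rightarrow>\<^sub>E carrier A) \<times> carrier H,
      monoid.mult = (\<lambda>(f1, h1) (f2, h2).
        (\<lambda>h\<in>carrier H. f1 (h2 \<otimes>\<^bsub>H\<^esub> h) \<otimes>\<^bsub>A\<^esub> f2 h, h1 \<otimes>\<^bsub>H\<^esub> h2)),
      one = (\<lambda>h\<in>carrier H. \<one>\<^bsub>A\<^esub>, \<one>\<^bsub>H\<^esub>)\<rparr>"

text \<open>
  Formal expressions built from unit groups by products and wreath products with the
  integers.  The index set of a product is any set of natural numbers, that is, up to
  renaming, any countable set; the empty product is the unit group.
\<close>

datatype representation =
    Unit_Rep
  | Prod_Rep "nat set" "nat \<Rightarrow> representation"
  | Wreath_Rep representation

text \<open>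
  The group denoted by an expression.  The type \<open>group_value\<close> only serves to let the groups
  denoted by all the expressions have elements of one type.
\<close>

datatype group_value =
    Point
  | Tuple "nat \<Rightarrow> group_value"
  | Wreath "(int \<Rightarrow> group_value) \<times> int"

primrec represented_group :: "representation \<Rightarrow> group_value monoid" where
  "represented_group Unit_Rep =
     \<lparr>carrier = {Point}, monoid.mult = (\<lambda>_ _. Point), one = Point\<rparr>"
| "represented_group (Prod_Rep I R) =
     image_group Tuple (product_group I (\<lambda>i. represented_group (R i)))"
| "represented_group (Wreath_Rep R) =
     image_group Wreath (wreath_product (represented_group R) integer_group)"

primrec height :: "representation \<Rightarrow> enat" where
  "height Unit_Rep = 0"
| "height (Prod_Rep I R) = 1 + (SUP i\<in>I. height (R i))"
| "height (Wreath_Rep R) = 1 + height R"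

definition class_G' :: "'g monoid set" where
  "class_G' = {G. group G \<and> (\<exists>R. height R < \<infinity> \<and> G \<cong> represented_group R)}"

end

theory Submission
  imports Defs
begin

text \<open>
  A surface of the class \<open>\<FF>\<close> is a rooted tree of strips of finite depth: every strip has one lower
  interval, so it has at most one parent, and its children sit on its upper intervals.  Apart from
  the symmetric strip, a foliated homeomorphism cannot reverse the transverse direction, hence it
  maps strips to strips and shifts the upper intervals of every strip by an integer.  These shifts
  form the portrait of the homeomorphism, an automorphism of the tree.  Every automorphism is
  realized by horizontal shears.  The homeomorphisms with trivial portrait are joined to the identity
  by straight-line homotopies inside the strips, and conversely the portrait is constant along paths;
  so the homeotopy group is the automorphism group of the tree.

  If the root is fixed by all automorphisms, this group is the product of the automorphism groups
  of the subtrees at the root.  Otherwise the shifts of the root form a group \<open>m\<int>\<close> with \<open>m > 0\<close>, and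
  the group is the wreath product with \<open>\<int>\<close> of the product of the automorphism groups of \<open>m\<close>
  consecutive subtrees.  Conversely a representation of finite height is turned into a tree by
  recursion: products give roots with the upper intervals \<open>1, 2, \<dots>\<close>, and wreath products give
  roots with the upper intervals indexed by \<open>\<int>\<close> and equal subtrees.
\<close>

section \<open>Groups\<close>

text \<open>A homeomorphism of the surface does not refer to strips, so the strips must be recovered
  from the leaves. Away from the special leaves the surface is a disjoint union of open connected
  pieces, one in each strip, and the closure of a piece is its strip. That glued leaves are special
  is what reducedness supplies. Inside a strip the topology is reduced to order: maps are monotone
  in the level and along the leaves. This gives continuity of inverses and, by the intermediate
  value theorem, bijectivity of convex combinations with the identity. The symmetric strip has to be
  set apart because its group has an element of order two, while products and wreath products with
  \<int> of torsion-free groups are torsion-free. Shifts are recorded for all upper intervals, glued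
  or not, since a strip with unglued intervals indexed by \<int> already contributes a factor
  \<int>. One level of a tree costs at most one product and one wreath product, so depth
  \<open>d\<close> bounds the height by \<open>2 * d\<close>.\<close>

lemma product_group_singleton_iso: "product_group {i} G \<cong> G i"
proof -
  have "(\<lambda>x. x i) \<in> iso (product_group {i} G) (G i)"
    unfolding iso_def
  proof (intro CollectI conjI)
    show "(\<lambda>x. x i) \<in> hom (product_group {i} G) (G i)"
      by (intro homI) auto
    show "bij_betw (\<lambda>x. x i) (carrier (product_group {i} G)) (carrier (G i))"
      by (rule bij_betw_byWitness[where f' = "\<lambda>x. \<lambda>j\<in>{i}. x"])
        (auto simp: PiE_iff extensional_def fun_eq_iff split: if_splits)
  qed
  then show ?thesis by (auto simp: is_iso_def)
qed

lemma wreath_product_cong_iso: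
  assumes "A \<cong> A'" and "group A" and "group H"
  shows "wreath_product A H \<cong> wreath_product A' H"
proof -
  obtain f where f: "f \<in> iso A A'" using assms(1) by (auto simp: is_iso_def)
  then have bij: "bij_betw f (carrier A) (carrier A')"
    and mult: "\<And>x y. x \<in> carrier A \<Longrightarrow> y \<in> carrier A \<Longrightarrow> f (x \<otimes>\<^bsub>A\<^esub> y) = f x \<otimes>\<^bsub>A'\<^esub> f y"
    by (auto simp: iso_def hom_def)
  interpret A: group A by fact
  interpret H: group H by fact
  let ?F = "\<lambda>(x, h). (\<lambda>i\<in>carrier H. f (x i), h)"
  have "bij_betw ?F (carrier (wreath_product A H)) (carrier (wreath_product A' H))"
  proof (rule bij_betw_byWitness[where f' = "\<lambda>(x, h). (\<lambda>i\<in>carrier H. inv_into (carrier A) f (x i), h)"])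
  qed (use bij in \<open>auto simp: wreath_product_def fun_eq_iff PiE_iff extensional_def bij_betw_def
         inv_into_f_f f_inv_into_f inv_into_into\<close>)
  moreover have "?F \<in> hom (wreath_product A H) (wreath_product A' H)"
    using bij by (intro homI)
      (auto simp: wreath_product_def bij_betw_def PiE_iff fun_eq_iff mult)
  ultimately show ?thesis
    by (auto simp: is_iso_def iso_def)
qed

lemma group_wreath_product:
  assumes "group A" and "group H"
  shows "group (wreath_product A H)"
proof -
  interpret A: group A by fact
  interpret H: group H by fact
  show ?thesis
  proof (rule groupI)
    fix x assume x: "x \<in> carrier (wreath_product A H)"
    obtain f h where fh: "x = (f, h)" by force
    \<comment> \<open>Solving \<open>g (h \<otimes> i) \<otimes> f i = \<one>\<close> for the first
      component \<open>g\<close> of a left inverse puts \<open>inv h\<close> inside the argument of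
      \<open>f\<close>.\<close>
    let ?y = "(\<lambda>i\<in>carrier H. inv\<^bsub>A\<^esub> f (inv\<^bsub>H\<^esub> h \<otimes>\<^bsub>H\<^esub> i), inv\<^bsub>H\<^esub> h)"
    have "?y \<in> carrier (wreath_product A H)"
      using x by (auto simp: wreath_product_def fh PiE_iff)
    moreover have "?y \<otimes>\<^bsub>wreath_product A H\<^esub> x = \<one>\<^bsub>wreath_product A H\<^esub>"
      using x by (auto simp: wreath_product_def fh PiE_iff fun_eq_iff H.m_assoc[symmetric])
    ultimately show "\<exists>y\<in>carrier (wreath_product A H). y \<otimes>\<^bsub>wreath_product A H\<^esub> x = \<one>\<^bsub>wreath_product A H\<^esub>"
      by blast
  next
    fix x y z assume "x \<in> carrier (wreath_product A H)" "y \<in> carrier (wreath_product A H)"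
      "z \<in> carrier (wreath_product A H)"
    then show "x \<otimes>\<^bsub>wreath_product A H\<^esub> y \<otimes>\<^bsub>wreath_product A H\<^esub> z =
       x \<otimes>\<^bsub>wreath_product A H\<^esub> (y \<otimes>\<^bsub>wreath_product A H\<^esub> z)"
      by (auto simp: wreath_product_def PiE_iff fun_eq_iff A.m_assoc H.m_assoc)
  next
    fix x assume "x \<in> carrier (wreath_product A H)"
    then show "\<one>\<^bsub>wreath_product A H\<^esub> \<otimes>\<^bsub>wreath_product A H\<^esub> x = x"
      by (auto simp: wreath_product_def PiE_iff fun_eq_iff extensional_def)
  qed (auto simp: wreath_product_def PiE_iff)
qed

lemma group_represented_group: "group (represented_group R)"
proof (induction R)
  case Unit_Rep
  show ?case by (rule groupI) auto
next
  case (Prod_Rep I R)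
  then have "group (product_group I (\<lambda>i. represented_group (R i)))" by (simp add: rangeI)
  then show ?case by (simp add: group.inj_imp_image_group_is_group inj_on_def)
next
  case (Wreath_Rep R)
  then have "group (wreath_product (represented_group R) integer_group)"
    by (simp add: group_wreath_product)
  then show ?case by (simp add: group.inj_imp_image_group_is_group inj_on_def)
qed

lemma represented_group_Prod_Rep_iso:
  "product_group I (\<lambda>i. represented_group (R i)) \<cong> represented_group (Prod_Rep I R)"
  unfolding is_iso_def represented_group.simps
  using inj_imp_image_group_iso[of Tuple "product_group I (\<lambda>i. represented_group (R i))"]
  by (auto simp: inj_on_def)

lemma represented_group_Wreath_Rep_iso:
  "wreath_product (represented_group R) integer_group \<cong> represented_group (Wreath_Rep R)"
  unfolding is_iso_def represented_group.simps
  using inj_imp_image_group_iso[of Wreath "wreath_product (represented_group R) integer_group"]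
  by (auto simp: inj_on_def)

section \<open>Automorphisms of trees\<close>

text \<open>
  A vertex of a tree is encoded by the list of the positions passed on the way to it from the
  root, and \<open>T a\<close> is the index set of the upper boundary of the strip at \<open>a\<close>.  Some of its
  elements need not be positions of children: these are the intervals that are not glued.
  An automorphism is encoded by its portrait, which gives for each vertex the amount by which
  the upper intervals of its strip are shifted; it is zero where this amount has no meaning.
\<close>

type_synonym tree = "int list \<Rightarrow> int set option"

text \<open>The value type is left open because trees and portraits are restricted to a branch in
  the same way.\<close>

definition subtree :: "(int list \<Rightarrow> 'a) \<Rightarrow> int \<Rightarrow> int list \<Rightarrow> 'a" where
  "subtree T i = (\<lambda>a. T (i # a))"

text \<open>Below the root the portrait is read along the original vertex, not along its image: the
  branch used is the one at \<open>i\<close>, before the shift.\<close>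

fun act :: "(int list \<Rightarrow> int) \<Rightarrow> int list \<Rightarrow> int list" where
  "act k [] = []"
| "act k (i # a) = (i + k []) # act (subtree k i) a"

text \<open>Here \<open>i\<close> is a position in the image, so the branch to be read is the one at
  its preimage \<open>i - k []\<close>.\<close>

fun unact :: "(int list \<Rightarrow> int) \<Rightarrow> int list \<Rightarrow> int list" where
  "unact k [] = []"
| "unact k (i # a) = (i - k []) # unact (subtree k (i - k [])) a"

text \<open>The chain rule for a composite in which \<open>l\<close> acts first: \<open>k\<close>
  contributes its shift at the image vertex \<open>act l a\<close>.\<close>

definition portrait_mult :: "(int list \<Rightarrow> int) \<Rightarrow> (int list \<Rightarrow> int) \<Rightarrow> int list \<Rightarrow> int" where
  "portrait_mult k l = (\<lambda>a. k (act l a) + l a)"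

definition portrait_inv :: "(int list \<Rightarrow> int) \<Rightarrow> int list \<Rightarrow> int" where
  "portrait_inv k = (\<lambda>a. - k (unact k a))"

text \<open>The recursion of \<open>act\<close> works from the root; this form works from the far
  end and shows that the position of a child under its parent \<open>a\<close> moves by
  \<open>k a\<close>. Strips are compared across a seam in this form.\<close>

lemma act_snoc: "act k (a @ [i]) = act k a @ [i + k a]"
  by (induction a arbitrary: k) (auto simp: subtree_def)

lemma act_unact [simp]: "act k (unact k a) = a"
  by (induction a arbitrary: k) auto

lemma unact_act [simp]: "unact k (act k a) = a"
  by (induction a arbitrary: k) auto

text \<open>The factor \<open>l\<close> has already moved branch \<open>i\<close> to the position
  \<open>i + l []\<close>, so \<open>k\<close> is restricted to that branch.\<close>

lemma subtree_portrait_mult: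
  "subtree (portrait_mult k l) i = portrait_mult (subtree k (i + l [])) (subtree l i)"
  by (auto simp: portrait_mult_def subtree_def fun_eq_iff)

lemma act_portrait_mult: "act (portrait_mult k l) a = act k (act l a)"
proof (induction a arbitrary: k l)
  case (Cons i a)
  then show ?case
    by (simp add: subtree_portrait_mult) (simp add: portrait_mult_def)
qed simp

lemma portrait_mult_assoc:
  "portrait_mult (portrait_mult k l) m = portrait_mult k (portrait_mult l m)"
  by (simp add: portrait_mult_def fun_eq_iff act_portrait_mult[unfolded portrait_mult_def])

lemma subtree_zero [simp]: "subtree (\<lambda>_. c) i = (\<lambda>_. c)"
  by (simp add: subtree_def)

lemma act_zero [simp]: "act (\<lambda>_. 0) a = a"
  by (induction a) auto

lemma portrait_mult_zero [simp]:
  "portrait_mult (\<lambda>_. 0) k = k" "portrait_mult k (\<lambda>_. 0) = k"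
  by (auto simp: portrait_mult_def)

lemma subtree_portrait_inv: "subtree (portrait_inv k) i = portrait_inv (subtree k (i - k []))"
  by (simp add: portrait_inv_def subtree_def fun_eq_iff)

lemma act_portrait_inv [simp]: "act (portrait_inv k) a = unact k a"
proof (induction a arbitrary: k)
  case (Cons i a)
  then show ?case by (simp add: subtree_portrait_inv) (simp add: portrait_inv_def)
qed simp

lemma portrait_inv_mult [simp]:
  "portrait_mult (portrait_inv k) k = (\<lambda>_. 0)" "portrait_mult k (portrait_inv k) = (\<lambda>_. 0)"
  by (auto simp: portrait_mult_def fun_eq_iff) (auto simp: portrait_inv_def)

text \<open>Two trees are involved even in the study of automorphisms: one that shifts the root maps
  a branch to another branch. The normalization to zero at vertices that are absent or have no upper
  intervals makes portraits unique, so that the group consists of portraits and not of classes of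
  them.\<close>

definition tree_isos :: "tree \<Rightarrow> tree \<Rightarrow> (int list \<Rightarrow> int) set" where
  "tree_isos T T' = {k. \<forall>a. T' (act k a) = map_option (image (\<lambda>i. i + k a)) (T a) \<and>
     (T a = None \<or> T a = Some {} \<longrightarrow> k a = 0)}"

definition tree_group :: "tree \<Rightarrow> (int list \<Rightarrow> int) monoid" where
  "tree_group T = \<lparr>carrier = tree_isos T T, monoid.mult = portrait_mult, one = (\<lambda>_. 0)\<rparr>"

lemma tree_isos_mult:
  assumes "k \<in> tree_isos T' T''" and "l \<in> tree_isos T T'"
  shows "portrait_mult k l \<in> tree_isos T T''"
  unfolding tree_isos_def
proof (intro CollectI allI)
  fix a
  have l: "T' (act l a) = map_option (image (\<lambda>i. i + l a)) (T a)"
    "T a = None \<or> T a = Some {} \<longrightarrow> l a = 0"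
    using assms(2) by (auto simp: tree_isos_def)
  have k: "T'' (act k (act l a)) = map_option (image (\<lambda>i. i + k (act l a))) (T' (act l a))"
    "T' (act l a) = None \<or> T' (act l a) = Some {} \<longrightarrow> k (act l a) = 0"
    using assms(1) by (auto simp: tree_isos_def)
  show "T'' (act (portrait_mult k l) a) =
          map_option (image (\<lambda>i. i + portrait_mult k l a)) (T a) \<and>
        (T a = None \<or> T a = Some {} \<longrightarrow> portrait_mult k l a = 0)"
    unfolding act_portrait_mult using k l
    by (cases "T a") (auto simp: portrait_mult_def image_image algebra_simps)
qed

lemma map_option_image_zero: "map_option (image (\<lambda>i::int. i + 0)) x = x"
  by (cases x) auto

lemma tree_isos_zero: "(\<lambda>_. 0) \<in> tree_isos T T"
  by (auto simp: tree_isos_def map_option_image_zero[simplified])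

lemma tree_isos_inv:
  assumes "k \<in> tree_isos T T'"
  shows "portrait_inv k \<in> tree_isos T' T"
  unfolding tree_isos_def
proof (intro CollectI allI)
  fix a
  let ?b = "unact k a"
  have k: "T' a = map_option (image (\<lambda>i. i + k ?b)) (T ?b)"
    "T ?b = None \<or> T ?b = Some {} \<longrightarrow> k ?b = 0"
    using assms by (auto simp: tree_isos_def) (metis act_unact)
  show "T (act (portrait_inv k) a) = map_option (image (\<lambda>i. i + portrait_inv k a)) (T' a) \<and>
       (T' a = None \<or> T' a = Some {} \<longrightarrow> portrait_inv k a = 0)"
    unfolding act_portrait_inv using k by (cases "T ?b") (auto simp: portrait_inv_def image_image)
qed

lemma carrier_tree_group [simp]: "carrier (tree_group T) = tree_isos T T"
  and mult_tree_group [simp]: "k \<otimes>\<^bsub>tree_group T\<^esub> l = portrait_mult k l"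
  and one_tree_group [simp]: "\<one>\<^bsub>tree_group T\<^esub> = (\<lambda>_. 0)"
  by (auto simp: tree_group_def)

lemma group_tree_group: "group (tree_group T)"
  by (rule groupI) (auto simp: tree_isos_mult tree_isos_zero portrait_mult_assoc
      intro!: bexI[OF _ tree_isos_inv])

text \<open>An isomorphism amounts to an admissible root shift together with independently chosen
  isomorphisms of the branches. Both decompositions of the automorphism group take portraits apart
  and assemble them through this equivalence.\<close>

lemma tree_isos_iff_subtree:
  "k \<in> tree_isos T T' \<longleftrightarrow>
     T' [] = map_option (image (\<lambda>i. i + k [])) (T []) \<and>
     (T [] = None \<or> T [] = Some {} \<longrightarrow> k [] = 0) \<and>
     (\<forall>i. subtree k i \<in> tree_isos (subtree T i) (subtree T' (i + k [])))"
proof -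
  have *: "(\<forall>a::int list. P a) \<longleftrightarrow> P [] \<and> (\<forall>i a. P (i # a))" for P
    by (metis neq_Nil_conv)
  show ?thesis
    unfolding tree_isos_def mem_Collect_eq by (subst *) (auto simp: subtree_def)
qed

lemma subtree_tree_isos:
  "k \<in> tree_isos T T' \<Longrightarrow> subtree k i \<in> tree_isos (subtree T i) (subtree T' (i + k []))"
  by (subst (asm) tree_isos_iff_subtree) blast

lemma tree_isos_NilD:
  "k \<in> tree_isos T T' \<Longrightarrow> T' [] = map_option (image (\<lambda>i. i + k [])) (T [])"
  by (subst (asm) tree_isos_iff_subtree) blast

lemma tree_isos_zeroD: "k \<in> tree_isos T T' \<Longrightarrow> T a = None \<or> T a = Some {} \<Longrightarrow> k a = 0"
  unfolding tree_isos_def by blast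

lemma tree_isos_empty: "tree_isos (\<lambda>_. None) (\<lambda>_. None) = {\<lambda>_. 0}"
  by (auto simp: tree_isos_def)

section \<open>Splitting the automorphism group at the root\<close>

definition attach :: "'a \<Rightarrow> (int \<Rightarrow> int list \<Rightarrow> 'a) \<Rightarrow> int list \<Rightarrow> 'a" where
  "attach x k a = (case a of [] \<Rightarrow> x | i # b \<Rightarrow> k i b)"

lemma attach_Nil [simp]: "attach x k [] = x"
  and subtree_attach [simp]: "subtree (attach x k) i = k i"
  by (auto simp: attach_def subtree_def)

lemma eqI_subtree:
  assumes "k [] = l []" and "\<And>i. subtree k i = subtree l i"
  shows "k = l"
proof
  fix a show "k a = l a"
    using assms by (cases a) (auto simp: subtree_def fun_eq_iff)
qed

text \<open>Without root shifts every branch is mapped to itself and multiplication is branchwise.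
  The map \<open>f\<close> enumerates branches; those it misses have no vertices, so zero is their
  only portrait.\<close>

lemma tree_group_iso_product:
  assumes rigid: "\<And>k. k \<in> tree_isos T T \<Longrightarrow> k [] = 0"
    and inj: "inj_on f I"
    and empty: "\<And>j. j \<notin> f ` I \<Longrightarrow> subtree T j = (\<lambda>_. None)"
  shows "tree_group T \<cong> product_group I (\<lambda>i. tree_group (subtree T (f i)))"
proof -
  let ?P = "product_group I (\<lambda>i. tree_group (subtree T (f i)))"
  let ?F = "\<lambda>k. \<lambda>i\<in>I. subtree k (f i)"
  \<comment> \<open>\<open>attach\<close> rebuilds a portrait from its root shift and its branches;
    the missed branches receive the zero portrait.\<close>
  let ?G = "\<lambda>x. attach 0 (\<lambda>j. if j \<in> f ` I then x (inv_into I f j) else (\<lambda>_. 0))"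
  have sub: "subtree k j \<in> tree_isos (subtree T j) (subtree T j)" if "k \<in> tree_isos T T" for k j
    using subtree_tree_isos[OF that, of j] rigid[OF that] by simp
  have "bij_betw ?F (carrier (tree_group T)) (carrier ?P)"
  proof (rule bij_betw_byWitness[where f' = ?G])
    show "\<forall>k\<in>carrier (tree_group T). ?G (?F k) = k"
    proof
      fix k assume "k \<in> carrier (tree_group T)"
      then have k: "k \<in> tree_isos T T" by simp
      show "?G (?F k) = k"
      proof (rule eqI_subtree)
        fix j
        show "subtree (?G (?F k)) j = subtree k j"
        proof (cases "j \<in> f ` I")
          case True
          then show ?thesis using inj by (auto simp: inv_into_f_f)
        next
          case False
          then show ?thesis using sub[OF k, of j] empty[of j] by (simp add: tree_isos_empty)
        qed
      qed (simp add: rigid[OF k])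
    qed
    show "\<forall>x\<in>carrier ?P. ?F (?G x) = x"
      using inj by (auto simp: fun_eq_iff PiE_iff extensional_def)
    show "?F ` carrier (tree_group T) \<subseteq> carrier ?P"
      using sub by auto
    show "?G ` carrier ?P \<subseteq> carrier (tree_group T)"
    proof
      fix k assume "k \<in> ?G ` carrier ?P"
      then obtain x where x: "x \<in> carrier ?P" and k: "k = ?G x" by blast
      have "k \<in> tree_isos T T"
        unfolding k using x inj
        by (subst tree_isos_iff_subtree) (auto simp: PiE_iff map_option_image_zero[simplified] tree_isos_zero)
      then show "k \<in> carrier (tree_group T)" by simp
    qed
  qed
  moreover have "?F \<in> hom (tree_group T) ?P"
  proof (rule homI)
    fix k l assume "k \<in> carrier (tree_group T)" "l \<in> carrier (tree_group T)"
    then have "l [] = 0" by (simp add: rigid)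
    then show "?F (k \<otimes>\<^bsub>tree_group T\<^esub> l) = ?F k \<otimes>\<^bsub>?P\<^esub> ?F l"
      by (auto simp: subtree_portrait_mult intro!: restrict_ext)
  qed (use sub in auto)
  ultimately show ?thesis
    by (auto simp: is_iso_def iso_def)
qed


lemma portrait_inv_cancel [simp]:
  "portrait_mult (portrait_inv k) (portrait_mult k l) = l"
  "portrait_mult k (portrait_mult (portrait_inv k) l) = l"
  by (simp_all flip: portrait_mult_assoc)

lemma portrait_mult_Nil [simp]: "portrait_mult k l [] = k [] + l []"
  and portrait_inv_Nil [simp]: "portrait_inv k [] = - k []"
  by (simp_all add: portrait_mult_def portrait_inv_def)

text \<open>
  Conjugating an automorphism \<open>k\<close> that shifts the positions at the root by \<open>m * n\<close> with the
  automorphisms \<open>\<sigma> q\<close> moves its restriction to the \<open>q\<close>-th block of \<open>m\<close> subtrees to the block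
  of the positions \<open>0, \<dots>, m - 1\<close>.
\<close>

lemma tree_group_iso_wreath:
  assumes \<sigma>: "\<And>q. \<sigma> q \<in> tree_isos T T" "\<And>q. \<sigma> q [] = int m * q" and m: "m > 0"
    and shift: "\<And>k. k \<in> tree_isos T T \<Longrightarrow> int m dvd k []"
  shows "tree_group T \<cong>
    wreath_product (product_group {..<m} (\<lambda>r. tree_group (subtree T (int r)))) integer_group"
proof -
  let ?W = "wreath_product (product_group {..<m} (\<lambda>r. tree_group (subtree T (int r)))) integer_group"
  \<comment> \<open>\<open>s q r\<close> carries branch \<open>r\<close> of the base block to the
    corresponding branch of block \<open>q\<close> and serves to identify the two.\<close>
  define s where "s q r = subtree (\<sigma> q) r" for q r
  have s: "s q r \<in> tree_isos (subtree T r) (subtree T (r + int m * q))" for q r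
    using subtree_tree_isos[OF \<sigma>(1)] by (simp add: s_def \<sigma>(2))
  define F where "F k = (\<lambda>q. \<lambda>r\<in>{..<m}. portrait_mult (portrait_inv (s (q + k [] div int m) (int r)))
       (portrait_mult (subtree k (int r + int m * q)) (s q (int r))), k [] div int m)" for k
  \<comment> \<open>Position \<open>j\<close> is branch \<open>j mod m\<close> of block
    \<open>j div m\<close>; undoing the conjugation of \<open>F\<close> there gives the inverse
    map.\<close>
  define G where "G = (\<lambda>(x :: int \<Rightarrow> nat \<Rightarrow> int list \<Rightarrow> int, n). attach (int m * n)
      (\<lambda>j. portrait_mult (s (j div int m + n) (j mod int m))
         (portrait_mult (x (j div int m) (nat (j mod int m)))
           (portrait_inv (s (j div int m) (j mod int m))))))"
  have carrier: "carrier ?W = (UNIV \<rightarrow>\<^sub>E (\<Pi>\<^sub>E r\<in>{..<m}. tree_isos (subtree T (int r)) (subtree T (int r)))) \<times> UNIV"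
    by (simp add: wreath_product_def)
  have pos: "int m > 0" using m by simp
  have "bij_betw F (carrier (tree_group T)) (carrier ?W)"
  proof (rule bij_betw_byWitness[where f' = G])
    show "\<forall>k\<in>carrier (tree_group T). G (F k) = k"
    proof
      fix k assume "k \<in> carrier (tree_group T)"
      then have k: "int m dvd k []" using shift by simp
      show "G (F k) = k"
      proof (rule eqI_subtree)
        show "G (F k) [] = k []" using k by (simp add: F_def G_def)
        fix j
        have "nat (j mod int m) < m" using pos by (simp add: nat_less_iff)
        moreover have "int (nat (j mod int m)) = j mod int m" using pos by simp
        ultimately show "subtree (G (F k)) j = subtree k j"
          by (simp add: F_def G_def portrait_mult_assoc)
      qed
    qed
    show "\<forall>y\<in>carrier ?W. F (G y) = y"
    proof
      fix y assume y: "y \<in> carrier ?W"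
      obtain x n where xn: "y = (x, n)" by force
      have "(int r + int m * q) div int m = q" "(int r + int m * q) mod int m = int r"
        if "r < m" for r q
        using that by auto
      then have "fst (F (G y)) q r = x q r" for q r
        using y m by (auto simp: carrier xn F_def G_def portrait_mult_assoc PiE_iff extensional_def)
      then show "F (G y) = y"
        using m by (auto simp: xn F_def G_def fun_eq_iff)
    qed
    show "F ` carrier (tree_group T) \<subseteq> carrier ?W"
    proof -
      have "portrait_mult (portrait_inv (s (q + k [] div int m) (int r)))
             (portrait_mult (subtree k (int r + int m * q)) (s q (int r)))
            \<in> tree_isos (subtree T (int r)) (subtree T (int r))"
        if k: "k \<in> tree_isos T T" for k q r
      proof -
      obtain n where n: "k [] = int m * n" using shift[OF k] by blast
      have 1: "subtree k (int r + int m * q) \<in>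
          tree_isos (subtree T (int r + int m * q)) (subtree T (int r + int m * (q + n)))"
        using subtree_tree_isos[OF k, of "int r + int m * q"] by (simp add: n algebra_simps)
      have "k [] div int m = n" using m by (simp add: n)
      then show ?thesis
        using tree_isos_mult[OF tree_isos_inv[OF s] tree_isos_mult[OF 1 s]] by simp
      qed
      then show ?thesis unfolding carrier F_def by (intro image_subsetI) (simp add: PiE_iff)
    qed
    show "G ` carrier ?W \<subseteq> carrier (tree_group T)"
    proof
      fix k assume "k \<in> G ` carrier ?W"
      then obtain x n where x: "\<And>q r. r < m \<Longrightarrow> x q r \<in> tree_isos (subtree T (int r)) (subtree T (int r))"
        and k: "k = G (x, n)" by (auto simp: carrier PiE_iff)
      have kn: "k [] = \<sigma> n []" by (simp add: k G_def \<sigma>(2))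
      have "k \<in> tree_isos T T"
      proof (subst tree_isos_iff_subtree, intro conjI allI)
        show "T [] = map_option ((`) (\<lambda>i. i + k [])) (T [])"
          "T [] = None \<or> T [] = Some {} \<longrightarrow> k [] = 0"
          unfolding kn using \<sigma>(1)[of n] by (subst (asm) tree_isos_iff_subtree, blast)+
        fix j
        let ?q = "j div int m" and ?r = "j mod int m"
        have r: "nat ?r < m" "int (nat ?r) = ?r" using pos by (simp_all add: nat_less_iff)
        have j: "?r + int m * ?q = j" by simp
        have "portrait_mult (s (?q + n) ?r) (portrait_mult (x ?q (nat ?r)) (portrait_inv (s ?q ?r)))
          \<in> tree_isos (subtree T (?r + int m * ?q)) (subtree T (?r + int m * (?q + n)))"
          using x[OF r(1), of ?q] unfolding r(2)
          by (intro tree_isos_mult[OF s] tree_isos_mult[OF _ tree_isos_inv[OF s]])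
        moreover have "?r + int m * (?q + n) = j + k []"
          using j by (simp add: kn \<sigma>(2) algebra_simps)
        ultimately show "subtree k j \<in> tree_isos (subtree T j) (subtree T (j + k []))"
          unfolding j by (simp add: k G_def)
      qed
      then show "k \<in> carrier (tree_group T)" by simp
    qed
  qed
  moreover have "F \<in> hom (tree_group T) ?W"
  proof (rule homI)
    fix k l assume "k \<in> carrier (tree_group T)" "l \<in> carrier (tree_group T)"
    then obtain n n' where n: "k [] = int m * n" and n': "l [] = int m * n'"
      using shift by (metis carrier_tree_group dvd_def)
    have "k [] div int m = n" "l [] div int m = n'" "(k [] + l []) div int m = n + n'"
      using m by (simp_all add: n n' flip: distrib_left)
    \<comment> \<open>The two inner factors \<open>s\<close> cancel when the component of
      \<open>k\<close> is taken \<open>l [] div m\<close> blocks further on, which is the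
      translation in the wreath multiplication.\<close>
    then show "F (k \<otimes>\<^bsub>tree_group T\<^esub> l) = F k \<otimes>\<^bsub>?W\<^esub> F l"
      by (auto simp: F_def wreath_product_def fun_eq_iff subtree_portrait_mult portrait_mult_assoc
          n n' algebra_simps)
  qed (use bij_betwE[OF calculation] in blast)
  ultimately show ?thesis
    by (auto simp: is_iso_def iso_def)
qed

text \<open>Induction on the depth. The root is either rigid or its shifts form a nonzero subgroup
  of \<int>. A rigid root costs one product, any other root a finite product followed by a wreath
  product, whence the factor 2 in the bound.\<close>

lemma tree_group_represented:
  assumes "\<And>a. d \<le> length a \<Longrightarrow> T a = None"
  shows "\<exists>R. height R \<le> enat (2 * d) \<and> tree_group T \<cong> represented_group R"
  using assms
proof (induction d arbitrary: T)
  case 0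
  then have "T = (\<lambda>_. None)" by auto
  then have "(\<lambda>_. Point) \<in> iso (tree_group T) (represented_group Unit_Rep)"
    by (auto simp: iso_def tree_isos_empty hom_def bij_betw_def)
  then have "height Unit_Rep \<le> enat (2 * 0) \<and> tree_group T \<cong> represented_group Unit_Rep"
    by (auto simp: is_iso_def zero_enat_def)
  then show ?case by blast
next
  case (Suc d)
  have "\<exists>R. height R \<le> enat (2 * d) \<and> tree_group (subtree T i) \<cong> represented_group R" for i
    by (rule Suc.IH) (simp add: subtree_def Suc.prems)
  then obtain R where R: "\<And>i. height (R i) \<le> enat (2 * d)"
    "\<And>i. tree_group (subtree T i) \<cong> represented_group (R i)"
    by metis
  have prod: "product_group I (\<lambda>i. tree_group (subtree T (f i)))
      \<cong> represented_group (Prod_Rep I (\<lambda>i. R (f i)))" for I and f :: "nat \<Rightarrow> int"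
    by (rule iso_trans[OF iso_product_groupI represented_group_Prod_Rep_iso])
      (auto simp: R group_tree_group group_represented_group)
  have height: "height (Prod_Rep I (\<lambda>i. R (f i))) \<le> enat (2 * d + 1)" for I and f :: "nat \<Rightarrow> int"
  proof -
    have "(SUP i\<in>I. height (R (f i))) \<le> enat (2 * d)"
      by (rule SUP_least) (rule R)
    then have "1 + (SUP i\<in>I. height (R (f i))) \<le> 1 + enat (2 * d)"
      by (rule add_left_mono)
    then show ?thesis by (simp add: one_enat_def)
  qed
  show ?case
  proof (cases "\<forall>k\<in>tree_isos T T. k [] = 0")
    case True
    \<comment> \<open>All integers serve as positions, enumerated by \<open>int_decode\<close>;
      empty branches give trivial factors.\<close>
    have "tree_group T \<cong> product_group UNIV (\<lambda>n. tree_group (subtree T (int_decode n)))"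
      by (rule tree_group_iso_product) (use True in \<open>auto simp: surj_int_decode inj_int_decode\<close>)
    then have "tree_group T \<cong> represented_group (Prod_Rep UNIV (\<lambda>n. R (int_decode n)))"
      by (rule iso_trans) (rule prod)
    moreover have "height (Prod_Rep UNIV (\<lambda>n. R (int_decode n))) \<le> enat (2 * Suc d)"
      using height by (rule order_trans) simp
    ultimately show ?thesis by blast
  next
    case False
    \<comment> \<open>The root shifts of automorphisms form a subgroup of \<int>, generated by its
      least positive element \<open>m\<close>.\<close>
    define Z where "Z = {k [] |k. k \<in> tree_isos T T}"
    have add: "x + y \<in> Z" if "x \<in> Z" "y \<in> Z" for x y
      using that tree_isos_mult unfolding Z_def mem_Collect_eq by (metis portrait_mult_Nil)
    have neg: "- x \<in> Z" if "x \<in> Z" for x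
      using that tree_isos_inv unfolding Z_def mem_Collect_eq by (metis portrait_inv_Nil)
    have mult: "x * q \<in> Z" if "x \<in> Z" for x q
    proof (induction q rule: int_induct[of _ 0])
      case base
      show ?case using add[OF that neg[OF that]] by simp
    next
      case (step1 i)
      then show ?case using add[OF _ that] by (simp add: distrib_left)
    next
      case (step2 i)
      then show ?case using add[OF _ neg[OF that]] by (simp add: right_diff_distrib)
    qed
    obtain x where x: "x \<in> Z" "x \<noteq> 0" using False by (auto simp: Z_def)
    then have "int (nat \<bar>x\<bar>) \<in> Z \<and> nat \<bar>x\<bar> > 0" using neg by (auto simp: abs_if)
    then have ex: "\<exists>n. int n \<in> Z \<and> n > 0" by blast
    define m where "m = (LEAST n. int n \<in> Z \<and> n > 0)"
    have m: "int m \<in> Z" "m > 0" using LeastI_ex[OF ex] by (auto simp: m_def)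
    have least: "int m dvd k []" if "k \<in> tree_isos T T" for k
    proof (rule ccontr)
      assume "\<not> int m dvd k []"
      then have "k [] mod int m > 0" using m(2)
        by (metis dvd_eq_mod_eq_0 of_nat_0_less_iff order_le_less pos_mod_sign)
      moreover have "k [] mod int m \<in> Z"
      proof -
        have "k [] \<in> Z" using that by (auto simp: Z_def)
        from add[OF this mult[OF m(1), of "- (k [] div int m)"]]
        show ?thesis by (simp only: mult_minus_right add_uminus_conv_diff minus_mult_div_eq_mod)
      qed
      ultimately have "m \<le> nat (k [] mod int m)"
        unfolding m_def by (intro Least_le) auto
      then show False using m(2)
        by (metis linorder_not_le nat_less_iff of_nat_0_less_iff order_less_imp_le pos_mod_bound pos_mod_sign)
    qed
    \<comment> \<open>The automorphisms are chosen separately for each \<open>q\<close>, with no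
      compatibility between the choices.\<close>
    have "\<forall>q. \<exists>k. k \<in> tree_isos T T \<and> k [] = int m * q"
      using mult[OF m(1)] by (auto simp: Z_def) metis
    then obtain \<sigma> where \<sigma>: "\<And>q. \<sigma> q \<in> tree_isos T T" "\<And>q. \<sigma> q [] = int m * q"
      by metis
    let ?P = "product_group {..<m} (\<lambda>r. tree_group (subtree T (int r)))"
    have "tree_group T \<cong> wreath_product ?P integer_group"
      by (rule tree_group_iso_wreath[where \<sigma> = \<sigma>]) (use \<sigma> m(2) least in auto)
    also have "wreath_product ?P integer_group \<cong>
        wreath_product (represented_group (Prod_Rep {..<m} (\<lambda>i. R (int i)))) integer_group"
      by (intro wreath_product_cong_iso prod) (auto simp: group_tree_group)
    finally (iso_trans) have "tree_group T \<cong> \<dots>" .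
    then have "tree_group T \<cong> represented_group (Wreath_Rep (Prod_Rep {..<m} (\<lambda>i. R (int i))))"
      using represented_group_Wreath_Rep_iso by (rule iso_trans)
    moreover have "height (Wreath_Rep (Prod_Rep {..<m} (\<lambda>i. R (int i)))) \<le> enat (2 * Suc d)"
    proof -
      have "1 + height (Prod_Rep {..<m} (\<lambda>i. R (int i))) \<le> 1 + enat (2 * d + 1)"
        by (rule add_left_mono) (rule height)
      then show ?thesis by (simp add: one_enat_def)
    qed
    ultimately show ?thesis by blast
  qed
qed

section \<open>Trees of representations\<close>

text \<open>The ray \<open>{1..}\<close> admits no nonzero shift and makes the root of a product
  rigid, while \<open>UNIV\<close> over equal branches admits every shift. In a product the
  positions that do not come from \<open>I\<close> remain as unglued intervals. No strip has exactly
  one upper interval, so the surface built from the tree is reduced and is not the symmetric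
  strip.\<close>

primrec tree_of :: "representation \<Rightarrow> tree" where
  "tree_of Unit_Rep = attach (Some {}) (\<lambda>_ _. None)"
| "tree_of (Prod_Rep I R) =
     attach (Some {1..}) (\<lambda>i. if i \<in> (\<lambda>n. int n + 1) ` I then tree_of (R (nat (i - 1))) else (\<lambda>_. None))"
| "tree_of (Wreath_Rep R) = attach (Some UNIV) (\<lambda>_. tree_of R)"

lemma tree_of_Nil: "tree_of R [] \<in> {Some {}, Some {1..}, Some UNIV}"
  by (cases R) auto

lemma attach_Cons [simp]: "attach x k (i # a) = k i a"
  by (simp add: attach_def)

lemma tree_of_in: "tree_of R a \<in> {None, Some {}, Some {1..}, Some UNIV}"
proof (induction R arbitrary: a)
  case Unit_Rep
  show ?case by (cases a) simp_all
next
  case (Prod_Rep I R)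
  note IH = Prod_Rep[OF rangeI]
  show ?case
  proof (cases a)
    case (Cons i b)
    then show ?thesis using IH[of "nat (i - 1)" b] by (simp split: if_split)
  qed simp
next
  case (Wreath_Rep R)
  then show ?case by (cases a) simp_all
qed

text \<open>This is the condition \<open>T_snoc\<close> demanded of the trees of surfaces; it makes
  the set of vertices closed under prefixes.\<close>

lemma tree_of_snoc:
  assumes "tree_of R (a @ [i]) \<noteq> None"
  shows "\<exists>\<Delta>. tree_of R a = Some \<Delta> \<and> i \<in> \<Delta>"
  using assms
proof (induction R arbitrary: a)
  case Unit_Rep
  then show ?case by (cases a) simp_all
next
  case (Prod_Rep I R)
  note IH = Prod_Rep.IH[OF rangeI]
  show ?case
  proof (cases a)
    case Nil
    then show ?thesis using Prod_Rep.prems by (auto split: if_splits)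
  next
    case (Cons j b)
    then have "j \<in> (\<lambda>n. int n + 1) ` I" "tree_of (R (nat (j - 1))) (b @ [i]) \<noteq> None"
      using Prod_Rep.prems by (simp_all split: if_splits)
    then show ?thesis using IH[of "nat (j - 1)" b] by (simp add: Cons)
  qed
next
  case (Wreath_Rep R)
  then show ?case by (cases a) simp_all
qed

lemma one_plus_le_enat_SucD: "1 + x \<le> enat (Suc e) \<Longrightarrow> x \<le> enat e"
  by (cases x) (auto simp: one_enat_def)

lemma not_one_plus_le_zero: "\<not> 1 + x \<le> enat 0"
  by (cases x) (auto simp: one_enat_def)

text \<open>Every constructor that adds a level also adds one to the height. Height \<open>d\<close>
  allows vertices on the levels \<open>0\<close> to \<open>d\<close>, hence the strict
  inequality.\<close>

lemma tree_of_depth: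
  assumes "height R \<le> enat d" and "d < length a"
  shows "tree_of R a = None"
  using assms
proof (induction R arbitrary: a d)
  case (Unit_Rep)
  then show ?case by (cases a) simp_all
next
  case (Prod_Rep I R)
  obtain i b where a: "a = i # b" using Prod_Rep.prems(2) by (cases a) auto
  obtain e where d: "d = Suc e"
    using Prod_Rep.prems(1) not_one_plus_le_zero by (cases d) auto
  have e: "(SUP i\<in>I. height (R i)) \<le> enat e"
    using Prod_Rep.prems(1) unfolding d height.simps by (rule one_plus_le_enat_SucD)
  have "tree_of (R n) b = None" if "n \<in> I" for n
  proof (rule Prod_Rep.IH[OF rangeI])
    show "height (R n) \<le> enat e" using e that by (meson SUP_upper order_trans)
    show "e < length b" using Prod_Rep.prems(2) by (simp add: a d)
  qed
  then show ?case by (auto simp: a)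
next
  case (Wreath_Rep R)
  obtain i b where a: "a = i # b" using Wreath_Rep.prems(2) by (cases a) auto
  obtain e where d: "d = Suc e"
    using Wreath_Rep.prems(1) not_one_plus_le_zero by (cases d) auto
  have "height R \<le> enat e"
    using Wreath_Rep.prems(1) unfolding d height.simps by (rule one_plus_le_enat_SucD)
  then show ?case using Wreath_Rep.IH[of e b] Wreath_Rep.prems(2) by (simp add: a d)
qed

text \<open>A translation carries least elements to least elements.\<close>

lemma shift_atLeast_one:
  assumes "{1::int..} = (\<lambda>i. i + c) ` {1..}"
  shows "c = 0"
proof -
  have "1 + c \<in> (\<lambda>i. i + c) ` {1..}" by simp
  then have "1 + c \<in> {1..}" using assms by metis
  moreover have "1 \<in> (\<lambda>i. i + c) ` {1..}" using assms by (metis atLeast_iff order_refl)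
  ultimately show ?thesis by auto
qed

text \<open>Recursion over the expression. A product has a rigid root, so the group splits over the
  branches; for a wreath product all root shifts occur and the blocks have length one.\<close>

lemma represented_group_iso_tree_group: "represented_group R \<cong> tree_group (tree_of R)"
proof (induction R)
  case Unit_Rep
  have "k = (\<lambda>_. 0)" if "k \<in> tree_isos (tree_of Unit_Rep) (tree_of Unit_Rep)" for k
  proof
    fix a show "k a = 0" by (rule tree_isos_zeroD[OF that]) (cases a; simp)
  qed
  then have "tree_isos (tree_of Unit_Rep) (tree_of Unit_Rep) = {\<lambda>_. 0}"
    using tree_isos_zero by blast
  then have "(\<lambda>_. \<lambda>_. 0) \<in> iso (represented_group Unit_Rep) (tree_group (tree_of Unit_Rep))"
    by (auto simp: iso_def hom_def bij_betw_def)
  then show ?case by (auto simp: is_iso_def)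
next
  case (Prod_Rep I R)
  let ?f = "\<lambda>n. int n + 1"
  let ?T = "tree_of (Prod_Rep I R)"
  have sub: "subtree ?T (?f n) = tree_of (R n)" if "n \<in> I" for n
    using that by auto
  have "tree_group ?T \<cong> product_group I (\<lambda>n. tree_group (subtree ?T (?f n)))"
  proof (rule tree_group_iso_product)
    fix k assume "k \<in> tree_isos ?T ?T"
    from tree_isos_NilD[OF this] have "{1..} = (\<lambda>i. i + k []) ` {1..}" by simp
    then show "k [] = 0" by (rule shift_atLeast_one)
  next
    show "inj_on ?f I" by (simp add: inj_on_def)
  next
    fix j assume "j \<notin> ?f ` I"
    then show "subtree ?T j = (\<lambda>_. None)" by simp
  qed
  also have "product_group I (\<lambda>n. tree_group (subtree ?T (?f n))) \<cong> product_group I (\<lambda>n. represented_group (R n))"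
  proof (rule iso_product_groupI)
    fix n assume "n \<in> I"
    then show "tree_group (subtree ?T (?f n)) \<cong> represented_group (R n)"
      unfolding sub[OF \<open>n \<in> I\<close>] by (intro group.iso_sym[OF group_represented_group] Prod_Rep rangeI)
  qed (simp_all only: group_tree_group group_represented_group)
  finally (iso_trans) have "tree_group ?T \<cong> \<dots>" .
  from iso_trans[OF this represented_group_Prod_Rep_iso]
  show ?case by (rule group.iso_sym[OF group_tree_group])
next
  case (Wreath_Rep R)
  let ?T = "tree_of (Wreath_Rep R)"
  \<comment> \<open>All branches are equal, so a bare shift of the root, with zero portraits below,
    is an automorphism.\<close>
  let ?\<sigma> = "\<lambda>q::int. attach q (\<lambda>_ _. 0)"
  have "?\<sigma> q \<in> tree_isos ?T ?T" for q
  proof (subst tree_isos_iff_subtree, intro conjI allI)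
    have "range (\<lambda>i. i + q) = UNIV" by (rule surjI[of _ "\<lambda>i. i - q"]) simp
    then show "?T [] = map_option ((`) (\<lambda>i. i + ?\<sigma> q [])) (?T [])" by simp
  next
    show "?T [] = None \<or> ?T [] = Some {} \<longrightarrow> ?\<sigma> q [] = 0" by simp
  next
    fix i
    show "subtree (?\<sigma> q) i \<in> tree_isos (subtree ?T i) (subtree ?T (i + ?\<sigma> q []))"
      by (simp add: tree_isos_zero)
  qed
  then have 1: "tree_group ?T \<cong> wreath_product
     (product_group {..<1} (\<lambda>r. tree_group (subtree ?T (int r)))) integer_group"
    by (intro tree_group_iso_wreath[where \<sigma> = ?\<sigma>]) simp_all
  have "product_group {..<1} (\<lambda>r. tree_group (subtree ?T (int r))) \<cong> represented_group R"
  proof -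
    have "product_group {..<1} (\<lambda>r. tree_group (subtree ?T (int r))) \<cong> tree_group (tree_of R)"
      using product_group_singleton_iso[of "0::nat" "\<lambda>r. tree_group (subtree ?T (int r))"]
      by (simp add: lessThan_Suc)
    then show ?thesis
      by (rule iso_trans) (rule group.iso_sym[OF group_represented_group Wreath_Rep])
  qed
  then have "wreath_product (product_group {..<1} (\<lambda>r. tree_group (subtree ?T (int r)))) integer_group
      \<cong> wreath_product (represented_group R) integer_group"
    by (rule wreath_product_cong_iso) (simp_all only: group_tree_group product_group group_integer_group)
  from iso_trans[OF iso_trans[OF 1 this] represented_group_Wreath_Rep_iso]
  show ?case by (rule group.iso_sym[OF group_tree_group])
qed

section \<open>Maps between strips\<close>

lemma mem_J_iff: "x \<in> J i \<longleftrightarrow> of_int i < x \<and> x < of_int i + 1/2"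
  by (auto simp: J_def)

lemma J_floor: "x \<in> J i \<Longrightarrow> \<lfloor>x\<rfloor> = i"
  by (auto simp: mem_J_iff floor_eq_iff)

lemma J_inj: "x \<in> J i \<Longrightarrow> x \<in> J j \<Longrightarrow> i = j"
  using J_floor by blast

lemma J_shift: "x + of_int k \<in> J (i + k) \<longleftrightarrow> x \<in> J i"
  by (auto simp: mem_J_iff)

lemma J_mid: "of_int i + 1/4 \<in> J i"
  by (auto simp: mem_J_iff)

lemma open_J: "open (J i)" and convex_J: "convex (J i)"
  by (auto simp: J_def)

definition model :: "int set \<Rightarrow> (real \<times> real) set" where
  "model \<Delta> = UNIV \<times> {-1<..<1} \<union> J 1 \<times> {-1} \<union> (\<Union>i\<in>\<Delta>. J i \<times> {1})"

lemma mem_model: "(x, t) \<in> model \<Delta> \<longleftrightarrow>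
    -1 < t \<and> t < 1 \<or> t = -1 \<and> x \<in> J 1 \<or> t = 1 \<and> (\<exists>i\<in>\<Delta>. x \<in> J i)"
  by (auto simp: model_def)

text \<open>The leaf of a model strip through \<open>z\<close>. Since \<open>J i\<close> lies
  between consecutive integers, the floor of the first coordinate names the interval on a boundary
  line. Outside a model the value has no meaning.\<close>

definition hleaf :: "real \<times> real \<Rightarrow> (real \<times> real) set" where
  "hleaf z = (if -1 < snd z \<and> snd z < 1 then UNIV else J \<lfloor>fst z\<rfloor>) \<times> {snd z}"

lemma mem_hleaf_self: "z \<in> model \<Delta> \<Longrightarrow> z \<in> hleaf z"
  by (cases z) (auto simp: hleaf_def mem_model J_floor)

lemma hleaf_subset: "z \<in> model \<Delta> \<Longrightarrow> hleaf z \<subseteq> model \<Delta>"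
  by (cases z) (auto simp: hleaf_def mem_model J_floor)

lemma hleaf_eq: "w \<in> hleaf z \<Longrightarrow> hleaf w = hleaf z"
  by (cases z; cases w) (auto simp: hleaf_def J_floor split: if_splits)

lemma mem_hleaf_iff:
  assumes "z \<in> model \<Delta>"
  shows "w \<in> hleaf z \<longleftrightarrow> w \<in> model \<Delta> \<and> snd w = snd z \<and> (snd z = 1 \<longrightarrow> \<lfloor>fst w\<rfloor> = \<lfloor>fst z\<rfloor>)"
  using assms by (cases z; cases w) (auto simp: hleaf_def mem_model J_floor)

lemma hleaf_cases:
  assumes "z \<in> model \<Delta>"
  obtains t where "hleaf z = UNIV \<times> {t}" "-1 < t" "t < 1"
  | "hleaf z = J 1 \<times> {-1}" "snd z = -1"
  | i where "i \<in> \<Delta>" "hleaf z = J i \<times> {1}" "snd z = 1" "fst z \<in> J i"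
  using assms by (cases z) (auto simp: hleaf_def mem_model J_floor)

lemma model_level: "z \<in> model \<Delta> \<Longrightarrow> -1 \<le> snd z \<and> snd z \<le> 1"
  by (cases z) (auto simp: mem_model)

lemma connected_hleaf: "connected (hleaf z)"
  unfolding hleaf_def by (intro connected_Times) (auto simp: convex_connected convex_J)

text \<open>Each member is open in the union, and so is the union of the other members; hence it is
  open and closed there and absorbs every connected set that meets it.\<close>

lemma components_eqI:
  assumes "\<And>C. C \<in> \<C> \<Longrightarrow> connected C" "\<And>C. C \<in> \<C> \<Longrightarrow> C \<noteq> {}"
    and op: "\<And>C. C \<in> \<C> \<Longrightarrow> openin (top_of_set (\<Union>\<C>)) C"
    and disj: "pairwise disjnt \<C>"
  shows "components (\<Union>\<C>) = \<C>"
proof -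
  have max: "d \<subseteq> C" if "C \<in> \<C>" "connected d" "d \<subseteq> \<Union>\<C>" "C \<inter> d \<noteq> {}" for C d
  proof -
    have "\<Union>\<C> - C = \<Union>(\<C> - {C})"
      using disj that(1) by (auto simp: pairwise_def disjnt_def)
    moreover have "openin (top_of_set (\<Union>\<C>)) (\<Union>(\<C> - {C}))"
      using op by (intro openin_Union) auto
    ultimately have "closedin (top_of_set (\<Union>\<C>)) C"
      using that(1) by (auto simp: closedin_def)
    moreover have "\<Union>\<C> \<inter> C = C" using that(1) by blast
    ultimately have "closedin (top_of_set d) (d \<inter> C)" "openin (top_of_set d) (d \<inter> C)"
      using closedin_subtopology_Int_subset[of euclidean "\<Union>\<C>" C d]
        openin_subtopology_Int_subset[of "\<Union>\<C>" C d] op[OF that(1)] that(3) by simp_all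
    then have "d \<inter> C = d"
      using that(2,4) by (auto simp: connected_clopen)
    then show ?thesis by blast
  qed
  have sub: "C \<in> components (\<Union>\<C>)" if "C \<in> \<C>" for C
    unfolding in_components_maximal using assms(1,2) that max
    by (metis Sup_upper inf.absorb_iff1 subset_antisym)
  moreover have "C \<in> \<C>" if C: "C \<in> components (\<Union>\<C>)" for C
  proof -
    obtain x where "x \<in> C" using in_components_nonempty[OF C] by blast
    moreover have "x \<in> \<Union>\<C>" using in_components_subset[OF C] \<open>x \<in> C\<close> by blast
    then obtain C' where "C' \<in> \<C>" "x \<in> C'" by blast
    ultimately have "C = C'"
      using components_nonoverlap[OF C sub[OF \<open>C' \<in> \<C>\<close>]] by blast
    then show ?thesis using \<open>C' \<in> \<C>\<close> by simp
  qed
  ultimately show ?thesis by blast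
qed

lemma lower_boundary_model: "lower_boundary (model \<Delta>) = J 1 \<times> {-1}"
  and upper_boundary_model: "upper_boundary (model \<Delta>) = (\<Union>i\<in>\<Delta>. J i \<times> {1})"
  by (auto simp: lower_boundary_def upper_boundary_def mem_model)

lemma boundary_pieces:
  fixes \<C> :: "(real \<times> real) set set"
  assumes "\<C> \<subseteq> insert (J 1 \<times> {-1}) (range (\<lambda>i. J i \<times> {1}))"
  shows "components (\<Union>\<C>) = \<C>"
proof (rule components_eqI)
  fix C assume "C \<in> \<C>"
  then have "C = J 1 \<times> {-1} \<or> (\<exists>i. C = J i \<times> {1})" using assms by auto
  then show "connected C"
    by (auto intro!: connected_Times simp: convex_connected convex_J)
  show "C \<noteq> {}" using J_mid \<open>C = J 1 \<times> {-1} \<or> (\<exists>i. C = J i \<times> {1})\<close> by auto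
  show "openin (top_of_set (\<Union>\<C>)) C"
  proof (cases "C = J 1 \<times> {-1}")
    case True
    have pC: "p \<in> C" if p: "p \<in> \<Union>\<C>" "snd p < 0" for p
    proof -
      obtain X where X: "X \<in> \<C>" "p \<in> X" using p by blast
      then have "X = J 1 \<times> {-1} \<or> (\<exists>i. X = J i \<times> {1})" using assms by auto
      then show ?thesis using X p True by auto
    qed
    have "C \<subseteq> (\<Union>\<C>) \<inter> (UNIV \<times> {..<0})"
      using \<open>C \<in> \<C>\<close> True by auto
    moreover have "(\<Union>\<C>) \<inter> (UNIV \<times> {..<0}) \<subseteq> C"
      by (rule subsetI, rule pC) auto
    ultimately have "C = (\<Union>\<C>) \<inter> (UNIV \<times> {..<0})" by (rule equalityI)
    moreover have "openin (top_of_set (\<Union>\<C>)) ((\<Union>\<C>) \<inter> (UNIV \<times> {..<0}))"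
      by (intro openin_open_Int open_Times) auto
    ultimately show ?thesis by simp
  next
    case False
    then obtain i where C: "C = J i \<times> {1}"
      using \<open>C = J 1 \<times> {-1} \<or> (\<exists>i. C = J i \<times> {1})\<close> by auto
    have pC: "p \<in> C" if p: "p \<in> \<Union>\<C>" "fst p \<in> J i" "snd p > 0" for p
    proof -
      obtain X where X: "X \<in> \<C>" "p \<in> X" using p by blast
      then have "X = J 1 \<times> {-1} \<or> (\<exists>i. X = J i \<times> {1})" using assms by auto
      then show ?thesis using X p C by (auto dest: J_inj)
    qed
    have "C \<subseteq> (\<Union>\<C>) \<inter> (J i \<times> {0<..})"
      using \<open>C \<in> \<C>\<close> C by auto
    moreover have "(\<Union>\<C>) \<inter> (J i \<times> {0<..}) \<subseteq> C"
      by (rule subsetI, rule pC) auto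
    ultimately have "C = (\<Union>\<C>) \<inter> (J i \<times> {0<..})" by (rule equalityI)
    moreover have "openin (top_of_set (\<Union>\<C>)) ((\<Union>\<C>) \<inter> (J i \<times> {0<..}))"
      by (intro openin_open_Int open_Times) (auto simp: open_J)
    ultimately show ?thesis by simp
  qed
next
  have "pairwise disjnt (insert (J 1 \<times> {-1 :: real}) (range (\<lambda>i. J i \<times> {1})))"
    by (auto simp: pairwise_def disjnt_def dest: J_inj)
  then show "pairwise disjnt \<C>" by (rule pairwise_subset[OF _ assms])
qed

lemma components_lower: "components (J 1 \<times> {-1}) = {J 1 \<times> {-1 :: real}}"
  using boundary_pieces[of "{J 1 \<times> {-1}}"] by simp

lemma components_upper: "components (\<Union>i\<in>\<Delta>. J i \<times> {1 :: real}) = (\<lambda>i. J i \<times> {1}) ` \<Delta>"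
  by (rule boundary_pieces) auto

lemma components_strip_boundary:
  "components (strip_boundary (model \<Delta>)) = insert (J 1 \<times> {-1}) ((\<lambda>i. J i \<times> {1}) ` \<Delta>)"
proof -
  have "strip_boundary (model \<Delta>) = \<Union>(insert (J 1 \<times> {-1}) ((\<lambda>i. J i \<times> {1}) ` \<Delta>))"
    by (simp add: strip_boundary_def lower_boundary_model upper_boundary_model)
  then show ?thesis by (simp only:) (rule boundary_pieces, auto)
qed

lemma strip_leaves_model: "strip_leaves (model \<Delta>) = hleaf ` model \<Delta>"
proof
  have "UNIV \<times> {t} \<in> hleaf ` model \<Delta>" if "-1 < t" "t < 1" for t
    using that by (intro image_eqI[of _ _ "(0, t)"]) (auto simp: hleaf_def mem_model)
  moreover have "J 1 \<times> {-1} \<in> hleaf ` model \<Delta>"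
    using J_mid[of 1] by (intro image_eqI[of _ _ "(1 + 1/4, -1)"]) (auto simp: hleaf_def mem_model J_floor)
  moreover have "J i \<times> {1} \<in> hleaf ` model \<Delta>" if "i \<in> \<Delta>" for i
    using J_mid[of i] that J_floor[OF J_mid[of i]]
    by (intro image_eqI[of _ _ "(of_int i + 1/4, 1)"]) (auto simp: hleaf_def mem_model)
  ultimately show "strip_leaves (model \<Delta>) \<subseteq> hleaf ` model \<Delta>"
    by (auto simp: strip_leaves_def components_strip_boundary)
next
  show "hleaf ` model \<Delta> \<subseteq> strip_leaves (model \<Delta>)"
  proof clarify
    fix x t assume "(x, t) \<in> model \<Delta>"
    then show "hleaf (x, t) \<in> strip_leaves (model \<Delta>)"
      by (rule hleaf_cases) (auto simp: strip_leaves_def components_strip_boundary)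
  qed
qed

text \<open>
  Leaf preserving maps without reversal are exactly the continuous bijections that are strictly
  increasing for the lexicographic order which compares the second coordinates first.
\<close>

definition strip_map :: "int set \<Rightarrow> int set \<Rightarrow> (real \<times> real \<Rightarrow> real \<times> real) \<Rightarrow> bool" where
  "strip_map \<Delta> \<Delta>' F \<longleftrightarrow> continuous_on (model \<Delta>) F \<and> bij_betw F (model \<Delta>) (model \<Delta>') \<and>
     (\<forall>z\<in>model \<Delta>. \<forall>w\<in>model \<Delta>. snd z < snd w \<longrightarrow> snd (F z) < snd (F w)) \<and>
     (\<forall>z\<in>model \<Delta>. \<forall>w\<in>model \<Delta>. snd z = snd w \<longrightarrow> fst z < fst w \<longrightarrow>
        snd (F z) = snd (F w) \<and> fst (F z) < fst (F w))"

lemma interior_model: "-1 < t \<Longrightarrow> t < 1 \<Longrightarrow> (x, t) \<in> model \<Delta>"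
  by (simp add: mem_model)

context
  fixes \<Delta> \<Delta>' F assumes F: "strip_map \<Delta> \<Delta>' F"
begin

lemma strip_map_continuous: "continuous_on (model \<Delta>) F"
  and strip_map_bij: "bij_betw F (model \<Delta>) (model \<Delta>')"
  and strip_map_level_less: "z \<in> model \<Delta> \<Longrightarrow> w \<in> model \<Delta> \<Longrightarrow> snd z < snd w \<Longrightarrow> snd (F z) < snd (F w)"
  and strip_map_less: "z \<in> model \<Delta> \<Longrightarrow> w \<in> model \<Delta> \<Longrightarrow> snd z = snd w \<Longrightarrow> fst z < fst w \<Longrightarrow> fst (F z) < fst (F w)"
  using F by (auto simp: strip_map_def)

lemma strip_map_in: "z \<in> model \<Delta> \<Longrightarrow> F z \<in> model \<Delta>'"
  using strip_map_bij by (auto simp: bij_betw_def)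

lemma strip_map_level_eq:
  "z \<in> model \<Delta> \<Longrightarrow> w \<in> model \<Delta> \<Longrightarrow> snd z = snd w \<Longrightarrow> snd (F z) = snd (F w)"
  using F unfolding strip_map_def by (metis linorder_neqE prod_eq_iff)

lemma strip_map_level_iff:
  assumes "z \<in> model \<Delta>" "w \<in> model \<Delta>"
  shows "snd (F z) < snd (F w) \<longleftrightarrow> snd z < snd w" "snd (F z) = snd (F w) \<longleftrightarrow> snd z = snd w"
    and "snd (F z) \<le> snd (F w) \<longleftrightarrow> snd z \<le> snd w"
  using strip_map_level_less[OF assms] strip_map_level_less[OF assms(2,1)] strip_map_level_eq[OF assms]
  by (metis less_asym less_irrefl linorder_neqE not_le)+

lemma strip_map_less_iff:
  assumes "z \<in> model \<Delta>" "w \<in> model \<Delta>" "snd z = snd w"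
  shows "fst (F z) < fst (F w) \<longleftrightarrow> fst z < fst w"
  using strip_map_less[OF assms] strip_map_less[OF assms(2,1)] assms(3)
  by (metis less_asym less_irrefl linorder_neqE prod_eq_iff)

text \<open>Every model has points at level -1, so the lower line is the set of points of least
  level, which the order alone recognizes.\<close>

lemma strip_map_bottom_iff:
  assumes "z \<in> model \<Delta>" shows "snd (F z) = -1 \<longleftrightarrow> snd z = -1"
proof -
  have bot: "snd z = -1 \<longleftrightarrow> (\<forall>w\<in>model \<Delta>. snd z \<le> snd w)" if "z \<in> model \<Delta>" for z \<Delta>
  proof
    assume "\<forall>w\<in>model \<Delta>. snd z \<le> snd w"
    moreover have "(1 + 1/4, -1) \<in> model \<Delta>" using J_mid[of 1] by (simp add: mem_model)
    ultimately show "snd z = -1" using model_level[OF that] by fastforce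
  qed (use model_level in auto)
  show ?thesis
    using bot[OF assms] bot[OF strip_map_in[OF assms]] strip_map_level_iff(3)[OF assms]
      strip_map_bij unfolding bij_betw_def by (metis image_iff strip_map_in)
qed

text \<open>A point at a level below 1 always has an interior point above it. The upper line is
  therefore the set of points of greatest level, also when it is empty and there is no greatest
  level.\<close>

lemma strip_map_top_iff:
  assumes "z \<in> model \<Delta>" shows "snd (F z) = 1 \<longleftrightarrow> snd z = 1"
proof -
  have top: "snd z = 1 \<longleftrightarrow> (\<forall>w\<in>model \<Delta>. snd w \<le> snd z)" if "z \<in> model \<Delta>" for z \<Delta>
  proof
    assume *: "\<forall>w\<in>model \<Delta>. snd w \<le> snd z"
    show "snd z = 1"
    proof (rule ccontr)
      assume "snd z \<noteq> 1"
      then have "(0, (snd z + 1) / 2) \<in> model \<Delta>" "snd z < (snd z + 1) / 2"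
        using model_level[OF that] by (auto intro!: interior_model)
      then show False using * by fastforce
    qed
  qed (use model_level in auto)
  show ?thesis
    using top[OF assms] top[OF strip_map_in[OF assms]] strip_map_level_iff(3)[OF _ assms]
      strip_map_bij unfolding bij_betw_def by (metis image_iff strip_map_in)
qed

text \<open>Monotonicity takes the place of invariance of domain. The level of the preimage is
  squeezed by comparison points on the vertical line over 0; afterwards its first coordinate is
  squeezed by comparison points on its own level.\<close>

lemma strip_map_inverse_continuous:
  "continuous_on (model \<Delta>') (inv_into (model \<Delta>) F)"
  unfolding continuous_on_def
proof
  fix w assume w: "w \<in> model \<Delta>'"
  let ?G = "inv_into (model \<Delta>) F"
  let ?F = "at w within model \<Delta>'"
  have G: "?G v \<in> model \<Delta>" "F (?G v) = v" if "v \<in> model \<Delta>'" for v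
    using that strip_map_bij by (auto simp: bij_betw_def inv_into_into f_inv_into_f)
  obtain x t where xt: "?G w = (x, t)" by force
  have xt_in: "(x, t) \<in> model \<Delta>" using G(1)[OF w] xt by simp
  have ev: "eventually (\<lambda>v. v \<in> model \<Delta>') ?F" by (simp add: eventually_at_filter)
  have snd_lim: "((\<lambda>v. snd (?G v)) \<longlongrightarrow> t) ?F"
  proof (rule order_tendstoI)
    fix a assume a: "a < t"
    show "eventually (\<lambda>v. a < snd (?G v)) ?F"
    proof (cases "a < -1")
      case True
      then show ?thesis by (intro eventually_mono[OF ev]) (use G(1) model_level in fastforce)
    next
      case False
      obtain s where s: "a < s" "s < t" using a dense by blast
      have s_in: "(0, s) \<in> model \<Delta>" using s False model_level[OF xt_in] by (intro interior_model) auto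
      have "snd (F (0, s)) < snd w"
        using strip_map_level_less[OF s_in xt_in] s G(2)[OF w] xt by simp
      then have "eventually (\<lambda>v. snd (F (0, s)) < snd v) ?F"
        by (intro order_tendstoD(1)[OF tendsto_snd[OF tendsto_ident_at]])
      with ev show ?thesis
      proof eventually_elim
        case (elim v)
        then have "s < snd (?G v)"
          using strip_map_level_iff(1)[OF s_in G(1)[OF elim(1)]] G(2)[OF elim(1)] by simp
        then show ?case using s by simp
      qed
    qed
  next
    fix a assume a: "t < a"
    show "eventually (\<lambda>v. snd (?G v) < a) ?F"
    proof (cases "1 < a")
      case True
      then show ?thesis by (intro eventually_mono[OF ev]) (use G(1) model_level in fastforce)
    next
      case False
      obtain s where s: "t < s" "s < a" using a dense by blast
      have s_in: "(0, s) \<in> model \<Delta>" using s False model_level[OF xt_in] by (intro interior_model) auto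
      have "snd w < snd (F (0, s))"
        using strip_map_level_less[OF xt_in s_in] s G(2)[OF w] xt by simp
      then have "eventually (\<lambda>v. snd v < snd (F (0, s))) ?F"
        by (intro order_tendstoD(2)[OF tendsto_snd[OF tendsto_ident_at]])
      with ev show ?thesis
      proof eventually_elim
        case (elim v)
        then have "snd (?G v) < s"
          using strip_map_level_iff(1)[OF G(1)[OF elim(1)] s_in] G(2)[OF elim(1)] by simp
        then show ?case using s by simp
      qed
    qed
  qed
  \<comment> \<open>First coordinates can be compared only on a common level, so the comparison
    point over \<open>y\<close> has to follow the level of \<open>?G v\<close>.\<close>
  have F_lim: "((\<lambda>v. F (y, snd (?G v))) \<longlongrightarrow> F (y, t)) ?F"
    and F_in: "eventually (\<lambda>v. (y, snd (?G v)) \<in> model \<Delta>) ?F" if y: "(y, t) \<in> model \<Delta>" for y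
  proof -
    \<comment> \<open>The radius keeps interior levels interior; at a boundary level, radius 1 shuts
      out the opposite boundary line.\<close>
    have "(if t = 1 \<or> t = -1 then 1 else min (1 - t) (t + 1)) > 0"
      using model_level[OF xt_in] by auto
    then have "eventually (\<lambda>v. dist (snd (?G v)) t < (if t = 1 \<or> t = -1 then 1 else min (1 - t) (t + 1))) ?F"
      by (rule tendstoD[OF snd_lim])
    with ev show *: "eventually (\<lambda>v. (y, snd (?G v)) \<in> model \<Delta>) ?F"
    proof eventually_elim
      case (elim v)
      have "-1 \<le> snd (?G v)" "snd (?G v) \<le> 1" using model_level[OF G(1)[OF elim(1)]] by auto
      then show ?case
        using elim(2) y model_level[OF y]
        by (auto simp: mem_model dist_real_def abs_less_iff split: if_splits)
    qed
    have "((\<lambda>v. (y, snd (?G v))) \<longlongrightarrow> (y, t)) ?F"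
      by (intro tendsto_intros snd_lim)
    then show "((\<lambda>v. F (y, snd (?G v))) \<longlongrightarrow> F (y, t)) ?F"
      using continuous_on_tendsto_compose[OF strip_map_continuous _ y *] by simp
  qed
  have near: "\<exists>y. (y, t) \<in> model \<Delta> \<and> a < y \<and> y < x" if "a < x" for a
  proof (cases "-1 < t \<and> t < 1")
    case True
    then show ?thesis using dense[OF that] interior_model by blast
  next
    case False
    then obtain i where "x \<in> J i" "\<And>y. y \<in> J i \<Longrightarrow> (y, t) \<in> model \<Delta>"
      using xt_in by (auto simp: mem_model)
    moreover have "max a (of_int i) < x" using that \<open>x \<in> J i\<close> by (simp add: mem_J_iff)
    then obtain y where "max a (of_int i) < y" "y < x" using dense by blast
    ultimately have "(y, t) \<in> model \<Delta> \<and> a < y \<and> y < x" by (simp add: mem_J_iff)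
    then show ?thesis by blast
  qed
  have near': "\<exists>y. (y, t) \<in> model \<Delta> \<and> x < y \<and> y < a" if "x < a" for a
  proof (cases "-1 < t \<and> t < 1")
    case True
    then show ?thesis using dense[OF that] interior_model by blast
  next
    case False
    then obtain i where "x \<in> J i" "\<And>y. y \<in> J i \<Longrightarrow> (y, t) \<in> model \<Delta>"
      using xt_in by (auto simp: mem_model)
    moreover have "x < min a (of_int i + 1/2)" using that \<open>x \<in> J i\<close> by (simp add: mem_J_iff)
    then obtain y where "x < y" "y < min a (of_int i + 1/2)" using dense by blast
    ultimately have "(y, t) \<in> model \<Delta> \<and> x < y \<and> y < a" by (simp add: mem_J_iff)
    then show ?thesis by blast
  qed
  have fst_lim: "((\<lambda>v. fst (?G v)) \<longlongrightarrow> x) ?F"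
  proof (rule order_tendstoI)
    fix a assume "a < x"
    then obtain y where y: "(y, t) \<in> model \<Delta>" "a < y" "y < x" using near by blast
    have "fst (F (y, t)) < fst w"
      using strip_map_less[OF y(1) xt_in] y G(2)[OF w] xt by simp
    \<comment> \<open>A value strictly in between separates two simultaneous limits:
      \<open>fst v\<close> stays above it and the image of the comparison point below it.\<close>
    then obtain m where m: "fst (F (y, t)) < m" "m < fst w" using dense by blast
    have "eventually (\<lambda>v. m < fst v) ?F"
      using m by (intro order_tendstoD(1)[OF tendsto_fst[OF tendsto_ident_at]])
    moreover have "eventually (\<lambda>v. fst (F (y, snd (?G v))) < m) ?F"
      using m by (intro order_tendstoD(2)[OF tendsto_fst[OF F_lim[OF y(1)]]])
    ultimately show "eventually (\<lambda>v. a < fst (?G v)) ?F"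
      using ev F_in[OF y(1)]
    proof eventually_elim
      case (elim v)
      then have "fst (F (y, snd (?G v))) < fst (F (?G v))" using G(2)[of v] by simp
      then have "y < fst (?G v)"
        using strip_map_less_iff[OF elim(4) G(1)[OF elim(3)]] by simp
      then show ?case using y by simp
    qed
  next
    fix a assume "x < a"
    then obtain y where y: "(y, t) \<in> model \<Delta>" "x < y" "y < a" using near' by blast
    have "fst w < fst (F (y, t))"
      using strip_map_less[OF xt_in y(1)] y G(2)[OF w] xt by simp
    then obtain m where m: "fst w < m" "m < fst (F (y, t))" using dense by blast
    have "eventually (\<lambda>v. fst v < m) ?F"
      using m by (intro order_tendstoD(2)[OF tendsto_fst[OF tendsto_ident_at]])
    moreover have "eventually (\<lambda>v. m < fst (F (y, snd (?G v)))) ?F"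
      using m by (intro order_tendstoD(1)[OF tendsto_fst[OF F_lim[OF y(1)]]])
    ultimately show "eventually (\<lambda>v. fst (?G v) < a) ?F"
      using ev F_in[OF y(1)]
    proof eventually_elim
      case (elim v)
      then have "fst (F (?G v)) < fst (F (y, snd (?G v)))" using G(2)[of v] by simp
      then have "fst (?G v) < y"
        using strip_map_less_iff[OF G(1)[OF elim(3)] elim(4)] by simp
      then show ?case using y by simp
    qed
  qed
  have "((\<lambda>v. (fst (?G v), snd (?G v))) \<longlongrightarrow> (x, t)) ?F"
    by (intro tendsto_Pair fst_lim snd_lim)
  then show "(?G \<longlongrightarrow> ?G w) ?F" by (simp add: xt)
qed

lemma strip_map_inverse: "strip_map \<Delta>' \<Delta> (inv_into (model \<Delta>) F)"
proof -
  let ?G = "inv_into (model \<Delta>) F"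
  have G: "?G v \<in> model \<Delta>" "F (?G v) = v" if "v \<in> model \<Delta>'" for v
    using that strip_map_bij by (auto simp: bij_betw_def inv_into_into f_inv_into_f)
  show ?thesis
    unfolding strip_map_def
  proof (intro conjI ballI impI)
    show "continuous_on (model \<Delta>') ?G" by (rule strip_map_inverse_continuous)
    show "bij_betw ?G (model \<Delta>') (model \<Delta>)" by (rule bij_betw_inv_into[OF strip_map_bij])
    fix z w assume zw: "z \<in> model \<Delta>'" "w \<in> model \<Delta>'"
    show "snd (?G z) < snd (?G w)" if "snd z < snd w"
      using that strip_map_level_iff(1)[OF G(1)[OF zw(1)] G(1)[OF zw(2)]] G(2) zw by simp
    assume eq: "snd z = snd w" and less: "fst z < fst w"
    show level: "snd (?G z) = snd (?G w)"
      using eq strip_map_level_iff(2)[OF G(1)[OF zw(1)] G(1)[OF zw(2)]] G(2) zw by simp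
    show "fst (?G z) < fst (?G w)"
      using less strip_map_less_iff[OF G(1)[OF zw(1)] G(1)[OF zw(2)] level] G(2) zw by simp
  qed
qed

end

text \<open>Only upper intervals are at issue, since elsewhere the level determines the leaf. The
  image of a leaf is connected and cannot jump the gap between two intervals.\<close>

lemma strip_map_hleaf_subset:
  assumes F: "strip_map \<Delta> \<Delta>' F" and z: "z \<in> model \<Delta>"
  shows "F ` hleaf z \<subseteq> hleaf (F z)"
proof
  fix w' assume "w' \<in> F ` hleaf z"
  then obtain w where w: "w \<in> hleaf z" "w' = F w" by blast
  have w_in: "w \<in> model \<Delta>" "snd w = snd z" using w(1) z by (auto simp: mem_hleaf_iff)
  have "\<lfloor>fst (F w)\<rfloor> = \<lfloor>fst (F z)\<rfloor>" if "snd (F z) = 1"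
  proof (rule ccontr)
    assume ne: "\<lfloor>fst (F w)\<rfloor> \<noteq> \<lfloor>fst (F z)\<rfloor>"
    have top: "snd v = 1" if "v \<in> hleaf z" for v
      using that strip_map_top_iff[OF F z] \<open>snd (F z) = 1\<close> z by (auto simp: mem_hleaf_iff)
    have sub: "hleaf z \<subseteq> model \<Delta>" by (rule hleaf_subset[OF z])
    have conn: "connected ((fst \<circ> F) ` hleaf z)"
      using continuous_on_subset[OF strip_map_continuous[OF F] sub]
      by (intro connected_continuous_image connected_hleaf continuous_on_compose continuous_intros) auto
    have J: "\<exists>i. fst (F v) \<in> J i" if "v \<in> hleaf z" for v
    proof -
      have "snd (F v) = 1" using strip_map_top_iff[OF F] top[OF that] sub that by blast
      then show ?thesis using strip_map_in[OF F subsetD[OF sub that]]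
        by (cases "F v") (auto simp: mem_model)
    qed
    have "z \<in> hleaf z" by (rule mem_hleaf_self[OF z])
    obtain i j where i: "fst (F w) \<in> J i" and j: "fst (F z) \<in> J j"
      using J w(1) \<open>z \<in> hleaf z\<close> by blast
    have "i \<noteq> j" using ne J_floor[OF i] J_floor[OF j] by simp
    \<comment> \<open>The right end of the left one of the two intervals lies in the connected
      image, but in no interval \<open>J l\<close>.\<close>
    have "\<exists>x k. x \<in> (fst \<circ> F) ` hleaf z \<and> x = of_int k + 1/2"
    proof (cases "i < j")
      case True
      then have "of_int i + 1 \<le> (of_int j :: real)" by linarith
      then have "of_int i + 1/2 \<in> (fst \<circ> F) ` hleaf z"
        using connectedD_interval[OF conn, of "fst (F w)" "fst (F z)" "of_int i + 1/2"]
          i j w(1) \<open>z \<in> hleaf z\<close> by (auto simp: mem_J_iff)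
      then show ?thesis by blast
    next
      case False
      then have "of_int j + 1 \<le> (of_int i :: real)" using \<open>i \<noteq> j\<close> by linarith
      then have "of_int j + 1/2 \<in> (fst \<circ> F) ` hleaf z"
        using connectedD_interval[OF conn, of "fst (F z)" "fst (F w)" "of_int j + 1/2"]
          i j w(1) \<open>z \<in> hleaf z\<close> by (auto simp: mem_J_iff)
      then show ?thesis by blast
    qed
    then obtain k v where v: "v \<in> hleaf z" "fst (F v) = of_int k + 1/2" by auto
    then obtain l where "fst (F v) \<in> J l" using J by blast
    then have "of_int l < of_int k + (1/2::real)" "of_int k + 1/2 < of_int l + (1/2::real)"
      using v(2) by (auto simp: mem_J_iff)
    then have "(of_int l :: real) < of_int (k + 1)" "(of_int k :: real) < of_int l" by simp_all
    then show False by (simp only: of_int_less_iff)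
  qed
  then show "w' \<in> hleaf (F z)"
    unfolding w(2) mem_hleaf_iff[OF strip_map_in[OF F z]]
    using strip_map_in[OF F w_in(1)] strip_map_level_eq[OF F w_in(1) z w_in(2)] by simp
qed

lemma strip_map_hleaf:
  assumes F: "strip_map \<Delta> \<Delta>' F" and z: "z \<in> model \<Delta>"
  shows "F ` hleaf z = hleaf (F z)"
proof
  show "hleaf (F z) \<subseteq> F ` hleaf z"
  proof
    fix w assume w: "w \<in> hleaf (F z)"
    let ?G = "inv_into (model \<Delta>) F"
    have w': "w \<in> model \<Delta>'" using hleaf_subset[OF strip_map_in[OF F z]] w by blast
    have "?G w \<in> hleaf (?G (F z))"
      using strip_map_hleaf_subset[OF strip_map_inverse[OF F] strip_map_in[OF F z]] w by blast
    moreover have "?G (F z) = z" "F (?G w) = w"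
      using strip_map_bij[OF F] z w' by (auto simp: bij_betw_def inv_into_f_f f_inv_into_f)
    ultimately show "w \<in> F ` hleaf z" by (metis image_eqI)
  qed
qed (rule strip_map_hleaf_subset[OF F z])

section \<open>Shears and straight-line homotopies\<close>

text \<open>The identity on the lower line and the translation by \<open>k\<close> on the upper one,
  with linear interpolation between them. As nothing moves at the bottom, shears of adjacent strips
  fit along a seam whatever their amounts.\<close>

definition shear :: "int \<Rightarrow> real \<times> real \<Rightarrow> real \<times> real" where
  "shear k z = (fst z + of_int k * (snd z + 1) / 2, snd z)"

lemma shear_in: "z \<in> model \<Delta> \<Longrightarrow> shear k z \<in> model ((\<lambda>i. i + k) ` \<Delta>)"
  by (cases z) (auto simp: shear_def mem_model J_shift)

lemma strip_map_shear: "strip_map \<Delta> ((\<lambda>i. i + k) ` \<Delta>) (shear k)"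
proof -
  have "bij_betw (shear k) (model \<Delta>) (model ((\<lambda>i. i + k) ` \<Delta>))"
  proof (rule bij_betw_byWitness[where f' = "shear (- k)"])
    show "shear (- k) ` model ((\<lambda>i. i + k) ` \<Delta>) \<subseteq> model \<Delta>"
    proof
      fix w assume "w \<in> shear (- k) ` model ((\<lambda>i. i + k) ` \<Delta>)"
      then obtain z where "w = shear (- k) z" "z \<in> model ((\<lambda>i. i + k) ` \<Delta>)" by blast
      then show "w \<in> model \<Delta>" using shear_in[of z "(\<lambda>i. i + k) ` \<Delta>" "- k"] by (simp add: image_image)
    qed
    show "shear k ` model \<Delta> \<subseteq> model ((\<lambda>i. i + k) ` \<Delta>)"
      by (intro image_subsetI shear_in)
  next
    have "shear (- k) (shear k z) = z" "shear k (shear (- k) z) = z" for z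
      by (cases z; simp add: shear_def)+
    then show "\<forall>z\<in>model \<Delta>. shear (- k) (shear k z) = z"
      "\<forall>z\<in>model ((\<lambda>i. i + k) ` \<Delta>). shear k (shear (- k) z) = z" by simp_all
  qed
  moreover have "continuous_on (model \<Delta>) (shear k)"
    unfolding shear_def by (intro continuous_intros) simp
  ultimately show ?thesis by (auto simp: strip_map_def shear_def)
qed

text \<open>At the smaller of \<open>x\<close> and \<open>f x\<close> the combination is at most
  \<open>f x\<close>, at the larger one it is at least \<open>f x\<close>, so the intermediate value
  theorem applies. This is the source of surjectivity for the straight-line homotopies.\<close>

lemma convex_combination_surj:
  fixes f :: "real \<Rightarrow> real"
  assumes I: "is_interval I" and f: "continuous_on I f" "mono_on I f"
    and x: "x \<in> I" and y: "f x \<in> I" and s: "0 \<le> s" "s \<le> 1"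
  shows "\<exists>u\<in>I. (1 - s) * u + s * f u = f x"
proof -
  let ?g = "\<lambda>u. (1 - s) * u + s * f u"
  let ?a = "min x (f x)" and ?b = "max x (f x)"
  have mem: "?a \<in> I" "?b \<in> I" using x y by (simp_all add: min_def max_def)
  have sub: "{?a..?b} \<subseteq> I"
    using mem_is_interval_1_I[OF I mem] by (meson atLeastAtMost_iff subsetI)
  have conv: "(1 - s) * u + s * v \<le> c" if "u \<le> c" "v \<le> c" for u v c :: real
    using convex_bound_le[OF that, of "1 - s" s] s by simp
  have conv': "c \<le> (1 - s) * u + s * v" if "c \<le> u" "c \<le> v" for u v c :: real
  proof -
    have "(1 - s) * c + s * c \<le> (1 - s) * u + s * v"
      using that s by (intro add_mono mult_left_mono) auto
    then show ?thesis by (simp add: left_diff_distrib)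
  qed
  have "?g ?a \<le> f x"
    by (rule conv) (use mono_onD[OF f(2) mem(1) x] in auto)
  moreover have "f x \<le> ?g ?b"
    by (rule conv') (use mono_onD[OF f(2) x mem(2)] in auto)
  moreover have "continuous_on {?a..?b} ?g"
    by (intro continuous_intros continuous_on_subset[OF f(1) sub])
  ultimately obtain u where "?a \<le> u" "u \<le> ?b" "?g u = f x"
    using IVT'[of ?g ?a "f x" ?b] by (meson min.cobounded1 max.cobounded1 order_trans)
  then show ?thesis using sub by (meson atLeastAtMost_iff subsetD)
qed

text \<open>The straight line from the identity, at \<open>s = 0\<close>, to \<open>F\<close>, at
  \<open>s = 1\<close>.\<close>

definition blend :: "real \<Rightarrow> (real \<times> real \<Rightarrow> real \<times> real) \<Rightarrow> real \<times> real \<Rightarrow> real \<times> real" where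
  "blend s F z = (1 - s) *\<^sub>R z + s *\<^sub>R F z"

text \<open>Strict inequalities survive convex combinations, which yields the order conditions and
  injectivity. Surjectivity is obtained first for the levels and then along a leaf. By
  \<open>top\<close> an upper point and its image share an interval, so the segment between them
  stays in the strip.\<close>

lemma strip_map_blend:
  assumes F: "strip_map \<Delta> \<Delta> F" and s: "0 \<le> s" "s \<le> 1"
    and top: "\<And>z. z \<in> model \<Delta> \<Longrightarrow> snd z = 1 \<Longrightarrow> \<lfloor>fst (F z)\<rfloor> = \<lfloor>fst z\<rfloor>"
  shows "strip_map \<Delta> \<Delta> (blend s F)"
proof -
  have strict: "(1 - s) * u + s * v < (1 - s) * u' + s * v'" if "u < u'" "v < v'" for u v u' v' :: real
  proof (cases "s = 0")
    case False
    then show ?thesis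
      using that s by (intro add_le_less_mono mult_left_mono mult_strict_left_mono) auto
  qed (use that in simp)
  have into: "blend s F z \<in> model \<Delta>" if z: "z \<in> model \<Delta>" for z
  proof -
    have conv: "(1 - s) * u + s * v \<in> C" if "convex C" "u \<in> C" "v \<in> C" for u v :: real and C
      using that s by (auto dest!: convexD[of C u v "1 - s" s])
    consider "-1 < snd z" "snd z < 1" | "snd z = -1" | "snd z = 1"
      using model_level[OF z] by fastforce
    then show ?thesis
    proof cases
      case 1
      have "snd (F z) \<noteq> -1" "snd (F z) \<noteq> 1"
        using strip_map_top_iff[OF F z] strip_map_bottom_iff[OF F z] 1 by auto
      then have "snd (F z) \<in> {-1<..<1}"
        using model_level[OF strip_map_in[OF F z]] by auto
      then have "snd (blend s F z) \<in> {-1<..<1}"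
        using conv[of "{-1<..<1}" "snd z" "snd (F z)"] 1 by (simp add: blend_def)
      then show ?thesis by (cases "blend s F z") (auto simp: mem_model)
    next
      case 2
      have "snd (F z) = -1" using strip_map_bottom_iff[OF F z] 2 by simp
      then have "fst z \<in> J 1" "fst (F z) \<in> J 1"
        using 2 z strip_map_in[OF F z] by (cases z; cases "F z"; auto simp: mem_model)+
      then have "fst (blend s F z) \<in> J 1"
        using conv[OF convex_J] by (simp add: blend_def)
      moreover have "snd (blend s F z) = -1"
        using 2 \<open>snd (F z) = -1\<close> by (simp add: blend_def)
      ultimately show ?thesis by (cases "blend s F z") (auto simp: mem_model)
    next
      case 3
      have "snd (F z) = 1" using strip_map_top_iff[OF F z] 3 by simp
      then obtain i j where "i \<in> \<Delta>" "fst z \<in> J i" "fst (F z) \<in> J j"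
        using 3 z strip_map_in[OF F z] by (cases z; cases "F z"; auto simp: mem_model)
      moreover have "i = j" using top[OF z 3] J_floor calculation by metis
      ultimately have "fst (blend s F z) \<in> J i"
        using conv[OF convex_J] by (simp add: blend_def)
      moreover have "snd (blend s F z) = 1"
        using 3 \<open>snd (F z) = 1\<close> by (simp add: blend_def)
      ultimately show ?thesis using \<open>i \<in> \<Delta>\<close> by (cases "blend s F z") (auto simp: mem_model)
    qed
  qed
  have level_less: "snd (blend s F z) < snd (blend s F w)"
    if "z \<in> model \<Delta>" "w \<in> model \<Delta>" "snd z < snd w" for z w
    unfolding blend_def using strict[OF that(3) strip_map_level_less[OF F that]] by simp
  have less: "snd (blend s F z) = snd (blend s F w) \<and> fst (blend s F z) < fst (blend s F w)"
    if "z \<in> model \<Delta>" "w \<in> model \<Delta>" "snd z = snd w" "fst z < fst w" for z w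
    unfolding blend_def using strict[OF that(4) strip_map_less[OF F that]]
      strip_map_level_eq[OF F that(1-3)] that(3) by simp
  have "inj_on (blend s F) (model \<Delta>)"
  proof (rule inj_onI)
    fix z w assume zw: "z \<in> model \<Delta>" "w \<in> model \<Delta>" "blend s F z = blend s F w"
    then have "snd z = snd w" using level_less by (metis less_irrefl linorder_neqE)
    moreover have "fst z = fst w" using zw less calculation by (metis less_irrefl linorder_neqE)
    ultimately show "z = w" by (simp add: prod_eq_iff)
  qed
  moreover have "model \<Delta> \<subseteq> blend s F ` model \<Delta>"
  proof
    fix w assume w: "w \<in> model \<Delta>"
    let ?G = "inv_into (model \<Delta>) F"
    have G: "?G v \<in> model \<Delta>" "F (?G v) = v" if "v \<in> model \<Delta>" for v
      using that strip_map_bij[OF F] by (auto simp: bij_betw_def inv_into_into f_inv_into_f)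
    \<comment> \<open>The level comes first. The boundary lines are kept by \<open>F\<close>, so
      there the target itself serves; inside, the levels along the vertical line over 0 are
      blended.\<close>
    have "\<exists>z\<in>model \<Delta>. snd (blend s F z) = snd w \<and> (snd w = 1 \<longrightarrow> \<lfloor>fst z\<rfloor> = \<lfloor>fst w\<rfloor>)"
    proof (cases "-1 < snd w \<and> snd w < 1")
      case False
      then have "snd w = -1 \<or> snd w = 1" using model_level[OF w] by fastforce
      then have "snd (blend s F w) = snd w"
        using strip_map_top_iff[OF F w] strip_map_bottom_iff[OF F w] by (auto simp: blend_def)
      then show ?thesis using w by blast
    next
      case True
      let ?b = "\<lambda>t. snd (F (0, t))"
      have w0: "(0, snd w) \<in> model \<Delta>" using True by (simp add: mem_model)
      obtain x t where xt: "?G (0, snd w) = (x, t)" by force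
      have xt': "(x, t) \<in> model \<Delta>" "F (x, t) = (0, snd w)" using G[OF w0] xt by auto
      then have t: "-1 < t" "t < 1"
        using strip_map_top_iff[OF F xt'(1)] strip_map_bottom_iff[OF F xt'(1)] model_level[OF xt'(1)] True
        by auto
      have bt: "?b t = snd w"
        using strip_map_level_eq[OF F xt'(1) interior_model[OF t, of 0]] xt'(2) by simp
      have "\<exists>u\<in>{-1<..<1}. (1 - s) * u + s * ?b u = ?b t"
      proof (rule convex_combination_surj)
        show "continuous_on {-1<..<1} ?b"
          by (intro continuous_intros continuous_on_compose2[OF strip_map_continuous[OF F]])
            (auto intro: interior_model)
        show "mono_on {-1<..<1} ?b"
          by (intro mono_onI) (use strip_map_level_iff(3)[OF F interior_model interior_model] in auto)
      qed (use t bt True s in \<open>auto simp: is_interval_convex_1\<close>)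
      then obtain u where "-1 < u" "u < 1" "(1 - s) * u + s * ?b u = snd w" using bt by auto
      then show ?thesis using True by (intro bexI[of _ "(0, u)"]) (auto simp: blend_def interior_model)
    qed
    then obtain z where z: "z \<in> model \<Delta>" "snd (blend s F z) = snd w"
      "snd w = 1 \<Longrightarrow> \<lfloor>fst z\<rfloor> = \<lfloor>fst w\<rfloor>" by blast
    \<comment> \<open>The first coordinates on the leaf through \<open>z\<close>, an interval also
      on the boundary lines.\<close>
    define I where "I = (if -1 < snd z \<and> snd z < 1 then UNIV else J \<lfloor>fst z\<rfloor>)"
    have hz: "hleaf z = I \<times> {snd z}" by (simp add: I_def hleaf_def)
    have I: "is_interval I" by (simp add: I_def is_interval_convex_1 convex_J)
    have in_model: "(x, snd z) \<in> model \<Delta>" if "x \<in> I" for x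
      using hleaf_subset[OF z(1)] hz that by blast
    have bottom: "snd w = -1 \<longleftrightarrow> snd z = -1" and top': "snd w = 1 \<longleftrightarrow> snd z = 1"
    proof -
      have b: "snd (blend s F z) = (1 - s) * snd z + s * snd (F z)" by (simp add: blend_def)
      have lv: "-1 \<le> snd z" "snd z \<le> 1" "-1 \<le> snd (F z)" "snd (F z) \<le> 1"
        using model_level[OF z(1)] model_level[OF strip_map_in[OF F z(1)]] by auto
      show "snd w = -1 \<longleftrightarrow> snd z = -1"
      proof
        assume "snd z = -1"
        then show "snd w = -1" using z(2) b strip_map_bottom_iff[OF F z(1)] by simp
      next
        assume *: "snd w = -1"
        show "snd z = -1"
        proof (rule ccontr)
          assume "snd z \<noteq> -1"
          then have "-1 < snd z" "-1 < snd (F z)"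
            using lv strip_map_bottom_iff[OF F z(1)] by auto
          from strict[OF this] show False using * z(2) b by (simp add: algebra_simps)
        qed
      qed
      show "snd w = 1 \<longleftrightarrow> snd z = 1"
      proof
        assume "snd z = 1"
        then show "snd w = 1" using z(2) b strip_map_top_iff[OF F z(1)] by simp
      next
        assume *: "snd w = 1"
        show "snd z = 1"
        proof (rule ccontr)
          assume "snd z \<noteq> 1"
          then have "snd z < 1" "snd (F z) < 1"
            using lv strip_map_top_iff[OF F z(1)] by auto
          from strict[OF this] show False using * z(2) b by (simp add: algebra_simps)
        qed
      qed
    qed
    have y: "fst w \<in> I"
    proof -
      have "(fst w, snd z) \<in> hleaf z"
        using w bottom top' z(3) unfolding mem_hleaf_iff[OF z(1)]
        by (cases w) (use model_level[OF z(1)] in \<open>fastforce simp: mem_model\<close>)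
      then show ?thesis by (simp add: hz)
    qed
    \<comment> \<open>The leaf and its image have the same interval of first coordinates, on the
      upper line by \<open>top\<close>. Hence \<open>fst w\<close> is the first coordinate of some
      image point, as \<open>convex_combination_surj\<close> requires.\<close>
    have "hleaf (F z) = I \<times> {snd (F z)}"
      using strip_map_top_iff[OF F z(1)] strip_map_bottom_iff[OF F z(1)] top[OF z(1)] hz
        model_level[OF z(1)] model_level[OF strip_map_in[OF F z(1)]] z(1) strip_map_in[OF F z(1)]
      by (cases z; cases "F z") (auto simp: I_def hleaf_def mem_model J_floor)
    then have "(fst w, snd (F z)) \<in> F ` hleaf z"
      using strip_map_hleaf[OF F z(1)] y by simp
    then obtain x where x: "x \<in> I" "F (x, snd z) = (fst w, snd (F z))" using hz by auto
    let ?f = "\<lambda>x. fst (F (x, snd z))"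
    have "\<exists>u\<in>I. (1 - s) * u + s * ?f u = ?f x"
    proof (rule convex_combination_surj[OF I])
      show "continuous_on I ?f"
        by (intro continuous_intros continuous_on_compose2[OF strip_map_continuous[OF F]])
          (use in_model in auto)
      show "mono_on I ?f"
        by (intro mono_onI) (use strip_map_less[OF F in_model in_model] in \<open>force simp: le_less\<close>)
    qed (use x y s in auto)
    then obtain u where u: "u \<in> I" "(1 - s) * u + s * ?f u = fst w" using x by auto
    have "snd (F (u, snd z)) = snd (F z)"
      using strip_map_level_eq[OF F in_model[OF u(1)] z(1)] by simp
    then have "blend s F (u, snd z) = w"
      using u z(2) by (simp add: blend_def prod_eq_iff)
    then show "w \<in> blend s F ` model \<Delta>" using in_model[OF u(1)] by (metis image_eqI)
  qed
  ultimately have "bij_betw (blend s F) (model \<Delta>) (model \<Delta>)"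
    using into by (auto simp: bij_betw_def)
  moreover have "continuous_on (model \<Delta>) (blend s F)"
    unfolding blend_def by (intro continuous_intros strip_map_continuous[OF F])
  ultimately show ?thesis
    unfolding strip_map_def using level_less less by blast
qed

section \<open>The surface of a tree of strips\<close>

lemma open_interval_image_affine:
  fixes k c :: real
  assumes "k > 0"
  shows "(\<lambda>x. k * x + c) ` {a<..<b} = {k * a + c<..<k * b + c}"
proof -
  have "y \<in> (\<lambda>x. k * x + c) ` {a<..<b}" if "k * a + c < y" "y < k * b + c" for y
    using that assms by (intro image_eqI[of _ _ "(y - c) / k"]) (auto simp: field_simps)
  then show ?thesis using assms by auto
qed

text \<open>All intervals \<open>J i\<close> have length \<open>1/2\<close>, which forces slope 1;
  gluing is translation by \<open>j - i\<close>.\<close>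

lemma oriented_affine_homeo_J:
  assumes "oriented_affine_homeo (J i \<times> {s}) (J j \<times> {t}) f" "x \<in> J i"
  shows "f (x, s) = (x + of_int j - of_int i, t)"
proof -
  obtain k c where f: "f ` (J i \<times> {s}) = J j \<times> {t}" "k > 0"
    "\<And>x. x \<in> J i \<Longrightarrow> fst (f (x, s)) = k * x + c"
    using assms(1) by (auto simp: oriented_affine_homeo_def)
  have "(\<lambda>x. k * x + c) ` J i = fst ` f ` (J i \<times> {s})"
    using f(3) by (force simp: image_iff)
  also have "\<dots> = J j" unfolding f(1) by auto
  finally have "{k * of_int i + c<..<k * (of_int i + 1/2) + c} = {of_int j<..<of_int j + 1/2}"
    unfolding J_def open_interval_image_affine[OF f(2)] .
  moreover have "k * of_int i + c < k * (of_int i + 1/2) + c" using f(2) by (simp add: algebra_simps)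
  ultimately have "k * of_int i + c = of_int j" "k * (of_int i + 1/2) + c = of_int j + 1/2"
    by (simp_all add: greaterThanLessThan_eq_iff)
  moreover from this have "k = 1" by (simp add: algebra_simps)
  ultimately have "k = 1" "c = of_int j - of_int i" by simp_all
  moreover have "snd (f (x, s)) = t" using f(1) assms(2) by (metis SigmaI imageI mem_Times_iff singleton_iff)
  ultimately show ?thesis using f(3)[OF assms(2)] by (simp add: prod_eq_iff)
qed

lemma bottom_in_J: "z \<in> model \<Delta> \<Longrightarrow> snd z = -1 \<Longrightarrow> fst z \<in> J 1"
  and top_in_J: "z \<in> model \<Delta> \<Longrightarrow> snd z = 1 \<Longrightarrow> fst z \<in> J \<lfloor>fst z\<rfloor> \<and> \<lfloor>fst z\<rfloor> \<in> \<Delta>"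
  by (cases z; auto simp: mem_model J_floor)+

text \<open>The equality \<open>seams\<close> says at once that every child is glued to its parent
  and that nothing else is glued. Addresses name the upper interval a child sits on, so
  \<open>T\<close> determines the strips and their gluings.\<close>

locale striped_tree =
  fixes D :: "('l, 'c) striped_data" and addr :: "'l \<Rightarrow> int list" and T :: tree
  assumes bij_addr: "bij_betw addr (strips D) {a. T a \<noteq> None}"
    and strip_model: "l \<in> strips D \<Longrightarrow> strip D l = model (the (T (addr l)))"
    and seams: "(\<lambda>\<gamma>. (lower_side D \<gamma>, upper_side D \<gamma>)) ` seams D =
      {((l, J 1 \<times> {-1}), (m, J i \<times> {1})) |l m i. l \<in> strips D \<and> m \<in> strips D \<and> addr l = addr m @ [i]}"
    and T_snoc: "T (a @ [i]) \<noteq> None \<Longrightarrow> \<exists>\<Delta>. T a = Some \<Delta> \<and> i \<in> \<Delta>"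
begin

abbreviation tops :: "'l \<Rightarrow> int set" where
  "tops l \<equiv> the (T (addr l))"

abbreviation S :: "'l \<Rightarrow> (real \<times> real) set" where
  "S l \<equiv> model (tops l)"

definition node :: "int list \<Rightarrow> 'l" where
  "node = inv_into (strips D) addr"

definition pr :: "'l \<Rightarrow> real \<times> real \<Rightarrow> 'l surface_point" where
  "pr l z = strip_proj D (l, z)"

lemma addr_inj: "l \<in> strips D \<Longrightarrow> m \<in> strips D \<Longrightarrow> addr l = addr m \<longleftrightarrow> l = m"
  using bij_addr by (auto simp: bij_betw_def inj_on_def)

lemma addr_in: "l \<in> strips D \<Longrightarrow> T (addr l) = Some (tops l)"
  using bij_betwE[OF bij_addr] by force

lemma node_addr [simp]: "l \<in> strips D \<Longrightarrow> node (addr l) = l"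
  using bij_addr by (simp add: node_def bij_betw_def)

lemma node_in: "T a \<noteq> None \<Longrightarrow> node a \<in> strips D"
  and addr_node: "T a \<noteq> None \<Longrightarrow> addr (node a) = a"
  using bij_addr by (auto simp: node_def bij_betw_def inv_into_into f_inv_into_f)

lemma parent:
  assumes "l \<in> strips D" "addr l = a @ [i]"
  shows "node a \<in> strips D" "addr (node a) = a" "i \<in> tops (node a)"
proof -
  have "T (a @ [i]) \<noteq> None" using addr_in[OF assms(1)] unfolding assms(2) by (metis option.distinct(1))
  from T_snoc[OF this] obtain \<Delta> where \<Delta>: "T a = Some \<Delta>" "i \<in> \<Delta>" by blast
  then show "node a \<in> strips D" "addr (node a) = a" by (simp_all add: node_in addr_node)
  then show "i \<in> tops (node a)" using \<Delta> by simp
qed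

lemma child_tops:
  assumes "l \<in> strips D" "m \<in> strips D" "addr l = addr m @ [i]"
  shows "i \<in> tops m"
  using parent(3)[OF assms(1,3)] assms(2) by simp

text \<open>The lower interval is always \<open>J 1\<close>, and the translation by
  \<open>i - 1\<close> takes it to \<open>J i\<close>; this is the origin of the offset in all seam
  formulas.\<close>

lemma glued_iff:
  "glued D p q \<longleftrightarrow> (\<exists>l\<in>strips D. \<exists>m\<in>strips D. \<exists>i x. addr l = addr m @ [i] \<and> x \<in> J 1 \<and>
     p = (l, x, -1) \<and> q = (m, x + of_int i - 1, 1))"
proof
  assume "glued D p q"
  then obtain \<gamma> X Y f where g: "\<gamma> \<in> seams D" "lower_side D \<gamma> = (fst p, X)" "upper_side D \<gamma> = (fst q, Y)"
    "oriented_affine_homeo X Y f" "snd p \<in> X" "snd q = f (snd p)"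
    unfolding glued_def by blast
  then have "((fst p, X), (fst q, Y)) \<in> (\<lambda>\<gamma>. (lower_side D \<gamma>, upper_side D \<gamma>)) ` seams D"
    by force
  then obtain i where i: "X = J 1 \<times> {-1}" "Y = J i \<times> {1}" "fst p \<in> strips D" "fst q \<in> strips D"
    "addr (fst p) = addr (fst q) @ [i]"
    unfolding seams by auto
  moreover obtain x where x: "x \<in> J 1" "snd p = (x, -1)" using g(5) i by auto
  moreover have "snd q = (x + of_int i - 1, 1)"
    using oriented_affine_homeo_J[of 1 "-1" i 1 f x] g(4,6) i x by simp
  ultimately show "\<exists>l\<in>strips D. \<exists>m\<in>strips D. \<exists>i x. addr l = addr m @ [i] \<and> x \<in> J 1 \<and>
     p = (l, x, -1) \<and> q = (m, x + of_int i - 1, 1)"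
    by (metis prod.collapse)
next
  assume "\<exists>l\<in>strips D. \<exists>m\<in>strips D. \<exists>i x. addr l = addr m @ [i] \<and> x \<in> J 1 \<and>
     p = (l, x, -1) \<and> q = (m, x + of_int i - 1, 1)"
  then obtain l m i x where *: "l \<in> strips D" "m \<in> strips D" "addr l = addr m @ [i]" "x \<in> J 1"
    "p = (l, x, -1)" "q = (m, x + of_int i - 1, 1)" by blast
  then have "((l, J 1 \<times> {-1}), (m, J i \<times> {1})) \<in> (\<lambda>\<gamma>. (lower_side D \<gamma>, upper_side D \<gamma>)) ` seams D"
    unfolding seams by blast
  then obtain \<gamma> where \<gamma>: "\<gamma> \<in> seams D" "lower_side D \<gamma> = (l, J 1 \<times> {-1})" "upper_side D \<gamma> = (m, J i \<times> {1})"
    by auto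
  let ?f = "\<lambda>z. (fst z + of_int i - 1, 1) :: real \<times> real"
  have "y \<in> (\<lambda>x. x + of_int i - 1) ` J 1" if "y \<in> J i" for y
    using that by (intro image_eqI[of _ _ "y - of_int i + 1"]) (auto simp: mem_J_iff)
  then have "?f ` (J 1 \<times> {-1}) = J i \<times> {1}"
    by (auto simp: image_iff) (auto simp: mem_J_iff)
  moreover have "\<exists>k>0. \<exists>c. \<forall>z\<in>J 1 \<times> {- 1::real}. fst (?f z) = k * fst z + c"
    by (intro exI[of _ 1] conjI exI[of _ "of_int i - 1"]) auto
  ultimately have "oriented_affine_homeo (J 1 \<times> {-1}) (J i \<times> {1}) ?f"
    by (simp add: oriented_affine_homeo_def)
  then show "glued D p q"
    unfolding glued_def using \<gamma> * by (intro bexI[of _ \<gamma>] exI[of _ ?f]) auto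
qed

text \<open>A point on a glued lower side is represented by its copy on the upper side of the parent.\<close>

definition nf :: "'l \<times> real \<times> real \<Rightarrow> 'l \<times> real \<times> real" where
  "nf p = (if snd (snd p) = -1 \<and> addr (fst p) \<noteq> []
     then (node (butlast (addr (fst p))), fst (snd p) + of_int (last (addr (fst p))) - 1, 1) else p)"

lemma strip_points_eq: "strip_points D = (SIGMA l:strips D. S l)"
  by (auto simp: strip_points_def strip_model)

lemma nf_bottom: "m \<in> strips D \<Longrightarrow> addr l = addr m @ [i] \<Longrightarrow> nf (l, x, -1) = (m, x + of_int i - 1, 1)"
  and nf_top: "nf (m, x, 1) = (m, x, 1)"
  by (simp_all add: nf_def)

lemma nf_glued: "glued D p q \<Longrightarrow> nf p = nf q"
  unfolding glued_iff by (elim bexE exE conjE) (simp only: nf_bottom nf_top)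

lemma equivclp_nf:
  assumes "p \<in> strip_points D"
  shows "equivclp (glued D) p (nf p)"
proof (cases "snd (snd p) = -1 \<and> addr (fst p) \<noteq> []")
  case True
  obtain l x t where p: "p = (l, x, t)" by (cases p) auto
  obtain a i where a: "addr l = a @ [i]" using True p by (metis fst_conv rev_exhaust)
  have l: "l \<in> strips D" "(x, t) \<in> S l" using assms p by (auto simp: strip_points_eq)
  have "x \<in> J 1" using l True p by (auto simp: mem_model)
  then have "glued D p (nf p)"
    using l True p a parent(1,2)[OF l(1) a] by (auto simp: glued_iff nf_def)
  then show ?thesis by (simp add: r_into_equivclp)
next
  case False
  then show ?thesis by (auto simp: nf_def)
qed

text \<open>Gluing does not change \<open>nf\<close>, and every point is equivalent to its
  \<open>nf\<close>. A single replacement suffices because it ends on level 1, where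
  \<open>nf\<close> is the identity.\<close>

lemma equivclp_iff_nf:
  assumes "p \<in> strip_points D" "q \<in> strip_points D"
  shows "equivclp (glued D) p q \<longleftrightarrow> nf p = nf q"
proof
  assume "equivclp (glued D) p q"
  then show "nf p = nf q"
    by (induction rule: equivclp_induct) (auto dest: nf_glued)
next
  assume "nf p = nf q"
  then show "equivclp (glued D) p q"
    using equivclp_nf[OF assms(1)] equivclp_nf[OF assms(2)]
    by (metis equivclp_sym equivclp_trans)
qed

lemma pr_eq_iff_nf:
  assumes "l \<in> strips D" "m \<in> strips D" "z \<in> S l" "w \<in> S m"
  shows "pr l z = pr m w \<longleftrightarrow> nf (l, z) = nf (m, w)"
proof -
  have in_points: "(l, z) \<in> strip_points D" "(m, w) \<in> strip_points D"
    using assms by (auto simp: strip_points_eq)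
  have "pr k v = {y \<in> strip_points D. nf (k, v) = nf y}" if "(k, v) \<in> strip_points D" for k v
    using that by (auto simp: pr_def strip_proj_def glue_rel_def equivclp_iff_nf)
  then show ?thesis using in_points by auto
qed

definition below :: "'l \<Rightarrow> real \<times> real \<Rightarrow> 'l \<Rightarrow> real \<times> real \<Rightarrow> bool" where
  "below l z m w \<longleftrightarrow> (\<exists>i. addr l = addr m @ [i] \<and> snd z = -1 \<and> w = (fst z + of_int i - 1, 1))"

text \<open>Classes have at most two points: the address of a child names the interval it is glued
  to, so an upper interval carries at most one child.\<close>

lemma pr_eq_iff:
  assumes "l \<in> strips D" "m \<in> strips D" "z \<in> S l" "w \<in> S m"
  shows "pr l z = pr m w \<longleftrightarrow> l = m \<and> z = w \<or> below l z m w \<or> below m w l z"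
proof -
  have below: "nf (l, z) = nf (m, w)" if "below l z m w" "l \<in> strips D" "m \<in> strips D" for l z m w
    using that nf_bottom nf_top unfolding below_def by (metis prod.collapse)
  have "l = m \<and> z = w \<or> below l z m w \<or> below m w l z" if eq: "nf (l, z) = nf (m, w)"
  proof -
    have 1: "below l z m w" if "nf (l, z) = (m, w)" "snd z = -1" "addr l \<noteq> []" "l \<in> strips D"
      for l z m w
    proof -
      obtain a i where a: "addr l = a @ [i]" using \<open>addr l \<noteq> []\<close> by (metis rev_exhaust)
      then show ?thesis using that parent(2)[OF \<open>l \<in> strips D\<close> a] by (auto simp: below_def nf_def)
    qed
    show ?thesis
    proof (cases "snd z = -1 \<and> addr l \<noteq> []"; cases "snd w = -1 \<and> addr m \<noteq> []")
      assume z: "snd z = -1 \<and> addr l \<noteq> []" and w: "snd w = -1 \<and> addr m \<noteq> []"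
      obtain a i where a: "addr l = a @ [i]" using z by (metis rev_exhaust)
      obtain b j where b: "addr m = b @ [j]" using w by (metis rev_exhaust)
      have "node a = node b" "fst z + of_int i = fst w + of_int j"
        using eq z w a b by (auto simp: nf_def)
      then have "a = b" using parent(2)[OF assms(1) a] parent(2)[OF assms(2) b] by metis
      have "fst z \<in> J 1" "fst w \<in> J 1" using bottom_in_J assms(3,4) z w by blast+
      \<comment> \<open>Both points have the same copy on the parent, and the interval containing
        that copy determines the last position of the address.\<close>
      then have "fst z + of_int i \<in> J (1 + i)" "fst w + of_int j \<in> J (1 + j)"
        by (simp_all only: J_shift)
      then have "1 + i = 1 + j" using \<open>fst z + of_int i = fst w + of_int j\<close> J_inj by metis
      then have "addr l = addr m" "fst z = fst w"
        using a b \<open>a = b\<close> \<open>fst z + of_int i = fst w + of_int j\<close> by auto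
      then show ?thesis using addr_inj[OF assms(1,2)] z w by (auto simp: prod_eq_iff)
    next
      assume z: "snd z = -1 \<and> addr l \<noteq> []" and w: "\<not> (snd w = -1 \<and> addr m \<noteq> [])"
      then have "nf (l, z) = (m, w)" using eq by (auto simp: nf_def)
      then show ?thesis using 1[OF _ _ _ assms(1)] z by blast
    next
      assume z: "\<not> (snd z = -1 \<and> addr l \<noteq> [])" and w: "snd w = -1 \<and> addr m \<noteq> []"
      then have "nf (m, w) = (l, z)" using eq by (auto simp: nf_def)
      then show ?thesis using 1[OF _ _ _ assms(2)] w by blast
    next
      assume z: "\<not> (snd z = -1 \<and> addr l \<noteq> [])" and w: "\<not> (snd w = -1 \<and> addr m \<noteq> [])"
      then show ?thesis using eq by (auto simp: nf_def)
    qed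
  qed
  then show ?thesis
    unfolding pr_eq_iff_nf[OF assms] using below[of l z m w] below[of m w l z] assms(1,2) by auto
qed

lemma pr_inj: "l \<in> strips D \<Longrightarrow> z \<in> S l \<Longrightarrow> w \<in> S l \<Longrightarrow> pr l z = pr l w \<longleftrightarrow> z = w"
  by (auto simp: pr_eq_iff below_def)

lemma below_pr:
  "below l z m w \<Longrightarrow> l \<in> strips D \<Longrightarrow> m \<in> strips D \<Longrightarrow> z \<in> S l \<Longrightarrow> w \<in> S m \<and> pr l z = pr m w"
proof -
  assume b: "below l z m w" and l: "l \<in> strips D" "m \<in> strips D" and z: "z \<in> S l"
  obtain i where i: "addr l = addr m @ [i]" "snd z = -1" "w = (fst z + of_int i - 1, 1)"
    using b by (auto simp: below_def)
  have "fst z \<in> J 1" using bottom_in_J z i(2) by blast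
  then have "fst w \<in> J i" using i(3) by (auto simp: mem_J_iff)
  then have "w \<in> S m" using child_tops[OF l i(1)] i(3) by (auto simp: mem_model)
  then show ?thesis using pr_eq_iff[OF l z] b by blast
qed

section \<open>The quotient topology\<close>

lemma topspace_surface: "topspace (surface D) = {pr l z |l z. l \<in> strips D \<and> z \<in> S l}"
proof -
  have "topspace (surface D) = strip_proj D ` (SIGMA l:strips D. S l)"
    by (simp add: surface_def o_def strip_model cong: Sigma_cong)
  then show ?thesis by (auto simp: pr_def image_iff)
qed

lemma pr_in: "l \<in> strips D \<Longrightarrow> z \<in> S l \<Longrightarrow> pr l z \<in> topspace (surface D)"
  unfolding topspace_surface by blast

lemma openin_surface:
  "openin (surface D) U \<longleftrightarrow> U \<subseteq> topspace (surface D) \<and>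
     (\<forall>l\<in>strips D. openin (top_of_set (S l)) {z \<in> S l. pr l z \<in> U})"
proof -
  let ?X = "sum_topology (\<lambda>l. top_of_set (strip D l)) (strips D)"
  have "openin (surface D) U \<longleftrightarrow> U \<subseteq> topspace (surface D) \<and> openin ?X {x \<in> topspace ?X. strip_proj D x \<in> U}"
    unfolding surface_def openin_quotient_topology by simp
  also have "openin ?X {x \<in> topspace ?X. strip_proj D x \<in> U} \<longleftrightarrow>
      (\<forall>l\<in>strips D. openin (top_of_set (S l)) {z \<in> S l. pr l z \<in> U})"
    by (auto simp: openin_sum_topology strip_model pr_def)
  finally show ?thesis .
qed

lemma closedin_surface:
  "closedin (surface D) U \<longleftrightarrow> U \<subseteq> topspace (surface D) \<and>
     (\<forall>l\<in>strips D. closedin (top_of_set (S l)) {z \<in> S l. pr l z \<in> U})"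
proof -
  have "{z \<in> S l. pr l z \<in> topspace (surface D) - U} = S l - {z \<in> S l. pr l z \<in> U}" if "l \<in> strips D" for l
    using pr_in[OF that] by auto
  then show ?thesis
    by (auto simp: closedin_def openin_surface)
qed

lemma continuous_map_pr: "l \<in> strips D \<Longrightarrow> continuous_map (top_of_set (S l)) (surface D) (pr l)"
  by (auto simp: continuous_map_def pr_in openin_surface)

lemma continuous_map_from_surface:
  "continuous_map (surface D) Y f \<longleftrightarrow>
    (\<forall>l\<in>strips D. continuous_map (top_of_set (S l)) Y (\<lambda>z. f (pr l z)))"
proof
  assume "continuous_map (surface D) Y f"
  then show "\<forall>l\<in>strips D. continuous_map (top_of_set (S l)) Y (\<lambda>z. f (pr l z))"
    using continuous_map_compose[OF continuous_map_pr] by (auto simp: o_def)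
next
  assume *: "\<forall>l\<in>strips D. continuous_map (top_of_set (S l)) Y (\<lambda>z. f (pr l z))"
  show "continuous_map (surface D) Y f"
    unfolding continuous_map_def
  proof (intro conjI allI impI)
    show "f \<in> topspace (surface D) \<rightarrow> topspace Y"
      using * by (auto simp: topspace_surface continuous_map_def Pi_iff)
    fix U assume U: "openin Y U"
    show "openin (surface D) {x \<in> topspace (surface D). f x \<in> U}"
      unfolding openin_surface
    proof (intro conjI ballI)
      fix l assume l: "l \<in> strips D"
      have "{z \<in> S l. pr l z \<in> {x \<in> topspace (surface D). f x \<in> U}} = {z \<in> S l. f (pr l z) \<in> U}"
        using pr_in[OF l] by auto
      then show "openin (top_of_set (S l)) {z \<in> S l. pr l z \<in> {x \<in> topspace (surface D). f x \<in> U}}"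
        using * l U by (simp add: continuous_map_def)
    qed auto
  qed
qed

text \<open>The image of a closed set meets a neighbouring strip only along their seam, and a seam
  interval is relatively closed in both strips because they do not contain its end points.\<close>

lemma closed_map_pr:
  assumes l: "l \<in> strips D"
  shows "closed_map (top_of_set (S l)) (surface D) (pr l)"
  unfolding closed_map_def
proof (intro allI impI)
  fix C assume C: "closedin (top_of_set (S l)) C"
  then have CS: "C \<subseteq> S l" by (simp add: closedin_def)
  show "closedin (surface D) (pr l ` C)"
    unfolding closedin_surface
  proof (intro conjI ballI)
    show "pr l ` C \<subseteq> topspace (surface D)" using CS pr_in[OF l] by auto
    fix m assume m: "m \<in> strips D"
    have mem: "pr m z \<in> pr l ` C \<longleftrightarrow> (\<exists>w\<in>C. m = l \<and> z = w \<or> below m z l w \<or> below l w m z)"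
      if "z \<in> S m" for z
    proof -
      have "pr m z = pr l w \<longleftrightarrow> m = l \<and> z = w \<or> below m z l w \<or> below l w m z" if "w \<in> C" for w
        using pr_eq_iff[OF m l \<open>z \<in> S m\<close>] that CS by blast
      then show ?thesis by (auto simp: image_iff)
    qed
    \<comment> \<open>The trace in the strip \<open>m\<close> is the preimage of \<open>C\<close>
      under a seam translation, restricted to a closed segment of a boundary line.\<close>
    have pull: "closedin (top_of_set (S m)) {z \<in> S m. snd z = c \<and> a \<le> fst z \<and> fst z \<le> b \<and> g z \<in> C}"
      if g: "continuous_on UNIV g" and gS: "\<And>z. z \<in> S m \<Longrightarrow> snd z = c \<Longrightarrow> a \<le> fst z \<Longrightarrow> fst z \<le> b \<Longrightarrow> g z \<in> S l"
      for g :: "real \<times> real \<Rightarrow> real \<times> real" and a b c :: real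
    proof -
      let ?B = "{z \<in> S m. snd z = c \<and> a \<le> fst z \<and> fst z \<le> b}"
      have "?B = S m \<inter> ({a..b} \<times> {c})" by auto
      then have B: "closedin (top_of_set (S m)) ?B" by (simp add: closedin_closed_Int closed_Times)
      have "closedin (top_of_set ?B) (?B \<inter> g -` C)"
        by (rule continuous_closedin_preimage_gen[OF continuous_on_subset[OF g] _ C]) (use gS in auto)
      then have "closedin (top_of_set (S m)) (?B \<inter> g -` C)"
        using B by (rule closedin_trans)
      moreover have "?B \<inter> g -` C = {z \<in> S m. snd z = c \<and> a \<le> fst z \<and> fst z \<le> b \<and> g z \<in> C}" by auto
      ultimately show ?thesis by simp
    qed
    consider "m = l" | i where "addr l = addr m @ [i]" | i where "addr m = addr l @ [i]"
      | "m \<noteq> l" "\<And>i. addr l \<noteq> addr m @ [i]" "\<And>i. addr m \<noteq> addr l @ [i]" by blast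
    then show "closedin (top_of_set (S m)) {z \<in> S m. pr m z \<in> pr l ` C}"
    proof cases
      case 1
      then have "{z \<in> S m. pr m z \<in> pr l ` C} = C"
        using mem CS by (auto simp: below_def)
      then show ?thesis using C 1 by simp
    next
      case (2 i)
      let ?g = "\<lambda>z. (fst z - of_int i + 1, -1) :: real \<times> real"
      \<comment> \<open>On the closed segment the end points are ruled out by membership in
        \<open>S m\<close>.\<close>
      have gS: "?g z \<in> S l" if "z \<in> S m" "snd z = 1" "of_int i \<le> fst z" "fst z \<le> of_int i + 1/2" for z
      proof -
        have "fst z \<in> J \<lfloor>fst z\<rfloor>" using top_in_J that by blast
        moreover have "\<lfloor>fst z\<rfloor> = i" using that by (simp add: floor_eq_iff)
        ultimately show ?thesis by (auto simp: mem_model mem_J_iff)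
      qed
      have "pr m z \<in> pr l ` C \<longleftrightarrow> snd z = 1 \<and> of_int i \<le> fst z \<and> fst z \<le> of_int i + 1/2 \<and> ?g z \<in> C"
        if z: "z \<in> S m" for z
      proof
        assume "pr m z \<in> pr l ` C"
        then obtain w where w: "w \<in> C" "snd w = -1" "z = (fst w + of_int i - 1, 1)"
          using mem[OF z] 2 by (auto simp: below_def)
        have "fst w \<in> J 1" using bottom_in_J w CS by blast
        moreover have "?g z = w" using w by (simp add: prod_eq_iff)
        ultimately show "snd z = 1 \<and> of_int i \<le> fst z \<and> fst z \<le> of_int i + 1/2 \<and> ?g z \<in> C"
          using w by (auto simp: mem_J_iff)
      next
        assume *: "snd z = 1 \<and> of_int i \<le> fst z \<and> fst z \<le> of_int i + 1/2 \<and> ?g z \<in> C"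
        then have "below l (?g z) m z" using 2 by (auto simp: below_def prod_eq_iff)
        then show "pr m z \<in> pr l ` C" using mem[OF z] * by blast
      qed
      then have "{z \<in> S m. pr m z \<in> pr l ` C} =
          {z \<in> S m. snd z = 1 \<and> of_int i \<le> fst z \<and> fst z \<le> of_int i + 1/2 \<and> ?g z \<in> C}" by blast
      moreover have "closedin (top_of_set (S m)) \<dots>"
        by (rule pull) (use gS in \<open>auto intro!: continuous_intros\<close>)
      ultimately show ?thesis by simp
    next
      case (3 i)
      let ?g = "\<lambda>z. (fst z + of_int i - 1, 1) :: real \<times> real"
      have gS: "?g z \<in> S l" if "z \<in> S m" "snd z = -1" for z
        using below_pr[of m z l "?g z"] 3 m l that by (auto simp: below_def)
      have "pr m z \<in> pr l ` C \<longleftrightarrow> snd z = -1 \<and> 1 \<le> fst z \<and> fst z \<le> 3/2 \<and> ?g z \<in> C"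
        if z: "z \<in> S m" for z
      proof
        assume "pr m z \<in> pr l ` C"
        then have "snd z = -1 \<and> ?g z \<in> C"
          using mem[OF z] 3 by (auto simp: below_def)
        then show "snd z = -1 \<and> 1 \<le> fst z \<and> fst z \<le> 3/2 \<and> ?g z \<in> C"
          using bottom_in_J[OF z] by (auto simp: mem_J_iff)
      next
        assume *: "snd z = -1 \<and> 1 \<le> fst z \<and> fst z \<le> 3/2 \<and> ?g z \<in> C"
        then have "below m z l (?g z)" using 3 by (auto simp: below_def)
        then show "pr m z \<in> pr l ` C" using mem[OF z] * by blast
      qed
      then have "{z \<in> S m. pr m z \<in> pr l ` C} =
          {z \<in> S m. snd z = -1 \<and> 1 \<le> fst z \<and> fst z \<le> 3/2 \<and> ?g z \<in> C}" by blast
      moreover have "closedin (top_of_set (S m)) \<dots>"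
        by (rule pull) (use gS in \<open>auto intro!: continuous_intros\<close>)
      ultimately show ?thesis by simp
    next
      case 4
      then have "{z \<in> S m. pr m z \<in> pr l ` C} = {}" using mem by (auto simp: below_def)
      then show ?thesis by (simp only: closedin_empty)
    qed
  qed
qed

subsection \<open>Leaves\<close>

definition lf :: "'l \<Rightarrow> real \<times> real \<Rightarrow> 'l surface_point set" where
  "lf l z = pr l ` hleaf z"

lemma leaf_eq: "leaf D l \<omega> = pr l ` \<omega>"
  by (auto simp: leaf_def pr_def image_iff)

lemma leaves_eq: "leaves D = {lf l z |l z. l \<in> strips D \<and> z \<in> S l}"
proof -
  have "\<omega> \<in> leaves D \<longleftrightarrow> (\<exists>l\<in>strips D. \<exists>h\<in>strip_leaves (strip D l). \<omega> = pr l ` h)" for \<omega>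
    unfolding leaves_def leaf_eq by blast
  also have "\<dots> \<omega> \<longleftrightarrow> (\<exists>l\<in>strips D. \<exists>z\<in>S l. \<omega> = lf l z)" for \<omega>
    by (simp add: strip_model strip_leaves_model lf_def cong: bex_cong)
  finally show ?thesis by blast
qed

lemma lf_in_leaves: "l \<in> strips D \<Longrightarrow> z \<in> S l \<Longrightarrow> lf l z \<in> leaves D"
  unfolding leaves_eq by blast

lemma leavesE:
  assumes "\<omega> \<in> leaves D"
  obtains l z where "l \<in> strips D" "z \<in> S l" "\<omega> = lf l z"
  using assms unfolding leaves_eq by blast

lemma lf_subset: "l \<in> strips D \<Longrightarrow> z \<in> S l \<Longrightarrow> lf l z \<subseteq> topspace (surface D)"
  unfolding lf_def using pr_in hleaf_subset by blast

lemma pr_in_lf: "z \<in> S l \<Longrightarrow> pr l z \<in> lf l z"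
  by (simp add: lf_def mem_hleaf_self)

lemma lf_below:
  assumes "below l z m w" "l \<in> strips D" "m \<in> strips D" "z \<in> S l"
  shows "lf l z = lf m w"
proof -
  obtain i where i: "addr l = addr m @ [i]" "snd z = -1" "w = (fst z + of_int i - 1, 1)"
    using assms(1) by (auto simp: below_def)
  have w: "w \<in> S m" using below_pr[OF assms] by blast
  have z1: "fst z \<in> J 1" by (rule bottom_in_J[OF assms(4) i(2)])
  then have "fst w \<in> J i" using i(3) by (auto simp: mem_J_iff)
  then have hw: "hleaf w = J i \<times> {1}" and hz: "hleaf z = J 1 \<times> {-1}"
    using J_floor z1 i by (auto simp: hleaf_def)
  have pr: "pr l (x, -1) = pr m (x + of_int i - 1, 1)" if "x \<in> J 1" for x
    using below_pr[of l "(x, -1)" m "(x + of_int i - 1, 1)"] assms i that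
    by (auto simp: below_def mem_model)
  have "x - of_int i + 1 \<in> J 1" if "x \<in> J i" for x using that by (auto simp: mem_J_iff)
  then have "pr m (x, 1) \<in> pr l ` (J 1 \<times> {-1})" if "x \<in> J i" for x
    using pr[of "x - of_int i + 1"] that by (auto intro!: image_eqI[of _ _ "(x - of_int i + 1, -1)"])
  moreover have "pr l (x, -1) \<in> pr m ` (J i \<times> {1})" if "x \<in> J 1" for x
    using pr[OF that] that by (auto simp: mem_J_iff intro!: image_eqI[of _ _ "(x + of_int i - 1, 1)"])
  ultimately show ?thesis unfolding lf_def hw hz by auto
qed

lemma lf_eq:
  assumes "l \<in> strips D" "m \<in> strips D" "z \<in> S l" "w \<in> S m" "pr m w \<in> lf l z"
  shows "lf l z = lf m w"
proof -
  obtain v where v: "v \<in> hleaf z" "pr m w = pr l v" using assms(5) by (auto simp: lf_def)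
  have vS: "v \<in> S l" using hleaf_subset[OF assms(3)] v(1) by blast
  have "lf l z = lf l v" using hleaf_eq[OF v(1)] by (simp add: lf_def)
  also have "lf l v = lf m w"
    using v(2) lf_below assms(1,2,4) vS unfolding pr_eq_iff[OF assms(2,1,4) vS] by metis
  finally show ?thesis .
qed

lemma leaf_eqI:
  assumes "\<omega> \<in> leaves D" "l \<in> strips D" "z \<in> S l" "pr l z \<in> \<omega>"
  shows "\<omega> = lf l z"
  using assms lf_eq unfolding leaves_eq by blast

lemma leaves_disjoint:
  assumes "\<omega> \<in> leaves D" "\<omega>' \<in> leaves D" "p \<in> \<omega>" "p \<in> \<omega>'"
  shows "\<omega> = \<omega>'"
proof -
  have "p \<in> topspace (surface D)" using assms(1,3) lf_subset by (auto simp: leaves_eq)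
  then obtain l z where "l \<in> strips D" "z \<in> S l" "p = pr l z" by (auto simp: topspace_surface)
  then show ?thesis using leaf_eqI assms by metis
qed

text \<open>The order may be read off in any strip containing the leaf, because seams are
  translations and preserve the order of first coordinates.\<close>

lemma leaf_less_pr:
  assumes "l \<in> strips D" "z \<in> S l" "w \<in> S l"
  shows "leaf_less D (pr l z) (pr l w) \<longleftrightarrow> w \<in> hleaf z \<and> fst z < fst w"
proof
  assume "leaf_less D (pr l z) (pr l w)"
  then obtain m \<omega> x y where m: "m \<in> strips D" "\<omega> \<in> strip_leaves (strip D m)" "x \<in> \<omega>" "y \<in> \<omega>"
    "fst x < fst y" "pr l z = pr m x" "pr l w = pr m y"
    by (auto simp: leaf_less_def pr_def)
  then obtain v where v: "v \<in> S m" "\<omega> = hleaf v" by (auto simp: strip_model strip_leaves_model)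
  have xy: "x \<in> S m" "y \<in> S m" "y \<in> hleaf x"
    using m(3,4) hleaf_subset[OF v(1)] hleaf_eq v(2) by auto
  have level: "snd y = snd x" "snd x = 1 \<Longrightarrow> \<lfloor>fst y\<rfloor> = \<lfloor>fst x\<rfloor>"
    using xy by (auto simp: mem_hleaf_iff)
  consider "l = m" "z = x" | "below l z m x" | "below m x l z"
    using m(6) pr_eq_iff[OF assms(1) m(1) assms(2) xy(1)] by blast
  then show "w \<in> hleaf z \<and> fst z < fst w"
  proof cases
    case 1
    then have "w = y" using m(7) pr_inj[OF assms(1,3), of y] xy by simp
    then show ?thesis using m(5) xy 1 by simp
  next
    case 2
    then obtain i where i: "addr l = addr m @ [i]" "snd z = -1" "x = (fst z + of_int i - 1, 1)"
      by (auto simp: below_def)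
    then have "below l w m y"
      using m(7) pr_eq_iff[OF assms(1) m(1) assms(3) xy(2)] by (auto simp: below_def)
    then have "snd w = -1" "y = (fst w + of_int i - 1, 1)" using i by (auto simp: below_def)
    then show ?thesis using i m(5) assms by (simp add: mem_hleaf_iff)
  next
    case 3
    then obtain i where i: "addr m = addr l @ [i]" "snd x = -1" "z = (fst x + of_int i - 1, 1)"
      by (auto simp: below_def)
    then have "below m y l w"
      using m(7) pr_eq_iff[OF assms(1) m(1) assms(3) xy(2)] by (auto simp: below_def)
    then have w: "snd y = -1" "w = (fst y + of_int i - 1, 1)" using i by (auto simp: below_def)
    have "fst x \<in> J 1" "fst y \<in> J 1" using bottom_in_J xy i w by blast+
    then have "fst z \<in> J i" "fst w \<in> J i" using i w by (auto simp: mem_J_iff)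
    moreover have "snd z = 1" "snd w = 1" using i w by simp_all
    ultimately have "w \<in> hleaf z" by (simp add: hleaf_def J_floor mem_Times_iff)
    then show ?thesis using i w m(5) by simp
  qed
next
  assume "w \<in> hleaf z \<and> fst z < fst w"
  then show "leaf_less D (pr l z) (pr l w)"
    unfolding leaf_less_def pr_def
    using assms mem_hleaf_self[OF assms(2)] by (auto simp: strip_model strip_leaves_model)
qed

lemma leaf_less_pr_iff:
  "leaf_less D u v \<longleftrightarrow> (\<exists>l\<in>strips D. \<exists>z\<in>S l. \<exists>w\<in>hleaf z. fst z < fst w \<and> u = pr l z \<and> v = pr l w)"
proof
  assume "leaf_less D u v"
  then obtain m \<omega> x y where m: "m \<in> strips D" "\<omega> \<in> strip_leaves (strip D m)" "x \<in> \<omega>" "y \<in> \<omega>"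
    "fst x < fst y" "u = pr m x" "v = pr m y"
    by (auto simp: leaf_less_def pr_def)
  then obtain z where z: "z \<in> S m" "\<omega> = hleaf z" by (auto simp: strip_model strip_leaves_model)
  have "x \<in> S m" "y \<in> hleaf x" using m(3,4) hleaf_subset[OF z(1)] hleaf_eq z(2) by auto
  then show "\<exists>l\<in>strips D. \<exists>z\<in>S l. \<exists>w\<in>hleaf z. fst z < fst w \<and> u = pr l z \<and> v = pr l w"
    using m by blast
next
  assume "\<exists>l\<in>strips D. \<exists>z\<in>S l. \<exists>w\<in>hleaf z. fst z < fst w \<and> u = pr l z \<and> v = pr l w"
  then show "leaf_less D u v" using leaf_less_pr hleaf_subset by blast
qed

subsection \<open>Special leaves\<close>

text \<open>Unions of leaves prescribed by sets of levels. Once \<open>consistent\<close> makes both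
  sides of every seam agree, openness and closedness in the surface can be read off from the sets of
  reals.\<close>

definition level_set :: "('l \<Rightarrow> real set) \<Rightarrow> 'l surface_point set" where
  "level_set A = {pr l z |l z. l \<in> strips D \<and> z \<in> S l \<and> snd z \<in> A l}"

definition consistent :: "('l \<Rightarrow> real set) \<Rightarrow> bool" where
  "consistent A \<longleftrightarrow> (\<forall>l\<in>strips D. \<forall>m\<in>strips D. \<forall>i. addr l = addr m @ [i] \<longrightarrow> (-1 \<in> A l \<longleftrightarrow> 1 \<in> A m))"

lemma pr_in_level_set:
  assumes "consistent A" "m \<in> strips D" "z \<in> S m"
  shows "pr m z \<in> level_set A \<longleftrightarrow> snd z \<in> A m"
proof
  assume "pr m z \<in> level_set A"
  then obtain l w where "l \<in> strips D" "w \<in> S l" "snd w \<in> A l" "pr m z = pr l w"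
    by (auto simp: level_set_def)
  then show "snd z \<in> A m"
    using assms pr_eq_iff[of m l z w] by (auto simp: below_def consistent_def)
next
  assume "snd z \<in> A m"
  then show "pr m z \<in> level_set A" unfolding level_set_def using assms by blast
qed

lemma level_setI: "l \<in> strips D \<Longrightarrow> z \<in> S l \<Longrightarrow> snd z \<in> A l \<Longrightarrow> pr l z \<in> level_set A"
  unfolding level_set_def by blast

lemma level_set_subset: "level_set A \<subseteq> topspace (surface D)"
  by (auto simp: level_set_def topspace_surface)

lemma openin_level_set:
  assumes "consistent A" "\<And>l. l \<in> strips D \<Longrightarrow> open (A l)"
  shows "openin (surface D) (level_set A)"
  unfolding openin_surface
proof (intro conjI ballI level_set_subset)
  fix l assume l: "l \<in> strips D"
  have "{z \<in> S l. pr l z \<in> level_set A} = S l \<inter> (UNIV \<times> A l)"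
    using pr_in_level_set[OF assms(1) l] by auto
  then show "openin (top_of_set (S l)) {z \<in> S l. pr l z \<in> level_set A}"
    using assms(2)[OF l] by (simp add: openin_open_Int open_Times)
qed

lemma closedin_level_set:
  assumes "consistent A" "\<And>l. l \<in> strips D \<Longrightarrow> closed (A l)"
  shows "closedin (surface D) (level_set A)"
  unfolding closedin_surface
proof (intro conjI ballI level_set_subset)
  fix l assume l: "l \<in> strips D"
  have "{z \<in> S l. pr l z \<in> level_set A} = S l \<inter> (UNIV \<times> A l)"
    using pr_in_level_set[OF assms(1) l] by auto
  then show "closedin (top_of_set (S l)) {z \<in> S l. pr l z \<in> level_set A}"
    using assms(2)[OF l] by (simp add: closedin_closed_Int closed_Times)
qed

lemma saturation_level_set:
  assumes "consistent A"
  shows "saturation D (level_set A) \<subseteq> level_set A"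
proof
  fix p assume "p \<in> saturation D (level_set A)"
  then obtain \<omega> where \<omega>: "\<omega> \<in> leaves D" "\<omega> \<inter> level_set A \<noteq> {}" "p \<in> \<omega>"
    unfolding saturation_def by blast
  then obtain l z where l: "l \<in> strips D" "z \<in> S l" "p \<in> lf l z" "\<omega> = lf l z" using leavesE by metis
  obtain v where v: "v \<in> hleaf z" "pr l v \<in> level_set A" using \<omega>(2) l(4) unfolding lf_def by blast
  have "snd v \<in> A l" using pr_in_level_set[OF assms l(1)] hleaf_subset[OF l(2)] v by blast
  then have "snd z \<in> A l" using l(2) v(1) by (simp add: mem_hleaf_iff)
  moreover obtain w where "w \<in> hleaf z" "p = pr l w" using l(3) by (auto simp: lf_def)
  ultimately show "p \<in> level_set A"
    using l(1,2) by (auto simp: mem_hleaf_iff intro!: level_setI)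
qed

text \<open>The open level sets around the leaf are saturated, so the closures of their saturations
  stay in the closed level sets, and these shrink to the leaf.\<close>

lemma not_special_leafI:
  assumes l: "l \<in> strips D" "z \<in> S l"
    and cons: "\<And>e::real. 0 < e \<Longrightarrow> e < 1 \<Longrightarrow> consistent (V e) \<and> consistent (C e)"
    and op: "\<And>e m. 0 < e \<Longrightarrow> e < 1 \<Longrightarrow> open (V e m) \<and> closed (C e m) \<and> V e m \<subseteq> C e m"
    and z: "\<And>e. 0 < e \<Longrightarrow> snd z \<in> V e l"
    and sep: "\<And>m w. m \<in> strips D \<Longrightarrow> w \<in> S m \<Longrightarrow> pr m w \<notin> lf l z \<Longrightarrow> \<exists>e. 0 < e \<and> e < 1 \<and> snd w \<notin> C e m"
  shows "\<not> special_leaf D (lf l z)"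
proof -
  let ?I = "\<Inter>{surface D closure_of saturation D N |N. openin (surface D) N \<and> lf l z \<subseteq> N}"
  have "lf l z \<in> leaves D" using l by (rule lf_in_leaves)
  have "lf l z \<subseteq> ?I"
  proof (clarify)
    fix p N assume p: "p \<in> lf l z" and N: "openin (surface D) N" "lf l z \<subseteq> N"
    have "saturation D N \<subseteq> topspace (surface D)"
      using lf_subset by (auto simp: saturation_def leaves_eq)
    moreover have "p \<in> saturation D N"
      using p N \<open>lf l z \<in> leaves D\<close> by (auto simp: saturation_def)
    ultimately show "p \<in> surface D closure_of saturation D N"
      by (meson closure_of_subset subsetD)
  qed
  moreover have "?I \<subseteq> lf l z"
  proof
    fix p assume p: "p \<in> ?I"
    have cl: "p \<in> level_set (C e)" if e: "0 < e" "e < 1" for e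
    proof -
      have VC: "level_set (V e) \<subseteq> level_set (C e)" using op[OF e] by (auto simp: level_set_def) blast
      have "lf l z \<subseteq> level_set (V e)"
        using z[OF e(1)] l by (auto simp: lf_def mem_hleaf_iff intro!: level_setI)
      then have "p \<in> surface D closure_of saturation D (level_set (V e))"
        using p openin_level_set[of "V e"] cons[OF e] op[OF e] by blast
      moreover have "surface D closure_of saturation D (level_set (V e)) \<subseteq> level_set (C e)"
        using closedin_level_set[of "C e"] cons[OF e] op[OF e] saturation_level_set[of "V e"] VC
        by (intro closure_of_minimal) auto
      ultimately show ?thesis by blast
    qed
    have "p \<in> topspace (surface D)" using cl[of "1/2"] level_set_subset by auto
    then obtain m w where w: "m \<in> strips D" "w \<in> S m" "p = pr m w" by (auto simp: topspace_surface)
    show "p \<in> lf l z"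
    proof (rule ccontr)
      assume "p \<notin> lf l z"
      then obtain e where e: "0 < e" "e < 1" "snd w \<notin> C e m" using sep w by blast
      then show False using cl[OF e(1,2)] pr_in_level_set w cons[OF e(1,2)] by blast
    qed
  qed
  ultimately show ?thesis unfolding special_leaf_def by blast
qed

lemma not_special_interior:
  assumes l: "l \<in> strips D" "z \<in> S l" and z: "-1 < snd z" "snd z < 1"
  shows "\<not> special_leaf D (lf l z)"
proof -
  \<comment> \<open>The largest half-width for which the band stays between the boundary lines;
    scaled by \<open>e < 1\<close>, the closed band misses both lines and consistency at the seams
    is automatic.\<close>
  define d where "d = min (snd z + 1) (1 - snd z)"
  have d: "d > 0" "snd z - d \<ge> -1" "snd z + d \<le> 1" using z by (auto simp: d_def min_def)
  show ?thesis
  proof (rule not_special_leafI[OF l, where V = "\<lambda>e m. if m = l then {snd z - d * e<..<snd z + d * e} else {}"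
        and C = "\<lambda>e m. if m = l then {snd z - d * e..snd z + d * e} else {}"])
    fix e :: real assume e: "0 < e" "e < 1"
    then have "d * e < d" using d(1) by simp
    then have "-1 < snd z - d * e" "snd z + d * e < 1" using d by linarith+
    then show "consistent (\<lambda>m. if m = l then {snd z - d * e<..<snd z + d * e} else {}) \<and>
        consistent (\<lambda>m. if m = l then {snd z - d * e..snd z + d * e} else {})"
      by (auto simp: consistent_def)
  next
    fix e :: real assume "0 < e" then show "snd z \<in> (if l = l then {snd z - d * e<..<snd z + d * e} else {})"
      using d by simp
  next
    fix m w assume m: "m \<in> strips D" "w \<in> S m" "pr m w \<notin> lf l z"
    show "\<exists>e. 0 < e \<and> e < 1 \<and> snd w \<notin> (if m = l then {snd z - d * e..snd z + d * e} else {})"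
    proof (cases "m = l")
      case False
      then show ?thesis by (intro exI[of _ "1/2"]) simp
    next
      case True
      then have "snd w \<noteq> snd z" using m l z by (auto simp: lf_def mem_hleaf_iff)
      then have pos: "\<bar>snd w - snd z\<bar> > 0" by simp
      define e where "e = min (1/2) (\<bar>snd w - snd z\<bar> / (2 * d))"
      have e: "0 < e" "e < 1" using d(1) pos by (auto simp: e_def)
      have "d * e \<le> \<bar>snd w - snd z\<bar> / 2"
        using d(1) mult_left_mono[OF min.cobounded2[of "1/2" "\<bar>snd w - snd z\<bar> / (2 * d)"], of d]
        by (simp add: e_def)
      then have "d * e < \<bar>snd w - snd z\<bar>" by (rule le_less_trans) (use pos in simp)
      then have "snd w \<notin> {snd z - d * e..snd z + d * e}"
        by (cases "snd z \<le> snd w") auto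
      then show ?thesis using e True by (intro exI[of _ e]) simp
    qed
  qed auto
qed

text \<open>Nothing is glued to the lower leaf of the root, so one-sided bands in a single strip
  shrink to it.\<close>

lemma not_special_root_bottom:
  assumes l: "l \<in> strips D" "z \<in> S l" and z: "snd z = -1" "addr l = []"
  shows "\<not> special_leaf D (lf l z)"
proof (rule not_special_leafI[OF l, where V = "\<lambda>e m. if m = l then {..<-1 + e} else {}"
        and C = "\<lambda>e m. if m = l then {..-1 + e} else {}"])
  fix m w assume m: "m \<in> strips D" "w \<in> S m" "pr m w \<notin> lf l z"
  show "\<exists>e. 0 < e \<and> e < 1 \<and> snd w \<notin> (if m = l then {..-1 + e} else {})"
  proof (cases "m = l")
    case False
    then show ?thesis by (intro exI[of _ "1/2"]) simp
  next
    case True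
    then have "snd w \<noteq> -1" using m l z by (auto simp: lf_def mem_hleaf_iff)
    then have "snd w > -1" using model_level[OF m(2)] by simp
    then have "0 < (snd w + 1) / 3" "(snd w + 1) / 3 < 1" "\<not> snd w \<le> -1 + (snd w + 1) / 3"
      using model_level[OF m(2)] by (simp_all add: field_simps)
    then show ?thesis using True by (intro exI[of _ "(snd w + 1) / 3"]) simp
  qed
qed (use z in \<open>auto simp: consistent_def\<close>)

text \<open>A sole upper leaf is the limit of bands lying below it in \<open>l\<close> and, across
  the seam, above it in the child, if there is one.\<close>

lemma not_special_single_top:
  assumes l: "l \<in> strips D" "z \<in> S l" and z: "snd z = 1" "tops l = {\<lfloor>fst z\<rfloor>}"
  shows "\<not> special_leaf D (lf l z)"
proof -
  define ch where "ch m \<longleftrightarrow> (\<exists>i. addr m = addr l @ [i])" for m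
  have l_ch: "\<not> ch l" by (simp add: ch_def)
  have cons: "consistent (\<lambda>m. if m = l then A else if ch m then B else {})"
    if "1 \<in> A" "-1 \<notin> A" "-1 \<in> B" "1 \<notin> B" for A B
    using that l_ch addr_inj l(1) by (auto simp: consistent_def ch_def)
  show ?thesis
  proof (rule not_special_leafI[OF l,
        where V = "\<lambda>e m. if m = l then {1 - e<..} else if ch m then {..<-1 + e} else {}"
          and C = "\<lambda>e m. if m = l then {1 - e..} else if ch m then {..-1 + e} else {}"])
    fix m w assume m: "m \<in> strips D" "w \<in> S m" "pr m w \<notin> lf l z"
    have top: "w \<in> hleaf z" if "w \<in> S l" "snd w = 1" for w
      using that top_in_J[OF that] l z by (auto simp: mem_hleaf_iff)
    consider "m = l" | "ch m" "m \<noteq> l" | "\<not> ch m" "m \<noteq> l" by blast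
    then show "\<exists>e. 0 < e \<and> e < 1 \<and>
      snd w \<notin> (if m = l then {1 - e..} else if ch m then {..-1 + e} else {})"
    proof cases
      case 1
      then have "snd w \<noteq> 1" using m top[of w] unfolding lf_def by blast
      then have "snd w < 1" using model_level[OF m(2)] by simp
      then have "0 < (1 - snd w) / 3" "(1 - snd w) / 3 < 1" "\<not> 1 - (1 - snd w) / 3 \<le> snd w"
        using model_level[OF m(2)] by (simp_all add: field_simps)
      then show ?thesis using 1 by (intro exI[of _ "(1 - snd w) / 3"]) simp
    next
      case 2
      have "snd w \<noteq> -1"
      proof
        assume "snd w = -1"
        moreover obtain i where "addr m = addr l @ [i]" using 2 by (auto simp: ch_def)
        ultimately have "below m w l (fst w + of_int i - 1, 1)" by (auto simp: below_def)
        then have "pr m w \<in> lf l z"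
          using below_pr[OF _ m(1) l(1) m(2)] top by (auto simp: lf_def)
        then show False using m(3) by simp
      qed
      then have "snd w > -1" using model_level[OF m(2)] by simp
      then have "0 < (snd w + 1) / 3" "(snd w + 1) / 3 < 1" "\<not> snd w \<le> -1 + (snd w + 1) / 3"
        using model_level[OF m(2)] by (simp_all add: field_simps)
      then show ?thesis using 2 by (intro exI[of _ "(snd w + 1) / 3"]) simp
    next
      case 3
      then show ?thesis by (intro exI[of _ "1/2"]) simp
    qed
  qed (use z in \<open>auto intro!: cons\<close>)
qed

text \<open>The leaves just below the upper line run under all upper intervals. The saturation of
  any neighbourhood of one upper leaf therefore accumulates at every other upper leaf of the
  strip.\<close>

lemma special_top:
  assumes l: "l \<in> strips D" "z \<in> S l" and z: "snd z = 1" "tops l \<noteq> {\<lfloor>fst z\<rfloor>}"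
  shows "special_leaf D (lf l z)"
proof -
  obtain j where j: "j \<in> tops l" "j \<noteq> \<lfloor>fst z\<rfloor>" using z(2) top_in_J[OF l(2) z(1)] by auto
  let ?v = "(of_int j + 1/4, 1) :: real \<times> real"
  have v: "?v \<in> S l" using j(1) J_mid by (auto simp: mem_model)
  have "pr l ?v \<notin> lf l z"
  proof
    assume "pr l ?v \<in> lf l z"
    then obtain w where w: "w \<in> hleaf z" "pr l ?v = pr l w" unfolding lf_def by blast
    then have "?v = w" using pr_inj[OF l(1) v] hleaf_subset[OF l(2)] by blast
    then have "?v \<in> hleaf z" using w by blast
    then show False using j(2) z(1) J_floor[OF J_mid[of j]] l(2) by (simp add: mem_hleaf_iff)
  qed
  moreover have "pr l ?v \<in> surface D closure_of saturation D N" if N: "openin (surface D) N" "lf l z \<subseteq> N" for N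
    unfolding in_closure_of
  proof (intro conjI allI impI pr_in[OF l(1) v])
    fix O' assume O': "pr l ?v \<in> O' \<and> openin (surface D) O'"
    have near: "\<exists>d>0. \<forall>t. 1 - d < t \<and> t < 1 \<longrightarrow> pr l (x, t) \<in> U"
      if U: "openin (surface D) U" "pr l (x, 1) \<in> U" "(x, 1) \<in> S l" for U x
    proof -
      have "openin (top_of_set (S l)) {w \<in> S l. pr l w \<in> U}" using U(1) l(1) by (simp add: openin_surface)
      moreover have "(x, 1) \<in> {w \<in> S l. pr l w \<in> U}" using U(2,3) by simp
      ultimately obtain d where d: "d > 0" "ball (x, 1) d \<inter> S l \<subseteq> {w \<in> S l. pr l w \<in> U}"
        unfolding openin_contains_ball by meson
      have "pr l (x, t) \<in> U" if "1 - min d 1 < t" "t < 1" for t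
      proof -
        have "(x, t) \<in> ball (x, 1) d" using that by (simp add: dist_prod_def dist_real_def)
        moreover have "(x, t) \<in> S l" using that by (intro interior_model) auto
        ultimately show ?thesis using d(2) by blast
      qed
      then show ?thesis using d(1) by (intro exI[of _ "min d 1"]) auto
    qed
    have z_eq: "z = (fst z, 1)" using z(1) by (simp add: prod_eq_iff)
    then have "pr l (fst z, 1) \<in> N" "(fst z, 1) \<in> S l" using N(2) pr_in_lf[OF l(2)] l(2) by auto
    then obtain d where d: "d > 0" "\<And>t. 1 - d < t \<Longrightarrow> t < 1 \<Longrightarrow> pr l (fst z, t) \<in> N"
      using near[OF N(1)] by blast
    obtain d' where d': "d' > 0" "\<And>t. 1 - d' < t \<Longrightarrow> t < 1 \<Longrightarrow> pr l (of_int j + 1/4, t) \<in> O'"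
      using near[of O' "of_int j + 1/4"] O' v by blast
    \<comment> \<open>This level is above both thresholds, and the cap by 1 keeps it at least
      \<open>1/2\<close>, inside the strip.\<close>
    define t where "t = 1 - min (min d d') 1 / 2"
    have t: "1 - d < t" "1 - d' < t" "t < 1" "-1 < t" using d(1) d'(1) by (auto simp: t_def)
    have "(fst z, t) \<in> S l" using t by (intro interior_model)
    then have "lf l (fst z, t) \<subseteq> saturation D N"
      using d(2)[OF t(1,3)] pr_in_lf l(1) unfolding saturation_def leaves_eq by blast
    moreover have "pr l (of_int j + 1/4, t) \<in> lf l (fst z, t)"
      using t by (auto simp: lf_def hleaf_def)
    ultimately show "\<exists>y. y \<in> saturation D N \<and> y \<in> O'" using d'(2)[OF t(2,3)] by blast
  qed
  ultimately show ?thesis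
    unfolding special_leaf_def leaves_eq using l by blast
qed

text \<open>The lower leaf of a child coincides with an upper leaf of its parent, so upper leaves
  account for all special leaves.\<close>

lemma special_leaf_iff:
  "special_leaf D \<omega> \<longleftrightarrow> (\<exists>l\<in>strips D. \<exists>z\<in>S l. \<omega> = lf l z \<and> snd z = 1 \<and> tops l \<noteq> {\<lfloor>fst z\<rfloor>})"
proof
  assume sp: "special_leaf D \<omega>"
  then obtain l z where l: "l \<in> strips D" "z \<in> S l" "\<omega> = lf l z"
    by (auto simp: special_leaf_def leaves_eq)
  consider "-1 < snd z" "snd z < 1" | "snd z = 1" | "snd z = -1" "addr l = []" | "snd z = -1" "addr l \<noteq> []"
    using model_level[OF l(2)] by fastforce
  then show "\<exists>l\<in>strips D. \<exists>z\<in>S l. \<omega> = lf l z \<and> snd z = 1 \<and> tops l \<noteq> {\<lfloor>fst z\<rfloor>}"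
  proof cases
    case 1
    then show ?thesis using not_special_interior l sp by blast
  next
    case 2
    then show ?thesis using not_special_single_top l sp by blast
  next
    case 3
    then show ?thesis using not_special_root_bottom l sp by blast
  next
    case 4
    obtain a i where a: "addr l = a @ [i]" using 4 by (metis rev_exhaust)
    note p = parent[OF l(1) a]
    define w where "w = (fst z + of_int i - 1, 1 :: real)"
    have "below l z (node a) w" using a 4 p by (auto simp: below_def w_def)
    then have "w \<in> S (node a)" "lf l z = lf (node a) w"
      using below_pr[OF _ l(1) p(1) l(2)] lf_below[OF _ l(1) p(1) l(2)] by auto
    moreover have "snd w = 1" by (simp add: w_def)
    ultimately show ?thesis
      using not_special_single_top[OF p(1)] sp l(3) p(1) by metis
  qed
next
  assume "\<exists>l\<in>strips D. \<exists>z\<in>S l. \<omega> = lf l z \<and> snd z = 1 \<and> tops l \<noteq> {\<lfloor>fst z\<rfloor>}"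
  then show "special_leaf D \<omega>" using special_top by blast
qed

lemma special_lf_top_iff:
  assumes l: "l \<in> strips D" "z \<in> S l" "snd z = 1"
  shows "special_leaf D (lf l z) \<longleftrightarrow> tops l \<noteq> {\<lfloor>fst z\<rfloor>}"
  using special_top[OF l] not_special_single_top[OF l] by blast

text \<open>A leaf properly contained in an upper boundary is an upper leaf with companions, hence
  special, and conversely; the lower boundary is a single leaf and contributes none. What remains of
  reducedness is that glued leaves be special, that is, have companions on the upper side.\<close>

lemma reduced_iff:
  "reduced D \<longleftrightarrow> (\<forall>l\<in>strips D. \<forall>m\<in>strips D. \<forall>i. addr l = addr m @ [i] \<longrightarrow> tops m \<noteq> {i})"
proof -
  let ?seam = "\<lambda>\<omega>. \<exists>\<gamma>\<in>seams D. \<omega> = seam_leaf D \<gamma>"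
  let ?part = "\<lambda>\<omega>. \<exists>l\<in>strips D. \<omega> \<subset> leaf D l (lower_boundary (strip D l)) \<or>
                      \<omega> \<subset> leaf D l (upper_boundary (strip D l))"
  let ?mid = "\<lambda>i. (of_int i + 1/4, 1) :: real \<times> real"
  have mid: "?mid i \<in> S m" "hleaf (?mid i) = J i \<times> {1}" "\<lfloor>fst (?mid i)\<rfloor> = i"
    if "i \<in> tops m" for i m
    using that J_mid[of i] J_floor[OF J_mid[of i]] by (auto simp: mem_model hleaf_def)
  have seam: "?seam \<omega> \<longleftrightarrow> (\<exists>l\<in>strips D. \<exists>m\<in>strips D. \<exists>i. addr l = addr m @ [i] \<and> \<omega> = lf m (?mid i))" for \<omega>
  proof -
    have lower: "leaf D l (J 1 \<times> {-1}) = lf m (?mid i)"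
      if "l \<in> strips D" "m \<in> strips D" "addr l = addr m @ [i]" for l m i
    proof -
      have z: "(1 + 1/4, -1) \<in> S l" "hleaf (1 + 1/4, -1) = J 1 \<times> {-1}"
        using J_mid[of 1] J_floor[OF J_mid[of 1]] by (auto simp: mem_model hleaf_def)
      have "below l (1 + 1/4, -1) m (?mid i)" using that by (auto simp: below_def)
      from lf_below[OF this that(1,2) z(1)] show ?thesis unfolding leaf_eq lf_def z(2) .
    qed
    have "?seam \<omega> \<longleftrightarrow> (\<exists>x\<in>(\<lambda>\<gamma>. (lower_side D \<gamma>, upper_side D \<gamma>)) ` seams D.
        \<omega> = leaf D (fst (fst x)) (snd (fst x)))"
      by (simp add: seam_leaf_def)
    also have "\<dots> \<longleftrightarrow> (\<exists>l\<in>strips D. \<exists>m\<in>strips D. \<exists>i. addr l = addr m @ [i] \<and> \<omega> = leaf D l (J 1 \<times> {-1}))"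
      unfolding seams by auto
    finally have *: "?seam \<omega> \<longleftrightarrow> (\<exists>l\<in>strips D. \<exists>m\<in>strips D. \<exists>i. addr l = addr m @ [i] \<and> \<omega> = leaf D l (J 1 \<times> {-1}))" .
    show ?thesis
      unfolding * by (intro bex_cong[OF refl] ex_cong conj_cong refl) (simp only: lower)
  qed
  have part: "?part \<omega> \<longleftrightarrow> special_leaf D \<omega>" if \<omega>: "\<omega> \<in> leaves D" for \<omega>
  proof
    assume "?part \<omega>"
    then obtain l where l: "l \<in> strips D"
      and "\<omega> \<subset> leaf D l (lower_boundary (strip D l)) \<or> \<omega> \<subset> leaf D l (upper_boundary (strip D l))"
      by blast
    then have sub: "\<omega> \<subset> pr l ` (J 1 \<times> {-1}) \<or> \<omega> \<subset> pr l ` (\<Union>i\<in>tops l. J i \<times> {1})"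
      by (simp add: leaf_eq strip_model lower_boundary_model upper_boundary_model)
    obtain p where p: "p \<in> \<omega>" using \<omega> pr_in_lf by (auto simp: leaves_eq)
    show "special_leaf D \<omega>"
    proof (cases "\<omega> \<subset> pr l ` (J 1 \<times> {-1})")
      case True
      then obtain z where z: "z \<in> J 1 \<times> {-1}" "p = pr l z" using p by blast
      then have zS: "z \<in> S l" "hleaf z = J 1 \<times> {-1}" by (auto simp: mem_model hleaf_def J_floor)
      then have "\<omega> = lf l z" using leaf_eqI[OF \<omega> l zS(1)] z p by blast
      then show ?thesis using True zS by (auto simp: lf_def)
    next
      case False
      with sub have sub': "\<omega> \<subset> pr l ` (\<Union>i\<in>tops l. J i \<times> {1})" by (simp only: simp_thms)
      from psubsetD[OF sub' p] obtain z where "p = pr l z" "z \<in> (\<Union>i\<in>tops l. J i \<times> {1})" by (rule imageE)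
      then obtain i where z: "i \<in> tops l" "z \<in> J i \<times> {1}" "p = pr l z" by (elim UN_E)
      then have zS: "z \<in> S l" "hleaf z = J i \<times> {1}" "snd z = 1" "\<lfloor>fst z\<rfloor> = i"
        by (auto simp: mem_model hleaf_def J_floor)
      then have eq: "\<omega> = lf l z" using leaf_eqI[OF \<omega> l zS(1)] z p by blast
      have "tops l \<noteq> {i}"
      proof
        assume "tops l = {i}"
        then have "(\<Union>i\<in>tops l. J i \<times> {1 :: real}) = hleaf z" using zS by simp
        then show False using sub' unfolding eq lf_def by simp
      qed
      then show ?thesis using special_top[OF l zS(1,3)] zS(4) eq by simp
    qed
  next
    assume "special_leaf D \<omega>"
    then obtain l z where l: "l \<in> strips D" "z \<in> S l" "\<omega> = lf l z" "snd z = 1" "tops l \<noteq> {\<lfloor>fst z\<rfloor>}"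
      by (auto simp: special_leaf_iff)
    obtain j where j: "j \<in> tops l" "j \<noteq> \<lfloor>fst z\<rfloor>" using l(5) top_in_J[OF l(2,4)] by auto
    have hz: "hleaf z = J \<lfloor>fst z\<rfloor> \<times> {1}" using l(4) by (simp add: hleaf_def)
    have "\<omega> \<subseteq> pr l ` (\<Union>i\<in>tops l. J i \<times> {1})"
      unfolding l(3) lf_def hz using top_in_J[OF l(2,4)] by blast
    moreover have "pr l (?mid j) \<notin> \<omega>"
    proof
      assume "pr l (?mid j) \<in> \<omega>"
      then obtain w where w: "w \<in> hleaf z" "pr l (?mid j) = pr l w" unfolding l(3) lf_def by blast
      then have "?mid j = w" using pr_inj[OF l(1) mid(1)[OF j(1)]] hleaf_subset[OF l(2)] by blast
      then have "?mid j \<in> hleaf z" using w by blast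
      then show False using j(2) mid(3)[OF j(1)] l(2,4) by (simp add: mem_hleaf_iff)
    qed
    moreover have "pr l (?mid j) \<in> pr l ` (\<Union>i\<in>tops l. J i \<times> {1})"
      using j(1) J_mid by blast
    ultimately have "\<omega> \<subset> leaf D l (upper_boundary (strip D l))"
      unfolding leaf_eq strip_model[OF l(1)] upper_boundary_model by blast
    then show "?part \<omega>" using l(1) by blast
  qed
  have "reduced D \<longleftrightarrow> (\<forall>\<omega>\<in>leaves D. ?seam \<omega> \<longrightarrow> special_leaf D \<omega>)"
    unfolding reduced_def using part by blast
  also have "\<dots> \<longleftrightarrow> (\<forall>l\<in>strips D. \<forall>m\<in>strips D. \<forall>i. addr l = addr m @ [i] \<longrightarrow> special_leaf D (lf m (?mid i)))"
    unfolding seam using lf_in_leaves[OF _ mid(1)[OF child_tops]] by blast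
  also have "\<dots> \<longleftrightarrow> (\<forall>l\<in>strips D. \<forall>m\<in>strips D. \<forall>i. addr l = addr m @ [i] \<longrightarrow> tops m \<noteq> {i})"
  proof (intro ball_cong refl all_cong)
    fix l m i assume "l \<in> strips D" "m \<in> strips D" "addr l = addr m @ [i]"
    note i = child_tops[OF this]
    show "special_leaf D (lf m (?mid i)) \<longleftrightarrow> tops m \<noteq> {i}"
      using special_lf_top_iff[OF \<open>m \<in> strips D\<close> mid(1)[OF i]] mid(3)[OF i] by simp
  qed
  finally show ?thesis .
qed

end

section \<open>Foliated homeomorphisms\<close>

text \<open>A value skipped between \<open>\<pi> i\<close> and \<open>\<pi> (i + 1)\<close> would
  belong to \<open>\<Delta>'\<close> by convexity, and its preimage would lie strictly between
  \<open>i\<close> and \<open>i + 1\<close>.\<close>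

lemma shift_of_strict_mono_bij:
  fixes \<pi> :: "int \<Rightarrow> int"
  assumes bij: "bij_betw \<pi> \<Delta> \<Delta>'" and mono: "\<And>i j. i \<in> \<Delta> \<Longrightarrow> j \<in> \<Delta> \<Longrightarrow> i < j \<Longrightarrow> \<pi> i < \<pi> j"
    and conv: "\<And>i j x. i \<in> \<Delta> \<Longrightarrow> j \<in> \<Delta> \<Longrightarrow> i \<le> x \<Longrightarrow> x \<le> j \<Longrightarrow> x \<in> \<Delta>"
      "\<And>i j x. i \<in> \<Delta>' \<Longrightarrow> j \<in> \<Delta>' \<Longrightarrow> i \<le> x \<Longrightarrow> x \<le> j \<Longrightarrow> x \<in> \<Delta>'"
  shows "\<exists>k. (\<Delta> = {} \<longrightarrow> k = 0) \<and> (\<forall>i\<in>\<Delta>. \<pi> i = i + k)"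
proof (cases "\<Delta> = {}")
  case False
  have less: "i < j" if "i \<in> \<Delta>" "j \<in> \<Delta>" "\<pi> i < \<pi> j" for i j
    using that mono[of j i] by (cases i j rule: linorder_cases) auto
  have step: "\<pi> (i + 1) = \<pi> i + 1" if "i \<in> \<Delta>" "i + 1 \<in> \<Delta>" for i
  proof (rule ccontr)
    assume ne: "\<pi> (i + 1) \<noteq> \<pi> i + 1"
    have "\<pi> i < \<pi> (i + 1)" using mono that by simp
    then have "\<pi> i \<le> \<pi> i + 1" "\<pi> i + 1 \<le> \<pi> (i + 1)" by simp_all
    moreover have "\<pi> i \<in> \<Delta>'" "\<pi> (i + 1) \<in> \<Delta>'" using bij that by (auto simp: bij_betw_def)
    ultimately have "\<pi> i + 1 \<in> \<Delta>'" using conv(2) by blast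
    then obtain x where x: "x \<in> \<Delta>" "\<pi> x = \<pi> i + 1" using bij by (auto simp: bij_betw_def)
    have "i < x" using less[OF that(1) x(1)] x(2) by simp
    moreover have "x < i + 1" using less[OF x(1) that(2)] x(2) ne \<open>\<pi> i < \<pi> (i + 1)\<close> by simp
    ultimately show False by simp
  qed
  have up: "\<pi> (i + int n) = \<pi> i + int n" if "i \<in> \<Delta>" "i + int n \<in> \<Delta>" for i n
    using that(2)
  proof (induction n)
    case (Suc n)
    have "i + int n \<in> \<Delta>" using conv(1)[OF that(1) Suc.prems] by simp
    then show ?case using Suc step[of "i + int n"] by (simp add: algebra_simps)
  qed simp
  obtain i where i: "i \<in> \<Delta>" using False by blast
  have "\<pi> j = j + (\<pi> i - i)" if "j \<in> \<Delta>" for j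
  proof (cases "i \<le> j")
    case True
    then show ?thesis using up[of i "nat (j - i)"] i that by simp
  next
    case False
    then show ?thesis using up[of j "nat (i - j)"] i that by simp
  qed
  then show ?thesis using False by blast
qed auto

lemma index_sets_convex:
  "\<Delta> \<in> index_sets \<Longrightarrow> i \<in> \<Delta> \<Longrightarrow> j \<in> \<Delta> \<Longrightarrow> i \<le> x \<Longrightarrow> x \<le> j \<Longrightarrow> x \<in> \<Delta>"
  by (auto simp: index_sets_def)

lemma index_sets_singleton: "{i} \<in> index_sets \<Longrightarrow> i = 1"
proof -
  assume "{i} \<in> index_sets"
  then consider n where "{i} = {1..int n}" | "{i} = {1..}" | "{i} = {..-1}" | "{i} = UNIV"
    by (auto simp: index_sets_def)
  then show "i = 1"
  proof cases
    case 1
    then have "i \<in> {1..int n}" by blast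
    then have "1 \<in> {1..int n}" by simp
    then have "1 \<in> {i}" using 1 by simp
    then show ?thesis by simp
  next
    case 2
    then have "1 \<in> {i}" by simp
    then show ?thesis by simp
  next
    case 3
    then have "-1 \<in> {i}" "-2 \<in> {i}" by simp_all
    then show ?thesis by simp
  next
    case 4
    then have "1 \<in> {i}" by simp
    then show ?thesis by simp
  qed
qed

text \<open>Points over the same first coordinate that tend to \<open>z\<close> from the interior.
  The summand 2 makes the factor positive already for \<open>n = 0\<close>, so the sequence stays on
  the side of level 0 on which \<open>z\<close> lies.\<close>

definition approach :: "real \<times> real \<Rightarrow> nat \<Rightarrow> real \<times> real" where
  "approach z n = (fst z, snd z * (1 - 1 / (real n + 2)))"

lemma approach_in:
  assumes "z \<in> model \<Delta>"
  shows "-1 < snd (approach z n)" "snd (approach z n) < 1" "approach z n \<in> model \<Delta>"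
    "fst (approach z n) = fst z"
proof -
  let ?c = "1 - 1 / (real n + 2)"
  have "0 < ?c" "?c < 1" by (auto simp: field_simps)
  have "\<bar>snd z\<bar> \<le> 1" using model_level[OF assms] by (simp add: abs_le_iff)
  then have "\<bar>snd z\<bar> * ?c \<le> 1 * ?c" by (rule mult_right_mono) (use \<open>0 < ?c\<close> in simp)
  then have "\<bar>snd z\<bar> * ?c < 1" using \<open>?c < 1\<close> by (simp only: mult_1)
  then have "\<bar>snd z * ?c\<bar> < 1" using \<open>0 < ?c\<close> by (simp add: abs_mult)
  then show *: "-1 < snd (approach z n)" "snd (approach z n) < 1" by (auto simp: approach_def)
  show "approach z n \<in> model \<Delta>" using * interior_model by (metis prod.collapse)
  show "fst (approach z n) = fst z" by (simp add: approach_def)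
qed

lemma approach_tendsto:
  assumes "z \<in> model \<Delta>" "continuous_on (model \<Delta>) F"
  shows "(\<lambda>n. F (approach z n)) \<longlonglongrightarrow> F z"
proof -
  have "(\<lambda>n. 1 / (real n + 2)) \<longlonglongrightarrow> 0" by real_asymp
  then have "(\<lambda>n. (fst z, snd z * (1 - 1 / (real n + 2)))) \<longlonglongrightarrow> (fst z, snd z * (1 - 0))"
    by (intro tendsto_intros)
  then have "approach z \<longlonglongrightarrow> z" by (simp add: approach_def[abs_def])
  from continuous_on_tendsto_compose[OF assms(2) this assms(1)]
  show ?thesis by (simp add: approach_in(3)[OF assms(1)])
qed

section \<open>The group of foliated homeomorphisms\<close>

context striped_tree
begin

abbreviation H where "H \<equiv> carrier (foliated_homeos D)"

lemma H_iff: "h \<in> H \<longleftrightarrow> h \<in> Bij (topspace (surface D)) \<and> homeomorphic_map (surface D) (surface D) h \<and>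
    (\<forall>\<omega>\<in>leaves D. h ` \<omega> \<in> leaves D) \<and> (\<forall>u v. leaf_less D u v \<longrightarrow> leaf_less D (h u) (h v))"
  by (auto simp: foliated_homeos_def)

lemma leaf_less_same_leaf:
  assumes "leaf_less D u v"
  obtains \<omega> where "\<omega> \<in> leaves D" "u \<in> \<omega>" "v \<in> \<omega>" "u \<noteq> v" "\<not> leaf_less D v u"
proof -
  obtain l z w where l: "l \<in> strips D" "z \<in> S l" "w \<in> hleaf z" "fst z < fst w" "u = pr l z" "v = pr l w"
    using assms unfolding leaf_less_pr_iff by blast
  have w: "w \<in> S l" using hleaf_subset l(2,3) by blast
  have "u \<in> lf l z" "v \<in> lf l z" using l pr_in_lf unfolding lf_def by auto
  moreover have "u \<noteq> v" using pr_inj[OF l(1,2) w] l by auto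
  moreover have "\<not> leaf_less D v u" using leaf_less_pr[OF l(1) w l(2)] l by auto
  ultimately show ?thesis using that lf_in_leaves[OF l(1,2)] by blast
qed

lemma leaf_less_linear:
  assumes "\<omega> \<in> leaves D" "u \<in> \<omega>" "v \<in> \<omega>" "u \<noteq> v"
  shows "leaf_less D u v \<or> leaf_less D v u"
proof -
  obtain l z where l: "l \<in> strips D" "z \<in> S l" "\<omega> = lf l z" using assms(1) by (rule leavesE)
  obtain x y where xy: "x \<in> hleaf z" "y \<in> hleaf z" "u = pr l x" "v = pr l y"
    using assms(2,3) l(3) unfolding lf_def by blast
  have S: "x \<in> S l" "y \<in> S l" using hleaf_subset l(2) xy by blast+
  have "snd x = snd y" using xy(1,2) l(2) by (simp add: mem_hleaf_iff)
  then have "fst x \<noteq> fst y" using assms(4) xy(3,4) by (metis prod_eqI)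
  moreover have "y \<in> hleaf x" "x \<in> hleaf y" using xy hleaf_eq by metis+
  ultimately show ?thesis using leaf_less_pr[OF l(1)] S xy by (metis linorder_neqE)
qed

lemma leaves_subset: "\<omega> \<in> leaves D \<Longrightarrow> \<omega> \<subseteq> topspace (surface D)"
  using lf_subset leavesE by metis

lemma leaf_nonempty: "\<omega> \<in> leaves D \<Longrightarrow> \<omega> \<noteq> {}"
  using pr_in_lf leavesE by (metis empty_iff)

lemma point_in_leaf: "p \<in> topspace (surface D) \<Longrightarrow> \<exists>\<omega>\<in>leaves D. p \<in> \<omega>"
  unfolding topspace_surface using pr_in_lf lf_in_leaves by blast

lemma H_bij: "h \<in> H \<Longrightarrow> bij_betw h (topspace (surface D)) (topspace (surface D))"
  by (simp add: H_iff Bij_def)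

lemma H_leaf: "h \<in> H \<Longrightarrow> \<omega> \<in> leaves D \<Longrightarrow> h ` \<omega> \<in> leaves D"
  by (simp add: H_iff)

lemma H_less: "h \<in> H \<Longrightarrow> leaf_less D u v \<Longrightarrow> leaf_less D (h u) (h v)"
  by (simp add: H_iff)

lemma H_homeo: "h \<in> H \<Longrightarrow> homeomorphic_map (surface D) (surface D) h"
  by (simp add: H_iff)

text \<open>The definition constrains \<open>h\<close> only in the forward direction. The inverse
  maps leaves to leaves because leaves partition the surface, and it preserves their orientation
  because the order on a leaf is total.\<close>

lemma H_inverse:
  assumes h: "h \<in> H"
  shows "(\<lambda>x\<in>topspace (surface D). inv_into (topspace (surface D)) h x) \<in> H"
proof -
  let ?X = "topspace (surface D)"
  let ?g = "\<lambda>x\<in>?X. inv_into ?X h x"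
  have inj: "inj_on h ?X" and img: "h ` ?X = ?X" using H_bij[OF h] by (auto simp: bij_betw_def)
  have gh: "?g (h x) = x" if "x \<in> ?X" for x using that inj img by (auto simp: inv_into_f_f)
  have hg: "h (?g x) = x" "?g x \<in> ?X" if "x \<in> ?X" for x
    using that img by (simp_all add: f_inv_into_f inv_into_into)
  have g_Bij: "?g \<in> Bij ?X" using h by (intro restrict_inv_into_Bij) (simp add: H_iff)
  have "homeomorphic_maps (surface D) (surface D) h ?g"
  proof -
    obtain g' where g': "homeomorphic_maps (surface D) (surface D) h g'"
      using H_homeo[OF h] by (auto simp: homeomorphic_map_maps)
    have "g' x = ?g x" if "x \<in> ?X" for x
    proof -
      have "g' (h (?g x)) = ?g x" using g' hg(2)[OF that] unfolding homeomorphic_maps_def by blast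
      then show ?thesis unfolding hg(1)[OF that] .
    qed
    then show ?thesis by (rule homeomorphic_maps_eq[OF g' refl])
  qed
  then have "homeomorphic_maps (surface D) (surface D) ?g h" by (rule iffD1[OF homeomorphic_maps_sym])
  then have homeo: "homeomorphic_map (surface D) (surface D) ?g"
    unfolding homeomorphic_map_maps by blast
  have g_leaf: "\<exists>\<omega>'\<in>leaves D. \<omega> = h ` \<omega>' \<and> ?g ` \<omega> = \<omega>'" if \<omega>: "\<omega> \<in> leaves D" for \<omega>
  proof -
    obtain p where p: "p \<in> \<omega>" using leaf_nonempty[OF \<omega>] by blast
    then have "p \<in> ?X" using leaves_subset[OF \<omega>] by blast
    then obtain \<omega>' where \<omega>': "\<omega>' \<in> leaves D" "?g p \<in> \<omega>'" using point_in_leaf hg(2) by blast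
    have "h (?g p) \<in> h ` \<omega>'" using \<omega>'(2) by (rule imageI)
    then have "p \<in> h ` \<omega>'" unfolding hg(1)[OF \<open>p \<in> ?X\<close>] .
    then have eq: "\<omega> = h ` \<omega>'" using leaves_disjoint[OF \<omega> H_leaf[OF h \<omega>'(1)]] p by blast
    have "(\<lambda>x. ?g (h x)) ` \<omega>' = (\<lambda>x. x) ` \<omega>'"
      by (rule image_cong[OF refl gh]) (rule subsetD[OF leaves_subset[OF \<omega>'(1)]])
    then have "?g ` h ` \<omega>' = \<omega>'" by (simp only: image_image image_ident)
    then show ?thesis using eq \<omega>'(1) by blast
  qed
  have "leaf_less D (?g u) (?g v)" if uv: "leaf_less D u v" for u v
  proof -
    obtain \<omega> where \<omega>: "\<omega> \<in> leaves D" "u \<in> \<omega>" "v \<in> \<omega>" "u \<noteq> v" "\<not> leaf_less D v u"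
      using uv by (rule leaf_less_same_leaf)
    have X: "u \<in> ?X" "v \<in> ?X" using leaves_subset \<omega> by blast+
    obtain \<omega>' where \<omega>': "\<omega>' \<in> leaves D" "?g ` \<omega> = \<omega>'" using g_leaf[OF \<omega>(1)] by blast
    have "h (?g u) \<noteq> h (?g v)" unfolding hg(1)[OF X(1)] hg(1)[OF X(2)] by (rule \<omega>(4))
    then have "?g u \<noteq> ?g v" by metis
    then have "leaf_less D (?g u) (?g v) \<or> leaf_less D (?g v) (?g u)"
      using leaf_less_linear[OF \<omega>'(1)] \<omega>'(2) \<omega>(2,3) by blast
    moreover have "\<not> leaf_less D (?g v) (?g u)"
      using H_less[OF h, of "?g v" "?g u"] \<omega>(5) unfolding hg(1)[OF X(1)] hg(1)[OF X(2)] by blast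
    ultimately show ?thesis by blast
  qed
  then show ?thesis using g_Bij homeo g_leaf unfolding H_iff by blast
qed

lemma H_compose:
  assumes "h \<in> H" "g \<in> H"
  shows "compose (topspace (surface D)) h g \<in> H"
proof -
  let ?X = "topspace (surface D)"
  have eq: "compose ?X h g x = h (g x)" if "x \<in> ?X" for x using that by (simp add: compose_def)
  have "homeomorphic_map (surface D) (surface D) (h \<circ> g)"
    using homeomorphic_map_compose[OF H_homeo[OF assms(2)] H_homeo[OF assms(1)]] .
  then have "homeomorphic_map (surface D) (surface D) (compose ?X h g)"
    by (rule homeomorphic_map_eq) (simp add: eq)
  moreover have "compose ?X h g ` \<omega> \<in> leaves D" if "\<omega> \<in> leaves D" for \<omega>
  proof -
    have "compose ?X h g ` \<omega> = (\<lambda>x. h (g x)) ` \<omega>"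
      by (rule image_cong[OF refl eq]) (rule subsetD[OF leaves_subset[OF that]])
    then have "compose ?X h g ` \<omega> = h ` g ` \<omega>" by (simp only: image_image)
    then show ?thesis using H_leaf[OF assms(1) H_leaf[OF assms(2) that]] by (simp only:)
  qed
  moreover have "leaf_less D (compose ?X h g u) (compose ?X h g v)" if uv: "leaf_less D u v" for u v
  proof -
    obtain \<omega> where "\<omega> \<in> leaves D" "u \<in> \<omega>" "v \<in> \<omega>" using uv by (rule leaf_less_same_leaf)
    then have "u \<in> ?X" "v \<in> ?X" using leaves_subset by blast+
    then show ?thesis
      using H_less[OF assms(1) H_less[OF assms(2) uv]] by (simp only: eq)
  qed
  moreover have "compose ?X h g \<in> Bij ?X"
    by (rule compose_Bij) (use assms in \<open>simp_all only: H_iff\<close>)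
  ultimately show ?thesis unfolding H_iff by (intro conjI ballI allI impI)
qed

lemma H_id: "(\<lambda>x\<in>topspace (surface D). x) \<in> H"
proof -
  let ?X = "topspace (surface D)"
  have "homeomorphic_map (surface D) (surface D) (\<lambda>x\<in>?X. x)"
    by (rule homeomorphic_map_eq[of _ _ id]) (simp_all add: homeomorphic_map_id)
  moreover have "(\<lambda>x\<in>?X. x) ` \<omega> = \<omega>" if "\<omega> \<in> leaves D" for \<omega>
  proof -
    have "(\<lambda>x\<in>?X. x) ` \<omega> = (\<lambda>x. x) ` \<omega>"
      by (rule image_cong[OF refl]) (use leaves_subset[OF that] in \<open>simp add: subsetD\<close>)
    then show ?thesis by simp
  qed
  moreover have "leaf_less D ((\<lambda>x\<in>?X. x) u) ((\<lambda>x\<in>?X. x) v)" if uv: "leaf_less D u v" for u v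
  proof -
    obtain \<omega> where "\<omega> \<in> leaves D" "u \<in> \<omega>" "v \<in> \<omega>" using uv by (rule leaf_less_same_leaf)
    then have "u \<in> ?X" "v \<in> ?X" using leaves_subset by blast+
    then show ?thesis using uv by simp
  qed
  ultimately show ?thesis using id_Bij unfolding H_iff by (intro conjI ballI allI impI) simp_all
qed

lemma foliated_homeos_mult:
  "h \<in> H \<Longrightarrow> g \<in> H \<Longrightarrow> h \<otimes>\<^bsub>foliated_homeos D\<^esub> g = compose (topspace (surface D)) h g"
  by (simp add: H_iff) (simp add: foliated_homeos_def BijGroup_def)

lemma foliated_homeos_one: "\<one>\<^bsub>foliated_homeos D\<^esub> = (\<lambda>x\<in>topspace (surface D). x)"
  by (simp add: foliated_homeos_def BijGroup_def)

lemma group_foliated_homeos: "group (foliated_homeos D)"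
proof -
  let ?X = "topspace (surface D)"
  have "subgroup H (BijGroup ?X)"
  proof (rule group.subgroupI[OF group_BijGroup])
    show "H \<subseteq> carrier (BijGroup ?X)" by (auto simp: H_iff BijGroup_def)
    show "H \<noteq> {}" using H_id by blast
    fix h assume h: "h \<in> H"
    have hB: "h \<in> Bij ?X" using h by (simp only: H_iff)
    then have gB: "(\<lambda>x\<in>?X. inv_into ?X h x) \<in> Bij ?X" by (rule restrict_inv_into_Bij)
    have "inv\<^bsub>BijGroup ?X\<^esub> h = (\<lambda>x\<in>?X. inv_into ?X h x)"
    proof (rule group.inv_equality[OF group_BijGroup])
      show "(\<lambda>x\<in>?X. inv_into ?X h x) \<otimes>\<^bsub>BijGroup ?X\<^esub> h = \<one>\<^bsub>BijGroup ?X\<^esub>"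
        using hB gB Bij_compose_restrict_eq[OF hB] by (simp add: BijGroup_def)
    qed (use hB gB in \<open>simp_all add: BijGroup_def\<close>)
    then show "inv\<^bsub>BijGroup ?X\<^esub> h \<in> H" using H_inverse[OF h] by simp
    fix g assume g: "g \<in> H"
    have "h \<otimes>\<^bsub>BijGroup ?X\<^esub> g = compose ?X h g"
      using h g by (simp add: BijGroup_def H_iff)
    then show "h \<otimes>\<^bsub>BijGroup ?X\<^esub> g \<in> H" using H_compose[OF h g] by simp
  qed
  then have "group (BijGroup ?X \<lparr>carrier := H\<rparr>)"
    by (rule subgroup.subgroup_is_group[OF _ group_BijGroup])
  moreover have "BijGroup ?X \<lparr>carrier := H\<rparr> = foliated_homeos D"
    by (simp add: foliated_homeos_def)
  ultimately show ?thesis by simp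
qed

section \<open>Invariance of special leaves\<close>

text \<open>The points that saturated neighbourhoods cannot separate from the leaf; the leaf is
  special when some of them lie outside it.\<close>

definition limit_set :: "'l surface_point set \<Rightarrow> 'l surface_point set" where
  "limit_set \<omega> = \<Inter>{surface D closure_of saturation D N |N. openin (surface D) N \<and> \<omega> \<subseteq> N}"

lemma mem_limit_set:
  "p \<in> limit_set \<omega> \<longleftrightarrow>
    (\<forall>N. openin (surface D) N \<longrightarrow> \<omega> \<subseteq> N \<longrightarrow> p \<in> surface D closure_of saturation D N)"
  unfolding limit_set_def by blast

lemma saturation_subset: "saturation D N \<subseteq> topspace (surface D)"
  unfolding saturation_def using leaves_subset by blast

lemma special_leaf_iff_limit_set:
  assumes "\<omega> \<in> leaves D"
  shows "special_leaf D \<omega> \<longleftrightarrow> \<not> limit_set \<omega> \<subseteq> \<omega>"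
proof -
  have "\<omega> \<subseteq> limit_set \<omega>"
  proof
    fix p assume p: "p \<in> \<omega>"
    show "p \<in> limit_set \<omega>"
      unfolding mem_limit_set
    proof (intro allI impI)
      fix N assume N: "openin (surface D) N" "\<omega> \<subseteq> N"
      have "p \<in> saturation D N" using p N assms unfolding saturation_def by blast
      then show "p \<in> surface D closure_of saturation D N"
        by (rule subsetD[OF closure_of_subset[OF saturation_subset]])
    qed
  qed
  then have "\<omega> = limit_set \<omega> \<longleftrightarrow> limit_set \<omega> \<subseteq> \<omega>" by (metis subset_antisym subset_refl)
  then show ?thesis using assms unfolding special_leaf_def limit_set_def[symmetric] by simp
qed

text \<open>\<open>h\<close> carries open neighbourhoods of \<open>\<omega>\<close>, their
  saturations and closures to those of the image leaf, so a limit set contained in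
  \<open>\<omega>\<close> goes to one contained in the image.\<close>

lemma special_leaf_cancel:
  assumes h: "h \<in> H" and \<omega>: "\<omega> \<in> leaves D" and sp: "special_leaf D (h ` \<omega>)"
  shows "special_leaf D \<omega>"
proof (rule ccontr)
  let ?X = "topspace (surface D)"
  assume "\<not> special_leaf D \<omega>"
  then have I: "limit_set \<omega> \<subseteq> \<omega>" using \<omega> by (simp add: special_leaf_iff_limit_set)
  have img: "h ` ?X = ?X" and inj: "inj_on h ?X" using H_bij[OF h] by (auto simp: bij_betw_def)
  have sat: "saturation D (h ` N) \<subseteq> h ` saturation D N" if N: "N \<subseteq> ?X" for N
  proof
    fix p assume "p \<in> saturation D (h ` N)"
    then obtain \<omega>' q where q: "\<omega>' \<in> leaves D" "p \<in> \<omega>'" "q \<in> N" "h q \<in> \<omega>'"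
      unfolding saturation_def by blast
    obtain \<omega>'' where w: "\<omega>'' \<in> leaves D" "q \<in> \<omega>''"
      using point_in_leaf[OF subsetD[OF N q(3)]] by (elim bexE)
    have "h q \<in> h ` \<omega>''" using w(2) by (rule imageI)
    then have "h ` \<omega>'' = \<omega>'" using leaves_disjoint[OF H_leaf[OF h w(1)] q(1) _ q(4)] by simp
    then obtain r where r: "r \<in> \<omega>''" "p = h r" using q(2) by blast
    have "r \<in> saturation D N" using w q(3) r(1) unfolding saturation_def by blast
    then show "p \<in> h ` saturation D N" unfolding r(2) by (rule imageI)
  qed
  have "limit_set (h ` \<omega>) \<subseteq> h ` \<omega>"
  proof
    fix p assume p: "p \<in> limit_set (h ` \<omega>)"
    have cl: "p \<in> h ` (surface D closure_of saturation D N)" if N: "openin (surface D) N" "\<omega> \<subseteq> N" for N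
    proof -
      have NX: "N \<subseteq> ?X" using N(1) by (rule openin_subset)
      have "openin (surface D) (h ` N)"
        using homeomorphic_map_openness[OF H_homeo[OF h] NX] N(1) by simp
      then have "p \<in> surface D closure_of saturation D (h ` N)"
        using p image_mono[OF N(2), of h] unfolding mem_limit_set by simp
      then have "p \<in> surface D closure_of (h ` saturation D N)"
        by (rule subsetD[OF closure_of_mono[OF sat[OF NX]]])
      then show ?thesis
        unfolding homeomorphic_map_closure_of[OF H_homeo[OF h] saturation_subset] .
    qed
    have "p \<in> h ` (surface D closure_of saturation D ?X)"
      by (rule cl[OF openin_topspace leaves_subset[OF \<omega>]])
    then obtain r where r: "r \<in> ?X" "p = h r"
      using closure_of_subset_topspace[of "surface D"] by blast
    have "r \<in> surface D closure_of saturation D N" if N: "openin (surface D) N" "\<omega> \<subseteq> N" for N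
    proof -
      obtain r' where r': "r' \<in> surface D closure_of saturation D N" "p = h r'"
        using cl[OF N] by blast
      then have "r' \<in> ?X" using closure_of_subset_topspace[of "surface D"] by blast
      then have "r = r'" using inj_onD[OF inj _ r(1)] r(2) r'(2) by simp
      then show ?thesis using r'(1) by simp
    qed
    then have "r \<in> limit_set \<omega>" by (simp add: mem_limit_set)
    then show "p \<in> h ` \<omega>" using I r(2) by blast
  qed
  then show False using sp by (simp add: special_leaf_iff_limit_set[OF H_leaf[OF h \<omega>]])
qed

lemma special_leaf_image:
  assumes h: "h \<in> H" and \<omega>: "\<omega> \<in> leaves D"
  shows "special_leaf D (h ` \<omega>) \<longleftrightarrow> special_leaf D \<omega>"
proof
  assume sp: "special_leaf D \<omega>"
  let ?X = "topspace (surface D)"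
  let ?g = "\<lambda>x\<in>?X. inv_into ?X h x"
  have inj: "inj_on h ?X" using H_bij[OF h] by (auto simp: bij_betw_def)
  have gh: "?g (h x) = x" if "x \<in> ?X" for x
    using that inj H_bij[OF h] by (auto simp: bij_betw_def)
  have "(\<lambda>x. ?g (h x)) ` \<omega> = (\<lambda>x. x) ` \<omega>"
    by (rule image_cong[OF refl gh]) (rule subsetD[OF leaves_subset[OF \<omega>]])
  then have "?g ` h ` \<omega> = \<omega>" by (simp only: image_image image_ident)
  then show "special_leaf D (h ` \<omega>)"
    using special_leaf_cancel[OF H_inverse[OF h] H_leaf[OF h \<omega>]] sp by simp
qed (rule special_leaf_cancel[OF assms])

end

section \<open>Recovering the strips from the special leaves\<close>

text \<open>\<open>no_single\<close> is reducedness in terms of the tree. In its presence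
  \<open>asymmetric\<close> excludes just the symmetric strip, since a root with the index set
  \<open>{1}\<close> then has no children.\<close>

locale reduced_tree = striped_tree D addr T
  for D :: "('l, 'c) striped_data" and addr :: "'l \<Rightarrow> int list" and T :: tree +
  assumes index: "T a = Some \<Delta> \<Longrightarrow> \<Delta> \<in> index_sets"
    and no_single: "T (a @ [i]) \<noteq> None \<Longrightarrow> T a \<noteq> Some {i}"
    and asymmetric: "T [] \<noteq> Some {1}"
begin

lemma tops_index: "l \<in> strips D \<Longrightarrow> tops l \<in> index_sets"
  using addr_in index by blast

lemma tops_single: "l \<in> strips D \<Longrightarrow> tops l = {i} \<Longrightarrow> i = 1"
  using tops_index index_sets_singleton by metis

lemma no_single_child:
  assumes "l \<in> strips D" "m \<in> strips D" "addr l = addr m @ [i]"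
  shows "tops m \<noteq> {i}"
proof
  assume "tops m = {i}"
  then have "T (addr m) = Some {i}" using addr_in[OF assms(2)] by simp
  moreover have "T (addr m @ [i]) \<noteq> None"
    using addr_in[OF assms(1)] unfolding assms(3) by (metis option.distinct(1))
  ultimately show False using no_single by blast
qed

text \<open>What is left of a strip when the special leaves are removed. The decomposition of the
  surface into these parts is visible to every homeomorphism that preserves special leaves.\<close>

definition plain :: "'l \<Rightarrow> (real \<times> real) set" where
  "plain l = {z \<in> S l. \<not> special_leaf D (lf l z)}"

text \<open>Besides the interior, the lower line of the root is plain, and so is the upper line of a
  strip with only one upper interval, whose index is then 1 by the shape of
  \<open>index_sets\<close>.\<close>

definition plain_levels :: "'l \<Rightarrow> real set" where
  "plain_levels l = {t. -1 \<le> t \<and> t \<le> 1 \<and> (t = -1 \<longrightarrow> addr l = []) \<and> (t = 1 \<longrightarrow> tops l = {1})}"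

lemma special_bottom_iff:
  assumes "l \<in> strips D" "z \<in> S l" "snd z = -1"
  shows "special_leaf D (lf l z) \<longleftrightarrow> addr l \<noteq> []"
proof
  assume "addr l \<noteq> []"
  then obtain a i where a: "addr l = a @ [i]" by (metis rev_exhaust)
  note p = parent[OF assms(1) a]
  define w where "w = (fst z + of_int i - 1, 1 :: real)"
  have b: "below l z (node a) w" using a assms p by (auto simp: below_def w_def)
  have w: "w \<in> S (node a)" "lf l z = lf (node a) w" "snd w = 1"
    using below_pr[OF b assms(1) p(1) assms(2)] lf_below[OF b assms(1) p(1) assms(2)] by (auto simp: w_def)
  have "fst z \<in> J 1" by (rule bottom_in_J[OF assms(2,3)])
  then have "\<lfloor>fst w\<rfloor> = i" by (intro J_floor) (auto simp: w_def mem_J_iff)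
  then have "tops (node a) \<noteq> {\<lfloor>fst w\<rfloor>}" using no_single_child[OF assms(1) p(1)] a p(2) by simp
  then show "special_leaf D (lf l z)" unfolding w(2) by (rule special_top[OF p(1) w(1,3)])
qed (use not_special_root_bottom[OF assms] in blast)

lemma plain_iff:
  assumes l: "l \<in> strips D" and z: "z \<in> S l"
  shows "z \<in> plain l \<longleftrightarrow> snd z \<in> plain_levels l"
proof -
  have "-1 \<le> snd z" "snd z \<le> 1" using model_level[OF z] by auto
  then consider "-1 < snd z" "snd z < 1" | "snd z = -1" | "snd z = 1" by fastforce
  then show ?thesis
  proof cases
    case 1
    then show ?thesis using not_special_interior[OF l z] z by (simp add: plain_def plain_levels_def)
  next
    case 2
    then show ?thesis using special_bottom_iff[OF l z] z by (simp add: plain_def plain_levels_def)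
  next
    case 3
    have "tops l = {\<lfloor>fst z\<rfloor>} \<longleftrightarrow> tops l = {1}"
      using tops_single[OF l] top_in_J[OF z 3] by auto
    then show ?thesis using special_lf_top_iff[OF l z 3] z 3 by (simp add: plain_def plain_levels_def)
  qed
qed

lemma plain_subset: "plain l \<subseteq> S l"
  by (auto simp: plain_def)

text \<open>Every glued leaf is special, so points of a plain part have no second representative and
  plain parts of different strips are disjoint.\<close>

lemma pr_in_plain:
  assumes l: "l \<in> strips D" and m: "m \<in> strips D" and z: "z \<in> S m"
  shows "pr m z \<in> pr l ` plain l \<longleftrightarrow> m = l \<and> z \<in> plain l"
proof
  assume "pr m z \<in> pr l ` plain l"
  then obtain w where w: "w \<in> plain l" "pr m z = pr l w" by blast
  have wS: "w \<in> S l" using w(1) plain_subset by blast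
  consider "m = l" "z = w" | "below m z l w" | "below l w m z"
    using w(2) pr_eq_iff[OF m l z wS] by blast
  then show "m = l \<and> z \<in> plain l"
  proof cases
    case 2
    then obtain i where i: "addr m = addr l @ [i]" "snd w = 1" by (auto simp: below_def)
    then have "tops l = {1}" using w(1) plain_iff[OF l wS] by (simp add: plain_levels_def)
    then show ?thesis using no_single_child[OF m l i(1)] child_tops[OF m l i(1)] by auto
  next
    case 3
    then have "snd w = -1" "addr l \<noteq> []" by (auto simp: below_def)
    then show ?thesis using w(1) plain_iff[OF l wS] by (simp add: plain_levels_def)
  qed (use w in simp)
qed blast

lemma openin_plain:
  assumes l: "l \<in> strips D"
  shows "openin (surface D) (pr l ` plain l)"
  unfolding openin_surface
proof (intro conjI ballI)
  show "pr l ` plain l \<subseteq> topspace (surface D)" using pr_in[OF l] plain_subset by blast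
  fix m assume m: "m \<in> strips D"
  show "openin (top_of_set (S m)) {z \<in> S m. pr m z \<in> pr l ` plain l}"
  proof (cases "m = l")
    case True
    define V where "V = (if addr l = [] then UNIV else {-1<..}) \<inter> (if tops l = {1} then UNIV else {..<1 :: real})"
    have "{z \<in> S m. pr m z \<in> pr l ` plain l} = S l \<inter> (UNIV \<times> V)"
    proof -
      have "pr l z \<in> pr l ` plain l \<longleftrightarrow> snd z \<in> V" if "z \<in> S l" for z
        unfolding pr_in_plain[OF l l that] plain_iff[OF l that]
        using model_level[OF that] by (auto simp: plain_levels_def V_def)
      then have "{z \<in> S l. pr l z \<in> pr l ` plain l} = {z \<in> S l. snd z \<in> V}" by blast
      also have "\<dots> = S l \<inter> (UNIV \<times> V)" by auto
      finally show ?thesis using True by simp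
    qed
    moreover have "open V" by (auto simp: V_def)
    ultimately show ?thesis using True by (simp add: openin_open_Int open_Times)
  next
    case False
    then have "{z \<in> S m. pr m z \<in> pr l ` plain l} = {}" using pr_in_plain[OF l m] by blast
    then show ?thesis by (simp only: openin_empty)
  qed
qed

lemma interior_subset_plain: "l \<in> strips D \<Longrightarrow> UNIV \<times> {-1<..<1} \<subseteq> plain l"
proof
  fix z :: "real \<times> real" assume l: "l \<in> strips D" and z: "z \<in> UNIV \<times> {-1<..<1}"
  then have "z \<in> S l" by (cases z) (auto intro: interior_model)
  then show "z \<in> plain l" using z by (auto simp: plain_iff[OF l] plain_levels_def)
qed

lemma closure_interior: "S l \<subseteq> closure (UNIV \<times> {-1<..<1})"
proof
  fix z assume "z \<in> S l"
  then have "-1 \<le> snd z \<and> snd z \<le> 1" by (rule model_level)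
  then show "z \<in> closure (UNIV \<times> {-1<..<1})"
    by (cases z) (simp add: closure_Times)
qed

text \<open>The plain part lies between the open strip, which is connected, and its closure.\<close>

lemma connectedin_plain:
  assumes l: "l \<in> strips D"
  shows "connectedin (surface D) (pr l ` plain l)"
proof -
  have "connected (UNIV \<times> {-1<..<1} :: (real \<times> real) set)"
    by (intro connected_Times) auto
  then have "connected (plain l)"
    using interior_subset_plain[OF l] order_trans[OF plain_subset closure_interior]
    by (rule connected_intermediate_closure)
  then have "connectedin (top_of_set (S l)) (plain l)"
    using plain_subset by (simp add: connectedin_subtopology)
  then show ?thesis by (rule connectedin_continuous_map_image[OF continuous_map_pr[OF l]])
qed

text \<open>The interior is dense in the strip, and the strip is closed in the surface; taking the
  closure restores exactly the special leaves of this strip.\<close>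

lemma closure_of_plain:
  assumes l: "l \<in> strips D"
  shows "surface D closure_of (pr l ` plain l) = pr l ` S l"
proof
  have "closedin (surface D) (pr l ` S l)"
    using closed_map_pr[OF l] by (simp add: closed_map_def)
  then show "surface D closure_of (pr l ` plain l) \<subseteq> pr l ` S l"
    by (intro closure_of_minimal image_mono plain_subset)
  have "S l \<subseteq> closure (plain l)"
    using closure_interior closure_mono[OF interior_subset_plain[OF l]] by blast
  then have "top_of_set (S l) closure_of plain l = S l"
    using plain_subset by (simp add: closure_of_subtopology Int_absorb1 Int_absorb2)
  then show "pr l ` S l \<subseteq> surface D closure_of (pr l ` plain l)"
    using continuous_map_image_closure_subset[OF continuous_map_pr[OF l], of "plain l"] by simp
qed

lemma H_plain:
  assumes h: "h \<in> H" and l: "l \<in> strips D" and z: "z \<in> plain l"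
    and m: "m \<in> strips D" and w: "w \<in> S m" and eq: "h (pr l z) = pr m w"
  shows "w \<in> plain m"
proof -
  have zS: "z \<in> S l" using z plain_subset by blast
  have "lf m w = h ` lf l z"
    using leaf_eqI[OF H_leaf[OF h lf_in_leaves[OF l zS]] m w] eq imageI[OF pr_in_lf[OF zS], of h] by simp
  then show ?thesis
    using z special_leaf_image[OF h lf_in_leaves[OF l zS]] w unfolding plain_def by simp
qed

text \<open>The image is connected and avoids special leaves, so it lies in one of the disjoint open
  plain parts.\<close>

lemma H_image_plain_subset:
  assumes h: "h \<in> H" and l: "l \<in> strips D"
  obtains m where "m \<in> strips D" "h ` pr l ` plain l \<subseteq> pr m ` plain m"
proof -
  let ?K = "h ` pr l ` plain l"
  have conn: "connectedin (surface D) ?K"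
    using connectedin_continuous_map_image[OF homeomorphic_imp_continuous_map[OF H_homeo[OF h]] connectedin_plain[OF l]] .
  have cover: "\<exists>m\<in>strips D. p \<in> pr m ` plain m" if p: "p \<in> ?K" for p
  proof -
    obtain z where z: "z \<in> plain l" "p = h (pr l z)" using p by blast
    have "p \<in> topspace (surface D)" using connectedin_subset_topspace[OF conn] p by blast
    then obtain m w where w: "m \<in> strips D" "w \<in> S m" "p = pr m w"
      unfolding topspace_surface by blast
    have "w \<in> plain m" using H_plain[OF h l z(1) w(1,2)] z(2) w(3) by simp
    then show ?thesis using w by blast
  qed
  have "(0, 0) \<in> plain l" using interior_subset_plain[OF l] by auto
  then obtain p where p: "p \<in> ?K" by blast
  then obtain m where m: "m \<in> strips D" "p \<in> pr m ` plain m" using cover by blast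
  define E where "E = pr m ` plain m"
  \<comment> \<open>All the other plain parts together form one open set, the second half of a
    would-be separation.\<close>
  define E' where "E' = (\<Union>n\<in>strips D - {m}. pr n ` plain n)"
  define K where "K = ?K"
  have op: "openin (surface D) E" "openin (surface D) E'"
    unfolding E_def E'_def by (auto intro!: openin_Union openin_plain m(1))
  have sub: "K \<subseteq> E \<union> E'"
  proof
    fix q assume "q \<in> K"
    then obtain n where "n \<in> strips D" "q \<in> pr n ` plain n"
      using bexE[OF cover[of q, folded K_def]] by metis
    then show "q \<in> E \<union> E'" unfolding E_def E'_def by (cases "n = m") auto
  qed
  have disj: "E \<inter> E' = {}"
  proof -
    have "pr n ` plain n \<inter> pr m ` plain m = {}" if "n \<in> strips D - {m}" for n
      using pr_in_plain[OF m(1), of n] that plain_subset[of n] by blast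
    then show ?thesis unfolding E_def E'_def by blast
  qed
  have ne: "E \<inter> K \<noteq> {}" using m(2) p unfolding E_def K_def by blast
  have "\<nexists>E1 E2. openin (surface D) E1 \<and> openin (surface D) E2 \<and>
      K \<subseteq> E1 \<union> E2 \<and> E1 \<inter> E2 \<inter> K = {} \<and> E1 \<inter> K \<noteq> {} \<and> E2 \<inter> K \<noteq> {}"
    using conn[folded K_def] unfolding connectedin by (rule conjunct2)
  then have "E' \<inter> K = {}"
    using op sub disj ne by blast
  then have "K \<subseteq> E" using sub by blast
  then show ?thesis using that[OF m(1)] by (simp add: E_def K_def)
qed

lemma H_image_plain:
  assumes h: "h \<in> H" and l: "l \<in> strips D"
  obtains m where "m \<in> strips D" "h ` pr l ` plain l = pr m ` plain m"
proof -
  let ?X = "topspace (surface D)"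
  let ?g = "\<lambda>x\<in>?X. inv_into ?X h x"
  obtain m where m: "m \<in> strips D" "h ` pr l ` plain l \<subseteq> pr m ` plain m"
    using H_image_plain_subset[OF h l] .
  obtain n where n: "n \<in> strips D" "?g ` pr m ` plain m \<subseteq> pr n ` plain n"
    using H_image_plain_subset[OF H_inverse[OF h] m(1)] .
  have inj: "inj_on h ?X" and img: "h ` ?X = ?X" using H_bij[OF h] by (auto simp: bij_betw_def)
  have gh: "?g (h x) = x" if "x \<in> ?X" for x using that inj img by auto
  have hg: "h (?g x) = x" if "x \<in> ?X" for x using that img by (simp add: f_inv_into_f)
  have sub: "pr k ` plain k \<subseteq> ?X" if "k \<in> strips D" for k
    using pr_in[OF that] plain_subset by blast
  have z: "(0, 0) \<in> plain l" using interior_subset_plain[OF l] by auto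
  then have p: "pr l (0, 0) \<in> ?X" using sub[OF l] by blast
  have "h (pr l (0, 0)) \<in> pr m ` plain m" using m(2) z by blast
  then have "?g (h (pr l (0, 0))) \<in> pr n ` plain n" using n(2) by blast
  then have "pr l (0, 0) \<in> pr n ` plain n" unfolding gh[OF p] .
  then have "l = n" using pr_in_plain[OF n(1) l, of "(0, 0)"] z plain_subset by blast
  have "pr m ` plain m \<subseteq> h ` pr l ` plain l"
  proof
    fix q assume q: "q \<in> pr m ` plain m"
    then have "?g q \<in> pr l ` plain l" using n(2) \<open>l = n\<close> by blast
    then have "h (?g q) \<in> h ` pr l ` plain l" by (rule imageI)
    moreover have "q \<in> ?X" using q sub[OF m(1)] by blast
    ultimately show "q \<in> h ` pr l ` plain l" using hg by simp
  qed
  then show ?thesis using that m by blast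
qed

text \<open>Closures of plain parts are strips, so \<open>h\<close> maps a strip onto a strip. The
  coordinate map \<open>F\<close> is continuous because the projection of a strip into the surface
  is a closed map.\<close>

lemma H_lift:
  assumes h: "h \<in> H" and l: "l \<in> strips D"
  obtains m F where "m \<in> strips D" "bij_betw F (S l) (S m)" "continuous_on (S l) F"
    "\<And>z. z \<in> S l \<Longrightarrow> h (pr l z) = pr m (F z)" "F ` plain l = plain m"
proof -
  obtain m where m: "m \<in> strips D" "h ` pr l ` plain l = pr m ` plain m" using H_image_plain[OF h l] .
  have "pr l ` plain l \<subseteq> topspace (surface D)" using pr_in[OF l] plain_subset by blast
  then have img: "h ` pr l ` S l = pr m ` S m"
    using homeomorphic_map_closure_of[OF H_homeo[OF h], of "pr l ` plain l"] m(2)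
      closure_of_plain[OF l] closure_of_plain[OF m(1)] by simp
  have injm: "inj_on (pr m) (S m)" using pr_inj[OF m(1)] by (auto simp: inj_on_def)
  have injl: "inj_on (pr l) (S l)" using pr_inj[OF l] by (auto simp: inj_on_def)
  have injh: "inj_on h (pr l ` S l)"
    by (rule inj_on_subset[OF bij_betw_imp_inj_on[OF H_bij[OF h]]]) (use pr_in[OF l] in blast)
  define F where "F = (\<lambda>z. inv_into (S m) (pr m) (h (pr l z)))"
  have eq: "h (pr l z) = pr m (F z)" and FS: "F z \<in> S m" if z: "z \<in> S l" for z
  proof -
    have "h (pr l z) \<in> pr m ` S m" using img z by blast
    then show "h (pr l z) = pr m (F z)" "F z \<in> S m" unfolding F_def by (simp_all add: f_inv_into_f inv_into_into)
  qed
  have inj: "inj_on F (S l)"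
  proof (rule inj_onI)
    fix z w assume zw: "z \<in> S l" "w \<in> S l" "F z = F w"
    then have "h (pr l z) = h (pr l w)" using eq by simp
    then have "pr l z = pr l w" using inj_onD[OF injh] zw by blast
    then show "z = w" using inj_onD[OF injl] zw by blast
  qed
  have image: "F ` A = B" if A: "A \<subseteq> S l" and B: "B \<subseteq> S m" and hAB: "h ` pr l ` A = pr m ` B" for A B
  proof
    show "F ` A \<subseteq> B"
    proof
      fix w assume "w \<in> F ` A"
      then obtain z where z: "z \<in> A" "w = F z" by blast
      then have zS: "z \<in> S l" using A by blast
      have "pr m (F z) \<in> pr m ` B" using eq[OF zS] z hAB by blast
      then show "w \<in> B" using inj_on_image_mem_iff[OF injm FS[OF zS] B] z(2) by simp
    qed
    show "B \<subseteq> F ` A"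
    proof
      fix w assume w: "w \<in> B"
      then have "pr m w \<in> h ` pr l ` A" using hAB by blast
      then obtain z where z: "z \<in> A" "pr m w = h (pr l z)" by blast
      then have zS: "z \<in> S l" using A by blast
      have "pr m w = pr m (F z)" using z(2) eq[OF zS] by simp
      then have "w = F z" by (rule inj_onD[OF injm]) (use w B FS[OF zS] in blast)+
      then show "w \<in> F ` A" using z(1) by blast
    qed
  qed
  have "bij_betw F (S l) (S m)" using inj image[OF subset_refl subset_refl img] by (simp add: bij_betw_def)
  moreover have "F ` plain l = plain m" by (rule image[OF plain_subset plain_subset m(2)])
  moreover have "continuous_on (S l) F"
  proof -
    have cont: "continuous_map (top_of_set (S l)) (surface D) (h \<circ> pr l)"
      by (rule continuous_map_compose[OF continuous_map_pr[OF l] homeomorphic_imp_continuous_map[OF H_homeo[OF h]]])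
    have "continuous_map (top_of_set (S l)) (top_of_set (S m)) F"
      unfolding continuous_map_closedin
    proof (intro conjI ballI allI impI)
      fix C assume C: "closedin (top_of_set (S m)) C"
      then have CS: "C \<subseteq> S m" by (simp add: closedin_def)
      have "F z \<in> C \<longleftrightarrow> (h \<circ> pr l) z \<in> pr m ` C" if z: "z \<in> S l" for z
        using eq[OF z] inj_on_image_mem_iff[OF injm FS[OF z] CS] by simp
      then have "{z \<in> topspace (top_of_set (S l)). F z \<in> C} =
          {z \<in> topspace (top_of_set (S l)). (h \<circ> pr l) z \<in> pr m ` C}" by auto
      moreover have "closedin (surface D) (pr m ` C)"
        using closed_map_pr[OF m(1)] C by (simp add: closed_map_def)
      ultimately show "closedin (top_of_set (S l)) {z \<in> topspace (top_of_set (S l)). F z \<in> C}"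
        using closedin_continuous_map_preimage[OF cont] by simp
    qed (use FS in auto)
    then show ?thesis by simp
  qed
  ultimately show ?thesis using that[OF m(1)] eq by blast
qed

lemma H_lift_leaf:
  assumes h: "h \<in> H" and l: "l \<in> strips D" and m: "m \<in> strips D" and bij: "bij_betw F (S l) (S m)"
    and eq: "\<And>z. z \<in> S l \<Longrightarrow> h (pr l z) = pr m (F z)" and z: "z \<in> S l"
  shows "F ` hleaf z = hleaf (F z)"
    and "\<And>w. w \<in> hleaf z \<Longrightarrow> fst z < fst w \<Longrightarrow> fst (F z) < fst (F w)"
    and "\<And>w. w \<in> hleaf z \<Longrightarrow> snd (F w) = snd (F z)"
proof -
  have FS: "F w \<in> S m" if "w \<in> S l" for w using bij that by (auto simp: bij_betw_def)
  have sub: "hleaf z \<subseteq> S l" by (rule hleaf_subset[OF z])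
  have injm: "inj_on (pr m) (S m)" using pr_inj[OF m] by (auto simp: inj_on_def)
  have "pr m (F z) \<in> h ` lf l z" using eq[OF z] imageI[OF pr_in_lf[OF z], of h] by simp
  then have "h ` lf l z = lf m (F z)"
    by (rule leaf_eqI[OF H_leaf[OF h lf_in_leaves[OF l z]] m FS[OF z]])
  moreover have "h ` lf l z = pr m ` F ` hleaf z"
    unfolding lf_def image_image using sub eq by (intro image_cong) auto
  ultimately have "pr m ` F ` hleaf z = pr m ` hleaf (F z)" by (simp add: lf_def)
  then show *: "F ` hleaf z = hleaf (F z)"
    using inj_on_image_eq_iff[OF injm, of "F ` hleaf z" "hleaf (F z)"] sub FS hleaf_subset[OF FS[OF z]] by blast
  fix w assume w: "w \<in> hleaf z"
  then have wS: "w \<in> S l" using sub by blast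
  have "F w \<in> hleaf (F z)" using * w by blast
  then show "snd (F w) = snd (F z)" using FS[OF z] by (simp add: mem_hleaf_iff)
  assume "fst z < fst w"
  then have "leaf_less D (pr l z) (pr l w)" using leaf_less_pr[OF l z wS] w by simp
  then have "leaf_less D (pr m (F z)) (pr m (F w))" using H_less[OF h] eq[OF z] eq[OF wS] by metis
  then show "fst (F z) < fst (F w)" using leaf_less_pr[OF m FS[OF z] FS[OF wS]] by simp
qed

end

text \<open>\<open>F\<close> maps the upper intervals bijectively and in increasing order, hence
  shifts their indices, as index sets are convex. Without upper intervals the shift is set to 0, in
  accordance with the normalization of portraits.\<close>

lemma strip_map_shift:
  assumes F: "strip_map \<Delta> \<Delta>' F" and \<Delta>: "\<Delta> \<in> index_sets" and \<Delta>': "\<Delta>' \<in> index_sets"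
  shows "\<exists>k. (\<Delta> = {} \<longrightarrow> k = 0) \<and> \<Delta>' = (\<lambda>i. i + k) ` \<Delta> \<and>
    (\<forall>i\<in>\<Delta>. F ` (J i \<times> {1}) = J (i + k) \<times> {1})"
proof -
  define c where "c i = (of_int i + 1/4 :: real, 1 :: real)" for i
  have c: "c i \<in> model \<Delta>" "hleaf (c i) = J i \<times> {1}" if "i \<in> \<Delta>" for i \<Delta>
    using that J_mid[of i] J_floor[OF J_mid[of i]] by (auto simp: c_def mem_model hleaf_def)
  define \<pi> where "\<pi> i = \<lfloor>fst (F (c i))\<rfloor>" for i
  have \<pi>: "\<pi> i \<in> \<Delta>'" "F ` (J i \<times> {1}) = J (\<pi> i) \<times> {1}" if i: "i \<in> \<Delta>" for i
  proof -
    have top: "snd (F (c i)) = 1" using strip_map_top_iff[OF F c(1)[OF i]] by (simp add: c_def)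
    show "\<pi> i \<in> \<Delta>'" using top_in_J[OF strip_map_in[OF F c(1)[OF i]] top] by (simp add: \<pi>_def)
    have "hleaf (F (c i)) = J (\<pi> i) \<times> {1}" using top by (simp add: hleaf_def \<pi>_def)
    then show "F ` (J i \<times> {1}) = J (\<pi> i) \<times> {1}"
      using strip_map_hleaf[OF F c(1)[OF i]] c(2)[OF i] by simp
  qed
  have inj: "i = j" if ij: "i \<in> \<Delta>" "j \<in> \<Delta>" "\<pi> i = \<pi> j" for i j
  proof -
    have "F ` (J i \<times> {1}) = F ` (J j \<times> {1})" using \<pi>(2) ij by simp
    moreover have sub: "J i \<times> {1} \<subseteq> model \<Delta>" "J j \<times> {1} \<subseteq> model \<Delta>" using ij by (auto simp: mem_model)
    ultimately have "J i \<times> {1 :: real} = J j \<times> {1}"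
      by (simp only: inj_on_image_eq_iff[OF bij_betw_imp_inj_on[OF strip_map_bij[OF F]] sub])
    then have "(of_int i + 1/4, 1 :: real) \<in> J j \<times> {1}" using J_mid[of i] by (metis SigmaI singletonI)
    then have "of_int i + 1/4 \<in> J j" by (simp only: mem_Times_iff fst_conv)
    then show "i = j" by (rule J_inj[OF J_mid[of i]])
  qed
  have mono: "\<pi> i < \<pi> j" if "i \<in> \<Delta>" "j \<in> \<Delta>" "i < j" for i j
  proof -
    have "fst (F (c i)) < fst (F (c j))"
      using strip_map_less[OF F c(1)[OF that(1)] c(1)[OF that(2)]] that(3) by (simp add: c_def)
    then have "\<pi> i \<le> \<pi> j" unfolding \<pi>_def by (intro floor_mono) simp
    then show ?thesis using inj[OF that(1,2)] that(3) by fastforce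
  qed
  have "\<exists>i\<in>\<Delta>. \<pi> i = j" if j: "j \<in> \<Delta>'" for j
  proof -
    obtain z where z: "z \<in> model \<Delta>" "F z = c j"
      using c(1)[OF j] strip_map_bij[OF F] unfolding bij_betw_def by (metis imageE)
    then have top: "snd z = 1" using strip_map_top_iff[OF F z(1)] by (simp add: c_def)
    let ?i = "\<lfloor>fst z\<rfloor>"
    have i: "?i \<in> \<Delta>" "z \<in> J ?i \<times> {1}" using top_in_J[OF z(1) top] top by (auto simp: mem_Times_iff)
    then have "c j \<in> J (\<pi> ?i) \<times> {1}" using \<pi>(2)[OF i(1)] z(2) by (metis imageI)
    then show ?thesis using J_inj[OF J_mid[of j]] i(1) by (auto simp: c_def)
  qed
  then have bij: "bij_betw \<pi> \<Delta> \<Delta>'" using inj \<pi>(1) by (auto simp: bij_betw_def inj_on_def)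
  have "\<exists>k. (\<Delta> = {} \<longrightarrow> k = 0) \<and> (\<forall>i\<in>\<Delta>. \<pi> i = i + k)"
    by (rule shift_of_strict_mono_bij[OF bij]) (fact mono index_sets_convex[OF \<Delta>] index_sets_convex[OF \<Delta>'])+
  then obtain k where k: "\<Delta> = {} \<longrightarrow> k = 0" "\<And>i. i \<in> \<Delta> \<Longrightarrow> \<pi> i = i + k" by metis
  have "\<Delta>' = \<pi> ` \<Delta>" using bij by (simp add: bij_betw_def)
  also have "\<dots> = (\<lambda>i. i + k) ` \<Delta>" by (rule image_cong[OF refl k(2)])
  finally have "\<Delta>' = (\<lambda>i. i + k) ` \<Delta>" .
  moreover have "F ` (J i \<times> {1}) = J (i + k) \<times> {1}" if "i \<in> \<Delta>" for i
    using \<pi>(2)[OF that] k(2)[OF that] by simp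
  ultimately show ?thesis using k(1) by (intro exI[of _ k] conjI ballI)
qed

context reduced_tree
begin

text \<open>A plain upper line carries a single interval, so in the plain part the level alone
  determines the leaf.\<close>

lemma plain_same_level:
  assumes "n \<in> strips D" "z \<in> plain n" "w \<in> S n" "snd w = snd z"
  shows "w \<in> hleaf z"
proof -
  have z: "z \<in> S n" using assms(2) plain_subset by blast
  have "\<lfloor>fst w\<rfloor> = \<lfloor>fst z\<rfloor>" if "snd z = 1"
  proof -
    have "tops n = {1}" using assms(2) plain_iff[OF assms(1) z] that by (simp add: plain_levels_def)
    then show ?thesis using top_in_J[OF z] top_in_J[OF assms(3)] assms(4) that by auto
  qed
  then show ?thesis using assms by (simp add: mem_hleaf_iff[OF z])
qed

text \<open>\<open>5/4\<close> is the midpoint of \<open>J 1\<close>, so the vertical line over it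
  meets all plain levels, boundary levels included.\<close>

lemma plain_center:
  assumes "n \<in> strips D" "t \<in> plain_levels n"
  shows "(5/4, t) \<in> S n" "(5/4, t) \<in> plain n"
proof -
  have "5/4 \<in> J 1" by (simp add: mem_J_iff)
  then show *: "(5/4, t) \<in> S n" using assms(2) by (auto simp: mem_model plain_levels_def)
  show "(5/4, t) \<in> plain n" using plain_iff[OF assms(1) *] assms(2) by simp
qed

lemma plain_levels_interior: "-1 < t \<Longrightarrow> t < 1 \<Longrightarrow> t \<in> plain_levels n"
  by (simp add: plain_levels_def)

lemma is_interval_plain_levels: "is_interval (plain_levels n)"
  unfolding is_interval_1
proof (intro ballI allI impI)
  fix a b x assume "a \<in> plain_levels n" "b \<in> plain_levels n" "a \<le> x \<and> x \<le> b"
  then show "x \<in> plain_levels n"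
    unfolding plain_levels_def by (cases "x = -1"; cases "x = 1") auto
qed

text \<open>
  An orientation reversal between two strips would make both of them strips with a single upper
  leaf and a free lower leaf, that is, the surface would be the symmetric strip.
\<close>

lemma H_strip_map:
  assumes h: "h \<in> H" and l: "l \<in> strips D"
  obtains m F where "m \<in> strips D" "strip_map (tops l) (tops m) F"
    "\<And>z. z \<in> S l \<Longrightarrow> h (pr l z) = pr m (F z)" "F ` plain l = plain m"
proof -
  obtain m F where m: "m \<in> strips D" and bij: "bij_betw F (S l) (S m)" and cont: "continuous_on (S l) F"
    and eq: "\<And>z. z \<in> S l \<Longrightarrow> h (pr l z) = pr m (F z)" and plain: "F ` plain l = plain m"
    using H_lift[OF h l] by blast
  have leaf: "F ` hleaf z = hleaf (F z)" "\<And>w. w \<in> hleaf z \<Longrightarrow> fst z < fst w \<Longrightarrow> fst (F z) < fst (F w)"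
    "\<And>w. w \<in> hleaf z \<Longrightarrow> snd (F w) = snd (F z)" if z: "z \<in> S l" for z
    using H_lift_leaf[OF h l m bij _ z] eq by blast+
  have FS: "F z \<in> S m" if "z \<in> S l" for z using bij that by (auto simp: bij_betw_def)
  have inj: "inj_on F (S l)" using bij by (simp add: bij_betw_def)
  have plainF: "F z \<in> plain m \<longleftrightarrow> z \<in> plain l" if "z \<in> S l" for z
    using inj_on_image_mem_iff[OF inj that plain_subset] plain by simp
  \<comment> \<open>\<open>b\<close> records how \<open>h\<close> moves the plain leaves
    transversally, read along the vertical line over \<open>5/4\<close>.\<close>
  define b where "b t = snd (F (5/4, t))" for t
  let ?I = "plain_levels l" and ?I' = "plain_levels m"
  have level: "snd (F z) = b (snd z)" if z: "z \<in> plain l" for z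
  proof -
    have zS: "z \<in> S l" using z plain_subset by blast
    then have "snd z \<in> ?I" using z plain_iff[OF l zS] by simp
    from leaf(3)[OF zS plain_same_level[OF l z plain_center(1)[OF l this]]]
    show ?thesis by (simp add: b_def)
  qed
  have b_in: "b t \<in> ?I'" if t: "t \<in> ?I" for t
  proof -
    note c = plain_center[OF l t]
    show ?thesis using plainF[OF c(1)] c(2) plain_iff[OF m FS[OF c(1)]] by (simp add: b_def)
  qed
  have b_surj: "\<exists>t\<in>?I. b t = s" if s: "s \<in> ?I'" for s
  proof -
    note c = plain_center[OF m s]
    have "(5/4, s) \<in> F ` plain l" using c(2) by (simp only: plain)
    then obtain z where z: "(5/4, s) = F z" "z \<in> plain l" by (rule imageE)
    have "snd z \<in> ?I" using plain_iff[OF l subsetD[OF plain_subset z(2)]] z(2) by (rule iffD1)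
    moreover have "b (snd z) = s" using level[OF z(2)] by (simp flip: z(1))
    ultimately show ?thesis by (rule bexI[rotated])
  qed
  have b_inj: "inj_on b ?I"
  proof (rule inj_onI)
    fix t s assume ts: "t \<in> ?I" "s \<in> ?I" "b t = b s"
    note ct = plain_center[OF l ts(1)] and cs = plain_center[OF l ts(2)]
    have "F (5/4, t) \<in> plain m" using plainF ct by blast
    then have "F (5/4, s) \<in> hleaf (F (5/4, t))"
      by (rule plain_same_level[OF m _ FS[OF cs(1)]]) (use ts(3) in \<open>simp add: b_def\<close>)
    then have "F (5/4, s) \<in> F ` hleaf (5/4, t)" using leaf(1)[OF ct(1)] by simp
    then have "(5/4, s) \<in> hleaf (5/4, t)"
      using inj_on_image_mem_iff[OF inj cs(1) hleaf_subset[OF ct(1)]] by simp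
    then show "t = s" using ct(1) by (simp add: mem_hleaf_iff)
  qed
  have "continuous_on ?I b"
    unfolding b_def
    by (intro continuous_intros continuous_on_compose2[OF cont]) (use plain_center(1)[OF l] in auto)
  \<comment> \<open>A continuous injection on an interval is strictly monotone in one direction or
    the other; ruling out the decreasing one is the purpose of what follows.\<close>
  then have "strict_mono_on ?I b \<or> strict_antimono_on ?I b"
    using injective_eq_monotone_map[OF is_interval_plain_levels] b_inj by blast
  then have cmp: "(\<forall>s\<in>?I. \<forall>t\<in>?I. b s < b t \<longleftrightarrow> s < t) \<or> (\<forall>s\<in>?I. \<forall>t\<in>?I. b s < b t \<longleftrightarrow> t < s)"
  proof
    assume "strict_mono_on ?I b"
    then show ?thesis by (simp add: strict_mono_on_less)
  next
    assume anti: "strict_antimono_on ?I b"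
    have "b s < b t \<longleftrightarrow> t < s" if "s \<in> ?I" "t \<in> ?I" for s t
      using monotone_onD[OF anti that] monotone_onD[OF anti that(2,1)]
      by (cases s t rule: linorder_cases) auto
    then show ?thesis by blast
  qed
  have bounds: "-1 \<le> t \<and> t \<le> 1" if "t \<in> plain_levels n" for t n
    using that by (simp add: plain_levels_def)
  have b_interior: "-1 < b t \<and> b t < 1 \<longleftrightarrow> -1 < t \<and> t < 1" if t: "t \<in> ?I" for t
  proof
    assume t': "-1 < t \<and> t < 1"
    define t1 t2 where "t1 = (t - 1) / 2" and "t2 = (t + 1) / 2"
    have "t1 < t" "t < t2" "t1 \<in> ?I" "t2 \<in> ?I"
      using t' by (auto simp: t1_def t2_def intro!: plain_levels_interior)
    moreover have "-1 \<le> b t1" "b t1 \<le> 1" "-1 \<le> b t2" "b t2 \<le> 1"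
      using bounds b_in calculation by blast+
    ultimately show "-1 < b t \<and> b t < 1" using cmp t by (meson le_less_trans less_le_trans)
  next
    assume s: "-1 < b t \<and> b t < 1"
    define s1 s2 where "s1 = (b t - 1) / 2" and "s2 = (b t + 1) / 2"
    have s12: "s1 < b t" "b t < s2" "s1 \<in> ?I'" "s2 \<in> ?I'"
      using s by (auto simp: s1_def s2_def intro!: plain_levels_interior)
    obtain t1 where t1: "t1 \<in> ?I" "b t1 = s1" using b_surj[OF s12(3)] by blast
    obtain t2 where t2: "t2 \<in> ?I" "b t2 = s2" using b_surj[OF s12(4)] by blast
    have "b t1 < b t" "b t < b t2" using s12 t1 t2 by auto
    then have "t1 < t \<and> t < t2 \<or> t2 < t \<and> t < t1" using cmp t t1(1) t2(1) by blast
    then show "-1 < t \<and> t < 1" using bounds[OF t1(1)] bounds[OF t2(1)] by auto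
  qed
  have interior: "-1 < snd (F z) \<and> snd (F z) < 1 \<longleftrightarrow> -1 < snd z \<and> snd z < 1" if z: "z \<in> S l" for z
  proof (cases "z \<in> plain l")
    case True
    then show ?thesis using b_interior level plain_iff[OF l z] by simp
  next
    case False
    then have "F z \<notin> plain m" using plainF[OF z] by blast
    then have "\<not> (-1 < snd (F z) \<and> snd (F z) < 1)" "\<not> (-1 < snd z \<and> snd z < 1)"
      using False plain_iff[OF m FS[OF z]] plain_iff[OF l z] plain_levels_interior by blast+
    then show ?thesis by blast
  qed
  have boundary: "snd (F z) = -1 \<or> snd (F z) = 1" if "z \<in> S l" "snd z = -1 \<or> snd z = 1" for z
    using interior[OF that(1)] model_level[OF FS[OF that(1)]] that(2) by fastforce
  \<comment> \<open>At special boundary leaves \<open>b\<close> gives no information, so the level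
    of the image is computed as a limit from the interior.\<close>
  have lim: "(\<lambda>n. b (snd (approach z n))) \<longlonglongrightarrow> snd (F z)" if z: "z \<in> S l" for z
  proof -
    have "snd (F (approach z n)) = b (snd (approach z n))" for n
    proof -
      have "approach z n \<in> plain l"
        using plain_iff[OF l approach_in(3)[OF z]] plain_levels_interior[OF approach_in(1,2)[OF z]] by blast
      then show ?thesis by (rule level)
    qed
    then show ?thesis using tendsto_snd[OF approach_tendsto[OF z cont]] by simp
  qed
  have zero: "0 \<in> ?I" by (rule plain_levels_interior) auto
  have approach_I: "snd (approach z n) \<in> ?I" if "z \<in> S l" for z n
    using plain_levels_interior[OF approach_in(1,2)[OF that]] by blast
  have fac: "0 < 1 - 1 / (real n + 2)" for n by (simp add: field_simps)
  have low: "snd (approach z n) < 0" if "snd z = -1" for z n using fac[of n] that by (simp add: approach_def)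
  have high: "0 < snd (approach z n)" if "snd z = 1" for z n using fac[of n] that by (simp add: approach_def)
  have b0: "-1 < b 0 \<and> b 0 < 1" using b_interior[OF zero] by simp
  have le0: "snd (F z) = -1" if "z \<in> S l" "snd z = -1 \<or> snd z = 1" "\<And>n. b (snd (approach z n)) < b 0" for z
  proof -
    have "snd (F z) \<le> b 0"
      by (rule LIMSEQ_le_const2[OF lim[OF that(1)]]) (use that(3) less_imp_le in blast)
    then show ?thesis using boundary[OF that(1,2)] b0 by auto
  qed
  have ge0: "snd (F z) = 1" if "z \<in> S l" "snd z = -1 \<or> snd z = 1" "\<And>n. b 0 < b (snd (approach z n))" for z
  proof -
    have "b 0 \<le> snd (F z)"
      by (rule LIMSEQ_le_const[OF lim[OF that(1)]]) (use that(3) less_imp_le in blast)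
    then show ?thesis using boundary[OF that(1,2)] b0 by auto
  qed
  have single: "tops n = {1}"
    if n: "n \<in> strips D" and z: "z \<in> S n" "snd z = 1" and all: "\<And>w. w \<in> S n \<Longrightarrow> snd w = 1 \<Longrightarrow> w \<in> hleaf z" for n z
  proof -
    have "i = \<lfloor>fst z\<rfloor>" if "i \<in> tops n" for i
    proof -
      have "(of_int i + 1/4, 1) \<in> S n" using that J_mid by (auto simp: mem_model)
      from all[OF this] have "\<lfloor>of_int i + 1/4 :: real\<rfloor> = \<lfloor>fst z\<rfloor>" using z by (simp add: mem_hleaf_iff)
      then show ?thesis using J_floor[OF J_mid] by simp
    qed
    then have "tops n = {\<lfloor>fst z\<rfloor>}" using top_in_J[OF z] by blast
    then show ?thesis using tops_single[OF n] by metis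
  qed
  have bottom_leaf: "w \<in> hleaf z" if "z \<in> S n" "w \<in> S n" "snd z = -1" "snd w = -1" for z w n
    using that by (simp add: mem_hleaf_iff)
  have c1: "(5/4, -1) \<in> S n" for n by (simp add: mem_model mem_J_iff)
  have surjF: "\<exists>v\<in>S l. F v = w" if "w \<in> S m" for w using that bij unfolding bij_betw_def by (metis imageE)
  have inc: "\<forall>s\<in>?I. \<forall>t\<in>?I. b s < b t \<longleftrightarrow> s < t"
  proof (rule ccontr)
    assume "\<not> (\<forall>s\<in>?I. \<forall>t\<in>?I. b s < b t \<longleftrightarrow> s < t)"
    then have anti: "b s < b t \<longleftrightarrow> t < s" if "s \<in> ?I" "t \<in> ?I" for s t using cmp that by blast
    have up: "snd (F z) = 1" if z: "z \<in> S l" "snd z = -1" for z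
      by (rule ge0) (use z anti[OF zero approach_I[OF z(1)]] low[OF z(2)] in auto)
    have down: "snd (F z) = -1" if z: "z \<in> S l" "snd z = 1" for z
      by (rule le0) (use z anti[OF approach_I[OF z(1)] zero] high[OF z(2)] in auto)
    let ?z = "(5/4, -1)"
    have Fz: "F ?z \<in> S m" "snd (F ?z) = 1" using FS[OF c1] up[OF c1] by simp_all
    have "w \<in> hleaf (F ?z)" if w: "w \<in> S m" "snd w = 1" for w
    proof -
      obtain v where v: "v \<in> S l" "F v = w" using surjF[OF w(1)] by blast
      have "snd v = -1"
        using interior[OF v(1)] down[OF v(1)] v(2) w(2) model_level[OF v(1)] by fastforce
      then have "v \<in> hleaf ?z" using bottom_leaf[OF c1 v(1)] by simp
      then show ?thesis using leaf(1)[OF c1] v(2) by blast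
    qed
    \<comment> \<open>The upper line of \<open>m\<close> is the image of the lower line of
      \<open>l\<close>, hence a single leaf and plain; so the lower line of \<open>l\<close> is
      plain too, which makes \<open>l\<close> the root.\<close>
    then have "tops m = {1}" using single[OF m Fz] by blast
    then have "F ?z \<in> plain m" using plain_iff[OF m Fz(1)] Fz(2) by (simp add: plain_levels_def)
    then have "?z \<in> plain l" using plainF[OF c1] by blast
    then have root: "addr l = []" using plain_iff[OF l c1] by (simp add: plain_levels_def)
    obtain v where v: "v \<in> S l" "F v = ?z" using surjF[OF c1] by blast
    have v1: "snd v = 1"
      using interior[OF v(1)] up[OF v(1)] v(2) model_level[OF v(1)] by fastforce
    have "w \<in> hleaf v" if w: "w \<in> S l" "snd w = 1" for w
    proof -
      have "F w \<in> hleaf (F v)" unfolding v(2) using bottom_leaf[OF c1 FS[OF w(1)]] down[OF w] by simp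
      then have "F w \<in> F ` hleaf v" using leaf(1)[OF v(1)] by simp
      then show ?thesis using inj_on_image_mem_iff[OF inj w(1) hleaf_subset[OF v(1)]] by simp
    qed
    \<comment> \<open>Conversely the upper line of \<open>l\<close> goes into the lower line of
      \<open>m\<close>, which is one leaf, so the root \<open>l\<close> has a single upper interval,
      contrary to \<open>asymmetric\<close>.\<close>
    then have "tops l = {1}" using single[OF l v(1) v1] by blast
    then show False using asymmetric addr_in[OF l] root by simp
  qed
  have bot: "snd (F z) = -1" if z: "z \<in> S l" "snd z = -1" for z
    by (rule le0) (use z inc approach_I[OF z(1)] zero low[OF z(2)] in auto)
  have top: "snd (F z) = 1" if z: "z \<in> S l" "snd z = 1" for z
    by (rule ge0) (use z inc approach_I[OF z(1)] zero high[OF z(2)] in auto)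
  have mono_level: "snd (F z) < snd (F w)" if zw: "z \<in> S l" "w \<in> S l" "snd z < snd w" for z w
  proof -
    have lv: "-1 \<le> snd z" "snd w \<le> 1" using model_level zw by auto
    have int: "-1 < snd (F v) \<and> snd (F v) < 1 \<and> v \<in> plain l \<and> snd v \<in> ?I" if "v \<in> S l" "-1 < snd v" "snd v < 1" for v
      using interior[OF that(1)] plain_iff[OF l that(1)] plain_levels_interior[OF that(2,3)] that by blast
    show ?thesis
    proof (cases "snd z = -1"; cases "snd w = 1")
      assume "snd z = -1" "snd w = 1"
      then show ?thesis using bot top zw by simp
    next
      assume "snd z = -1" "snd w \<noteq> 1"
      then show ?thesis using bot[OF zw(1)] int[OF zw(2)] zw(3) lv by simp
    next
      assume "snd z \<noteq> -1" "snd w = 1"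
      then show ?thesis using top[OF zw(2)] int[OF zw(1)] zw(3) lv by simp
    next
      assume "snd z \<noteq> -1" "snd w \<noteq> 1"
      then have "snd z \<in> ?I" "z \<in> plain l" "snd w \<in> ?I" "w \<in> plain l"
        using int[OF zw(1)] int[OF zw(2)] zw(3) lv by simp_all
      then show ?thesis using level inc zw(3) by simp
    qed
  qed
  \<comment> \<open>Points of different upper intervals share no leaf. They are compared through
    interior leaves running under both, and injectivity makes the limit inequality strict.\<close>
  have mono: "snd (F z) = snd (F w) \<and> fst (F z) < fst (F w)"
    if zw: "z \<in> S l" "w \<in> S l" "snd z = snd w" "fst z < fst w" for z w
  proof (cases "w \<in> hleaf z")
    case True
    then show ?thesis using leaf(2,3)[OF zw(1) True] zw(4) by simp
  next
    case False
    then have one: "snd z = 1" "snd w = 1" using zw by (auto simp: mem_hleaf_iff)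
    have "fst (F (approach z n)) \<le> fst (F (approach w n))" for n
    proof -
      have "approach w n \<in> hleaf (approach z n)"
        using approach_in[OF zw(1), of n] approach_in[OF zw(2), of n] zw(3)
        by (simp add: mem_hleaf_iff[OF approach_in(3)[OF zw(1)]]) (simp add: approach_def)
      then show ?thesis
        using leaf(2)[OF approach_in(3)[OF zw(1)]] zw(4) approach_in(4) zw(1,2) by (metis less_imp_le)
    qed
    then have "fst (F z) \<le> fst (F w)"
      using LIMSEQ_le[OF tendsto_fst[OF approach_tendsto[OF zw(1) cont]] tendsto_fst[OF approach_tendsto[OF zw(2) cont]]]
      by blast
    moreover have "fst (F z) \<noteq> fst (F w)"
      using inj_onD[OF inj _ zw(1,2)] top zw(1,2) one zw(4) by (metis less_irrefl prod_eqI)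
    ultimately show ?thesis using top zw(1,2) one by simp
  qed
  have "strip_map (tops l) (tops m) F"
    unfolding strip_map_def using cont bij mono_level mono by simp
  then show ?thesis using that[OF m] eq plain by blast
qed

section \<open>Portraits of homeomorphisms\<close>

definition shift_strip :: "(int list \<Rightarrow> int) \<Rightarrow> 'l \<Rightarrow> 'l" where
  "shift_strip k l = node (act k (addr l))"

text \<open>The last clause also fixes \<open>k\<close> on unglued upper intervals, of which the
  permutation of the strips retains nothing.\<close>

definition realizes :: "('l surface_point \<Rightarrow> 'l surface_point) \<Rightarrow> (int list \<Rightarrow> int) \<Rightarrow> bool" where
  "realizes h k \<longleftrightarrow> (\<forall>l\<in>strips D. \<exists>F. strip_map (tops l) (tops (shift_strip k l)) F \<and>
     (\<forall>z\<in>S l. h (pr l z) = pr (shift_strip k l) (F z)) \<and>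
     (\<forall>i\<in>tops l. F ` (J i \<times> {1}) = J (i + k (addr l)) \<times> {1}))"

lemma shift_strip:
  assumes "k \<in> tree_isos T T" "l \<in> strips D"
  shows "shift_strip k l \<in> strips D" "addr (shift_strip k l) = act k (addr l)"
    "tops (shift_strip k l) = (\<lambda>i. i + k (addr l)) ` tops l"
proof -
  have "T (act k (addr l)) = map_option (image (\<lambda>i. i + k (addr l))) (T (addr l))"
    using assms(1) unfolding tree_isos_def by blast
  then have *: "T (act k (addr l)) = Some ((\<lambda>i. i + k (addr l)) ` tops l)"
    using addr_in[OF assms(2)] by (metis option.map(2))
  then show "shift_strip k l \<in> strips D" "addr (shift_strip k l) = act k (addr l)"
    by (simp_all add: shift_strip_def node_in addr_node)
  then show "tops (shift_strip k l) = (\<lambda>i. i + k (addr l)) ` tops l" using * by simp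
qed

text \<open>Image strips, strip maps and shifts are chosen strip by strip; the seams then force the
  induced map of addresses to be \<open>act k\<close>.\<close>

lemma H_portrait:
  assumes h: "h \<in> H"
  shows "\<exists>k\<in>tree_isos T T. realizes h k"
proof -
  define Q where "Q l m F \<kappa> \<longleftrightarrow> m \<in> strips D \<and> strip_map (tops l) (tops m) F \<and>
      (\<forall>z\<in>S l. h (pr l z) = pr m (F z)) \<and> F ` plain l = plain m \<and> (tops l = {} \<longrightarrow> \<kappa> = 0) \<and>
      tops m = (\<lambda>i. i + \<kappa>) ` tops l \<and> (\<forall>i\<in>tops l. F ` (J i \<times> {1}) = J (i + \<kappa>) \<times> {1})"
    for l m F and \<kappa> :: int
  have "\<exists>m F \<kappa>. Q l m F \<kappa>" if l: "l \<in> strips D" for l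
  proof -
    obtain m F where m: "m \<in> strips D" "strip_map (tops l) (tops m) F"
      "\<And>z. z \<in> S l \<Longrightarrow> h (pr l z) = pr m (F z)" "F ` plain l = plain m"
      using H_strip_map[OF h l] by metis
    obtain \<kappa> where "(tops l = {} \<longrightarrow> \<kappa> = 0) \<and> tops m = (\<lambda>i. i + \<kappa>) ` tops l \<and>
        (\<forall>i\<in>tops l. F ` (J i \<times> {1}) = J (i + \<kappa>) \<times> {1})"
      using strip_map_shift[OF m(2) tops_index[OF l] tops_index[OF m(1)]] by (elim exE)
    then have "Q l m F \<kappa>" unfolding Q_def using m by (intro conjI ballI) simp_all
    then show ?thesis by (intro exI)
  qed
  then obtain \<sigma> F \<kappa> where Q: "\<And>l. l \<in> strips D \<Longrightarrow> Q l (\<sigma> l) (F l) (\<kappa> l)" by metis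
  have \<sigma>: "\<sigma> l \<in> strips D" if "l \<in> strips D" for l
    using Q[OF that] unfolding Q_def by (elim conjE)
  have F: "strip_map (tops l) (tops (\<sigma> l)) (F l)" if "l \<in> strips D" for l
    using Q[OF that] unfolding Q_def by (elim conjE)
  have plain: "F l ` plain l = plain (\<sigma> l)" if "l \<in> strips D" for l
    using Q[OF that] unfolding Q_def by (elim conjE)
  have \<kappa>_empty: "tops l = {} \<longrightarrow> \<kappa> l = 0" if "l \<in> strips D" for l
    using Q[OF that] unfolding Q_def by (elim conjE)
  have \<kappa>_tops: "tops (\<sigma> l) = (\<lambda>i. i + \<kappa> l) ` tops l" if "l \<in> strips D" for l
    using Q[OF that] unfolding Q_def by (elim conjE)
  have eq: "h (pr l z) = pr (\<sigma> l) (F l z)" if "l \<in> strips D" "z \<in> S l" for l z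
    using Q[OF that(1)] that(2) unfolding Q_def by (elim conjE) (erule bspec)
  have \<kappa>_image: "F l ` (J i \<times> {1}) = J (i + \<kappa> l) \<times> {1}" if "l \<in> strips D" "i \<in> tops l" for l i
    using Q[OF that(1)] that(2) unfolding Q_def by (elim conjE) (rule bspec)
  define k where "k a = (if T a \<noteq> None then \<kappa> (node a) else 0)" for a
  have k_addr: "k (addr l) = \<kappa> l" if l: "l \<in> strips D" for l
  proof -
    have "T (addr l) \<noteq> None" using addr_in[OF l] by (metis option.distinct(1))
    then show ?thesis using l by (simp add: k_def)
  qed
  have c1: "(5/4, -1) \<in> S n" for n by (simp add: mem_model mem_J_iff)
  have addr_\<sigma>: "addr (\<sigma> l) = act k a" if "l \<in> strips D" "addr l = a" for l a
    using that
  proof (induction a arbitrary: l rule: rev_induct)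
    case Nil
    \<comment> \<open>The lower leaf of the root is plain, hence so is its image, and only the root
      has a plain lower leaf.\<close>
    have "(5/4, -1) \<in> plain l" using plain_iff[OF Nil(1) c1] Nil(2) by (simp add: plain_levels_def)
    then have "F l (5/4, -1) \<in> plain (\<sigma> l)" using plain[OF Nil(1)] by blast
    moreover have "snd (F l (5/4, -1)) = -1" using strip_map_bottom_iff[OF F[OF Nil(1)] c1] by simp
    ultimately show ?case
      using plain_iff[OF \<sigma>[OF Nil(1)] strip_map_in[OF F[OF Nil(1)] c1]] by (simp add: plain_levels_def)
  next
    case (snoc i a)
    note l = snoc.prems(1)
    note p = parent[OF snoc.prems]
    let ?p = "node a" and ?z = "(5/4, -1)"
    \<comment> \<open>The copy, on the upper side of the parent, of the base point of the lower leaf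
      of \<open>l\<close>.\<close>
    define w where "w = (5/4 + of_int i - 1 :: real, 1 :: real)"
    have b: "below l ?z ?p w" using snoc.prems p by (simp add: below_def w_def)
    have w: "w \<in> S ?p" "pr l ?z = pr ?p w" using below_pr[OF b l p(1) c1] by auto
    have "pr (\<sigma> l) (F l ?z) = pr (\<sigma> ?p) (F ?p w)"
      using eq[OF l c1] eq[OF p(1) w(1)] w(2) by simp
    moreover have s: "snd (F l ?z) = -1" "snd (F ?p w) = 1"
      using strip_map_bottom_iff[OF F[OF l] c1] strip_map_top_iff[OF F[OF p(1)] w(1)] by (simp_all add: w_def)
    ultimately have "below (\<sigma> l) (F l ?z) (\<sigma> ?p) (F ?p w)"
      using pr_eq_iff[OF \<sigma>[OF l] \<sigma>[OF p(1)] strip_map_in[OF F[OF l] c1] strip_map_in[OF F[OF p(1)] w(1)]]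
      by (auto simp: below_def)
    then obtain j where j: "addr (\<sigma> l) = addr (\<sigma> ?p) @ [j]" "F ?p w = (fst (F l ?z) + of_int j - 1, 1)"
      by (auto simp: below_def)
    have "fst (F l ?z) \<in> J 1" using bottom_in_J[OF strip_map_in[OF F[OF l] c1] s(1)] .
    then have "fst (F ?p w) \<in> J j" using j(2) by (auto simp: mem_J_iff)
    moreover have "w \<in> J i \<times> {1}" by (auto simp: w_def mem_J_iff)
    then have "F ?p w \<in> J (i + \<kappa> ?p) \<times> {1}" using \<kappa>_image[OF p(1,3)] by blast
    ultimately have "j = i + \<kappa> ?p" using J_inj by auto
    moreover have "k a = \<kappa> ?p" using k_addr[OF p(1)] p(2) by simp
    ultimately show ?case using j(1) snoc.IH[OF p(1,2)] by (simp add: act_snoc)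
  qed
  have \<sigma>_surj: "\<exists>l\<in>strips D. \<sigma> l = m" if m: "m \<in> strips D" for m
  proof -
    have z0: "(0, 0) \<in> S m" by (rule interior_model) auto
    have "pr m (0, 0) \<in> h ` topspace (surface D)"
      using pr_in[OF m z0] H_bij[OF h] by (simp add: bij_betw_def)
    then obtain l z where l: "l \<in> strips D" "z \<in> S l" "pr m (0, 0) = h (pr l z)"
      unfolding topspace_surface by blast
    then have "pr m (0, 0) = pr (\<sigma> l) (F l z)" using eq by simp
    then have "m = \<sigma> l"
      using pr_eq_iff[OF m \<sigma>[OF l(1)] z0 strip_map_in[OF F[OF l(1)] l(2)]] by (auto simp: below_def)
    then show ?thesis using l(1) by blast
  qed
  have shift: "shift_strip k l = \<sigma> l" if "l \<in> strips D" for l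
    using addr_\<sigma>[OF that refl] node_addr[OF \<sigma>[OF that]] by (simp add: shift_strip_def)
  have "k \<in> tree_isos T T"
    unfolding tree_isos_def
  proof (intro CollectI allI)
    fix a
    show "T (act k a) = map_option (image (\<lambda>i. i + k a)) (T a) \<and> (T a = None \<or> T a = Some {} \<longrightarrow> k a = 0)"
    proof (cases "T a = None")
      case True
      \<comment> \<open>Absent vertices go to absent ones because the map of strips is onto and
        \<open>act k\<close> is injective.\<close>
      have "T (act k a) = None"
      proof (rule ccontr)
        assume "T (act k a) \<noteq> None"
        then have m: "node (act k a) \<in> strips D" "addr (node (act k a)) = act k a"
          by (rule node_in, rule addr_node)
        then obtain l where l: "l \<in> strips D" "\<sigma> l = node (act k a)" using \<sigma>_surj by blast
        then have "act k (addr l) = act k a" using addr_\<sigma>[OF l(1) refl] m(2) by simp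
        then have "addr l = a" by (metis unact_act)
        then show False using addr_in[OF l(1)] True by simp
      qed
      then show ?thesis using True by (simp add: k_def)
    next
      case False
      define l where "l = node a"
      have l: "l \<in> strips D" "addr l = a" using node_in[OF False] addr_node[OF False] by (simp_all add: l_def)
      have "T (act k a) = Some (tops (\<sigma> l))" using addr_in[OF \<sigma>[OF l(1)]] addr_\<sigma>[OF l] by simp
      moreover have "T a = Some (tops l)" using addr_in[OF l(1)] l(2) by simp
      moreover have "k a = \<kappa> l" using k_addr[OF l(1)] l(2) by simp
      ultimately show ?thesis using \<kappa>_empty[OF l(1)] \<kappa>_tops[OF l(1)] by simp
    qed
  qed
  moreover have "realizes h k"
    unfolding realizes_def
  proof
    fix l assume l: "l \<in> strips D"
    show "\<exists>F. strip_map (tops l) (tops (shift_strip k l)) F \<and>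
        (\<forall>z\<in>S l. h (pr l z) = pr (shift_strip k l) (F z)) \<and>
        (\<forall>i\<in>tops l. F ` (J i \<times> {1}) = J (i + k (addr l)) \<times> {1})"
      unfolding shift[OF l] k_addr[OF l] by (intro exI[of _ "F l"] conjI ballI F[OF l] eq[OF l] \<kappa>_image[OF l])
  qed
  ultimately show ?thesis by blast
qed

end

lemma strip_map_compose:
  assumes F: "strip_map \<Delta> \<Delta>' F" and G: "strip_map \<Delta>' \<Delta>'' G"
  shows "strip_map \<Delta> \<Delta>'' (G \<circ> F)"
proof -
  have img: "F ` model \<Delta> = model \<Delta>'" using strip_map_bij[OF F] by (simp add: bij_betw_def)
  have "continuous_on (model \<Delta>) (G \<circ> F)"
    by (rule continuous_on_compose[OF strip_map_continuous[OF F]])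
      (use strip_map_continuous[OF G] in \<open>simp only: img\<close>)
  moreover have "bij_betw (G \<circ> F) (model \<Delta>) (model \<Delta>'')"
    by (rule bij_betw_trans[OF strip_map_bij[OF F] strip_map_bij[OF G]])
  moreover have "snd (G (F z)) < snd (G (F w))" if "z \<in> model \<Delta>" "w \<in> model \<Delta>" "snd z < snd w" for z w
    by (rule strip_map_level_less[OF G strip_map_in[OF F that(1)] strip_map_in[OF F that(2)]
          strip_map_level_less[OF F that]])
  moreover have "snd (G (F z)) = snd (G (F w)) \<and> fst (G (F z)) < fst (G (F w))"
    if zw: "z \<in> model \<Delta>" "w \<in> model \<Delta>" "snd z = snd w" "fst z < fst w" for z w
  proof -
    note e = strip_map_level_eq[OF F zw(1,2,3)]
    note i = strip_map_in[OF F zw(1)] strip_map_in[OF F zw(2)]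
    show ?thesis
      using strip_map_level_eq[OF G i e] strip_map_less[OF G i e strip_map_less[OF F zw]] by simp
  qed
  ultimately show ?thesis unfolding strip_map_def by simp
qed

context reduced_tree
begin

lemma shift_strip_inj:
  assumes "k \<in> tree_isos T T" "l \<in> strips D" "m \<in> strips D" "shift_strip k l = shift_strip k m"
  shows "l = m"
proof -
  have "act k (addr l) = act k (addr m)"
    using shift_strip(2)[OF assms(1,2)] shift_strip(2)[OF assms(1,3)] assms(4) by simp
  then have "addr l = addr m" by (metis unact_act)
  then show ?thesis using addr_inj[OF assms(2,3)] by simp
qed

lemma shift_strip_surj:
  assumes k: "k \<in> tree_isos T T" and m: "m \<in> strips D"
  shows "\<exists>l\<in>strips D. shift_strip k l = m"
proof -
  define a where "a = unact k (addr m)"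
  have act: "act k a = addr m" by (simp add: a_def)
  have "T (act k a) = map_option (image (\<lambda>i. i + k a)) (T a)"
    using k unfolding tree_isos_def by blast
  then have "T a \<noteq> None" using addr_in[OF m] unfolding act by (metis option.distinct(1) option.map(1))
  then have a: "node a \<in> strips D" "addr (node a) = a" by (rule node_in, rule addr_node)
  have "shift_strip k (node a) = node (addr m)" unfolding shift_strip_def a(2) act ..
  then show ?thesis using a(1) node_addr[OF m] by (intro bexI[of _ "node a"]) simp_all
qed

section \<open>Gluing strip maps to a homeomorphism\<close>

text \<open>The value at a point is computed from an arbitrary representative. Independence of the
  choice comes from the assumption \<open>seam\<close> of the context that follows: in coordinates,
  it makes the maps on the two sides of a seam agree after the seam translations.\<close>

definition glue :: "(int list \<Rightarrow> int) \<Rightarrow> ('l \<Rightarrow> real \<times> real \<Rightarrow> real \<times> real) \<Rightarrow> 'l surface_point \<Rightarrow> 'l surface_point" where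
  "glue k G = (\<lambda>p\<in>topspace (surface D).
     let x = (SOME x. fst x \<in> strips D \<and> snd x \<in> S (fst x) \<and> p = pr (fst x) (snd x))
     in pr (shift_strip k (fst x)) (G (fst x) (snd x)))"

context
  fixes k G
  assumes k: "k \<in> tree_isos T T"
    and G: "\<And>l. l \<in> strips D \<Longrightarrow> strip_map (tops l) (tops (shift_strip k l)) (G l)"
    and seam: "\<And>l m i x. l \<in> strips D \<Longrightarrow> m \<in> strips D \<Longrightarrow> addr l = addr m @ [i] \<Longrightarrow> x \<in> J 1 \<Longrightarrow>
      G m (x + of_int i - 1, 1) = (fst (G l (x, -1)) + of_int (i + k (addr m)) - 1, 1)"
begin

lemma glue_below:
  assumes "below l z m w" "l \<in> strips D" "m \<in> strips D" "z \<in> S l"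
  shows "below (shift_strip k l) (G l z) (shift_strip k m) (G m w)"
proof -
  obtain i where i: "addr l = addr m @ [i]" "snd z = -1" "w = (fst z + of_int i - 1, 1)"
    using assms(1) by (auto simp: below_def)
  have "fst z \<in> J 1" by (rule bottom_in_J[OF assms(4) i(2)])
  moreover have "z = (fst z, -1)" using i(2) by (simp add: prod_eq_iff)
  ultimately have "G m w = (fst (G l z) + of_int (i + k (addr m)) - 1, 1)"
    using seam[OF assms(2,3) i(1)] unfolding i(3) by metis
  moreover have "addr (shift_strip k l) = addr (shift_strip k m) @ [i + k (addr m)]"
    using shift_strip(2)[OF k assms(2)] shift_strip(2)[OF k assms(3)] by (simp add: i(1) act_snoc)
  moreover have "snd (G l z) = -1" using strip_map_bottom_iff[OF G[OF assms(2)] assms(4)] i(2) by simp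
  ultimately show ?thesis unfolding below_def by blast
qed

lemma glue_well_defined:
  assumes "l \<in> strips D" "m \<in> strips D" "z \<in> S l" "w \<in> S m" "pr l z = pr m w"
  shows "pr (shift_strip k l) (G l z) = pr (shift_strip k m) (G m w)"
proof -
  have b: "pr (shift_strip k l) (G l z) = pr (shift_strip k m) (G m w)"
    if "below l z m w" "l \<in> strips D" "m \<in> strips D" "z \<in> S l" for l z m w
    using below_pr[OF glue_below[OF that] shift_strip(1)[OF k that(2)] shift_strip(1)[OF k that(3)]
        strip_map_in[OF G[OF that(2)] that(4)]] by blast
  consider "l = m \<and> z = w" | "below l z m w" | "below m w l z"
    using assms(5) pr_eq_iff[OF assms(1-4)] by blast
  then show ?thesis
  proof cases
    case 1 then show ?thesis by simp
  next
    case 2 then show ?thesis by (rule b) (fact assms)+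
  next
    case 3 then show ?thesis by (rule b[symmetric]) (fact assms)+
  qed
qed

lemma glue_pr:
  assumes "l \<in> strips D" "z \<in> S l"
  shows "glue k G (pr l z) = pr (shift_strip k l) (G l z)"
proof -
  define x where "x = (SOME x. fst x \<in> strips D \<and> snd x \<in> S (fst x) \<and> pr l z = pr (fst x) (snd x))"
  have "\<exists>x. fst x \<in> strips D \<and> snd x \<in> S (fst x) \<and> pr l z = pr (fst x) (snd x)"
    using assms by (intro exI[of _ "(l, z)"]) simp
  then have x: "fst x \<in> strips D \<and> snd x \<in> S (fst x) \<and> pr l z = pr (fst x) (snd x)"
    unfolding x_def by (rule someI_ex)
  have "glue k G (pr l z) = pr (shift_strip k (fst x)) (G (fst x) (snd x))"
    unfolding glue_def Let_def x_def using pr_in[OF assms] by simp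
  also have "\<dots> = pr (shift_strip k l) (G l z)"
    by (rule glue_well_defined) (use x assms in simp_all)
  finally show ?thesis .
qed

text \<open>A coincidence of images in different strips occurs on a seam between the images of
  \<open>l\<close> and \<open>m\<close>; as \<open>act k\<close> is injective, that seam comes from
  one between \<open>l\<close> and \<open>m\<close>.\<close>

lemma glue_inj:
  assumes l: "l \<in> strips D" "m \<in> strips D" "z \<in> S l" "w \<in> S m"
    and eq: "pr (shift_strip k l) (G l z) = pr (shift_strip k m) (G m w)"
  shows "pr l z = pr m w"
proof -
  have b: "pr l z = pr m w"
    if b: "below (shift_strip k l) (G l z) (shift_strip k m) (G m w)"
      and l: "l \<in> strips D" "m \<in> strips D" "z \<in> S l" "w \<in> S m" for l z m w
  proof -
    obtain j where j: "addr (shift_strip k l) = addr (shift_strip k m) @ [j]" "snd (G l z) = -1"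
      "G m w = (fst (G l z) + of_int j - 1, 1)"
      using b by (auto simp: below_def)
    define i where "i = j - k (addr m)"
    have "act k (addr l) = act k (addr m @ [i])"
      using j(1) shift_strip(2)[OF k l(1)] shift_strip(2)[OF k l(2)] by (simp add: act_snoc i_def)
    then have i: "addr l = addr m @ [i]" by (metis unact_act)
    have z: "snd z = -1" using strip_map_bottom_iff[OF G[OF l(1)] l(3)] j(2) by simp
    define w0 where "w0 = (fst z + of_int i - 1, 1 :: real)"
    have b0: "below l z m w0" using i z by (simp add: below_def w0_def)
    note w0 = below_pr[OF b0 l(1,2,3)]
    have "below (shift_strip k l) (G l z) (shift_strip k m) (G m w0)" by (rule glue_below[OF b0 l(1,2,3)])
    then have "G m w0 = G m w" using j by (auto simp: below_def)
    then have "w0 = w"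
      using inj_onD[OF bij_betw_imp_inj_on[OF strip_map_bij[OF G[OF l(2)]]]] w0 l(4) by blast
    then show ?thesis using w0 by simp
  qed
  note sh = shift_strip(1)[OF k l(1)] shift_strip(1)[OF k l(2)]
  note GS = strip_map_in[OF G[OF l(1)] l(3)] strip_map_in[OF G[OF l(2)] l(4)]
  consider "shift_strip k l = shift_strip k m \<and> G l z = G m w"
    | "below (shift_strip k l) (G l z) (shift_strip k m) (G m w)"
    | "below (shift_strip k m) (G m w) (shift_strip k l) (G l z)"
    using eq pr_eq_iff[OF sh GS] by blast
  then show ?thesis
  proof cases
    case 1
    then have "l = m" using shift_strip_inj[OF k l(1,2)] by blast
    then have "z = w"
      using inj_onD[OF bij_betw_imp_inj_on[OF strip_map_bij[OF G[OF l(1)]]] _ l(3)] 1 l(4) by simp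
    then show ?thesis using \<open>l = m\<close> by simp
  next
    case 2 then show ?thesis by (rule b) (fact l)+
  next
    case 3 then show ?thesis by (rule b[symmetric]) (fact l)+
  qed
qed

text \<open>Continuity in both directions is checked strip by strip; for the inverse this rests on
  the continuity of inverse strip maps.\<close>

lemma glue_in_H: "glue k G \<in> H"
proof -
  let ?X = "topspace (surface D)"
  let ?f = "glue k G"
  have ext: "?f \<in> extensional ?X" by (simp add: glue_def)
  have maps: "?f p \<in> ?X" if p: "p \<in> ?X" for p
  proof -
    obtain l z where l: "l \<in> strips D" "z \<in> S l" "p = pr l z" using p unfolding topspace_surface by blast
    show ?thesis unfolding l(3) glue_pr[OF l(1,2)]
      by (rule pr_in[OF shift_strip(1)[OF k l(1)] strip_map_in[OF G[OF l(1)] l(2)]])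
  qed
  have inj: "inj_on ?f ?X"
  proof (rule inj_onI)
    fix p q assume pq: "p \<in> ?X" "q \<in> ?X" "?f p = ?f q"
    obtain l z where l: "l \<in> strips D" "z \<in> S l" "p = pr l z" using pq(1) unfolding topspace_surface by blast
    obtain m w where m: "m \<in> strips D" "w \<in> S m" "q = pr m w" using pq(2) unfolding topspace_surface by blast
    show "p = q" using glue_inj[OF l(1) m(1) l(2) m(2)] pq(3) glue_pr[OF l(1,2)] glue_pr[OF m(1,2)] l(3) m(3) by simp
  qed
  have surj: "\<exists>l\<in>strips D. \<exists>z\<in>S l. q = ?f (pr l z)" if q: "q \<in> ?X" for q
  proof -
    obtain m w where m: "m \<in> strips D" "w \<in> S m" "q = pr m w" using q unfolding topspace_surface by blast
    obtain l where l: "l \<in> strips D" "shift_strip k l = m" using shift_strip_surj[OF k m(1)] by blast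
    have "w \<in> G l ` S l" using strip_map_bij[OF G[OF l(1)]] m(2) l(2) by (simp add: bij_betw_def)
    then obtain z where "z \<in> S l" "w = G l z" by blast
    then show ?thesis using glue_pr[OF l(1)] l m(3) by (intro bexI[of _ l] bexI[of _ z]) simp_all
  qed
  have bij: "bij_betw ?f ?X ?X"
    unfolding bij_betw_def
  proof
    show "?f ` ?X = ?X"
    proof
      show "?X \<subseteq> ?f ` ?X" using surj pr_in by fastforce
    qed (use maps in blast)
  qed (rule inj)
  have cont: "continuous_map (surface D) (surface D) ?f"
    unfolding continuous_map_from_surface
  proof
    fix l assume l: "l \<in> strips D"
    have "continuous_map (top_of_set (S l)) (top_of_set (S (shift_strip k l))) (G l)"
      using strip_map_continuous[OF G[OF l]] strip_map_in[OF G[OF l]] by auto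
    then have "continuous_map (top_of_set (S l)) (surface D) (pr (shift_strip k l) \<circ> G l)"
      by (rule continuous_map_compose[OF _ continuous_map_pr[OF shift_strip(1)[OF k l]]])
    then show "continuous_map (top_of_set (S l)) (surface D) (\<lambda>z. ?f (pr l z))"
      by (rule continuous_map_eq) (simp add: glue_pr[OF l])
  qed
  let ?g = "inv_into ?X ?f"
  have gf: "?g (?f p) = p" if "p \<in> ?X" for p using inj that by simp
  have fg: "?f (?g p) = p" if "p \<in> ?X" for p using bij that by (simp add: bij_betw_def f_inv_into_f)
  have "continuous_map (surface D) (surface D) ?g"
    unfolding continuous_map_from_surface
  proof
    fix m assume m: "m \<in> strips D"
    obtain l where l: "l \<in> strips D" "shift_strip k l = m" using shift_strip_surj[OF k m] by blast
    let ?i = "inv_into (S l) (G l)"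
    have Gl: "strip_map (tops l) (tops m) (G l)" using G[OF l(1)] l(2) by simp
    have i: "?i w \<in> S l" "G l (?i w) = w" if "w \<in> S m" for w
      using that strip_map_bij[OF Gl] by (auto simp: bij_betw_def inv_into_into f_inv_into_f)
    have "continuous_map (top_of_set (S m)) (top_of_set (S l)) ?i"
      using strip_map_inverse_continuous[OF Gl] i(1) by auto
    then have "continuous_map (top_of_set (S m)) (surface D) (pr l \<circ> ?i)"
      by (rule continuous_map_compose[OF _ continuous_map_pr[OF l(1)]])
    then show "continuous_map (top_of_set (S m)) (surface D) (\<lambda>w. ?g (pr m w))"
    proof (rule continuous_map_eq)
      fix w assume "w \<in> topspace (top_of_set (S m))"
      then have w: "w \<in> S m" by simp
      have "?f (pr l (?i w)) = pr m w" using glue_pr[OF l(1) i(1)[OF w]] i(2)[OF w] l(2) by simp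
      then show "(pr l \<circ> ?i) w = ?g (pr m w)" using gf[OF pr_in[OF l(1) i(1)[OF w]]] by simp
    qed
  qed
  then have "homeomorphic_maps (surface D) (surface D) ?f ?g"
    unfolding homeomorphic_maps_def using cont gf fg by simp
  then have homeo: "homeomorphic_map (surface D) (surface D) ?f"
    unfolding homeomorphic_map_maps by blast
  have leaf: "?f ` \<omega> \<in> leaves D" if \<omega>: "\<omega> \<in> leaves D" for \<omega>
  proof -
    obtain l z where l: "l \<in> strips D" "z \<in> S l" "\<omega> = lf l z" using \<omega> by (rule leavesE)
    have "?f ` \<omega> = (\<lambda>v. pr (shift_strip k l) (G l v)) ` hleaf z"
      unfolding l(3) lf_def image_image
      by (rule image_cong[OF refl glue_pr[OF l(1)]]) (rule subsetD[OF hleaf_subset[OF l(2)]])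
    also have "\<dots> = lf (shift_strip k l) (G l z)"
      unfolding lf_def strip_map_hleaf[OF G[OF l(1)] l(2), symmetric] image_image ..
    finally show ?thesis
      using lf_in_leaves[OF shift_strip(1)[OF k l(1)] strip_map_in[OF G[OF l(1)] l(2)]] by simp
  qed
  have less: "leaf_less D (?f u) (?f v)" if uv: "leaf_less D u v" for u v
  proof -
    obtain l z w where l: "l \<in> strips D" "z \<in> S l" "w \<in> hleaf z" "fst z < fst w" "u = pr l z" "v = pr l w"
      using uv unfolding leaf_less_pr_iff by blast
    have w: "w \<in> S l" using hleaf_subset[OF l(2)] l(3) by blast
    have "snd z = snd w" using l(3) by (simp add: mem_hleaf_iff[OF l(2)])
    then have "fst (G l z) < fst (G l w)" using strip_map_less[OF G[OF l(1)] l(2) w] l(4) by simp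
    moreover have "G l w \<in> hleaf (G l z)" using strip_map_hleaf[OF G[OF l(1)] l(2)] l(3) by blast
    ultimately show ?thesis
      unfolding l(5,6) glue_pr[OF l(1,2)] glue_pr[OF l(1) w]
      using leaf_less_pr[OF shift_strip(1)[OF k l(1)] strip_map_in[OF G[OF l(1)] l(2)] strip_map_in[OF G[OF l(1)] w]]
      by simp
  qed
  have "?f \<in> Bij ?X" using ext bij by (simp add: Bij_def)
  then show ?thesis
    unfolding H_iff using homeo leaf less by (intro conjI ballI allI impI)
qed

end

subsection \<open>The action on the tree\<close>

lemma shear_image_J: "shear k ` (J i \<times> {1}) = J (i + k) \<times> {1}"
proof
  show "shear k ` (J i \<times> {1}) \<subseteq> J (i + k) \<times> {1}" by (auto simp: shear_def J_shift)
  show "J (i + k) \<times> {1} \<subseteq> shear k ` (J i \<times> {1})"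
  proof
    fix z :: "real \<times> real" assume z: "z \<in> J (i + k) \<times> {1}"
    then have "(fst z - of_int k, 1) \<in> J i \<times> {1}" "z = shear k (fst z - of_int k, 1)"
      by (auto simp: shear_def mem_J_iff)
    then show "z \<in> shear k ` (J i \<times> {1})" by (rule image_eqI[rotated])
  qed
qed

text \<open>For shears the compatibility along the seams is an identity, because they fix the lower
  line and translate the upper one.\<close>

lemma realizes_surj:
  assumes k: "k \<in> tree_isos T T"
  shows "\<exists>h\<in>H. realizes h k"
proof -
  let ?G = "\<lambda>l. shear (k (addr l))"
  have G: "strip_map (tops l) (tops (shift_strip k l)) (?G l)" if "l \<in> strips D" for l
    unfolding shift_strip(3)[OF k that] by (rule strip_map_shear)
  have seam: "?G m (x + of_int i - 1, 1) = (fst (?G l (x, -1)) + of_int (i + k (addr m)) - 1, 1)" for l m i x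
    by (simp add: shear_def)
  have "glue k ?G \<in> H" by (rule glue_in_H[OF k G seam])
  moreover have "realizes (glue k ?G) k"
    unfolding realizes_def
  proof
    fix l assume l: "l \<in> strips D"
    show "\<exists>F. strip_map (tops l) (tops (shift_strip k l)) F \<and>
       (\<forall>z\<in>S l. glue k ?G (pr l z) = pr (shift_strip k l) (F z)) \<and>
       (\<forall>i\<in>tops l. F ` (J i \<times> {1}) = J (i + k (addr l)) \<times> {1})"
      by (intro exI[of _ "?G l"] conjI ballI G[OF l] glue_pr[OF k G seam l] shear_image_J)
  qed
  ultimately show ?thesis by blast
qed

text \<open>The image of one interior point determines the image strip, and the image of one upper
  interval then determines the shift; where there is no upper interval, the normalization
  does.\<close>

lemma realizes_unique:
  assumes k: "k \<in> tree_isos T T" "k' \<in> tree_isos T T" and r: "realizes h k" "realizes h k'"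
  shows "k = k'"
proof
  fix a
  show "k a = k' a"
  proof (cases "T a = None \<or> T a = Some {}")
    case True
    then show ?thesis using tree_isos_zeroD[OF k(1)] tree_isos_zeroD[OF k(2)] by simp
  next
    case False
    then have l: "node a \<in> strips D" "addr (node a) = a" using node_in addr_node by blast+
    define l where "l = node a"
    have l: "l \<in> strips D" "addr l = a" using l by (simp_all add: l_def)
    obtain F where F: "strip_map (tops l) (tops (shift_strip k l)) F"
      "\<And>z. z \<in> S l \<Longrightarrow> h (pr l z) = pr (shift_strip k l) (F z)"
      "\<And>i. i \<in> tops l \<Longrightarrow> F ` (J i \<times> {1}) = J (i + k (addr l)) \<times> {1}"
      using bspec[OF r(1)[unfolded realizes_def] l(1)] by (elim exE conjE) metis
    obtain F' where F': "strip_map (tops l) (tops (shift_strip k' l)) F'"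
      "\<And>z. z \<in> S l \<Longrightarrow> h (pr l z) = pr (shift_strip k' l) (F' z)"
      "\<And>i. i \<in> tops l \<Longrightarrow> F' ` (J i \<times> {1}) = J (i + k' (addr l)) \<times> {1}"
      using bspec[OF r(2)[unfolded realizes_def] l(1)] by (elim exE conjE) metis
    note m = shift_strip(1)[OF k(1) l(1)] shift_strip(1)[OF k(2) l(1)]
    have z0: "(0, 0) \<in> S l" by (rule interior_model) auto
    have "pr (shift_strip k l) (F (0, 0)) = pr (shift_strip k' l) (F' (0, 0))"
      using F(2)[OF z0] F'(2)[OF z0] by simp
    moreover have "snd (F (0, 0)) \<noteq> -1" "snd (F (0, 0)) \<noteq> 1"
      using strip_map_bottom_iff[OF F(1) z0] strip_map_top_iff[OF F(1) z0] by simp_all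
    ultimately have m_eq: "shift_strip k l = shift_strip k' l"
      using pr_eq_iff[OF m strip_map_in[OF F(1) z0] strip_map_in[OF F'(1) z0]] by (auto simp: below_def)
    have eq: "F z = F' z" if z: "z \<in> S l" for z
    proof -
      have "pr (shift_strip k l) (F z) = pr (shift_strip k l) (F' z)"
        using F(2)[OF z] F'(2)[OF z] m_eq by simp
      then show ?thesis
        using pr_inj[OF m(1) strip_map_in[OF F(1) z] strip_map_in[OF F'(1) z, folded m_eq]] by (rule iffD1[rotated])
    qed
    have "T a = Some (tops l)" using addr_in[OF l(1)] l(2) by simp
    then have "tops l \<noteq> {}" using False by metis
    then obtain i where i: "i \<in> tops l" by blast
    have "J i \<times> {1} \<subseteq> S l" using i by (auto simp: mem_model)
    then have "F ` (J i \<times> {1}) = F' ` (J i \<times> {1})" using eq by (intro image_cong[OF refl]) blast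
    then have "J (i + k a) \<times> {1 :: real} = J (i + k' a) \<times> {1}" using F(3)[OF i] F'(3)[OF i] l(2) by simp
    then have "(of_int (i + k a) + 1/4, 1 :: real) \<in> J (i + k' a) \<times> {1}"
      using J_mid[of "i + k a"] by (metis SigmaI singletonI)
    then have "of_int (i + k a) + 1/4 \<in> J (i + k' a)" by (simp only: mem_Times_iff fst_conv)
    then have "i + k a = i + k' a" by (rule J_inj[OF J_mid])
    then show ?thesis by simp
  qed
qed

text \<open>The outer map acts on the strip to which the inner one has moved \<open>l\<close>, so
  its shift is taken at the image address, as in \<open>portrait_mult\<close>.\<close>

lemma realizes_mult:
  assumes k: "k \<in> tree_isos T T" "k' \<in> tree_isos T T" and r: "realizes h k" "realizes g k'"
  shows "realizes (compose (topspace (surface D)) h g) (portrait_mult k k')"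
  unfolding realizes_def
proof
  fix l assume l: "l \<in> strips D"
  define m where "m = shift_strip k' l"
  have m: "m \<in> strips D" "addr m = act k' (addr l)" using shift_strip[OF k(2) l] by (simp_all add: m_def)
  obtain G where G: "strip_map (tops l) (tops m) G" "\<And>z. z \<in> S l \<Longrightarrow> g (pr l z) = pr m (G z)"
    "\<And>i. i \<in> tops l \<Longrightarrow> G ` (J i \<times> {1}) = J (i + k' (addr l)) \<times> {1}"
    using bspec[OF r(2)[unfolded realizes_def] l] unfolding m_def by (elim exE conjE) metis
  obtain F where F: "strip_map (tops m) (tops (shift_strip k m)) F"
    "\<And>z. z \<in> S m \<Longrightarrow> h (pr m z) = pr (shift_strip k m) (F z)"
    "\<And>i. i \<in> tops m \<Longrightarrow> F ` (J i \<times> {1}) = J (i + k (addr m)) \<times> {1}"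
    using bspec[OF r(1)[unfolded realizes_def] m(1)] by (elim exE conjE) metis
  have sh: "shift_strip (portrait_mult k k') l = shift_strip k m"
    unfolding shift_strip_def act_portrait_mult m(2) ..
  have "compose (topspace (surface D)) h g (pr l z) = pr (shift_strip k m) ((F \<circ> G) z)" if z: "z \<in> S l" for z
    using pr_in[OF l z] G(2)[OF z] F(2)[OF strip_map_in[OF G(1) z]] by (simp add: compose_def)
  moreover have "(F \<circ> G) ` (J i \<times> {1}) = J (i + portrait_mult k k' (addr l)) \<times> {1}" if i: "i \<in> tops l" for i
  proof -
    have "i + k' (addr l) \<in> tops m" using shift_strip(3)[OF k(2) l] i unfolding m_def by simp
    then have "F ` (J (i + k' (addr l)) \<times> {1}) = J (i + k' (addr l) + k (addr m)) \<times> {1}"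
      by (rule F(3))
    then show ?thesis
      using G(3)[OF i] m(2) unfolding image_comp[symmetric] by (simp add: portrait_mult_def algebra_simps)
  qed
  ultimately show "\<exists>F. strip_map (tops l) (tops (shift_strip (portrait_mult k k') l)) F \<and>
      (\<forall>z\<in>S l. compose (topspace (surface D)) h g (pr l z) = pr (shift_strip (portrait_mult k k') l) (F z)) \<and>
      (\<forall>i\<in>tops l. F ` (J i \<times> {1}) = J (i + portrait_mult k k' (addr l)) \<times> {1})"
    unfolding sh using strip_map_compose[OF G(1) F(1)]
    by (intro exI[of _ "F \<circ> G"] conjI ballI)
qed

definition portrait :: "('l surface_point \<Rightarrow> 'l surface_point) \<Rightarrow> int list \<Rightarrow> int" where
  "portrait h = (THE k. k \<in> tree_isos T T \<and> realizes h k)"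

lemma portrait_eq: "k \<in> tree_isos T T \<Longrightarrow> realizes h k \<Longrightarrow> portrait h = k"
  unfolding portrait_def using realizes_unique by (intro the_equality) blast+

lemma portrait:
  assumes "h \<in> H"
  shows "portrait h \<in> tree_isos T T" "realizes h (portrait h)"
proof -
  obtain k where "k \<in> tree_isos T T" "realizes h k" using H_portrait[OF assms] by blast
  then show "portrait h \<in> tree_isos T T" "realizes h (portrait h)" using portrait_eq by simp_all
qed

lemma group_hom_portrait: "group_hom (foliated_homeos D) (tree_group T) portrait"
proof (rule group_hom.intro[OF group_foliated_homeos group_tree_group])
  have "portrait \<in> hom (foliated_homeos D) (tree_group T)"
  proof (rule homI)
    fix h g assume hg: "h \<in> H" "g \<in> H"
    show "portrait (h \<otimes>\<^bsub>foliated_homeos D\<^esub> g) = portrait h \<otimes>\<^bsub>tree_group T\<^esub> portrait g"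
      unfolding foliated_homeos_mult[OF hg] mult_tree_group
      by (rule portrait_eq[OF tree_isos_mult realizes_mult]) (use portrait hg in simp_all)
  qed (simp add: portrait)
  then show "group_hom_axioms (foliated_homeos D) (tree_group T) portrait"
    by (rule group_hom_axioms.intro)
qed

lemma portrait_surj: "portrait ` H = carrier (tree_group T)"
proof
  show "portrait ` H \<subseteq> carrier (tree_group T)" by (simp add: image_subset_iff portrait)
  show "carrier (tree_group T) \<subseteq> portrait ` H"
  proof
    fix k assume "k \<in> carrier (tree_group T)"
    then have k: "k \<in> tree_isos T T" by simp
    then obtain h where h: "h \<in> H" "realizes h k" using realizes_surj by blast
    then show "k \<in> portrait ` H" using portrait_eq[OF k h(2)] by blast
  qed
qed

lemma kernel_portrait:
  "kernel (foliated_homeos D) (tree_group T) portrait = {h \<in> H. realizes h (\<lambda>_. 0)}"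
proof -
  have "portrait h = (\<lambda>_. 0) \<longleftrightarrow> realizes h (\<lambda>_. 0)" if "h \<in> H" for h
    using portrait(2)[OF that] portrait_eq[OF tree_isos_zero] by metis
  then show ?thesis by (auto simp: kernel_def)
qed

lemma shift_strip_zero: "l \<in> strips D \<Longrightarrow> shift_strip (\<lambda>_. 0) l = l"
  by (simp add: shift_strip_def)

end

text \<open>For compact \<open>K\<close> the projection of \<open>I \<times> K\<close> to
  \<open>I\<close> is closed, so the parameters at which some point of \<open>K\<close> is sent
  outside \<open>U\<close> form a closed set.\<close>

lemma continuous_into_compact_open:
  assumes \<Psi>: "continuous_map (prod_topology I X) Y (\<lambda>(s, p). \<Psi> s p)"
    and ext: "\<And>s. s \<in> topspace I \<Longrightarrow> \<Psi> s \<in> extensional (topspace X)"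
    and cont: "\<And>s. s \<in> topspace I \<Longrightarrow> continuous_map X Y (\<Psi> s)"
  shows "continuous_map I (compact_open_topology X Y) \<Psi>"
  unfolding compact_open_topology_def
proof (rule continuous_on_generated_topo)
  let ?N = "\<lambda>K U. {f \<in> extensional (topspace X). continuous_map X Y f \<and> f ` K \<subseteq> U}"
  fix W assume "W \<in> {?N K U |K U. compactin X K \<and> openin Y U}"
  then obtain K U where W: "W = ?N K U" and K: "compactin X K" and U: "openin Y U" by blast
  have KX: "K \<subseteq> topspace X" by (rule compactin_subset_topspace[OF K])
  let ?P = "prod_topology I (subtopology X K)"
  have "continuous_map ?P Y (\<lambda>(s, p). \<Psi> s p)"
    using \<Psi> by (simp add: prod_topology_subtopology continuous_map_from_subtopology)
  moreover have "closedin Y (topspace Y - U)" using U unfolding openin_closedin_eq by (rule conjunct2)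
  ultimately have "closedin ?P {y \<in> topspace ?P. (\<lambda>(s, p). \<Psi> s p) y \<in> topspace Y - U}"
    by (rule closedin_continuous_map_preimage)
  moreover have "closed_map ?P I fst"
    using K by (intro closed_map_fst) (simp add: compact_space_subtopology)
  ultimately have "closedin I (fst ` {y \<in> topspace ?P. (\<lambda>(s, p). \<Psi> s p) y \<in> topspace Y - U})"
    unfolding closed_map_def by blast
  moreover have "\<Psi> -` W \<inter> topspace I = topspace I - fst ` {y \<in> topspace ?P. (\<lambda>(s, p). \<Psi> s p) y \<in> topspace Y - U}"
  proof -
    have "\<Psi> s \<in> W \<longleftrightarrow> s \<notin> fst ` {y \<in> topspace ?P. (\<lambda>(s, p). \<Psi> s p) y \<in> topspace Y - U}"
      if s: "s \<in> topspace I" for s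
    proof -
      have "\<Psi> s p \<in> topspace Y" if "p \<in> K" for p
        using continuous_map_funspace[OF cont[OF s]] KX that by blast
      then have "s \<in> fst ` {y \<in> topspace ?P. (\<lambda>(s, p). \<Psi> s p) y \<in> topspace Y - U} \<longleftrightarrow> (\<exists>p\<in>K. \<Psi> s p \<notin> U)"
        using s KX by (force simp: image_iff)
      then show ?thesis unfolding W using ext[OF s] cont[OF s] by blast
    qed
    then show ?thesis by blast
  qed
  ultimately show "openin I (\<Psi> -` W \<inter> topspace I)" by (simp add: openin_diff)
next
  let ?N = "\<lambda>K U. {f \<in> extensional (topspace X). continuous_map X Y f \<and> f ` K \<subseteq> U}"
  show "\<Psi> ` topspace I \<subseteq> \<Union>{?N K U |K U. compactin X K \<and> openin Y U}"
  proof (rule image_subsetI)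
    fix s assume s: "s \<in> topspace I"
    \<comment> \<open>The generating set for \<open>K = {}\<close> consists of all extensional
      continuous maps, so it already covers the space.\<close>
    have "\<Psi> s \<in> ?N {} {}" using ext[OF s] cont[OF s] by simp
    moreover have "?N {} {} \<in> {?N K U |K U. compactin X K \<and> openin Y U}"
      unfolding mem_Collect_eq by (intro exI[of _ "{}"] conjI refl) simp_all
    ultimately show "\<Psi> s \<in> \<Union>{?N K U |K U. compactin X K \<and> openin Y U}" by (rule UnionI[rotated])
  qed
qed

context reduced_tree
begin

subsection \<open>The identity path component\<close>

abbreviation H_top where
  "H_top \<equiv> subtopology (compact_open_topology (surface D) (surface D)) H"

lemma topspace_H_top: "topspace H_top = H"
proof -
  let ?X = "topspace (surface D)"
  let ?B = "{{f \<in> extensional ?X. continuous_map (surface D) (surface D) f \<and> f ` K \<subseteq> U} |K U.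
        compactin (surface D) K \<and> openin (surface D) U}"
  have "H \<subseteq> \<Union>?B"
  proof
    fix h assume h: "h \<in> H"
    have "h \<in> {f \<in> extensional ?X. continuous_map (surface D) (surface D) f \<and> f ` {} \<subseteq> {}}"
      using h homeomorphic_imp_continuous_map[OF H_homeo[OF h]] by (simp add: H_iff Bij_def)
    moreover have "{f \<in> extensional ?X. continuous_map (surface D) (surface D) f \<and> f ` {} \<subseteq> {}} \<in> ?B"
      unfolding mem_Collect_eq by (intro exI[of _ "{}"] conjI refl) simp_all
    ultimately show "h \<in> \<Union>?B" by (rule UnionI[rotated])
  qed
  then have "H \<subseteq> topspace (compact_open_topology (surface D) (surface D))"
    unfolding compact_open_topology_def topology_generated_by_topspace .
  then show ?thesis by (simp add: Int_absorb1)
qed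

text \<open>A one-point set is compact, so the condition that \<open>p\<close> be sent into
  \<open>U\<close> is open in the compact-open topology.\<close>

lemma path_evaluation_continuous:
  assumes g: "continuous_map I H_top g" and p: "p \<in> topspace (surface D)"
  shows "continuous_map I (surface D) (\<lambda>s. g s p)"
  unfolding continuous_map_def
proof (intro conjI allI impI)
  have gH: "g s \<in> H" if "s \<in> topspace I" for s
    using continuous_map_funspace[OF g] that unfolding topspace_H_top by blast
  show "(\<lambda>s. g s p) \<in> topspace I \<rightarrow> topspace (surface D)"
    using bij_betwE[OF H_bij[OF gH]] p by blast
  fix U assume U: "openin (surface D) U"
  let ?X = "topspace (surface D)"
  let ?N = "{f \<in> extensional ?X. continuous_map (surface D) (surface D) f \<and> f ` {p} \<subseteq> U}"
  have "openin (compact_open_topology (surface D) (surface D)) ?N"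
    unfolding compact_open_topology_def
  proof (rule topology_generated_by_Basis)
    have "compactin (surface D) {p}" using p by simp
    then show "?N \<in> {{f \<in> extensional ?X. continuous_map (surface D) (surface D) f \<and> f ` K \<subseteq> U} |K U.
        compactin (surface D) K \<and> openin (surface D) U}"
      using U by blast
  qed
  moreover have "continuous_map I (compact_open_topology (surface D) (surface D)) g"
    using g by (simp add: continuous_map_in_subtopology)
  ultimately have "openin I {s \<in> topspace I. g s \<in> ?N}"
    by (rule openin_continuous_map_preimage[rotated])
  moreover have "g s \<in> ?N \<longleftrightarrow> g s p \<in> U" if "s \<in> topspace I" for s
    using gH[OF that] homeomorphic_imp_continuous_map[OF H_homeo[OF gH[OF that]]] by (simp add: H_iff Bij_def)
  then have "{s \<in> topspace I. g s \<in> ?N} = {s \<in> topspace I. g s p \<in> U}" by blast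
  ultimately show "openin I {s \<in> topspace I. g s p \<in> U}" by simp
qed

text \<open>In this set every leaf is open and closed, so a path of homeomorphisms cannot move a boundary
  leaf to another one.\<close>

definition seams_union :: "'l surface_point set" where
  "seams_union = {pr l z |l z. l \<in> strips D \<and> z \<in> S l \<and> (snd z = -1 \<or> snd z = 1)}"

lemma pr_in_seams_union:
  assumes "m \<in> strips D" "w \<in> S m"
  shows "pr m w \<in> seams_union \<longleftrightarrow> snd w = -1 \<or> snd w = 1"
proof
  assume "pr m w \<in> seams_union"
  then obtain l z where "l \<in> strips D" "z \<in> S l" "snd z = -1 \<or> snd z = 1" "pr m w = pr l z"
    unfolding seams_union_def by blast
  then show "snd w = -1 \<or> snd w = 1"
    using pr_eq_iff[OF assms(1) _ assms(2)] by (auto simp: below_def)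
qed (use assms in \<open>unfold seams_union_def, blast\<close>)

lemma H_seams_union:
  assumes h: "h \<in> H" and p: "p \<in> seams_union"
  shows "h p \<in> seams_union"
proof -
  obtain l z where l: "l \<in> strips D" "z \<in> S l" "snd z = -1 \<or> snd z = 1" "p = pr l z"
    using p unfolding seams_union_def by blast
  obtain m F where m: "m \<in> strips D" "strip_map (tops l) (tops m) F"
      "\<And>z. z \<in> S l \<Longrightarrow> h (pr l z) = pr m (F z)"
    using H_strip_map[OF h l(1)] by metis
  show ?thesis
    unfolding l(4) m(3)[OF l(2)] pr_in_seams_union[OF m(1) strip_map_in[OF m(2) l(2)]]
    using strip_map_bottom_iff[OF m(2) l(2)] strip_map_top_iff[OF m(2) l(2)] l(3) by blast
qed

text \<open>Arbitrary families are allowed because the lemma is applied both to a single leaf and to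
  all the others, the two halves of a separation.\<close>

lemma closedin_boundary_leaves:
  assumes \<L>: "\<L> \<subseteq> leaves D"
  shows "closedin (surface D) (seams_union \<inter> \<Union>\<L>)"
  unfolding closedin_surface
proof (intro conjI ballI)
  show "seams_union \<inter> \<Union>\<L> \<subseteq> topspace (surface D)"
    unfolding seams_union_def using pr_in by blast
  fix m assume m: "m \<in> strips D"
  let ?A = "{w \<in> S m. pr m w \<in> seams_union \<inter> \<Union>\<L>}"
  let ?C = "S m \<inter> (UNIV \<times> {-1, 1})"
  \<comment> \<open>Boxes around the boundary points outside the union. They reach less than 2
    vertically, so they miss the opposite line, and are as wide as one interval, so they meet one
    leaf only.\<close>
  define V where "V = (\<Union>w\<in>?C - ?A. J \<lfloor>fst w\<rfloor> \<times> {snd w - 1<..<snd w + 1})"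
  have "open V" unfolding V_def by (intro open_UN ballI open_Times open_J) auto
  have hl: "w \<in> hleaf v" if "v \<in> ?C" "w \<in> ?C" "w \<in> J \<lfloor>fst v\<rfloor> \<times> {snd v - 1<..<snd v + 1}" for v w
  proof -
    have "snd w = snd v" using that by auto
    moreover have "\<lfloor>fst w\<rfloor> = \<lfloor>fst v\<rfloor>" using that(3) J_floor by (auto simp: mem_Times_iff)
    moreover have "v \<in> S m" "w \<in> S m" using that(1,2) by blast+
    ultimately show ?thesis by (simp add: mem_hleaf_iff[OF \<open>v \<in> S m\<close>])
  qed
  have "?A = ?C - V"
  proof
    show "?A \<subseteq> ?C - V"
    proof
      fix w assume w: "w \<in> ?A"
      then have wS: "w \<in> S m" and wC: "w \<in> ?C"
        using pr_in_seams_union[OF m, of w] by (auto simp: mem_Times_iff)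
      obtain \<omega> where \<omega>: "\<omega> \<in> \<L>" "pr m w \<in> \<omega>" using w by blast
      have "w \<notin> V"
      proof
        assume "w \<in> V"
        then obtain v where v: "v \<in> ?C" "v \<notin> ?A" "w \<in> J \<lfloor>fst v\<rfloor> \<times> {snd v - 1<..<snd v + 1}"
          unfolding V_def by blast
        have vS: "v \<in> S m" "snd v = -1 \<or> snd v = 1" using v(1) by (auto simp: mem_Times_iff)
        have "hleaf w = hleaf v" using hleaf_eq[OF hl[OF v(1) wC v(3)]] .
        then have "\<omega> = lf m v"
          using leaf_eqI[OF subsetD[OF \<L> \<omega>(1)] m wS \<omega>(2)] by (simp add: lf_def)
        then have "pr m v \<in> \<Union>\<L>" using pr_in_lf[OF vS(1)] \<omega>(1) by blast
        then show False using v(2) vS pr_in_seams_union[OF m vS(1)] by simp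
      qed
      then show "w \<in> ?C - V" using wC by simp
    qed
    show "?C - V \<subseteq> ?A"
    proof
      fix w assume w: "w \<in> ?C - V"
      show "w \<in> ?A"
      proof (rule ccontr)
        assume "w \<notin> ?A"
        have wS: "w \<in> S m" "snd w = -1 \<or> snd w = 1" using w by (auto simp: mem_Times_iff)
        have "fst w \<in> J \<lfloor>fst w\<rfloor>"
          using bottom_in_J[OF wS(1)] top_in_J[OF wS(1)] wS(2) J_floor by metis
        then have "w \<in> J \<lfloor>fst w\<rfloor> \<times> {snd w - 1<..<snd w + 1}" by (simp add: mem_Times_iff)
        then have "w \<in> V" unfolding V_def using w \<open>w \<notin> ?A\<close> by (intro UN_I[of w]) simp_all
        then show False using w by simp
      qed
    qed
  qed
  moreover have "?C - V = S m \<inter> (UNIV \<times> {-1, 1} - V)" by blast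
  moreover have "closed (UNIV \<times> {-1, 1} - V)"
    using \<open>open V\<close> by (intro closed_Diff closed_Times) auto
  ultimately show "closedin (top_of_set (S m)) ?A" by (simp add: closedin_closed_Int)
qed

text \<open>The moving point stays in \<open>seams_union\<close>, which splits into the leaf it
  starts from and the remaining boundary leaves, both closed; the parameter interval is
  connected.\<close>

lemma path_fixes_boundary_leaf:
  assumes g: "pathin H_top g" "g 0 = \<one>\<^bsub>foliated_homeos D\<^esub>"
    and l: "l \<in> strips D" "z \<in> S l" "snd z = -1 \<or> snd z = 1"
  shows "g 1 (pr l z) \<in> lf l z"
proof -
  let ?I = "top_of_set {0..1 :: real}"
  have cg: "continuous_map ?I H_top g" using g(1) by (simp add: pathin_def)
  have gH: "g s \<in> H" if "s \<in> {0..1}" for s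
    using continuous_map_funspace[OF cg] that unfolding topspace_H_top by auto
  have p: "pr l z \<in> topspace (surface D)" by (rule pr_in[OF l(1,2)])
  note c = path_evaluation_continuous[OF cg p]
  define A where "A = seams_union \<inter> \<Union>{lf l z}"
  define B where "B = seams_union \<inter> \<Union>(leaves D - {lf l z})"
  have lz: "lf l z \<in> leaves D" by (rule lf_in_leaves[OF l(1,2)])
  have AB: "closedin (surface D) A" "closedin (surface D) B"
    unfolding A_def B_def using lz by (intro closedin_boundary_leaves; simp)+
  have disj: "q \<notin> B" if "q \<in> A" for q
  proof
    assume "q \<in> B"
    then obtain \<omega> where "\<omega> \<in> leaves D" "\<omega> \<noteq> lf l z" "q \<in> \<omega>" unfolding B_def by blast
    moreover have "q \<in> lf l z" using that unfolding A_def by simp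
    ultimately show False using leaves_disjoint[OF _ lz] by metis
  qed
  have cover: "q \<in> A \<or> q \<in> B" if q: "q \<in> seams_union" for q
  proof -
    have "q \<in> topspace (surface D)" using q pr_in unfolding seams_union_def by blast
    then obtain \<omega> where "\<omega> \<in> leaves D" "q \<in> \<omega>" using point_in_leaf by metis
    then show ?thesis using q unfolding A_def B_def by (cases "\<omega> = lf l z") auto
  qed
  have seam: "g s (pr l z) \<in> seams_union" if "s \<in> {0..1}" for s
    by (rule H_seams_union[OF gH[OF that]]) (use pr_in_seams_union[OF l(1,2)] l(3) in simp)
  define a where "a = {s \<in> topspace ?I. g s (pr l z) \<in> A}"
  define b where "b = {s \<in> topspace ?I. g s (pr l z) \<in> B}"
  have "closedin ?I a" "closedin ?I b"
    unfolding a_def b_def by (rule closedin_continuous_map_preimage[OF c AB(1)],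
        rule closedin_continuous_map_preimage[OF c AB(2)])
  moreover have ab: "a \<union> b = {0..1}"
  proof
    show "{0..1} \<subseteq> a \<union> b"
    proof
      fix s :: real assume s: "s \<in> {0..1}"
      then show "s \<in> a \<union> b" using cover[OF seam[OF s]] by (simp add: a_def b_def)
    qed
  qed (auto simp: a_def b_def)
  moreover have "a \<inter> b = {}" using disj by (auto simp: a_def b_def)
  moreover have "0 \<in> a"
  proof -
    have "g 0 (pr l z) = pr l z" using g(2) p by (simp add: foliated_homeos_one)
    then show ?thesis using pr_in_lf[OF l(2)] seam[of 0] by (simp add: a_def A_def)
  qed
  then have "a \<noteq> {}" by blast
  ultimately have "b \<noteq> {} \<Longrightarrow> \<not> connected {0..1 :: real}"
    unfolding connected_closedin_eq not_not by (intro exI[of _ a] exI[of _ b] conjI)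
  then have "b = {}" by (metis connected_Icc)
  then have "1 \<in> a" using ab by simp
  then show ?thesis by (simp add: a_def A_def)
qed

text \<open>The lower leaf being kept shows that the strip is mapped to itself; an upper leaf being
  kept shows that its shift is 0.\<close>

lemma boundary_fixing_portrait:
  assumes h: "h \<in> H"
    and fix_leaf: "\<And>l z. l \<in> strips D \<Longrightarrow> z \<in> S l \<Longrightarrow> snd z = -1 \<or> snd z = 1 \<Longrightarrow> h (pr l z) \<in> lf l z"
  shows "realizes h (\<lambda>_. 0)"
proof -
  define k where "k = portrait h"
  have k: "k \<in> tree_isos T T" "realizes h k" using portrait[OF h] by (simp_all add: k_def)
  have "k a = 0" for a
  proof (cases "T a = None \<or> T a = Some {}")
    case True
    then show ?thesis using tree_isos_zeroD[OF k(1)] by simp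
  next
    case False
    define l where "l = node a"
    have l: "l \<in> strips D" "addr l = a" using False node_in addr_node by (simp_all add: l_def)
    define m where "m = shift_strip k l"
    have m: "m \<in> strips D" using shift_strip(1)[OF k(1) l(1)] by (simp add: m_def)
    obtain F where F: "strip_map (tops l) (tops m) F"
      "\<And>z. z \<in> S l \<Longrightarrow> h (pr l z) = pr m (F z)"
      "\<And>i. i \<in> tops l \<Longrightarrow> F ` (J i \<times> {1}) = J (i + k (addr l)) \<times> {1}"
      using bspec[OF k(2)[unfolded realizes_def] l(1)] unfolding m_def by (elim exE conjE) metis
    have z: "(5/4, -1) \<in> S l" by (simp add: mem_model mem_J_iff)
    have "pr m (F (5/4, -1)) \<in> pr l ` hleaf (5/4, -1)"
      using fix_leaf[OF l(1) z] F(2)[OF z] by (simp add: lf_def)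
    then obtain v where v: "v \<in> hleaf (5/4, -1)" "pr m (F (5/4, -1)) = pr l v" by blast
    have vS: "v \<in> S l" using hleaf_subset[OF z] v(1) by blast
    have "snd v = -1" "snd (F (5/4, -1)) = -1"
      using v(1) z strip_map_bottom_iff[OF F(1) z] by (simp_all add: mem_hleaf_iff)
    then have "m = l"
      using v(2) pr_eq_iff[OF m l(1) strip_map_in[OF F(1) z] vS] by (auto simp: below_def)
    have "T a = Some (tops l)" using addr_in[OF l(1)] l(2) by simp
    then have "tops l \<noteq> {}" using False by metis
    then obtain i where i: "i \<in> tops l" by blast
    define c where "c = (of_int i + 1/4 :: real, 1 :: real)"
    have c: "c \<in> S l" "c \<in> J i \<times> {1}" using i J_mid by (auto simp: c_def mem_model)
    have hc: "hleaf c = J i \<times> {1}" using J_floor[OF J_mid[of i]] by (simp add: c_def hleaf_def)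
    have "pr l (F c) \<in> pr l ` hleaf c"
      using fix_leaf[OF l(1) c(1)] F(2)[OF c(1)] \<open>m = l\<close> by (simp add: lf_def c_def)
    then obtain w where w: "w \<in> hleaf c" "pr l (F c) = pr l w" by blast
    have "w \<in> S l" using hleaf_subset[OF c(1)] w(1) by blast
    then have "F c = w" using pr_inj[OF l(1) strip_map_in[OF F(1) c(1), unfolded \<open>m = l\<close>]] w(2) by blast
    then have "F c \<in> J i \<times> {1}" using w(1) hc by simp
    moreover have "F c \<in> J (i + k a) \<times> {1}" using F(3)[OF i] c(2) l(2) by blast
    ultimately have "fst (F c) \<in> J i" "fst (F c) \<in> J (i + k a)" by (simp_all add: mem_Times_iff)
    then have "i = i + k a" by (rule J_inj)
    then show ?thesis by simp
  qed
  then have "k = (\<lambda>_. 0)" by blast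
  then show ?thesis using k(2) by simp
qed

text \<open>The parameter interval is locally compact and Hausdorff, so its product with the
  quotient map is again a quotient map and joint continuity can be tested on the strips.\<close>

lemma isotopy_continuous:
  assumes F: "\<And>l. l \<in> strips D \<Longrightarrow> continuous_on (S l) (F l)"
    and B: "\<And>s l z. s \<in> {0..1} \<Longrightarrow> l \<in> strips D \<Longrightarrow> z \<in> S l \<Longrightarrow> blend s (F l) z \<in> S l"
    and \<Psi>: "\<And>s l z. s \<in> {0..1} \<Longrightarrow> l \<in> strips D \<Longrightarrow> z \<in> S l \<Longrightarrow> \<Psi> s (pr l z) = pr l (blend s (F l) z)"
  shows "continuous_map (prod_topology (top_of_set {0..1}) (surface D)) (surface D) (\<lambda>(s, p). \<Psi> s p)"
proof -
  let ?I = "top_of_set {0..1 :: real}"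
  let ?X = "sum_topology (\<lambda>l. top_of_set (strip D l)) (strips D)"
  have X: "topspace ?X = (SIGMA l:strips D. S l)"
    by (auto simp: strip_model)
  have q: "quotient_map ?X (surface D) (strip_proj D)"
    unfolding surface_def by (rule quotient_map_quotient_topology)
  have "compact_space ?I" by (simp add: compact_space_subtopology)
  then have "locally_compact_space ?I" by (intro compact_imp_locally_compact_space) auto
  then have Q: "quotient_map (prod_topology ?I ?X) (prod_topology ?I (surface D)) (\<lambda>(s, x). (s, strip_proj D x))"
    by (rule quotient_map_prod_right[OF _ _ q]) (simp add: Hausdorff_space_subtopology)
  have "continuous_map (prod_topology ?I ?X) (surface D) ((\<lambda>(s, p). \<Psi> s p) \<circ> (\<lambda>(s, x). (s, strip_proj D x)))"
    unfolding continuous_map_def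
  proof (intro conjI allI impI)
    have eq: "((\<lambda>(s, p). \<Psi> s p) \<circ> (\<lambda>(s, x). (s, strip_proj D x))) (s, (l, z)) = pr l (blend s (F l) z)"
      if "s \<in> {0..1}" "l \<in> strips D" "z \<in> S l" for s l z
      using \<Psi>[OF that] by (simp add: pr_def)
    show "(\<lambda>(s, p). \<Psi> s p) \<circ> (\<lambda>(s, x). (s, strip_proj D x)) \<in> topspace (prod_topology ?I ?X) \<rightarrow> topspace (surface D)"
    proof
      fix y assume "y \<in> topspace (prod_topology ?I ?X)"
      then obtain s l z where y: "y = (s, (l, z))" "s \<in> {0..1}" "l \<in> strips D" "z \<in> S l"
        by (cases y) (auto simp: strip_model)
      show "((\<lambda>(s, p). \<Psi> s p) \<circ> (\<lambda>(s, x). (s, strip_proj D x))) y \<in> topspace (surface D)"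
        unfolding y(1) eq[OF y(2-4)] by (rule pr_in[OF y(3) B[OF y(2-4)]])
    qed
    fix U assume U: "openin (surface D) U"
    let ?W = "{y \<in> topspace (prod_topology ?I ?X). ((\<lambda>(s, p). \<Psi> s p) \<circ> (\<lambda>(s, x). (s, strip_proj D x))) y \<in> U}"
    show "openin (prod_topology ?I ?X) ?W"
      unfolding openin_prod_topology_alt
    proof (intro allI impI)
      fix s x assume "(s, x) \<in> ?W"
      then obtain l z where y: "x = (l, z)" "s \<in> {0..1}" "l \<in> strips D" "z \<in> S l" "pr l (blend s (F l) z) \<in> U"
        using eq by (cases x) (auto simp: strip_model)
      let ?b = "\<lambda>y. blend (fst y) (F l) (snd y)"
      have "continuous_on ({0..1} \<times> S l) ?b"
        unfolding blend_def
        by (intro continuous_intros continuous_on_compose2[OF F[OF y(3)]]) auto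
      then have "continuous_map (prod_topology ?I (top_of_set (S l))) (top_of_set (S l)) ?b"
        using B y(3) by (auto simp: prod_topology_subtopology subtopology_subtopology
            euclidean_product_topology Times_Int_Times)
      then have "continuous_map (prod_topology ?I (top_of_set (S l))) (surface D) (pr l \<circ> ?b)"
        by (rule continuous_map_compose[OF _ continuous_map_pr[OF y(3)]])
      then have "openin (prod_topology ?I (top_of_set (S l)))
          {v \<in> topspace (prod_topology ?I (top_of_set (S l))). (pr l \<circ> ?b) v \<in> U}"
        using U by (rule openin_continuous_map_preimage)
      moreover have "(s, z) \<in> {v \<in> topspace (prod_topology ?I (top_of_set (S l))). (pr l \<circ> ?b) v \<in> U}"
        using y by simp
      ultimately obtain A C where AC: "openin ?I A" "openin (top_of_set (S l)) C" "s \<in> A" "z \<in> C"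
        "A \<times> C \<subseteq> {v \<in> topspace (prod_topology ?I (top_of_set (S l))). (pr l \<circ> ?b) v \<in> U}"
        unfolding openin_prod_topology_alt by meson
      have "openin (top_of_set (strip D l)) C" using AC(2) by (simp only: strip_model[OF y(3)])
      then have "openin ?X (Pair l ` C)"
        using open_map_component_injection[OF y(3), of "\<lambda>l. top_of_set (strip D l)"] unfolding open_map_def by blast
      moreover have "A \<times> Pair l ` C \<subseteq> ?W"
      proof
        fix v assume "v \<in> A \<times> Pair l ` C"
        then obtain s' z' where v: "v = (s', (l, z'))" "s' \<in> A" "z' \<in> C" by blast
        then have "(s', z') \<in> A \<times> C" by simp
        then have "(s', z') \<in> {v \<in> topspace (prod_topology ?I (top_of_set (S l))). (pr l \<circ> ?b) v \<in> U}"
          using AC(5) by blast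
        then have v': "s' \<in> {0..1}" "z' \<in> S l" "pr l (blend s' (F l) z') \<in> U" by simp_all
        then have "((\<lambda>(s, p). \<Psi> s p) \<circ> (\<lambda>(s, x). (s, strip_proj D x))) v \<in> U"
          unfolding v(1) eq[OF v'(1) y(3) v'(2)] by simp
        moreover have "v \<in> topspace (prod_topology ?I ?X)"
          unfolding topspace_prod_topology X v(1) using v' y(3) by simp
        ultimately show "v \<in> ?W" by (intro CollectI conjI)
      qed
      ultimately show "\<exists>U V. openin ?I U \<and> openin ?X V \<and> s \<in> U \<and> x \<in> V \<and> U \<times> V \<subseteq> ?W"
        using AC(1,3,4) y(1) by (intro exI[of _ A] exI[of _ "Pair l ` C"] conjI) simp_all
    qed
  qed
  then show ?thesis
    by (rule continuous_compose_quotient_map[OF Q])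
qed

text \<open>Seams are translations, which commute with convex combinations, so the blends of the
  strip maps with the identity remain compatible along the seams for every \<open>s\<close>.\<close>

lemma isotopy_to_identity:
  assumes h: "h \<in> H" and r: "realizes h (\<lambda>_. 0)"
  shows "path_component_of H_top \<one>\<^bsub>foliated_homeos D\<^esub> h"
proof -
  let ?X = "topspace (surface D)"
  have "\<exists>F. strip_map (tops l) (tops l) F \<and> (\<forall>z\<in>S l. h (pr l z) = pr l (F z)) \<and>
     (\<forall>i\<in>tops l. F ` (J i \<times> {1}) = J i \<times> {1})" if "l \<in> strips D" for l
    using bspec[OF r[unfolded realizes_def] that] by (simp add: shift_strip_zero[OF that])
  then obtain F where F: "\<And>l. l \<in> strips D \<Longrightarrow> strip_map (tops l) (tops l) (F l) \<and>
     (\<forall>z\<in>S l. h (pr l z) = pr l (F l z)) \<and> (\<forall>i\<in>tops l. F l ` (J i \<times> {1}) = J i \<times> {1})" by metis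
  have map: "strip_map (tops l) (tops l) (F l)" if "l \<in> strips D" for l using F[OF that] by (elim conjE)
  have hF: "h (pr l z) = pr l (F l z)" if "l \<in> strips D" "z \<in> S l" for l z
    using F[OF that(1)] that(2) by (elim conjE) (erule bspec)
  have img: "F l ` (J i \<times> {1}) = J i \<times> {1}" if "l \<in> strips D" "i \<in> tops l" for l i
    using F[OF that(1)] that(2) by (elim conjE) (rule bspec)
  \<comment> \<open>With the zero portrait every upper interval is kept, which is the hypothesis of
    \<open>strip_map_blend\<close> on the upper line.\<close>
  have floor: "\<lfloor>fst (F l z)\<rfloor> = \<lfloor>fst z\<rfloor>" if l: "l \<in> strips D" and z: "z \<in> S l" "snd z = 1" for l z
  proof -
    note t = top_in_J[OF z]
    have "z \<in> J \<lfloor>fst z\<rfloor> \<times> {1}" using t z(2) by (simp add: mem_Times_iff)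
    then have "F l z \<in> J \<lfloor>fst z\<rfloor> \<times> {1}" using img[OF l conjunct2[OF t]] by blast
    then show ?thesis using J_floor by (simp add: mem_Times_iff)
  qed
  have bl: "strip_map (tops l) (tops (shift_strip (\<lambda>_. 0) l)) (blend s (F l))"
    if "s \<in> {0..1}" "l \<in> strips D" for s l
    unfolding shift_strip_zero[OF that(2)]
    by (rule strip_map_blend[OF map[OF that(2)] _ _ floor[OF that(2)]]) (use that(1) in simp_all)
  have seam: "blend s (F m) (x + of_int i - 1, 1) = (fst (blend s (F l) (x, -1)) + of_int (i + 0) - 1, 1)"
    if l: "l \<in> strips D" "m \<in> strips D" and i: "addr l = addr m @ [i]" and x: "x \<in> J 1" for l m i x s
  proof -
    have z: "(x, -1) \<in> S l" using x by (simp add: mem_model)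
    have b: "below l (x, -1) m (x + of_int i - 1, 1)" using i by (simp add: below_def)
    note w = below_pr[OF b l z]
    have "pr l (F l (x, -1)) = pr m (F m (x + of_int i - 1, 1))"
      using hF[OF l(1) z] hF[OF l(2) conjunct1[OF w]] w by simp
    moreover have s: "snd (F l (x, -1)) = -1" "snd (F m (x + of_int i - 1, 1)) = 1"
      using strip_map_bottom_iff[OF map[OF l(1)] z] strip_map_top_iff[OF map[OF l(2)] conjunct1[OF w]] by simp_all
    ultimately have "below l (F l (x, -1)) m (F m (x + of_int i - 1, 1))"
      using pr_eq_iff[OF l strip_map_in[OF map[OF l(1)] z] strip_map_in[OF map[OF l(2)] conjunct1[OF w]]]
      by (auto simp: below_def)
    then have "F m (x + of_int i - 1, 1) = (fst (F l (x, -1)) + of_int i - 1, 1)"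
      using i by (auto simp: below_def)
    then show ?thesis by (simp add: blend_def algebra_simps)
  qed
  define \<Psi> where "\<Psi> s = glue (\<lambda>_. 0) (\<lambda>l. blend s (F l))" for s
  have \<Psi>_H: "\<Psi> s \<in> H" if "s \<in> {0..1}" for s
    unfolding \<Psi>_def by (rule glue_in_H[OF tree_isos_zero bl[OF that] seam])
  have \<Psi>_pr: "\<Psi> s (pr l z) = pr l (blend s (F l) z)" if "s \<in> {0..1}" "l \<in> strips D" "z \<in> S l" for s l z
    unfolding \<Psi>_def using glue_pr[OF tree_isos_zero bl[OF that(1)] seam that(2,3)]
    by (simp only: shift_strip_zero[OF that(2)])
  have ext: "\<Psi> s \<in> extensional ?X" for s by (simp add: \<Psi>_def glue_def)
  have "continuous_map (prod_topology (top_of_set {0..1}) (surface D)) (surface D) (\<lambda>(s, p). \<Psi> s p)"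
  proof (rule isotopy_continuous[OF _ _ \<Psi>_pr])
    fix s l z assume "s \<in> {0..1 :: real}" "l \<in> strips D" "z \<in> S l"
    then show "blend s (F l) z \<in> S l"
      using strip_map_in[OF bl] by (simp only: shift_strip_zero)
  qed (rule strip_map_continuous[OF map])
  then have "continuous_map (top_of_set {0..1}) (compact_open_topology (surface D) (surface D)) \<Psi>"
    by (rule continuous_into_compact_open[OF _ ext])
      (simp add: homeomorphic_imp_continuous_map[OF H_homeo[OF \<Psi>_H]])
  then have "pathin H_top \<Psi>"
    using \<Psi>_H by (auto simp: pathin_def continuous_map_in_subtopology)
  moreover have "\<Psi> 0 = \<one>\<^bsub>foliated_homeos D\<^esub>"
    unfolding foliated_homeos_one
  proof (rule extensionalityI[OF ext])
    fix p assume "p \<in> ?X"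
    then obtain l z where "l \<in> strips D" "z \<in> S l" "p = pr l z" unfolding topspace_surface by blast
    then show "\<Psi> 0 p = (\<lambda>x\<in>?X. x) p" using \<Psi>_pr[of 0 l z] pr_in[of l z] by (simp add: blend_def)
  qed simp
  moreover have "\<Psi> 1 = h"
  proof (rule extensionalityI[OF ext])
    show "h \<in> extensional ?X" using h by (simp add: H_iff Bij_def)
    fix p assume "p \<in> ?X"
    then obtain l z where "l \<in> strips D" "z \<in> S l" "p = pr l z" unfolding topspace_surface by blast
    then show "\<Psi> 1 p = h p" using \<Psi>_pr[of 1 l z] hF[of l z] by (simp add: blend_def)
  qed
  ultimately show ?thesis unfolding path_component_of_def by blast
qed

lemma identity_path_component_eq:
  "identity_path_component D = kernel (foliated_homeos D) (tree_group T) portrait"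
proof -
  have "path_component_of H_top \<one>\<^bsub>foliated_homeos D\<^esub> h \<longleftrightarrow> h \<in> H \<and> realizes h (\<lambda>_. 0)" for h
  proof
    assume "path_component_of H_top \<one>\<^bsub>foliated_homeos D\<^esub> h"
    then obtain g where g: "pathin H_top g" "g 0 = \<one>\<^bsub>foliated_homeos D\<^esub>" "g 1 = h"
      unfolding path_component_of_def by blast
    have "g 1 \<in> H"
      using g(1) continuous_map_funspace unfolding pathin_def by (fastforce simp: topspace_H_top simp del: topspace_subtopology)
    then show "h \<in> H \<and> realizes h (\<lambda>_. 0)"
      using boundary_fixing_portrait[of h] path_fixes_boundary_leaf[OF g(1,2)] g(3) by blast
  qed (use isotopy_to_identity in blast)
  then show ?thesis
    unfolding identity_path_component_def kernel_portrait by auto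
qed

theorem homeotopy_group_iso_tree_group: "homeotopy_group D \<cong> tree_group T"
  unfolding homeotopy_group_def identity_path_component_eq
  by (rule group_hom.FactGroup_iso[OF group_hom_portrait portrait_surj])

end

section \<open>The tree of a striped surface\<close>

lemma relpowp_functional:
  fixes P :: "'a \<Rightarrow> 'a \<Rightarrow> bool"
  assumes fn: "\<And>x y z. P x y \<Longrightarrow> P x z \<Longrightarrow> y = z"
  shows "(P ^^ n) x y \<Longrightarrow> (P ^^ n) x z \<Longrightarrow> y = z"
proof (induction n arbitrary: y z)
  case (Suc n)
  obtain y' where y': "(P ^^ n) x y'" "P y' y" using Suc.prems(1) by (rule relpowp_Suc_E)
  obtain z' where z': "(P ^^ n) x z'" "P z' z" using Suc.prems(2) by (rule relpowp_Suc_E)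
  have "y' = z'" using Suc.IH[OF y'(1) z'(1)] .
  then show ?case using fn y'(2) z'(2) by metis
qed simp

text \<open>Read \<open>P x y\<close> as: \<open>y\<close> is the parent of \<open>x\<close>.
  Prepending a step to the parent lengthens the ascent from \<open>u\<close>. Prepending a step to a
  child cancels the first step of the ascent, by uniqueness of parents, or, if that ascent is empty,
  lengthens the ascent from \<open>v\<close>.\<close>

lemma walk_common_ancestor:
  fixes P :: "'a \<Rightarrow> 'a \<Rightarrow> bool"
  assumes fn: "\<And>x y z. P x y \<Longrightarrow> P x z \<Longrightarrow> y = z"
    and walk: "pcas u p v" and arcs: "\<And>x y. (x, y) \<in> set p \<Longrightarrow> P x y \<or> P y x"
  shows "\<exists>a b w. a + b \<le> length p \<and> (P ^^ a) u w \<and> (P ^^ b) v w"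
  using walk arcs
proof (induction p arbitrary: u)
  case Nil
  then have "0 + 0 \<le> length [] \<and> (P ^^ 0) u v \<and> (P ^^ 0) v v" by simp
  then show ?case by (intro exI)
next
  case (Cons e p)
  obtain u' where e: "e = (u, u')" "pcas u' p v" using Cons.prems(1) by (cases e) auto
  obtain a b w where IH: "a + b \<le> length p" "(P ^^ a) u' w" "(P ^^ b) v w"
    using Cons.IH[OF e(2)] Cons.prems(2) by (metis list.set_intros(2))
  consider "P u u'" | "P u' u" using Cons.prems(2)[of u u'] e(1) by auto
  then show ?case
  proof cases
    case 1
    have "Suc a + b \<le> length (e # p) \<and> (P ^^ Suc a) u w \<and> (P ^^ b) v w"
      using IH relpowp_Suc_I2[of P, OF 1 IH(2)] by simp
    then show ?thesis by (intro exI)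
  next
    case 2
    show ?thesis
    proof (cases a)
      case 0
      then have "w = u'" using IH(2) by simp
      then have "0 + Suc b \<le> length (e # p) \<and> (P ^^ 0) u u \<and> (P ^^ Suc b) v u"
        using IH 2 0 relpowp_Suc_I[of b P v u' u] by simp
      then show ?thesis by (intro exI)
    next
      case (Suc a')
      then obtain x where x: "P u' x" "(P ^^ a') x w" using relpowp_Suc_D2[of a' P u' w] IH(2) by blast
      have "x = u" using fn[OF x(1) 2] .
      then have "a' + b \<le> length (e # p) \<and> (P ^^ a') u w \<and> (P ^^ b) v w" using IH x Suc by simp
      then show ?thesis by (intro exI)
    qed
  qed
qed

text \<open>\<open>E l m i\<close> stands for the gluing of the lower side of \<open>l\<close> to the \<open>i\<close>-th upper interval of \<open>m\<close>.\<close>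

inductive vertex_path :: "('l \<Rightarrow> 'l \<Rightarrow> int \<Rightarrow> bool) \<Rightarrow> 'l \<Rightarrow> int list \<Rightarrow> bool" for E where
  root: "(\<And>m i. \<not> E l m i) \<Longrightarrow> vertex_path E l []"
| step: "E l m i \<Longrightarrow> vertex_path E m a \<Longrightarrow> vertex_path E l (a @ [i])"

lemma model_strip_eq_model:
  assumes "model_strip S" "lower_boundary S = J 1 \<times> {-1}" "upper_boundary S = (\<Union>i\<in>\<Delta>. J i \<times> {1})"
  shows "S = model \<Delta>"
proof -
  have "z \<in> S \<longleftrightarrow> z \<in> model \<Delta>" for z
  proof -
    obtain x t where z: "z = (x, t)" by force
    have sub: "UNIV \<times> {-1<..<1} \<subseteq> S" "S \<subseteq> UNIV \<times> {-1..1}" using assms(1) by (simp_all add: model_strip_def)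
    have lower: "(x, -1) \<in> S \<longleftrightarrow> x \<in> J 1"
    proof -
      have "(x, -1) \<in> S \<longleftrightarrow> (x, -1) \<in> lower_boundary S" by (simp add: lower_boundary_def)
      then show ?thesis by (simp add: assms(2))
    qed
    have upper: "(x, 1) \<in> S \<longleftrightarrow> (\<exists>i\<in>\<Delta>. x \<in> J i)"
    proof -
      have "(x, 1) \<in> S \<longleftrightarrow> (x, 1) \<in> upper_boundary S" by (simp add: upper_boundary_def)
      then show ?thesis by (simp add: assms(3))
    qed
    consider "-1 < t" "t < 1" | "t = -1" | "t = 1" | "t < -1 \<or> 1 < t" by linarith
    then show "z \<in> S \<longleftrightarrow> z \<in> model \<Delta>"
    proof cases
      case 1 then show ?thesis using sub(1) by (auto simp: z mem_model)
    next
      case 2 then show ?thesis using lower by (simp add: z mem_model)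
    next
      case 3 then show ?thesis using upper by (simp add: z mem_model)
    next
      case 4 then show ?thesis using sub(2) by (auto simp: z mem_model)
    qed
  qed
  then show ?thesis by blast
qed

lemma J_Times_inj: "J i \<times> {s :: real} = J j \<times> {s} \<Longrightarrow> i = j"
proof -
  assume "J i \<times> {s} = J j \<times> {s}"
  then have "(of_int i + 1/4, s) \<in> J j \<times> {s}" using J_mid[of i] by (metis SigmaI singletonI)
  then show "i = j" using J_inj[OF J_mid[of i]] by simp
qed

text \<open>A shortest directed cycle repeats no vertex, and its arcs are then distinct because
  their heads are.\<close>

lemma no_directed_cycle:
  assumes cycle: "\<nexists>vs es. undirected_cycle G vs es"
    and P: "\<And>x y. P x y \<Longrightarrow> \<exists>e\<in>arcs G. head G e = x \<and> tail G e = y"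
  shows "n > 0 \<Longrightarrow> \<not> (P ^^ n) u u"
proof
  assume "n > 0" "(P ^^ n) u u"
  then have ex: "\<exists>n. n > 0 \<and> (P ^^ n) u u" by blast
  define m where "m = (LEAST n. n > 0 \<and> (P ^^ n) u u)"
  have m: "m > 0" "(P ^^ m) u u" using LeastI_ex[OF ex] by (simp_all add: m_def)
  have least: "m \<le> k" if "k > 0" "(P ^^ k) u u" for k
    unfolding m_def by (rule Least_le) (use that in simp)
  obtain f where f: "f 0 = u" "f m = u" "\<And>i. i < m \<Longrightarrow> P (f i) (f (Suc i))"
    using m(2) unfolding relpowp_fun_conv by blast
  have seg: "(P ^^ (j - i)) (f i) (f j)" if "i \<le> j" "j \<le> m" for i j
    unfolding relpowp_fun_conv using that f(3) by (intro exI[of _ "\<lambda>k. f (i + k)"]) auto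
  have f_inj: "i = j" if "i < m" "j < m" "f i = f j" for i j
  proof -
    have False if ij: "i < j" "j < m" "f i = f j" for i j
    proof -
      have "(P ^^ i) u (f j)" using seg[of 0 i] ij f(1) by simp
      moreover have "(P ^^ (m - j)) (f j) u" using seg[of j m] ij f(2) by simp
      ultimately have "(P ^^ (i + (m - j))) u u" by (metis relcomppI relpowp_add)
      then have "m \<le> i + (m - j)" by (rule least[rotated]) (use ij in simp)
      then show False using ij by simp
    qed
    then show ?thesis using that by (metis linorder_neqE_nat)
  qed
  have "\<forall>i\<in>{..<m}. \<exists>e\<in>arcs G. head G e = f i \<and> tail G e = f (Suc i)"
    using P f(3) by blast
  then obtain e where e: "\<And>i. i < m \<Longrightarrow> e i \<in> arcs G \<and> head G (e i) = f i \<and> tail G (e i) = f (Suc i)"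
    by (metis lessThan_iff)
  have "undirected_cycle G (map f [0..<m]) (map e [0..<m])"
    unfolding undirected_cycle_def
  proof (intro conjI allI impI)
    show "distinct (map f [0..<m])" using f_inj by (auto simp: distinct_map inj_on_def)
    have "i = j" if "i < m" "j < m" "e i = e j" for i j using f_inj[OF that(1,2)] e[OF that(1)] e[OF that(2)] that(3) by simp
    then show "distinct (map e [0..<m])" by (auto simp: distinct_map inj_on_def)
    show "set (map e [0..<m]) \<subseteq> arcs G" using e by auto
    fix i assume "i < length (map e [0..<m])"
    then have i: "i < m" by simp
    have "f (Suc i mod m) = f (Suc i)" using i f(1,2) by (cases "Suc i = m") auto
    then show "{tail G (map e [0..<m] ! i), head G (map e [0..<m] ! i)} =
        {map f [0..<m] ! i, map f [0..<m] ! (Suc i mod length (map e [0..<m]))}"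
      using e[OF i] i by auto
  qed (use m(1) in simp_all)
  then show False using cycle by blast
qed

text \<open>The absence of cycles and the diameter together bound all chains of parents, so every
  strip reaches a root, and walks between any two strips make the root unique. The address of a
  strip lists the intervals passed on this chain, read from the root.\<close>

lemma class_F_tree:
  assumes D: "D \<in> class_F - symmetric_strips"
  shows "\<exists>addr T d. reduced_tree D addr T \<and> (\<forall>a. d \<le> length a \<longrightarrow> T a = None)"
proof -
  let ?G = "strip_graph D"
  have D': "striped_datum D" "Defs.reduced D" "Digraph_Component.connected ?G" "finite_diameter ?G"
    "\<nexists>vs es. undirected_cycle ?G vs es"
    and each: "\<And>l. l \<in> strips D \<Longrightarrow> lower_boundary (strip D l) = J 1 \<times> {-1} \<and>
        (\<exists>\<Delta>\<in>index_sets. upper_boundary (strip D l) = (\<Union>i\<in>\<Delta>. J i \<times> {1}))"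
    using D unfolding class_F_def by blast+
  have "\<forall>l\<in>strips D. \<exists>\<Delta>. \<Delta> \<in> index_sets \<and> strip D l = model \<Delta>"
  proof
    fix l assume l: "l \<in> strips D"
    obtain \<Delta> where \<Delta>: "\<Delta> \<in> index_sets" "upper_boundary (strip D l) = (\<Union>i\<in>\<Delta>. J i \<times> {1})"
      using each[OF l] by blast
    have "model_strip (strip D l)" using D'(1) l by (simp add: striped_datum_def)
    then have "strip D l = model \<Delta>" using each[OF l] \<Delta>(2) by (intro model_strip_eq_model) simp_all
    then show "\<exists>\<Delta>. \<Delta> \<in> index_sets \<and> strip D l = model \<Delta>" using \<Delta>(1) by blast
  qed
  then obtain tops where tops: "\<And>l. l \<in> strips D \<Longrightarrow> tops l \<in> index_sets"
    "\<And>l. l \<in> strips D \<Longrightarrow> strip D l = model (tops l)" by metis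
  define E where "E l m i \<longleftrightarrow> (\<exists>\<gamma>\<in>seams D. lower_side D \<gamma> = (l, J 1 \<times> {-1}) \<and> upper_side D \<gamma> = (m, J i \<times> {1}))" for l m i
  have seam: "\<exists>l m i. lower_side D \<gamma> = (l, J 1 \<times> {-1}) \<and> upper_side D \<gamma> = (m, J i \<times> {1}) \<and>
      l \<in> strips D \<and> m \<in> strips D \<and> i \<in> tops m" if \<gamma>: "\<gamma> \<in> seams D" for \<gamma>
  proof -
    have low: "lower_side D \<gamma> \<in> (SIGMA l:strips D. components (lower_boundary (strip D l)))"
      and up: "upper_side D \<gamma> \<in> (SIGMA l:strips D. components (upper_boundary (strip D l)))"
      using D'(1) \<gamma> unfolding striped_datum_def by blast+
    obtain l X where l: "lower_side D \<gamma> = (l, X)" "l \<in> strips D" "X \<in> components (lower_boundary (strip D l))"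
      using low by blast
    obtain m Y where m: "upper_side D \<gamma> = (m, Y)" "m \<in> strips D" "Y \<in> components (upper_boundary (strip D m))"
      using up by blast
    have "X = J 1 \<times> {-1}" using l(3) by (simp add: tops(2)[OF l(2)] lower_boundary_model components_lower)
    moreover obtain i where "i \<in> tops m" "Y = J i \<times> {1}"
      using m(3) by (auto simp: tops(2)[OF m(2)] upper_boundary_model components_upper)
    ultimately show ?thesis using l m by blast
  qed
  have E_in: "l \<in> strips D \<and> m \<in> strips D \<and> i \<in> tops m" if E: "E l m i" for l m i
  proof -
    obtain \<gamma> where \<gamma>: "\<gamma> \<in> seams D" "lower_side D \<gamma> = (l, J 1 \<times> {-1})" "upper_side D \<gamma> = (m, J i \<times> {1})"
      using E unfolding E_def by blast
    obtain l' m' i' where s: "lower_side D \<gamma> = (l', J 1 \<times> {-1})" "upper_side D \<gamma> = (m', J i' \<times> {1})"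
      "l' \<in> strips D" "m' \<in> strips D" "i' \<in> tops m'" using seam[OF \<gamma>(1)] by blast
    then have "l = l'" "m = m'" "i = i'" using \<gamma>(2,3) J_Times_inj by auto
    then show ?thesis using s by simp
  qed
  have E_fun: "m = m' \<and> i = i'" if E: "E l m i" "E l m' i'" for l m m' i i'
  proof -
    obtain \<gamma> where \<gamma>: "\<gamma> \<in> seams D" "lower_side D \<gamma> = (l, J 1 \<times> {-1})" "upper_side D \<gamma> = (m, J i \<times> {1})"
      using E(1) unfolding E_def by blast
    obtain \<gamma>' where \<gamma>': "\<gamma>' \<in> seams D" "lower_side D \<gamma>' = (l, J 1 \<times> {-1})" "upper_side D \<gamma>' = (m', J i' \<times> {1})"
      using E(2) unfolding E_def by blast
    have "inj_on (lower_side D) (seams D)" using D'(1) by (simp add: striped_datum_def)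
    then have "\<gamma> = \<gamma>'" using \<gamma>(1,2) \<gamma>'(1,2) by (simp add: inj_on_def)
    then show ?thesis using \<gamma>(3) \<gamma>'(3) J_Times_inj by auto
  qed
  have E_inj: "l = l'" if E: "E l m i" "E l' m i" for l l' m i
  proof -
    obtain \<gamma> where \<gamma>: "\<gamma> \<in> seams D" "lower_side D \<gamma> = (l, J 1 \<times> {-1})" "upper_side D \<gamma> = (m, J i \<times> {1})"
      using E(1) unfolding E_def by blast
    obtain \<gamma>' where \<gamma>': "\<gamma>' \<in> seams D" "lower_side D \<gamma>' = (l', J 1 \<times> {-1})" "upper_side D \<gamma>' = (m, J i \<times> {1})"
      using E(2) unfolding E_def by blast
    have "inj_on (upper_side D) (seams D)" using D'(1) by (simp add: striped_datum_def)
    then have "\<gamma> = \<gamma>'" using \<gamma>(1,3) \<gamma>'(1,3) by (simp add: inj_on_def)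
    then show ?thesis using \<gamma>(2) \<gamma>'(2) by simp
  qed
  define P where "P l m \<longleftrightarrow> (\<exists>i. E l m i)" for l m
  have P_fun: "y = z" if "P x y" "P x z" for x y z using that E_fun unfolding P_def by metis
  have P_in: "x \<in> strips D \<and> y \<in> strips D" if "P x y" for x y using that E_in unfolding P_def by metis
  have acyclic: "n > 0 \<Longrightarrow> \<not> (P ^^ n) u u" for n u
  proof (rule no_directed_cycle[OF D'(5)])
    fix x y assume "P x y"
    then obtain i \<gamma> where "\<gamma> \<in> seams D" "lower_side D \<gamma> = (x, J 1 \<times> {-1})" "upper_side D \<gamma> = (y, J i \<times> {1})"
      unfolding P_def E_def by blast
    then show "\<exists>e\<in>arcs ?G. head ?G e = x \<and> tail ?G e = y"
      by (intro bexI[of _ \<gamma>]) (simp_all add: strip_graph_def)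
  qed
  obtain d where d: "\<And>u v. u \<in> strips D \<Longrightarrow> v \<in> strips D \<Longrightarrow>
      \<exists>p. pre_digraph.apath (with_proj (mk_symmetric ?G)) u p v \<and> length p \<le> d"
    using D'(4) unfolding finite_diameter_def by (auto simp: strip_graph_def)
  have ancestor: "\<exists>a b w. a + b \<le> d \<and> (P ^^ a) u w \<and> (P ^^ b) v w" if uv: "u \<in> strips D" "v \<in> strips D" for u v
  proof -
    obtain p where p: "pre_digraph.apath (with_proj (mk_symmetric ?G)) u p v" "length p \<le> d"
      using d[OF uv] by blast
    then have walk: "set p \<subseteq> parcs (mk_symmetric ?G)" "pcas u p v"
      unfolding pre_digraph.apath_def pre_digraph.awalk_def cas_with_proj_eq by simp_all
    have "P x y \<or> P y x" if xy: "(x, y) \<in> set p" for x y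
    proof -
      have "(x, y) \<in> parcs (mk_symmetric ?G)" using walk(1) xy by blast
      then obtain \<gamma> where \<gamma>: "\<gamma> \<in> seams D"
        "(x, y) = (fst (upper_side D \<gamma>), fst (lower_side D \<gamma>)) \<or> (x, y) = (fst (lower_side D \<gamma>), fst (upper_side D \<gamma>))"
        by (auto simp: parcs_mk_symmetric strip_graph_def)
      obtain l m i where s: "lower_side D \<gamma> = (l, J 1 \<times> {-1})" "upper_side D \<gamma> = (m, J i \<times> {1})"
        using seam[OF \<gamma>(1)] by blast
      then have "P l m" using \<gamma>(1) unfolding P_def E_def by blast
      then show ?thesis using \<gamma>(2) s by auto
    qed
    then have "\<exists>a b w. a + b \<le> length p \<and> (P ^^ a) u w \<and> (P ^^ b) v w"
      using walk_common_ancestor[of P u p v] P_fun walk(2) by metis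
    then obtain a b w where "a + b \<le> length p" "(P ^^ a) u w" "(P ^^ b) v w" by blast
    then have "a + b \<le> d \<and> (P ^^ a) u w \<and> (P ^^ b) v w" using p(2) by simp
    then show ?thesis by (intro exI)
  qed
  \<comment> \<open>Two ascents lead from \<open>u\<close> to \<open>w\<close>, of lengths
    \<open>n + b\<close> and \<open>a\<close>. As parents are unique, a longer first one would pass
    \<open>w\<close> and come back to it, a directed cycle.\<close>
  have bounded: "n \<le> d" if n: "(P ^^ n) u v" and u: "u \<in> strips D" "v \<in> strips D" for n u v
  proof -
    obtain a b w where abw: "a + b \<le> d" "(P ^^ a) u w" "(P ^^ b) v w" using ancestor[OF u] by blast
    have nb: "(P ^^ (n + b)) u w" using n abw(3) by (metis relcomppI relpowp_add)
    have "n + b \<le> a"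
    proof (rule ccontr)
      assume "\<not> n + b \<le> a"
      then obtain r where r: "n + b = a + r" "r > 0" by (metis less_imp_add_positive not_le)
      obtain w' where w': "(P ^^ a) u w'" "(P ^^ r) w' w" using nb unfolding r(1) relpowp_add by blast
      have "w' = w" using relpowp_functional[of P a u w' w] P_fun w'(1) abw(2) by metis
      then show False using acyclic[OF r(2)] w'(2) by simp
    qed
    then show ?thesis using abw(1) by simp
  qed
  have pow_in: "v \<in> strips D" if "(P ^^ n) u v" "u \<in> strips D" for n u v
    using that P_in by (cases n) (auto elim: relpowp_Suc_E)
  have root_ex: "\<exists>n r. (P ^^ n) u r \<and> (\<forall>m. \<not> P r m)" if u: "u \<in> strips D" for u
  proof (rule ccontr)
    assume no: "\<nexists>n r. (P ^^ n) u r \<and> (\<forall>m. \<not> P r m)"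
    have "\<exists>v. (P ^^ n) u v" for n
    proof (induction n)
      case (Suc n)
      then obtain v where v: "(P ^^ n) u v" by blast
      then obtain m where "P v m" using no by blast
      then have "(P ^^ Suc n) u m" using relpowp_Suc_I[OF v] by blast
      then show ?case by blast
    qed auto
    then obtain v where "(P ^^ Suc d) u v" by blast
    then show False using bounded[OF _ u pow_in[OF _ u]] by fastforce
  qed
  \<comment> \<open>A common ancestor of two roots can only be each of them.\<close>
  have root_unique: "r = r'" if r: "r \<in> strips D" "r' \<in> strips D" "\<And>m. \<not> P r m" "\<And>m. \<not> P r' m" for r r'
  proof -
    obtain a b w where w: "(P ^^ a) r w" "(P ^^ b) r' w" using ancestor[OF r(1,2)] by blast
    have top: "w = v" if v: "(P ^^ n) v w" "\<And>m. \<not> P v m" for n v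
    proof (cases n)
      case (Suc k)
      then have "(P ^^ Suc k) v w" using v(1) by simp
      from relpowp_Suc_D2[OF this] show ?thesis using v(2) by blast
    qed (use v(1) in simp)
    show ?thesis using top[OF w(1) r(3)] top[OF w(2) r(4)] by simp
  qed
  have path_ex: "\<exists>a. vertex_path E u a" if u: "u \<in> strips D" for u
  proof -
    obtain n r where "(P ^^ n) u r" "\<forall>m. \<not> P r m" using root_ex[OF u] by blast
    then show ?thesis
    proof (induction n arbitrary: u)
      case 0
      then have "vertex_path E u []" by (intro vertex_path.root) (auto simp: P_def)
      then show ?case by blast
    next
      case (Suc n)
      obtain v where v: "P u v" "(P ^^ n) v r" using relpowp_Suc_D2[OF Suc.prems(1)] by blast
      obtain a where a: "vertex_path E v a" using Suc.IH[OF v(2) Suc.prems(2)] by blast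
      obtain i where "E u v i" using v(1) unfolding P_def by blast
      then show ?case using vertex_path.step[OF _ a] by blast
    qed
  qed
  \<comment> \<open>Uniqueness of the address rests on the lower side being glued at most
    once.\<close>
  have path_fun: "vertex_path E u a \<Longrightarrow> vertex_path E u b \<Longrightarrow> a = b" for u a b
  proof (induction arbitrary: b rule: vertex_path.induct)
    case (root l)
    from root.prems root.hyps show ?case by (cases rule: vertex_path.cases) auto
  next
    case (step l m i a)
    from step.prems show ?case
    proof (cases rule: vertex_path.cases)
      case root then show ?thesis using step.hyps(1) by blast
    next
      case (step m' i' a')
      then show ?thesis using E_fun[OF \<open>E l m i\<close> step(2)] step.IH by blast
    qed
  qed
  have path_length: "vertex_path E u a \<Longrightarrow> \<exists>r. (P ^^ length a) u r" for u a
  proof (induction rule: vertex_path.induct)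
    case (step l m i a)
    then obtain r where "(P ^^ length a) m r" by blast
    moreover have "P l m" using step.hyps(1) unfolding P_def by blast
    ultimately show ?case using relpowp_Suc_I2[of P l m "length a" r] by auto
  qed auto
  \<comment> \<open>That an address determines its strip rests on upper sides being glued at most
    once and on the uniqueness of the root.\<close>
  have path_inj: "u = v" if "vertex_path E u a" "vertex_path E v a" "u \<in> strips D" "v \<in> strips D" for u v a
    using that
  proof (induction arbitrary: v rule: vertex_path.induct)
    case (root l)
    from root.prems(1) have "\<not> E v m i" for m i by (cases rule: vertex_path.cases) auto
    then show ?case using root_unique[OF root.prems(2,3)] root.hyps unfolding P_def by blast
  next
    case (step l m i a)
    from step.prems(1) obtain m' where m': "E v m' i" "vertex_path E m' a"
      by (cases rule: vertex_path.cases) auto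
    have "m = m'" using step.IH[OF m'(2)] E_in step.hyps(1) m'(1) by blast
    then show ?case using E_inj step.hyps(1) m'(1) by blast
  qed
  define addr where "addr l = (SOME a. vertex_path E l a)" for l
  have addr: "vertex_path E l (addr l)" if "l \<in> strips D" for l
    unfolding addr_def by (rule someI_ex[OF path_ex[OF that]])
  have addr_inj: "inj_on addr (strips D)"
    by (rule inj_onI) (metis addr path_inj)
  have addr_edge: "E l m i \<longleftrightarrow> l \<in> strips D \<and> m \<in> strips D \<and> addr l = addr m @ [i]" for l m i
  proof
    assume E: "E l m i"
    then have lm: "l \<in> strips D" "m \<in> strips D" using E_in by blast+
    have "addr l = addr m @ [i]" by (rule path_fun[OF addr[OF lm(1)] vertex_path.step[of E, OF E addr[OF lm(2)]]])
    then show "l \<in> strips D \<and> m \<in> strips D \<and> addr l = addr m @ [i]" using lm by simp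
  next
    assume *: "l \<in> strips D \<and> m \<in> strips D \<and> addr l = addr m @ [i]"
    then have "vertex_path E l (addr m @ [i])" using addr[of l] by simp
    then obtain m' where m': "E l m' i" "vertex_path E m' (addr m)"
      by (cases rule: vertex_path.cases) auto
    have "m' = m" using path_inj[OF m'(2) addr] E_in[OF m'(1)] * by blast
    then show "E l m i" using m'(1) by simp
  qed
  define T where "T a = (if a \<in> addr ` strips D then Some (tops (inv_into (strips D) addr a)) else None)" for a
  have T_addr: "T (addr l) = Some (tops l)" if "l \<in> strips D" for l
    using that addr_inj by (simp add: T_def)
  have T_some: "\<exists>l\<in>strips D. addr l = a" if "T a \<noteq> None" for a
    using that by (auto simp: T_def split: if_splits)
  have tree: "striped_tree D addr T"
  proof
    have "{a. T a \<noteq> None} = addr ` strips D" by (auto simp: T_def)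
    then show "bij_betw addr (strips D) {a. T a \<noteq> None}" using addr_inj by (simp add: bij_betw_def)
    show "strip D l = model (the (T (addr l)))" if "l \<in> strips D" for l
      using tops(2)[OF that] T_addr[OF that] by simp
    show "(\<lambda>\<gamma>. (lower_side D \<gamma>, upper_side D \<gamma>)) ` seams D =
      {((l, J 1 \<times> {-1}), (m, J i \<times> {1})) |l m i. l \<in> strips D \<and> m \<in> strips D \<and> addr l = addr m @ [i]}"
    proof -
      have "(\<lambda>\<gamma>. (lower_side D \<gamma>, upper_side D \<gamma>)) ` seams D = {((l, J 1 \<times> {-1}), (m, J i \<times> {1})) |l m i. E l m i}"
      proof
        show "(\<lambda>\<gamma>. (lower_side D \<gamma>, upper_side D \<gamma>)) ` seams D \<subseteq> {((l, J 1 \<times> {-1}), (m, J i \<times> {1})) |l m i. E l m i}"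
        proof (rule image_subsetI)
          fix \<gamma> assume \<gamma>: "\<gamma> \<in> seams D"
          obtain l m i where s: "lower_side D \<gamma> = (l, J 1 \<times> {-1})" "upper_side D \<gamma> = (m, J i \<times> {1})"
            using seam[OF \<gamma>] by blast
          then have "E l m i" using \<gamma> unfolding E_def by blast
          then show "(lower_side D \<gamma>, upper_side D \<gamma>) \<in> {((l, J 1 \<times> {-1}), (m, J i \<times> {1})) |l m i. E l m i}"
            using s by auto
        qed
        show "{((l, J 1 \<times> {-1}), (m, J i \<times> {1})) |l m i. E l m i} \<subseteq> (\<lambda>\<gamma>. (lower_side D \<gamma>, upper_side D \<gamma>)) ` seams D"
        proof clarify
          fix l m i assume "E l m i"
          then obtain \<gamma> where "\<gamma> \<in> seams D" "lower_side D \<gamma> = (l, J 1 \<times> {-1})" "upper_side D \<gamma> = (m, J i \<times> {1})"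
            unfolding E_def by blast
          then show "((l, J 1 \<times> {-1}), (m, J i \<times> {1})) \<in> (\<lambda>\<gamma>. (lower_side D \<gamma>, upper_side D \<gamma>)) ` seams D"
            by (intro image_eqI[of _ _ \<gamma>]) simp_all
        qed
      qed
      then show ?thesis by (simp only: addr_edge)
    qed
    show "\<exists>\<Delta>. T a = Some \<Delta> \<and> i \<in> \<Delta>" if Ta: "T (a @ [i]) \<noteq> None" for a i
    proof -
      obtain l where l: "l \<in> strips D" "addr l = a @ [i]" using T_some[OF Ta] by blast
      then have "vertex_path E l (a @ [i])" using addr[of l] by simp
      then obtain m where m: "E l m i" "vertex_path E m a" by (cases rule: vertex_path.cases) auto
      then have "m \<in> strips D" "i \<in> tops m" using E_in by blast+
      moreover have "addr m = a" using path_fun[OF addr m(2)] calculation by blast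
      ultimately show ?thesis using T_addr by blast
    qed
  qed
  have "reduced_tree D addr T"
  proof (intro reduced_tree.intro tree reduced_tree_axioms.intro)
    show "\<Delta> \<in> index_sets" if "T a = Some \<Delta>" for a \<Delta>
      using that T_some[of a] T_addr tops(1) by force
    have no_single: "T a \<noteq> Some {i}" if Ta: "T (a @ [i]) \<noteq> None" for a i
    proof
      assume single: "T a = Some {i}"
      obtain l where l: "l \<in> strips D" "addr l = a @ [i]" using T_some[OF Ta] by blast
      obtain m where m: "m \<in> strips D" "addr m = a" using T_some[of a] single by auto
      show False using striped_tree.reduced_iff[OF tree] D'(2) l m single by fastforce
    qed
    then show "T (a @ [i]) \<noteq> None \<Longrightarrow> T a \<noteq> Some {i}" for a i .
    \<comment> \<open>Such a root has no child by \<open>no_single\<close>, so the surface would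
      consist of this strip only and be symmetric.\<close>
    show "T [] \<noteq> Some {1}"
    proof
      assume single: "T [] = Some {1}"
      obtain r where r: "r \<in> strips D" "addr r = []" using T_some[of "[]"] single by auto
      have prefix: "T (a @ b) \<noteq> None \<Longrightarrow> T a \<noteq> None" for a b
      proof (induction b rule: rev_induct)
        case (snoc i b)
        then show ?case using striped_tree.T_snoc[OF tree, of "a @ b" i] by auto
      qed simp
      have "l = r" if l: "l \<in> strips D" for l
      proof (cases "addr l")
        case Nil
        then show ?thesis using addr_inj l r by (simp add: inj_on_def)
      next
        case (Cons i b)
        then have "T ([i] @ b) \<noteq> None" using T_addr[OF l] by simp
        then have i: "T ([] @ [i]) \<noteq> None" using prefix by (metis append_Nil)
        then have "i = 1" using striped_tree.T_snoc[OF tree, of "[]" i] single by auto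
        then show ?thesis using no_single[OF i] single by simp
      qed
      then have "strips D = {r}" using r(1) by blast
      moreover have "tops r = {1}" using T_addr[OF r(1)] r(2) single by simp
      then have "upper_boundary (strip D r) = J 1 \<times> {1}" by (simp add: tops(2)[OF r(1)] upper_boundary_model)
      ultimately have "D \<in> symmetric_strips" using D unfolding symmetric_strips_def by blast
      then show False using D by blast
    qed
  qed
  \<comment> \<open>An address of length \<open>n\<close> yields a chain of \<open>n\<close>
    parents, and \<open>n \<le> d\<close>; the first level that is surely empty is
    \<open>Suc d\<close>.\<close>
  moreover have "T a = None" if a: "Suc d \<le> length a" for a
  proof (rule ccontr)
    assume "T a \<noteq> None"
    then obtain l where l: "l \<in> strips D" "addr l = a" using T_some by blast
    then obtain r where "(P ^^ length a) l r" using path_length[of l a] addr[OF l(1)] by blast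
    then show False using bounded[OF _ l(1) pow_in[OF _ l(1)]] a by fastforce
  qed
  ultimately show ?thesis by blast
qed

section \<open>The striped surface of a tree\<close>

lemma model_strip_model: "model_strip (model \<Delta>)"
  unfolding model_strip_def
proof (intro conjI exI[of _ "insert (J 1 \<times> {-1}) ((\<lambda>i. J i \<times> {1}) ` \<Delta>)"])
  show "UNIV \<times> {-1<..<1} \<subseteq> model \<Delta>" by (auto simp: mem_model)
  show "model \<Delta> \<subseteq> UNIV \<times> {-1..1}" by (auto simp: mem_model)
  show "disjoint (insert (J 1 \<times> {-1 :: real}) ((\<lambda>i. J i \<times> {1}) ` \<Delta>))"
    by (auto simp: pairwise_def disjnt_def dest: J_inj)
  have "\<exists>a b e. a < b \<and> e \<in> {-1, 1} \<and> J i \<times> {s} = {a<..<b} \<times> {e}" if "s \<in> {-1, 1 :: real}" for i s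
    using that by (intro exI[of _ "of_int i"] exI[of _ "of_int i + 1/2"] exI[of _ s]) (simp add: J_def)
  then show "\<forall>I\<in>insert (J 1 \<times> {-1}) ((\<lambda>i. J i \<times> {1}) ` \<Delta>).
      \<exists>a b e. a < b \<and> e \<in> {-1, 1} \<and> I = {a<..<b} \<times> {e :: real}" by blast
  show "model \<Delta> \<inter> UNIV \<times> {-1, 1} = \<Union>(insert (J 1 \<times> {-1}) ((\<lambda>i. J i \<times> {1}) ` \<Delta>))"
    by (auto simp: mem_model)
qed

lemma closure_J: "closure (J i \<times> {s :: real}) = {of_int i..of_int i + 1/2} \<times> {s}"
  by (simp add: closure_Times J_def)

text \<open>Closing the intervals adds their end points and still leaves gaps of length
  \<open>1/2\<close> on a line, while the closed lower interval lies on another line. A bounded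
  range of first coordinates meets only finitely many of them.\<close>

lemma admissible_strip_model: "admissible_strip (model \<Delta>)"
  unfolding admissible_strip_def components_strip_boundary
proof
  have J_eq: "i = j" if "x \<in> {of_int i..of_int i + 1/2}" "x \<in> {of_int j..of_int j + 1/2}" for i j and x :: real
  proof -
    have "\<lfloor>x\<rfloor> = i" "\<lfloor>x\<rfloor> = j" using that by (simp_all add: floor_eq_iff)
    then show ?thesis by simp
  qed
  show "disjoint_family_on closure (insert (J 1 \<times> {-1 :: real}) ((\<lambda>i. J i \<times> {1}) ` \<Delta>))"
    unfolding disjoint_family_on_def
  proof (intro ballI impI)
    fix A B :: "(real \<times> real) set" assume A: "A \<in> insert (J 1 \<times> {-1}) ((\<lambda>i. J i \<times> {1}) ` \<Delta>)"
      and B: "B \<in> insert (J 1 \<times> {-1}) ((\<lambda>i. J i \<times> {1}) ` \<Delta>)" and "A \<noteq> B"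
    obtain i s where i: "A = J i \<times> {s}" "s = -1 \<and> i = 1 \<or> s = 1" using A by blast
    obtain j t where j: "B = J j \<times> {t}" "t = -1 \<and> j = 1 \<or> t = 1" using B by blast
    have "z \<notin> closure B" if "z \<in> closure A" for z
    proof
      assume "z \<in> closure B"
      then have z: "fst z \<in> {of_int i..of_int i + 1/2}" "fst z \<in> {of_int j..of_int j + 1/2}" "s = t"
        using that unfolding i(1) j(1) closure_J by (auto simp: mem_Times_iff)
      have "i = j" by (rule J_eq[OF z(1,2)])
      then show False using \<open>A \<noteq> B\<close> z(3) i(1) j(1) by simp
    qed
    then show "closure A \<inter> closure B = {}" by blast
  qed
  show "locally_finite_in euclidean (closure ` insert (J 1 \<times> {-1 :: real}) ((\<lambda>i. J i \<times> {1}) ` \<Delta>))"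
    unfolding locally_finite_in_def
  proof (intro conjI ballI)
    fix z :: "real \<times> real"
    let ?V = "{fst z - 1<..<fst z + 1} \<times> (UNIV :: real set)"
    let ?A = "closure ` insert (J 1 \<times> {-1}) ((\<lambda>i. J i \<times> {1}) ` \<Delta>)"
    let ?f = "\<lambda>i. {of_int i..of_int i + 1/2} \<times> {1 :: real}"
    have "{U \<in> ?A. U \<inter> ?V \<noteq> {}} \<subseteq> insert (closure (J 1 \<times> {-1})) (?f ` {\<lfloor>fst z\<rfloor> - 2..\<lfloor>fst z\<rfloor> + 2})"
    proof
      fix U assume "U \<in> {U \<in> ?A. U \<inter> ?V \<noteq> {}}"
      then have U: "U \<in> ?A" "U \<inter> ?V \<noteq> {}" by simp_all
      show "U \<in> insert (closure (J 1 \<times> {-1})) (?f ` {\<lfloor>fst z\<rfloor> - 2..\<lfloor>fst z\<rfloor> + 2})"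
      proof (cases "U = closure (J 1 \<times> {-1})")
        case False
        then obtain i where "U = closure (J i \<times> {1})" using U(1) by blast
        then have i: "U = ?f i" by (simp only: closure_J)
        then obtain x where "of_int i \<le> x" "x \<le> of_int i + 1/2" "fst z - 1 < x" "x < fst z + 1"
          using U(2) by auto
        then have "i \<in> {\<lfloor>fst z\<rfloor> - 2..\<lfloor>fst z\<rfloor> + 2}" by auto linarith+
        then show ?thesis using i by blast
      qed simp
    qed
    then have "finite {U \<in> ?A. U \<inter> ?V \<noteq> {}}" by (rule finite_subset) simp
    then show "\<exists>V. openin euclidean V \<and> z \<in> V \<and> finite {U \<in> ?A. U \<inter> V \<noteq> {}}"
      by (intro exI[of _ ?V]) (auto simp: open_Times mem_Times_iff)
  qed simp
qed

text \<open>Closed subwalks are cut out until no vertex is repeated, which never lengthens the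
  walk.\<close>

lemma (in wf_digraph) awalk_imp_short_apath:
  "awalk u p v \<Longrightarrow> \<exists>q. apath u q v \<and> length q \<le> length p"
proof (induction p rule: length_induct)
  case (1 p)
  show ?case
  proof (cases "distinct (awalk_verts u p)")
    case True
    then have "apath u p v \<and> length p \<le> length p" using 1 by (simp add: apath_def)
    then show ?thesis by (intro exI)
  next
    case False
    obtain q r s w where d: "p = q @ r @ s" "0 < length r" "awalk u q w" "awalk w s v"
      using awalk_not_distinct_decomp[OF 1(2) False] by metis
    have "awalk u (q @ s) v" using awalk_appendI[OF d(3,4)] .
    moreover have less: "length (q @ s) < length p" using d by simp
    ultimately obtain q' where "apath u q' v" "length q' \<le> length (q @ s)" using 1(1) by blast
    then have "apath u q' v \<and> length q' \<le> length p" using less by simp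
    then show ?thesis by (intro exI)
  qed
qed

text \<open>Strips are named by the codes of their addresses, which keeps the index types equal to
  \<open>nat\<close>. A seam bears the name of its child strip, so distinct seams have distinct
  lower sides by construction.\<close>

definition tree_datum :: "tree \<Rightarrow> (nat, nat) striped_data" where
  "tree_datum T = \<lparr>strips = to_nat ` {a. T a \<noteq> None}, strip = (\<lambda>n. model (the (T (from_nat n)))),
     seams = to_nat ` {a. T a \<noteq> None \<and> a \<noteq> []}, lower_side = (\<lambda>n. (n, J 1 \<times> {-1})),
     upper_side = (\<lambda>n. (to_nat (butlast (from_nat n :: int list)), J (last (from_nat n :: int list)) \<times> {1}))\<rparr>"

text \<open>\<open>T_no_single\<close> yields both reducedness and the exclusion of the symmetric
  strip. The strict inequality in \<open>T_depth\<close> matches the trees of representations of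
  height \<open>d\<close>, which may have vertices on level \<open>d\<close>.\<close>

locale finite_tree =
  fixes T :: tree and d :: nat
  assumes T_snoc: "T (a @ [i]) \<noteq> None \<Longrightarrow> \<exists>\<Delta>. T a = Some \<Delta> \<and> i \<in> \<Delta>"
    and T_index: "T a = Some \<Delta> \<Longrightarrow> \<Delta> \<in> index_sets"
    and T_no_single: "T a \<noteq> Some {i}"
    and T_root: "T [] \<noteq> None"
    and T_depth: "d < length a \<Longrightarrow> T a = None"
begin

abbreviation D where "D \<equiv> tree_datum T"

lemma strips_D: "strips D = to_nat ` {a. T a \<noteq> None}"
  and strip_D: "strip D (to_nat a) = model (the (T a))"
  and seams_D: "seams D = to_nat ` {a. T a \<noteq> None \<and> a \<noteq> []}"
  and lower_D: "lower_side D n = (n, J 1 \<times> {-1})"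
  and upper_D: "upper_side D (to_nat (a @ [i])) = (to_nat a, J i \<times> {1})"
  by (simp_all add: tree_datum_def)

lemma T_prefix: "T (a @ b) \<noteq> None \<Longrightarrow> T a \<noteq> None"
proof (induction b rule: rev_induct)
  case (snoc i b)
  then show ?case using T_snoc[of "a @ b" i] by auto
qed simp

lemma seamsE:
  assumes "n \<in> seams D"
  obtains a i where "n = to_nat (a @ [i])" "T (a @ [i]) \<noteq> None" "T a \<noteq> None" "i \<in> the (T a)"
proof -
  obtain b where b: "n = to_nat b" "T b \<noteq> None" "b \<noteq> []" using assms unfolding seams_D by blast
  obtain a i where a: "b = a @ [i]" using b(3) by (metis rev_exhaust)
  obtain \<Delta> where "T a = Some \<Delta>" "i \<in> \<Delta>" using T_snoc[of a i] b(2) a by blast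
  then show ?thesis using that b a by simp
qed

sublocale striped_tree D from_nat T
proof
  show "bij_betw from_nat (strips D) {a. T a \<noteq> None}"
    unfolding strips_D by (rule bij_betw_byWitness[where f' = to_nat]) auto
  show "strip D l = model (the (T (from_nat l)))" for l
    by (simp add: tree_datum_def)
  show "(\<lambda>\<gamma>. (lower_side D \<gamma>, upper_side D \<gamma>)) ` seams D =
      {((l, J 1 \<times> {-1}), (m, J i \<times> {1})) |l m i. l \<in> strips D \<and> m \<in> strips D \<and> from_nat l = from_nat m @ [i]}"
    (is "?L = ?R")
  proof
    show "?L \<subseteq> ?R"
    proof (rule image_subsetI)
      fix n assume "n \<in> seams D"
      then obtain a i where n: "n = to_nat (a @ [i])" "T (a @ [i]) \<noteq> None" "T a \<noteq> None"
        by (rule seamsE)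
      have "n \<in> strips D" "to_nat a \<in> strips D" using n unfolding strips_D by blast+
      moreover have "from_nat n = (from_nat (to_nat a) @ [i] :: int list)" using n(1) by simp
      ultimately show "(lower_side D n, upper_side D n) \<in> ?R"
        unfolding lower_D unfolding n(1) upper_D by blast
    qed
    show "?R \<subseteq> ?L"
    proof clarify
      fix l m and i :: int assume l: "l \<in> strips D" "m \<in> strips D" "from_nat l = from_nat m @ [i]"
      obtain a where a: "l = to_nat a" "T a \<noteq> None" using l(1) unfolding strips_D by blast
      obtain b where b: "m = to_nat b" "T b \<noteq> None" using l(2) unfolding strips_D by blast
      have ab: "a = b @ [i]" using l(3) a b by simp
      then have "l \<in> seams D" using a unfolding seams_D by blast
      then show "((l, J 1 \<times> {-1}), (m, J i \<times> {1})) \<in> ?L"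
        by (rule image_eqI[rotated]) (simp add: lower_D a(1) ab upper_D b)
    qed
  qed
qed (rule T_snoc)

abbreviation G where "G \<equiv> strip_graph D"

lemma verts_G: "verts G = to_nat ` {a. T a \<noteq> None}"
  by (simp add: strip_graph_def strips_D)

lemma wf_G: "wf_digraph G"
proof
  fix n assume "n \<in> arcs G"
  then have "n \<in> seams D" by (simp add: strip_graph_def)
  then obtain a i where n: "n = to_nat (a @ [i])" "T (a @ [i]) \<noteq> None" "T a \<noteq> None"
    by (rule seamsE)
  show "tail G n \<in> verts G"
    using n by (simp add: strip_graph_def upper_D strips_D)
  show "head G n \<in> verts G"
    using n by (simp add: strip_graph_def lower_D strips_D)
qed

sublocale sym: wf_digraph "with_proj (mk_symmetric G)"
  using wf_digraph.wellformed_mk_symmetric[OF wf_G] by (simp add: wf_digraph_wp_iff)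

text \<open>Walks in the symmetrized graph are directed, so the way up and the way down are
  constructed together.\<close>

lemma walk_to_root:
  "T a \<noteq> None \<Longrightarrow> \<exists>p q. sym.awalk (to_nat a) p (to_nat ([] :: int list)) \<and> length p = length a \<and>
     sym.awalk (to_nat ([] :: int list)) q (to_nat a) \<and> length q = length a"
proof (induction a rule: rev_induct)
  case Nil
  have "to_nat ([] :: int list) \<in> verts (with_proj (mk_symmetric G))"
    using T_root by (simp add: strip_graph_def strips_D)
  then have "sym.awalk (to_nat ([] :: int list)) [] (to_nat ([] :: int list))" by (simp add: sym.awalk_Nil_iff)
  then show ?case by (intro exI[of _ "[]"]) simp
next
  case (snoc i a)
  have "T a \<noteq> None" using snoc.prems T_prefix by blast
  then obtain p q where pq: "sym.awalk (to_nat a) p (to_nat ([] :: int list))" "length p = length a"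
    "sym.awalk (to_nat ([] :: int list)) q (to_nat a)" "length q = length a" using snoc.IH by blast
  have "to_nat (a @ [i]) \<in> arcs G" using snoc.prems by (simp add: strip_graph_def seams_D)
  moreover have "tail G (to_nat (a @ [i])) = to_nat a" "head G (to_nat (a @ [i])) = to_nat (a @ [i])"
    by (simp_all add: strip_graph_def upper_D lower_D)
  ultimately have arcs: "(to_nat a, to_nat (a @ [i])) \<in> arcs (with_proj (mk_symmetric G))"
    "(to_nat (a @ [i]), to_nat a) \<in> arcs (with_proj (mk_symmetric G))"
    by (force simp: parcs_mk_symmetric)+
  have up: "sym.awalk (to_nat (a @ [i])) [(to_nat (a @ [i]), to_nat a)] (to_nat a)"
    and down: "sym.awalk (to_nat a) [(to_nat a, to_nat (a @ [i]))] (to_nat (a @ [i]))"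
    using sym.arc_implies_awalk[OF arcs(2)] sym.arc_implies_awalk[OF arcs(1)] by simp_all
  have "sym.awalk (to_nat (a @ [i])) ([(to_nat (a @ [i]), to_nat a)] @ p) (to_nat ([] :: int list))"
    by (rule sym.awalk_appendI[OF up pq(1)])
  moreover have "sym.awalk (to_nat ([] :: int list)) (q @ [(to_nat a, to_nat (a @ [i]))]) (to_nat (a @ [i]))"
    by (rule sym.awalk_appendI[OF pq(3) down])
  ultimately show ?case
    using pq(2,4) by (intro exI[of _ "[(to_nat (a @ [i]), to_nat a)] @ p"] exI[of _ "q @ [(to_nat a, to_nat (a @ [i]))]"]) simp
qed

text \<open>The walk goes through the root, and each half is as long as the depth of its end, at
  most \<open>d\<close>.\<close>

lemma short_apath:
  assumes "u \<in> verts G" "v \<in> verts G"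
  shows "\<exists>p. sym.apath u p v \<and> length p \<le> 2 * d"
proof -
  obtain a where a: "u = to_nat a" "T a \<noteq> None" using assms(1) unfolding verts_G by blast
  obtain b where b: "v = to_nat b" "T b \<noteq> None" using assms(2) unfolding verts_G by blast
  obtain p where p: "sym.awalk u p (to_nat ([] :: int list))" "length p = length a"
    using walk_to_root[OF a(2)] unfolding a(1)[symmetric] by blast
  obtain q where q: "sym.awalk (to_nat ([] :: int list)) q v" "length q = length b"
    using walk_to_root[OF b(2)] unfolding b(1)[symmetric] by blast
  have "\<not> d < length a" "\<not> d < length b" using a(2) b(2) T_depth[of a] T_depth[of b] by auto
  then have pq: "length (p @ q) \<le> 2 * d" using p(2) q(2) by simp
  obtain r where "sym.apath u r v" "length r \<le> length (p @ q)"
    using sym.awalk_imp_short_apath[OF sym.awalk_appendI[OF p(1) q(1)]] by blast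
  then have "sym.apath u r v \<and> length r \<le> 2 * d" using pq by simp
  then show ?thesis by (rule exI)
qed

text \<open>A deepest vertex of the cycle can be left only through the arc to its parent, so the two
  arcs of the cycle at this vertex coincide. Distinctness of the arcs then leaves only a loop, but
  arcs join different depths.\<close>

lemma no_undirected_cycle: "\<not> undirected_cycle G vs es"
proof
  assume "undirected_cycle G vs es"
  then have ne: "es \<noteq> []" and len: "length vs = length es" and dist: "distinct vs" "distinct es"
    and es: "set es \<subseteq> arcs G"
    and ends: "\<And>i. i < length es \<Longrightarrow> {tail G (es ! i), head G (es ! i)} = {vs ! i, vs ! (Suc i mod length es)}"
    unfolding undirected_cycle_def by blast+
  define n where "n = length es"
  have n: "n > 0" using ne by (simp add: n_def)
  define depth where "depth v = length (from_nat v :: int list)" for v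
  \<comment> \<open>An arc carries the same number as its head, which is the deeper end.\<close>
  have edge: "head G e = e \<and> depth (tail G e) < depth e" if "e \<in> arcs G" for e
  proof -
    have "e \<in> seams D" using that by (simp add: strip_graph_def)
    then obtain a i where e: "e = to_nat (a @ [i])" "T (a @ [i]) \<noteq> None" by (rule seamsE)
    show ?thesis by (simp add: e(1) strip_graph_def upper_D lower_D depth_def)
  qed
  have "finite (depth ` set vs)" "depth ` set vs \<noteq> {}" using ne len by auto
  then obtain v where v: "v \<in> set vs" "depth v = Max (depth ` set vs)" using Max_in by (metis imageE)
  have max: "depth w \<le> depth v" if "w \<in> set vs" for w using that v(2) by simp
  obtain j where j: "j < n" "vs ! j = v" using v(1) len by (metis in_set_conv_nth n_def)
  have at_v: "es ! i = v" if i: "i < n" "v \<in> {vs ! i, vs ! (Suc i mod n)}" for i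
  proof -
    have e: "es ! i \<in> arcs G" using es i(1) by (auto simp: n_def)
    have eq: "{tail G (es ! i), head G (es ! i)} = {vs ! i, vs ! (Suc i mod n)}"
      using ends i(1) by (simp add: n_def)
    have "vs ! i \<in> set vs" "vs ! (Suc i mod n) \<in> set vs" using i(1) len n by (simp_all add: n_def)
    then have "head G (es ! i) \<in> set vs" using eq by (metis insertCI insertE singletonD)
    then have "depth (es ! i) \<le> depth v" using max edge[OF e] by simp
    moreover have "v = tail G (es ! i) \<or> v = head G (es ! i)" using i(2) eq by blast
    ultimately show ?thesis using edge[OF e] by auto
  qed
  \<comment> \<open>The cyclic predecessor of \<open>j\<close>; adding \<open>n\<close> before
    subtracting avoids truncation at \<open>j = 0\<close>.\<close>
  define i where "i = (j + n - 1) mod n"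
  have i: "i < n" using n by (simp add: i_def)
  have "Suc i mod n = j"
  proof -
    have "Suc i mod n = Suc (j + n - 1) mod n" unfolding i_def by (simp add: mod_Suc_eq)
    then show ?thesis using n j(1) by simp
  qed
  then have "es ! i = v" using at_v[OF i] j(2) by simp
  moreover have "es ! j = v" using at_v[OF j(1)] j(2) by simp
  ultimately have "es ! i = es ! j" by (rule trans[OF _ sym])
  then have "i = j"
    using nth_eq_iff_index_eq[OF dist(2)] i j(1) unfolding n_def by blast
  then have "Suc j mod n = j" using \<open>Suc i mod n = j\<close> by simp
  then have "{tail G v, head G v} = {v}" using ends[of j] j \<open>es ! j = v\<close> by (simp add: n_def)
  moreover have "v \<in> arcs G" using es j(1) \<open>es ! j = v\<close> by (metis n_def nth_mem subsetD)
  ultimately show False using edge[of v] by auto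
qed

lemma T_D: "T (from_nat l) = Some (tops l)" if "l \<in> strips D" for l
  by (rule addr_in[OF that])

lemma D_in_class_F: "D \<in> class_F"
proof -
  have 1: "striped_datum D"
    unfolding striped_datum_def
  proof (intro conjI ballI)
    show "model_strip (strip D l)" if "l \<in> strips D" for l
      unfolding strip_model[OF that] by (rule model_strip_model)
    show "lower_side D ` seams D \<subseteq> (SIGMA l:strips D. components (lower_boundary (strip D l)))"
    proof (rule image_subsetI)
      fix n assume "n \<in> seams D"
      then obtain a i where n: "n = to_nat (a @ [i])" "T (a @ [i]) \<noteq> None" by (rule seamsE)
      then show "lower_side D n \<in> (SIGMA l:strips D. components (lower_boundary (strip D l)))"
        by (simp add: lower_D strips_D strip_D lower_boundary_model components_lower)
    qed
    show "upper_side D ` seams D \<subseteq> (SIGMA l:strips D. components (upper_boundary (strip D l)))"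
    proof (rule image_subsetI)
      fix n assume "n \<in> seams D"
      then obtain a i where n: "n = to_nat (a @ [i])" "T a \<noteq> None" "i \<in> the (T a)" by (rule seamsE)
      then show "upper_side D n \<in> (SIGMA l:strips D. components (upper_boundary (strip D l)))"
        by (simp add: upper_D strips_D strip_D upper_boundary_model components_upper)
    qed
    show "inj_on (lower_side D) (seams D)" by (simp add: inj_on_def lower_D)
    show "inj_on (upper_side D) (seams D)"
    proof (rule inj_onI)
      fix m n assume mn: "m \<in> seams D" "n \<in> seams D" "upper_side D m = upper_side D n"
      obtain a i where m: "m = to_nat (a @ [i])" "T (a @ [i]) \<noteq> None" using mn(1) by (rule seamsE)
      obtain b j where n: "n = to_nat (b @ [j])" "T (b @ [j]) \<noteq> None" using mn(2) by (rule seamsE)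
      have "a = b" "J i \<times> {1 :: real} = J j \<times> {1}" using mn(3) by (simp_all add: m(1) n(1) upper_D)
      then have "i = j" by (intro J_Times_inj)
      then show "m = n" using m(1) n(1) \<open>a = b\<close> by simp
    qed
  qed
  have 2: "Defs.reduced D"
    unfolding reduced_iff
  proof (intro ballI allI impI)
    fix l m i assume "m \<in> strips D"
    then have "T (from_nat m) = Some (tops m)" by (rule T_D)
    then show "tops m \<noteq> {i}" using T_no_single[of "from_nat m" i] by auto
  qed
  have 3: "admissible_strip (strip D l) \<and> lower_boundary (strip D l) = J 1 \<times> {-1} \<and>
        (\<exists>\<Delta>\<in>index_sets. upper_boundary (strip D l) = (\<Union>i\<in>\<Delta>. J i \<times> {1}))" if l: "l \<in> strips D" for l
    unfolding strip_model[OF l] using T_index[OF T_D[OF l]]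
    by (simp add: admissible_strip_model lower_boundary_model upper_boundary_model)
      (intro bexI[of _ "tops l"] refl)
  have 4: "Digraph_Component.connected G"
    unfolding Digraph_Component.connected_def strongly_connected_def
  proof (intro conjI ballI)
    show "verts (with_proj (mk_symmetric G)) \<noteq> {}" using T_root by (auto simp: strip_graph_def strips_D)
    fix u v assume "u \<in> verts (with_proj (mk_symmetric G))" "v \<in> verts (with_proj (mk_symmetric G))"
    then have "u \<in> verts G" "v \<in> verts G" by simp_all
    then obtain p where "sym.apath u p v" using short_apath[of u v] by blast
    then show "u \<rightarrow>\<^sup>*\<^bsub>with_proj (mk_symmetric G)\<^esub> v"
      unfolding sym.reachable_awalk sym.apath_def by blast
  qed
  have 5: "finite_diameter G"
    unfolding finite_diameter_def using short_apath by blast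
  show ?thesis
    unfolding class_F_def
    by (intro CollectI conjI ballI notI 1 2 4 5) (use 3 no_undirected_cycle in \<open>blast+\<close>)
qed

text \<open>The components of the upper boundary determine the index set, and no index set of the
  tree is a singleton.\<close>

lemma D_not_symmetric: "D \<notin> symmetric_strips"
proof
  assume "D \<in> symmetric_strips"
  then obtain l where l: "strips D = {l}" "upper_boundary (strip D l) = J 1 \<times> {1}"
    unfolding symmetric_strips_def by blast
  have l': "l \<in> strips D" using l(1) by blast
  have "components (upper_boundary (strip D l)) = (\<lambda>i. J i \<times> {1}) ` tops l"
    unfolding strip_model[OF l'] upper_boundary_model components_upper ..
  moreover have "components (upper_boundary (strip D l)) = (\<lambda>i. J i \<times> {1}) ` {1}"
    unfolding l(2) using components_upper[of "{1}"] by simp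
  ultimately have "(\<lambda>i. J i \<times> {1 :: real}) ` tops l = (\<lambda>i. J i \<times> {1}) ` {1}" by simp
  moreover have "inj (\<lambda>i. J i \<times> {1 :: real})" by (rule injI) (rule J_Times_inj)
  ultimately have "tops l = {1}" by (simp only: inj_image_eq_iff)
  then show False using T_D[OF l'] T_no_single[of "from_nat l" 1] by simp
qed

sublocale reduced_tree D from_nat T
proof
  show "T a = Some \<Delta> \<Longrightarrow> \<Delta> \<in> index_sets" for a \<Delta> by (rule T_index)
  show "T (a @ [i]) \<noteq> None \<Longrightarrow> T a \<noteq> Some {i}" for a i by (rule T_no_single)
  show "T [] \<noteq> Some {1}" by (rule T_no_single)
qed

end

lemma finite_tree_tree_of:
  assumes "height R \<le> enat d"
  shows "finite_tree (tree_of R) d"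
proof
  show "tree_of R (a @ [i]) \<noteq> None \<Longrightarrow> \<exists>\<Delta>. tree_of R a = Some \<Delta> \<and> i \<in> \<Delta>" for a i
    by (rule tree_of_snoc)
  show "\<Delta> \<in> index_sets" if "tree_of R a = Some \<Delta>" for a \<Delta>
  proof -
    have "\<Delta> \<in> {{}, {1..}, UNIV}" using tree_of_in[of R a] that by auto
    moreover have "{} \<in> index_sets" unfolding index_sets_def by (rule UnI1) (intro CollectI exI[of _ 0], simp)
    ultimately show ?thesis unfolding index_sets_def by blast
  qed
  show "tree_of R a \<noteq> Some {i}" for a i
  proof
    assume "tree_of R a = Some {i}"
    then have "{i} \<in> {{}, {1..}, UNIV}" using tree_of_in[of R a] by auto
    then have "finite {1 :: int..} \<or> finite (UNIV :: int set)" by (metis empty_not_insert finite.emptyI finite_insert insertE singletonD)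
    then show False by (simp add: infinite_Ici infinite_UNIV_int)
  qed
  show "tree_of R [] \<noteq> None" using tree_of_Nil[of R] by auto
  show "d < length a \<Longrightarrow> tree_of R a = None" for a by (rule tree_of_depth[OF assms])
qed

section \<open>The two inclusions\<close>

text \<open>Both classes are closed under isomorphism within the element type \<open>'g\<close>. The
  first inclusion admits arbitrary types of names for strips and seams; the trees used for the
  second have countably many vertices, so their surfaces are named by natural numbers.\<close>

theorem theorem4p5:
  shows "homeotopy_groups (class_F - symmetric_strips :: ('l, 'c) striped_data set)
           \<subseteq> (class_G' :: 'g monoid set) \<and>
         (class_G' :: 'g monoid set)
           \<subseteq> homeotopy_groups (class_F - symmetric_strips :: (nat, nat) striped_data set)"
proof (intro conjI subsetI)
  fix G :: "'g monoid"
  assume "G \<in> homeotopy_groups (class_F - symmetric_strips :: ('l, 'c) striped_data set)"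
  then obtain D :: "('l, 'c) striped_data" where G: "group G"
    and D: "D \<in> class_F - symmetric_strips" "G \<cong> homeotopy_group D"
    unfolding homeotopy_groups_def by blast
  obtain addr T d where T: "reduced_tree D addr T" "\<And>a. d \<le> length a \<Longrightarrow> T a = None"
    using class_F_tree[OF D(1)] by blast
  obtain R where R: "height R \<le> enat (2 * d)" "tree_group T \<cong> represented_group R"
    using tree_group_represented[of d T] T(2) by blast
  have "G \<cong> represented_group R"
    by (rule iso_trans[OF iso_trans[OF D(2) reduced_tree.homeotopy_group_iso_tree_group[OF T(1)]] R(2)])
  moreover have "height R < \<infinity>" using R(1) by (rule le_less_trans) simp
  ultimately show "G \<in> class_G'" unfolding class_G'_def using G by blast
next
  fix G :: "'g monoid" assume "G \<in> class_G'"
  then obtain R where G: "group G" and R: "height R < \<infinity>" "G \<cong> represented_group R"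
    unfolding class_G'_def by blast
  obtain d where d: "height R = enat d" using R(1) by (cases "height R") auto
  interpret finite_tree "tree_of R" d by (rule finite_tree_tree_of) (simp add: d)
  have "homeotopy_group D \<cong> tree_group (tree_of R)" by (rule homeotopy_group_iso_tree_group)
  then have "tree_group (tree_of R) \<cong> homeotopy_group D"
  proof -
    assume *: "homeotopy_group D \<cong> tree_group (tree_of R)"
    \<comment> \<open>Reversing the isomorphism requires the quotient to be a group; the identity
      path component is normal as the kernel of \<open>portrait\<close>.\<close>
    have "group (homeotopy_group D)"
      unfolding homeotopy_group_def identity_path_component_eq
      by (rule normal.factorgroup_is_group[OF group_hom.normal_kernel[OF group_hom_portrait]])
    then show ?thesis using * by (rule group.iso_sym)
  qed
  then have "G \<cong> homeotopy_group D"
    by (rule iso_trans[OF iso_trans[OF R(2) represented_group_iso_tree_group]])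
  then show "G \<in> homeotopy_groups (class_F - symmetric_strips :: (nat, nat) striped_data set)"
    unfolding homeotopy_groups_def using G D_in_class_F D_not_symmetric by blast
qed

end
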